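(* The $\Bbbk$-algebra homomorphism $\Phi\colon\Bbbk Q\to A=\operatorname{End}(E)$, determined by $\Phi(e_\lambda)=\mathrm{id}_{\mathbb{S}^\lambda\mathcal{W}}$ for $\lambda\in Q_0$, $\Phi(a^{\lambda,1}_\rho)=f^\lambda_{u_\rho}$ and $\Phi(a^{\lambda,2}_\rho)=g^\lambda_{u_\rho}$ for all arrows of $Q$, is surjective.
   Context: Let $\Bbbk$ be an algebraically closed field of characteristic zero, $n\ge 4$, $V=\Bbbk^n$ with a fixed basis $u_1,\dots,u_n$. $\mathrm{Gr}(n,2)$ is the Grassmannian of $2$-dimensional quotients of $V$, and $\mathcal{W}$ is its rank $2$ tautological quotient bundle. $\mathrm{Young}(n-2,2)=\{\lambda\in\mathbb{Z}^2\mid n-2\ge\lambda_1\ge\lambda_2\ge 0\}$; $e_1,e_2$ is the standard basis of $\mathbb{Z}^2$. $E=\bigoplus_{\lambda\in\mathrm{Young}(n-2,2)}\mathbb{S}^\lambda\mathcal{W}$ (Kapranov's tilting bundle). $\mathbb{S}^\lambda\mathcal{W}$ is the Schur power (the bundle whose fibre is the irreducible $\mathrm{GL}(2)$-module of highest weight $\lambda$), realised as the quotient of $(\bigwedge^2\mathcal{W})^{\otimes\lambda_2}\otimes\mathrm{Sym}^{\lambda_1-\lambda_2}\mathcal{W}$ by the exchange relations. Its sections are written $w^\lambda=\underline{x}\otimes y_1\cdots y_{\lambda_1-\lambda_2}$ with $\underline{x}=x_{1,1}\wedge x_{1,2}\otimes\cdots\otimes x_{\lambda_2,1}\wedge x_{\lambda_2,2}$.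 The exchange relations are: (E1) for a factor $x_{a,1}\wedge x_{a,2}$ and a variable to its right (some $y_k$ or an entry of a later wedge factor), $w^\lambda$ equals the sum of the two tensors obtained by swapping that variable with $x_{a,1}$, respectively with $x_{a,2}$; (E2) $w^\lambda$ equals the tensor obtained by interchanging two wedge factors. For $v\in V$, $z_v\in H^0(\mathrm{Gr}(n,2),\mathcal{W})\cong V$ is the global section corresponding to $v$. For $\lambda,\lambda+e_1\in\mathrm{Young}(n-2,2)$, $f^\lambda_v\colon\mathbb{S}^\lambda\mathcal{W}\to\mathbb{S}^{\lambda+e_1}\mathcal{W}$ is $f^\lambda_v(w^\lambda)=\underline{x}\otimes y_1\cdots y_{\lambda_1-\lambda_2}z_v$. For $\lambda,\lambda+e_2\in\mathrm{Young}(n-2,2)$, $g^\lambda_v\colon\mathbb{S}^\lambda\mathcal{W}\to\mathbb{S}^{\lambda+e_2}\mathcal{W}$ is $g^\lambda_v(w^\lambda)=\sum_{k=1}^{\lambda_1-\lambda_2}\underline{x}\otimes y_k\wedge z_v\otimes\prod_{j\ne k}y_j$. The tilting quiver $Q$ has vertex set $Q_0=\mathrm{Young}(n-2,2)$ and, for every $i\in\{1,2\}$ and $\lambda$ with $\lambda,\lambda+e_i\in Q_0$, exactly $n$ arrows $a^{\lambda,i}_1,\dots,a^{\lambda,i}_n$ with tail $\lambda$ and head $\lambda+e_i$. $\Bbbk Q$ is its path algebra, with paths composed from right to left (like maps), and $e_\lambda$ is the idempotent of the length-zero path at $\lambda$. *)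

theory Defs
  imports
    "HOL-Analysis.Analysis"
    "HOL-Algebra.Module"
    "HOL-Algebra.AbelCoset"
    "HOL-Library.Poly_Mapping"
    "Graph_Theory.Digraph"
    "Graph_Theory.Arc_Walk"
begin

section \<open>Vector spaces with explicit carriers\<close>

text \<open>
  Vector spaces over the field type \<open>'k\<close> are \<open>module\<close> records. Where the record is used only as a
  vector space, its ring fields \<open>mult\<close> and \<open>one\<close> are irrelevant and left undefined.
\<close>

definition vector_module :: "'b set \<Rightarrow> 'b \<Rightarrow> ('b \<Rightarrow> 'b \<Rightarrow> 'b) \<Rightarrow> ('k \<Rightarrow> 'b \<Rightarrow> 'b) \<Rightarrow> ('k, 'b) module"
  where "vector_module C z p s =
    \<lparr>carrier = C, mult = undefined, one = undefined, zero = z, add = p, smult = s\<rparr>"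

definition quot_module :: "('k, 'b) module \<Rightarrow> 'b set \<Rightarrow> ('k, 'b set) module"
  where "quot_module M N =
    vector_module (a_rcosets\<^bsub>M\<^esub> N) N (\<lambda>C D. C <+>\<^bsub>M\<^esub> D) (\<lambda>c C. \<Union>x\<in>C. N +>\<^bsub>M\<^esub> (c \<odot>\<^bsub>M\<^esub> x))"

definition direct_sum :: "'i set \<Rightarrow> ('i \<Rightarrow> ('k, 'b) module) \<Rightarrow> ('k, 'i \<Rightarrow> 'b) module"
  where "direct_sum I M =
    vector_module (\<Pi>\<^sub>E i\<in>I. carrier (M i)) (\<lambda>i\<in>I. \<zero>\<^bsub>M i\<^esub>)
      (\<lambda>s t. \<lambda>i\<in>I. s i \<oplus>\<^bsub>M i\<^esub> t i) (\<lambda>c s. \<lambda>i\<in>I. c \<odot>\<^bsub>M i\<^esub> s i)"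

definition linear_maps :: "('k, 'b) module \<Rightarrow> ('k, 'c) module \<Rightarrow> ('b \<Rightarrow> 'c) set"
  where "linear_maps M N =
    {h \<in> carrier M \<rightarrow>\<^sub>E carrier N.
      (\<forall>x\<in>carrier M. \<forall>y\<in>carrier M. h (x \<oplus>\<^bsub>M\<^esub> y) = h x \<oplus>\<^bsub>N\<^esub> h y) \<and>
      (\<forall>c. \<forall>x\<in>carrier M. h (c \<odot>\<^bsub>M\<^esub> x) = c \<odot>\<^bsub>N\<^esub> h x)}"

definition alg_hom :: "('k, 'b) module \<Rightarrow> ('k, 'c) module \<Rightarrow> ('b \<Rightarrow> 'c) set"
  where "alg_hom A B =
    {h \<in> ring_hom A B. \<forall>c. \<forall>x\<in>carrier A. h (c \<odot>\<^bsub>A\<^esub> x) = c \<odot>\<^bsub>B\<^esub> h x}"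

definition pm_scale :: "'k::field \<Rightarrow> ('b \<Rightarrow>\<^sub>0 'k) \<Rightarrow> ('b \<Rightarrow>\<^sub>0 'k)"
  where "pm_scale c p = Poly_Mapping.map ((*) c) p"

lemma lookup_pm_scale [simp]: "Poly_Mapping.lookup (pm_scale c p) t = c * Poly_Mapping.lookup p t"
  by (simp add: pm_scale_def Poly_Mapping.map.rep_eq when_def)

interpretation pm: vector_space pm_scale
  by unfold_locales (rule poly_mapping_eqI, simp add: lookup_add algebra_simps)+

definition free_module :: "'b set \<Rightarrow> ('k::field, 'b \<Rightarrow>\<^sub>0 'k) module"
  where "free_module X = vector_module {p. Poly_Mapping.keys p \<subseteq> X} 0 (+) pm_scale"

definition linear_extension :: "('b \<Rightarrow> ('c \<Rightarrow>\<^sub>0 'k)) \<Rightarrow> ('b \<Rightarrow>\<^sub>0 'k::field) \<Rightarrow> ('c \<Rightarrow>\<^sub>0 'k)"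
  where "linear_extension h p = (\<Sum>t\<in>Poly_Mapping.keys p. pm_scale (Poly_Mapping.lookup p t) (h t))"

section \<open>Schur powers of a vector space\<close>

definition young :: "nat \<Rightarrow> (nat \<times> nat) set"
  where "young m = {l. fst l \<le> m \<and> snd l \<le> fst l}"

definition unit_weight :: "nat \<Rightarrow> nat \<times> nat"
  where "unit_weight i = (if i = 1 then (1, 0) else (0, 1))"

text \<open>
  The pair \<open>(xs, ys)\<close> stands for the tensor
  $x_{1,1}\wedge x_{1,2}\otimes\cdots\otimes x_{\lambda_2,1}\wedge x_{\lambda_2,2}
  \otimes y_1\cdots y_{\lambda_1-\lambda_2}$.
\<close>

type_synonym 'u word_tensor = "('u \<times> 'u) list \<times> 'u list"

definition schur_gens :: "nat \<times> nat \<Rightarrow> ('k, 'u) module \<Rightarrow> 'u word_tensor set"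
  where "schur_gens l U =
    {(xs, ys). length xs = snd l \<and> length ys = fst l - snd l \<and>
      set xs \<subseteq> carrier U \<times> carrier U \<and> set ys \<subseteq> carrier U}"

abbreviation gen :: "('u \<times> 'u) list \<Rightarrow> 'u list \<Rightarrow> ('u word_tensor \<Rightarrow>\<^sub>0 'k::field)"
  where "gen xs ys \<equiv> Poly_Mapping.single (xs, ys) 1"

text \<open>
  The rules \<open>lin_left\<close> to \<open>sym\<close> present
  $(\bigwedge^2 U)^{\otimes\lambda_2}\otimes\mathrm{Sym}^{\lambda_1-\lambda_2}U$ as a quotient of the free
  vector space on \<open>schur_gens l U\<close>; the remaining ones are the exchange relations (E1), for a variable
  in the symmetric part and for either entry of a later wedge factor, and (E2).
\<close>

inductive_set schur_relators ::
    "nat \<times> nat \<Rightarrow> ('k::field, 'u) module \<Rightarrow> ('u word_tensor \<Rightarrow>\<^sub>0 'k) set"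
  for l :: "nat \<times> nat" and U :: "('k, 'u) module"
  where
    lin_left: "\<lbrakk>(xs, ys) \<in> schur_gens l U; a < length xs;
        x \<in> carrier U; x' \<in> carrier U; z \<in> carrier U\<rbrakk> \<Longrightarrow>
      gen (xs[a := (x \<oplus>\<^bsub>U\<^esub> c \<odot>\<^bsub>U\<^esub> x', z)]) ys
        - gen (xs[a := (x, z)]) ys - pm_scale c (gen (xs[a := (x', z)]) ys) \<in> schur_relators l U"
  | lin_right: "\<lbrakk>(xs, ys) \<in> schur_gens l U; a < length xs;
        x \<in> carrier U; x' \<in> carrier U; z \<in> carrier U\<rbrakk> \<Longrightarrow>
      gen (xs[a := (z, x \<oplus>\<^bsub>U\<^esub> c \<odot>\<^bsub>U\<^esub> x')]) ys
        - gen (xs[a := (z, x)]) ys - pm_scale c (gen (xs[a := (z, x')]) ys) \<in> schur_relators l U"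
  | alt: "\<lbrakk>(xs, ys) \<in> schur_gens l U; a < length xs; x \<in> carrier U\<rbrakk> \<Longrightarrow>
      gen (xs[a := (x, x)]) ys \<in> schur_relators l U"
  | lin_sym: "\<lbrakk>(xs, ys) \<in> schur_gens l U; k < length ys; y \<in> carrier U; y' \<in> carrier U\<rbrakk> \<Longrightarrow>
      gen xs (ys[k := y \<oplus>\<^bsub>U\<^esub> c \<odot>\<^bsub>U\<^esub> y'])
        - gen xs (ys[k := y]) - pm_scale c (gen xs (ys[k := y'])) \<in> schur_relators l U"
  | sym: "\<lbrakk>(xs, ys) \<in> schur_gens l U; mset ys' = mset ys\<rbrakk> \<Longrightarrow>
      gen xs ys - gen xs ys' \<in> schur_relators l U"
  | E1_sym: "\<lbrakk>(xs, ys) \<in> schur_gens l U; a < length xs; xs ! a = (x\<^sub>1, x\<^sub>2); k < length ys\<rbrakk> \<Longrightarrow>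
      gen xs ys - (gen (xs[a := (ys ! k, x\<^sub>2)]) (ys[k := x\<^sub>1])
        + gen (xs[a := (x\<^sub>1, ys ! k)]) (ys[k := x\<^sub>2])) \<in> schur_relators l U"
  | E1_left: "\<lbrakk>(xs, ys) \<in> schur_gens l U; a < b; b < length xs;
        xs ! a = (x\<^sub>1, x\<^sub>2); xs ! b = (z\<^sub>1, z\<^sub>2)\<rbrakk> \<Longrightarrow>
      gen xs ys - (gen (xs[a := (z\<^sub>1, x\<^sub>2), b := (x\<^sub>1, z\<^sub>2)]) ys
        + gen (xs[a := (x\<^sub>1, z\<^sub>1), b := (x\<^sub>2, z\<^sub>2)]) ys) \<in> schur_relators l U"
  | E1_right: "\<lbrakk>(xs, ys) \<in> schur_gens l U; a < b; b < length xs;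
        xs ! a = (x\<^sub>1, x\<^sub>2); xs ! b = (z\<^sub>1, z\<^sub>2)\<rbrakk> \<Longrightarrow>
      gen xs ys - (gen (xs[a := (z\<^sub>2, x\<^sub>2), b := (z\<^sub>1, x\<^sub>1)]) ys
        + gen (xs[a := (x\<^sub>1, z\<^sub>2), b := (z\<^sub>1, x\<^sub>2)]) ys) \<in> schur_relators l U"
  | E2: "\<lbrakk>(xs, ys) \<in> schur_gens l U; a < length xs; b < length xs\<rbrakk> \<Longrightarrow>
      gen xs ys - gen (xs[a := xs ! b, b := xs ! a]) ys \<in> schur_relators l U"

definition schur_rels :: "nat \<times> nat \<Rightarrow> ('k::field, 'u) module \<Rightarrow> ('u word_tensor \<Rightarrow>\<^sub>0 'k) set"
  where "schur_rels l U = pm.span (schur_relators l U)"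

definition schur_class ::
    "nat \<times> nat \<Rightarrow> ('k::field, 'u) module \<Rightarrow> ('u word_tensor \<Rightarrow>\<^sub>0 'k) \<Rightarrow> ('u word_tensor \<Rightarrow>\<^sub>0 'k) set"
  where "schur_class l U p = schur_rels l U +>\<^bsub>free_module (schur_gens l U)\<^esub> p"

definition schur :: "nat \<times> nat \<Rightarrow> ('k::field, 'u) module \<Rightarrow> ('k, ('u word_tensor \<Rightarrow>\<^sub>0 'k) set) module"
  where "schur l U = quot_module (free_module (schur_gens l U)) (schur_rels l U)"

text \<open>
  The map $\mathbb{S}^\lambda U\to\mathbb{S}^\mu U$ induced by a map \<open>h\<close> on generators. The union is a
  single class, independent of representatives, exactly when the linear extension of \<open>h\<close> sends
  relations to relations.
\<close>

definition schur_induced ::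
    "nat \<times> nat \<Rightarrow> nat \<times> nat \<Rightarrow> ('k::field, 'u) module \<Rightarrow> ('u word_tensor \<Rightarrow> ('u word_tensor \<Rightarrow>\<^sub>0 'k))
      \<Rightarrow> ('u word_tensor \<Rightarrow>\<^sub>0 'k) set \<Rightarrow> ('u word_tensor \<Rightarrow>\<^sub>0 'k) set"
  where "schur_induced l m U h = (\<lambda>C\<in>carrier (schur l U). \<Union>p\<in>C. schur_class m U (linear_extension h p))"

section \<open>The Grassmannian of 2-dimensional quotients\<close>

text \<open>
  A closed point is the kernel of a quotient $V\to V/K$ of dimension 2. As the base field is
  algebraically closed and the Grassmannian is a variety, morphisms of vector bundles are the
  families of linear maps between the fibres over closed points that preserve regular local sections.
\<close>

definition Gr2 :: "('k::field ^ 'n) set set"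
  where "Gr2 = {K. vec.subspace K \<and> vec.dim K + 2 = CARD('n)}"

definition V_module :: "('k::field, 'k ^ 'n) module"
  where "V_module = vector_module UNIV 0 (+) (*s)"

definition W_fibre :: "('k::field ^ 'n) set \<Rightarrow> ('k, ('k ^ 'n) set) module"
  where "W_fibre K = quot_module V_module K"

definition z_section :: "'k::field ^ 'n \<Rightarrow> ('k ^ 'n) set \<Rightarrow> ('k ^ 'n) set"
  where "z_section v K = K +>\<^bsub>V_module\<^esub> v"

type_synonym ('k, 'n) schur_elem = "(('k ^ 'n) set word_tensor \<Rightarrow>\<^sub>0 'k) set"

definition S_fibre :: "nat \<times> nat \<Rightarrow> ('k::field ^ 'n) set \<Rightarrow> ('k, ('k, 'n) schur_elem) module"
  where "S_fibre l K = schur l (W_fibre K)"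

text \<open>
  \<open>chart a b\<close> is the standard affine open set on which $z_a,z_b$ form a frame of $\mathcal{W}$. There
  $z_v = x_v z_a + y_v z_b$ for unique functions $x_v,y_v$, and its coordinate ring is the algebra
  generated by all the $x_v,y_v$.
\<close>

definition chart :: "'k::field ^ 'n \<Rightarrow> 'k ^ 'n \<Rightarrow> ('k ^ 'n) set set"
  where "chart a b = {K \<in> Gr2. \<forall>v. \<exists>!c. v - (fst c *s a + snd c *s b) \<in> K}"

definition chart_coord :: "'k::field ^ 'n \<Rightarrow> 'k ^ 'n \<Rightarrow> 'k ^ 'n \<Rightarrow> ('k ^ 'n) set \<Rightarrow> 'k \<times> 'k"
  where "chart_coord a b v K = (THE c. v - (fst c *s a + snd c *s b) \<in> K)"

text \<open>
  Elements of \<open>regular_functions a b\<close> and \<open>regular_schur_sections a b l\<close> are meaningful on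
  \<open>chart a b\<close> only; their values at other points are never used.
\<close>

inductive_set regular_functions :: "'k::field ^ 'n \<Rightarrow> 'k ^ 'n \<Rightarrow> (('k ^ 'n) set \<Rightarrow> 'k) set"
  for a b :: "'k ^ 'n"
  where
    const: "(\<lambda>_. c) \<in> regular_functions a b"
  | coord_fst: "(\<lambda>K. fst (chart_coord a b v K)) \<in> regular_functions a b"
  | coord_snd: "(\<lambda>K. snd (chart_coord a b v K)) \<in> regular_functions a b"
  | add: "\<lbrakk>p \<in> regular_functions a b; q \<in> regular_functions a b\<rbrakk> \<Longrightarrow>
      (\<lambda>K. p K + q K) \<in> regular_functions a b"
  | mult: "\<lbrakk>p \<in> regular_functions a b; q \<in> regular_functions a b\<rbrakk> \<Longrightarrow>
      (\<lambda>K. p K * q K) \<in> regular_functions a b"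

text \<open>
  $\mathbb{S}^\lambda\mathcal{W}$ is a quotient of the trivial bundle $\mathbb{S}^\lambda V$, so over an
  affine open set its regular sections are the combinations of the images of constant tensors with
  regular coefficients.
\<close>

inductive_set regular_schur_sections ::
    "'k::field ^ 'n \<Rightarrow> 'k ^ 'n \<Rightarrow> nat \<times> nat \<Rightarrow> (('k ^ 'n) set \<Rightarrow> ('k, 'n) schur_elem) set"
  for a b :: "'k ^ 'n" and l :: "nat \<times> nat"
  where
    const: "(xs, ys) \<in> schur_gens l V_module \<Longrightarrow>
      (\<lambda>K. schur_class l (W_fibre K)
        (gen (map (\<lambda>(x, x'). (z_section x K, z_section x' K)) xs) (map (\<lambda>y. z_section y K) ys)))
        \<in> regular_schur_sections a b l"
  | add: "\<lbrakk>s \<in> regular_schur_sections a b l; t \<in> regular_schur_sections a b l\<rbrakk> \<Longrightarrow>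
      (\<lambda>K. s K \<oplus>\<^bsub>S_fibre l K\<^esub> t K) \<in> regular_schur_sections a b l"
  | smult: "\<lbrakk>p \<in> regular_functions a b; s \<in> regular_schur_sections a b l\<rbrakk> \<Longrightarrow>
      (\<lambda>K. p K \<odot>\<^bsub>S_fibre l K\<^esub> s K) \<in> regular_schur_sections a b l"

section \<open>Kapranov's bundle and its endomorphism algebra\<close>

definition E_fibre :: "('k::field ^ 'n) set \<Rightarrow> ('k, nat \<times> nat \<Rightarrow> ('k, 'n) schur_elem) module"
  where "E_fibre K = direct_sum (young (CARD('n) - 2)) (\<lambda>l. S_fibre l K)"

definition E_sections ::
    "'k::field ^ 'n \<Rightarrow> 'k ^ 'n \<Rightarrow> (('k ^ 'n) set \<Rightarrow> nat \<times> nat \<Rightarrow> ('k, 'n) schur_elem) set"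
  where "E_sections a b =
    {s \<in> (\<Pi>\<^sub>E K\<in>chart a b. carrier (E_fibre K)).
      \<forall>l\<in>young (CARD('n) - 2). \<exists>t\<in>regular_schur_sections a b l. \<forall>K\<in>chart a b. s K l = t K}"

type_synonym ('k, 'n) E_endo =
  "('k ^ 'n) set \<Rightarrow> (nat \<times> nat \<Rightarrow> ('k, 'n) schur_elem) \<Rightarrow> (nat \<times> nat \<Rightarrow> ('k, 'n) schur_elem)"

definition End_E :: "('k::field, ('k, 'n::finite) E_endo) module"
  where "End_E =
    \<lparr>carrier = {\<phi> \<in> (\<Pi>\<^sub>E K\<in>Gr2. linear_maps (E_fibre K) (E_fibre K)).
       \<forall>a b. \<forall>s\<in>E_sections a b. (\<lambda>K\<in>chart a b. \<phi> K (s K)) \<in> E_sections a b},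
     mult = (\<lambda>\<phi> \<psi>. \<lambda>K\<in>Gr2. compose (carrier (E_fibre K)) (\<phi> K) (\<psi> K)),
     one = (\<lambda>K\<in>Gr2. \<lambda>s\<in>carrier (E_fibre K). s),
     zero = (\<lambda>K\<in>Gr2. \<lambda>s\<in>carrier (E_fibre K). \<zero>\<^bsub>E_fibre K\<^esub>),
     add = (\<lambda>\<phi> \<psi>. \<lambda>K\<in>Gr2. \<lambda>s\<in>carrier (E_fibre K). \<phi> K s \<oplus>\<^bsub>E_fibre K\<^esub> \<psi> K s),
     smult = (\<lambda>c \<phi>. \<lambda>K\<in>Gr2. \<lambda>s\<in>carrier (E_fibre K). c \<odot>\<^bsub>E_fibre K\<^esub> \<phi> K s)\<rparr>"

text \<open>
  A bundle map $\mathbb{S}^\lambda\mathcal{W}\to\mathbb{S}^\mu\mathcal{W}$ viewed as an endomorphism of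
  \<open>E\<close>: projection to the summand $\lambda$, then the map, then inclusion of the summand $\mu$.
\<close>

definition summand_endo ::
    "nat \<times> nat \<Rightarrow> nat \<times> nat \<Rightarrow> (('k::field ^ 'n) set \<Rightarrow> ('k, 'n) schur_elem \<Rightarrow> ('k, 'n) schur_elem)
      \<Rightarrow> ('k, 'n) E_endo"
  where "summand_endo l m h =
    (\<lambda>K\<in>Gr2. \<lambda>s\<in>carrier (E_fibre K). \<lambda>r\<in>young (CARD('n) - 2).
      if r = m then h K (s l) else \<zero>\<^bsub>S_fibre r K\<^esub>)"

definition f_map ::
    "nat \<times> nat \<Rightarrow> 'k::field ^ 'n \<Rightarrow> ('k ^ 'n) set \<Rightarrow> ('k, 'n) schur_elem \<Rightarrow> ('k, 'n) schur_elem"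
  where "f_map l v K = schur_induced l (l + unit_weight 1) (W_fibre K)
    (\<lambda>(xs, ys). gen xs (ys @ [z_section v K]))"

definition g_map ::
    "nat \<times> nat \<Rightarrow> 'k::field ^ 'n \<Rightarrow> ('k ^ 'n) set \<Rightarrow> ('k, 'n) schur_elem \<Rightarrow> ('k, 'n) schur_elem"
  where "g_map l v K = schur_induced l (l + unit_weight 2) (W_fibre K)
    (\<lambda>(xs, ys). \<Sum>k<length ys. gen (xs @ [(ys ! k, z_section v K)]) (take k ys @ drop (Suc k) ys))"

section \<open>Path algebras and the tilting quiver\<close>

text \<open>
  A path is \<open>(u, p, v)\<close> where \<open>p\<close> is an arc walk from \<open>u\<close> to \<open>v\<close>. Walks list their arcs in order of
  traversal, so in the product of paths, composed like maps, the walk of the right factor comes first.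
\<close>

type_synonym ('v, 'a) path = "'v \<times> 'a list \<times> 'v"

definition path_algebra :: "('v, 'a) pre_digraph \<Rightarrow> ('k::field, ('v, 'a) path \<Rightarrow>\<^sub>0 'k) module"
  where "path_algebra Q =
    \<lparr>carrier = {x. \<forall>(u, p, v)\<in>Poly_Mapping.keys x. pre_digraph.awalk Q u p v},
     mult = (\<lambda>x y. \<Sum>(u', p', v')\<in>Poly_Mapping.keys x. \<Sum>(u, p, v)\<in>Poly_Mapping.keys y.
       if v = u' then Poly_Mapping.single (u, p @ p', v')
         (Poly_Mapping.lookup x (u', p', v') * Poly_Mapping.lookup y (u, p, v)) else 0),
     one = (\<Sum>v\<in>verts Q. Poly_Mapping.single (v, [], v) 1),
     zero = 0, add = (+), smult = pm_scale\<rparr>"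

definition vertex_idem :: "'v \<Rightarrow> (('v, 'a) path \<Rightarrow>\<^sub>0 'k::field)"
  where "vertex_idem v = Poly_Mapping.single (v, [], v) 1"

definition arrow_elem :: "('v, 'a) pre_digraph \<Rightarrow> 'a \<Rightarrow> (('v, 'a) path \<Rightarrow>\<^sub>0 'k::field)"
  where "arrow_elem Q a = Poly_Mapping.single (tail Q a, [a], head Q a) 1"

text \<open>
  The arrow $a^{\lambda,i}_\rho$ is the triple \<open>(\<lambda>, i, \<rho>)\<close>, the index \<open>\<rho>\<close> ranging over the \<open>CARD('n)\<close>
  elements of \<open>'n\<close>.
\<close>

type_synonym 'n arrow = "(nat \<times> nat) \<times> nat \<times> 'n"

definition tilting_quiver :: "(nat \<times> nat, 'n::finite arrow) pre_digraph"
  where "tilting_quiver =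
    \<lparr>verts = young (CARD('n) - 2),
     arcs = {(l, i, \<rho>). i \<in> {1, 2} \<and> l \<in> young (CARD('n) - 2) \<and>
       l + unit_weight i \<in> young (CARD('n) - 2)},
     tail = (\<lambda>(l, i, \<rho>). l),
     head = (\<lambda>(l, i, \<rho>). l + unit_weight i)\<rparr>"

definition kQ :: "('k::field, (nat \<times> nat, 'n::finite arrow) path \<Rightarrow>\<^sub>0 'k) module"
  where "kQ = path_algebra tilting_quiver"

definition tilting_hom ::
    "('n::finite \<Rightarrow> 'k::field ^ 'n) \<Rightarrow> (((nat \<times> nat, 'n arrow) path \<Rightarrow>\<^sub>0 'k) \<Rightarrow> ('k, 'n) E_endo) \<Rightarrow> bool"
  where "tilting_hom u \<Phi> \<longleftrightarrow>
    \<Phi> \<in> alg_hom kQ End_E \<and>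
    (\<forall>l\<in>verts (tilting_quiver :: (_, 'n arrow) pre_digraph).
       \<Phi> (vertex_idem l) = summand_endo l l (\<lambda>K s. s)) \<and>
    (\<forall>l \<rho>. (l, 1, \<rho>) \<in> arcs tilting_quiver \<longrightarrow>
       \<Phi> (arrow_elem tilting_quiver (l, 1, \<rho>)) = summand_endo l (l + unit_weight 1) (f_map l (u \<rho>))) \<and>
    (\<forall>l \<rho>. (l, 2, \<rho>) \<in> arcs tilting_quiver \<longrightarrow>
       \<Phi> (arrow_elem tilting_quiver (l, 2, \<rho>)) = summand_endo l (l + unit_weight 2) (g_map l (u \<rho>)))"

end

(*
  Let n be the rank of V. A point of the Grassmannian together with a basis of the fibre of W there is
  a frame c in (k^2)^n whose entries, the images of the basis vectors u_i, span k^2. In such a frame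
  S^lambda W becomes the GL(2)-module det^lambda_2 (x) Sym^(lambda_1 - lambda_2) of binary forms, so
  the (lambda, mu) block of an endomorphism of E is a GL(2)-equivariant regular family of linear maps
  F(c) between spaces of forms, over the nondegenerate frames. The degenerate frames have codimension
  n - 1 >= 2, so by Hartogs F is polynomial in c, and scalar matrices show that it is homogeneous of
  degree d = |mu| - |lambda|. If d < 0 then F = 0, and if d = 0 then F is constant and Schur's lemma
  makes it a scalar multiple of the identity. If d > 0, Euler's identity writes d F(c) p as the sum
  over i of the derivatives of F in the directions c_i, which is equivariant and linear in
  c_i (x) p. By the Pieri decomposition of k^2 (x) S^lambda it factors through multiplication of p by
  c_i (the map f) and contraction of p with c_i (the map g). Induction on d exhibits F as the image of
  an element of the path algebra. A factor through lambda + e_1 with lambda_1 = n - 2 = mu_1 lies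
  outside the quiver, but it vanishes because there is no nonzero equivariant family to a weight with
  smaller first entry.
*)
theory Submission
  imports Defs
begin

section \<open>Binary forms\<close>

text \<open>Forms are dehomogenised: a form of degree m in X, Y is a polynomial of degree at most m
  in Y alone, and m is carried by the weight. Scalars are constant polynomials, so everything lives
  in k[Y]. There are no limits over k; every analytic step is an identity along a line c + tN,
  resting on the fact that polynomials in t over k[Y] which agree at infinitely many scalars are
  equal. This gives the absence of zero divisors, derivatives, Euler's identity and the Hartogs
  extension. For the latter the line is chosen so that one minor becomes monic in t while another
  stays constant: division by a monic polynomial introduces no denominators. The bound n >= 4
  supplies two disjoint pairs of indices for these minors. The fibres of the Schur bundles are
  quotients by relations, so the passage to forms needs two directions: determinants and linear
  forms satisfy the relations, and modulo the relations every tensor reduces to a normal form that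
  its form determines. That images of paths are regular is seen on generators, where f and g send
  constant tensors to sums of constant tensors.\<close>

definition lin :: "'k::field \<times> 'k \<Rightarrow> 'k poly"
  where "lin y = [:fst y, snd y:]"

definition det2 :: "'k::field \<times> 'k \<Rightarrow> 'k \<times> 'k \<Rightarrow> 'k"
  where "det2 x y = fst x * snd y - snd x * fst y"

text \<open>The matrix with columns \<open>a\<close> and \<open>b\<close> applied to
  \<open>y\<close>. Group elements are given by their columns because a matrix acts on forms by
  substituting the linear forms \<open>lin a\<close> and \<open>lin b\<close> for X and Y.\<close>

definition comb :: "'k::field \<times> 'k \<Rightarrow> 'k \<times> 'k \<Rightarrow> 'k \<times> 'k \<Rightarrow> 'k \<times> 'k"
  where "comb a b y = (fst y * fst a + snd y * fst b, fst y * snd a + snd y * snd b)"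

text \<open>
  A polynomial \<open>p\<close> of degree at most \<open>m\<close> stands for the binary form
  $\sum_j p_j X^{m-j}Y^j$; this is the result of substituting \<open>A\<close>, \<open>B\<close> for $X$, $Y$.
\<close>

definition subst_form :: "nat \<Rightarrow> 'k::field poly \<Rightarrow> 'k poly \<Rightarrow> 'k poly \<Rightarrow> 'k poly"
  where "subst_form m A B p = (\<Sum>j\<le>m. [:poly.coeff p j:] * A ^ (m - j) * B ^ j)"

text \<open>Scalars act as multiplication by constant polynomials rather than through
  \<open>smult\<close>, so that one ring normalisation handles scalars and forms together. These
  rules push the constant through scalar arithmetic.\<close>

lemma const_poly_simps:
  "[:a + b:] = [:a:] + [:b:]" "[:a - b:] = [:a:] - [:b:]" "[:- a:] = - [:a:]" "[:a * b:] = [:a:] * [:b::'k::field:]"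
  "[:a ^ n:] = [:a:] ^ n" "[:of_nat n:] = of_nat n"
  by (simp_all add: of_nat_poly poly_const_pow)

lemma subst_form_add: "subst_form m A B (p + q) = subst_form m A B p + subst_form m A B q"
  unfolding subst_form_def coeff_add const_poly_simps distrib_right sum.distrib ..

lemma subst_form_const_mult: "subst_form m A B ([:a:] * p) = [:a:] * subst_form m A B p"
  unfolding subst_form_def sum_distrib_left by (rule sum.cong) (simp_all add: mult_ac)

lemma subst_form_0 [simp]: "subst_form m A B 0 = 0"
  by (simp add: subst_form_def)

lemma subst_form_sum: "subst_form m A B (sum f I) = (\<Sum>i\<in>I. subst_form m A B (f i))"
  by (induction I rule: infinite_finite_induct) (simp_all add: subst_form_add)

lemma subst_form_pCons:
  "subst_form (Suc m) A B (pCons a p) = [:a:] * A ^ Suc m + B * subst_form m A B p"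
  unfolding subst_form_def sum.atMost_Suc_shift sum_distrib_left
  by (simp add: mult_ac)

text \<open>A polynomial of degree at most m, read as a form of degree m + 1, is X times its reading
  as a form of degree m, and X is replaced by \<open>A\<close>.\<close>

lemma subst_form_Suc:
  assumes "degree p \<le> m"
  shows "subst_form (Suc m) A B p = A * subst_form m A B p"
proof -
  have "poly.coeff p (Suc m) = 0"
    using assms by (simp add: coeff_eq_0)
  then show ?thesis
    unfolding subst_form_def sum.atMost_Suc sum_distrib_left
    by (simp add: Suc_diff_le mult_ac)
qed

lemma lin_mult: "lin y * p = [:fst y:] * p + pCons 0 ([:snd y:] * p)"
  by (simp add: lin_def)

lemma subst_form_lin_mult:
  assumes "degree p \<le> m"
  shows "subst_form (Suc m) A B (lin y * p) = ([:fst y:] * A + [:snd y:] * B) * subst_form m A B p"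
  unfolding lin_mult subst_form_add subst_form_const_mult subst_form_pCons subst_form_Suc[OF assms]
  by (simp add: algebra_simps)

lemma degree_lin: "degree (lin y) \<le> 1"
  by (simp add: lin_def)

lemma degree_prod_list_lin: "degree (prod_list (map lin ys)) \<le> length ys"
  by (induction ys) (auto intro: order.trans[OF degree_mult_le] add_mono[OF degree_lin, simplified])

lemma subst_form_prod_list:
  "subst_form (length ys) A B (prod_list (map lin ys)) = prod_list (map (\<lambda>y. [:fst y:] * A + [:snd y:] * B) ys)"
proof (induction ys)
  case (Cons y ys)
  then show ?case
    using subst_form_lin_mult[OF degree_prod_list_lin, of ys A B y] by simp
qed (simp add: subst_form_def)

lemma lin_comb: "lin (comb a b y) = [:fst y:] * lin a + [:snd y:] * lin b"
  by (simp add: lin_def comb_def)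

lemma det2_comb: "det2 (comb a b x) (comb a b y) = det2 a b * det2 x y"
  by (simp add: det2_def comb_def algebra_simps)

lemma subst_form_monomial:
  "j \<le> m \<Longrightarrow> subst_form m A B (lin (1,0) ^ (m - j) * lin (0,1) ^ j) = A ^ (m - j) * B ^ j"
  using subst_form_prod_list[of "replicate (m - j) (1,0) @ replicate j (0,1)" A B]
  by (simp add: map_replicate_const)

lemma lin_unit: "lin (1,0) = 1" "lin (0,1) = [:0,1:]"
  by (simp_all add: lin_def)

lemma subst_form_power:
  "j \<le> m \<Longrightarrow> subst_form m A B ([:0,1:] ^ j) = A ^ (m - j) * B ^ j"
  using subst_form_monomial[of j m A B] by (simp add: lin_unit)

lemma poly_eq_sum_powers:
  assumes "degree p \<le> m"
  shows "p = (\<Sum>j\<le>m. [:poly.coeff p j:] * [:0,1::'k::field:] ^ j)"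
proof -
  have "p = (\<Sum>j\<le>m. monom (poly.coeff p j) j)"
    using poly_as_sum_of_monoms'[OF assms] by simp
  then show ?thesis
    by (simp add: monom_altdef)
qed

lemma subst_form_id: "degree p \<le> m \<Longrightarrow> subst_form m 1 [:0,1:] p = p"
  unfolding subst_form_def using poly_eq_sum_powers[of p m] by simp

text \<open>By linearity this reduces to products of linear forms, on which substitution is
  multiplicative. With the adjugate as inner matrix it inverts a substitution up to a power of the
  determinant.\<close>

lemma subst_form_subst_form:
  "subst_form m A B (subst_form m (lin a) (lin b) p)
    = subst_form m ([:fst a:] * A + [:snd a:] * B) ([:fst b:] * A + [:snd b:] * B) p"
proof -
  have "subst_form m A B (lin a ^ (m - j) * lin b ^ j)
      = ([:fst a:] * A + [:snd a:] * B) ^ (m - j) * ([:fst b:] * A + [:snd b:] * B) ^ j" if "j \<le> m" for j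
    using that subst_form_prod_list[of "replicate (m - j) a @ replicate j b" A B]
    by (simp add: map_replicate_const)
  then show ?thesis
    unfolding subst_form_def[of m "lin a"] subst_form_sum mult.assoc subst_form_const_mult
    by (simp add: subst_form_def mult.assoc)
qed

lemma subst_form_scale:
  "subst_form m (d * A) (d * B) p = d ^ m * subst_form m A B p"
  unfolding subst_form_def sum_distrib_left
proof (rule sum.cong)
  fix j assume "j \<in> {..m}"
  then have "d ^ m = d ^ (m - j) * d ^ j"
    by (simp flip: power_add)
  then show "[:poly.coeff p j:] * (d * A) ^ (m - j) * (d * B) ^ j = d ^ m
      * ([:poly.coeff p j:] * A ^ (m - j) * B ^ j)"
    by (simp add: power_mult_distrib mult_ac)
qed simp

lemma degree_subst_form:
  assumes "degree A \<le> 1" "degree B \<le> 1"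
  shows "degree (subst_form m A B p) \<le> m"
  unfolding subst_form_def
proof (rule degree_sum_le)
  fix j assume "j \<in> {..m}"
  have "degree ([:poly.coeff p j:] * A ^ (m - j) * B ^ j) \<le> 0 + degree A * (m - j) + degree B * j"
    by (intro order.trans[OF degree_mult_le] add_mono degree_power_le) simp
  also have "\<dots> \<le> 1 * (m - j) + 1 * j"
    using assms by (intro add_mono mult_right_mono) auto
  finally show "degree ([:poly.coeff p j:] * A ^ (m - j) * B ^ j) \<le> m"
    using \<open>j \<in> {..m}\<close> by simp
qed simp

text \<open>For a form q of degree m, Euler's identity makes
  \<open>of_nat m * q - [:0,1:] * pderiv q\<close> the dehomogenised X-derivative, while
  \<open>pderiv q\<close> is the Y-derivative. The operator is \<open>snd z\<close> times the former
  minus \<open>fst z\<close> times the latter: the contraction that replaces each linear factor y in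
  turn by the scalar \<open>det2 y z\<close>.\<close>

definition wedge :: "nat \<Rightarrow> 'k::field \<times> 'k \<Rightarrow> 'k poly \<Rightarrow> 'k poly"
  where "wedge m z q = [:snd z:] * (of_nat m * q - [:0,1:] * pderiv q) - [:fst z:] * pderiv q"

lemma wedge_add: "wedge m z (p + q) = wedge m z p + wedge m z q"
  by (simp add: wedge_def pderiv_add algebra_simps)

lemma wedge_const_mult: "wedge m z ([:a:] * p) = [:a:] * wedge m z p"
  by (simp add: wedge_def pderiv_smult algebra_simps smult_diff_right smult_add_right)

text \<open>The Leibniz rule for a first order operator. The index is the form degree, which enters
  the X-derivative, so the extra linear factor shifts it by one.\<close>

lemma wedge_Suc_lin_mult:
  "wedge (Suc m) z (lin y * p) = [:det2 y z:] * p + lin y * wedge m z p"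
proof -
  have 1: "pderiv (lin y) = [:snd y:]"
    by (simp add: lin_def pderiv_pCons)
  have 2: "lin y = [:fst y:] + [:snd y:] * [:0,1:]"
    by (simp add: lin_def)
  show ?thesis
    unfolding wedge_def pderiv_mult 1 det2_def const_poly_simps
    unfolding 2 by (simp only: of_nat_Suc mult_1_left algebra_simps)
qed

lemma wedge_prod_list:
  "wedge (length ys) z (prod_list (map lin ys))
    = (\<Sum>k<length ys. [:det2 (ys ! k) z:] * prod_list (map lin (take k ys @ drop (Suc k) ys)))"
proof (induction ys)
  case (Cons y ys)
  show ?case
    unfolding length_Cons list.map prod_list.Cons wedge_Suc_lin_mult Cons.IH sum.lessThan_Suc_shift sum_distrib_left
    by (simp add: mult_ac del: mult_pCons_left)
qed (simp add: wedge_def)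

text \<open>The coefficient of the X-derivative at exponent m + 1 is a difference of two equal
  terms, both m + 1 times the top coefficient. This is where the index of \<open>wedge\<close> has
  to match the degree of the form.\<close>

lemma degree_wedge:
  assumes "degree p \<le> Suc m"
  shows "degree (wedge (Suc m) z p) \<le> m"
proof (rule degree_le, intro allI impI)
  fix i assume "m < i"
  have "poly.coeff (of_nat (Suc m) * p - [:0,1:] * pderiv p) i = 0"
  proof (cases i)
    case (Suc j)
    then show ?thesis
      using assms \<open>m < i\<close>
      by (cases "i = Suc m") (simp_all add: of_nat_poly coeff_pderiv coeff_eq_0 algebra_simps)
  qed (use \<open>m < i\<close> in simp)
  moreover have "poly.coeff (pderiv p) i = 0"
    using assms \<open>m < i\<close> by (simp add: coeff_pderiv coeff_eq_0)
  ultimately show "poly.coeff (wedge (Suc m) z p) i = 0"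
    by (simp add: wedge_def)
qed

lemma wedge_degree_0: "degree p \<le> 0 \<Longrightarrow> wedge 0 z p = 0"
  by (auto simp: wedge_def pderiv_eq_0_iff elim: degree_eq_zeroE)

text \<open>The ring k[Y] is a domain, so a nonzero polynomial in t over it has finitely many roots,
  and distinct scalars t give distinct constants. The identities along lines of frames are derived
  from this.\<close>

lemma poly_const_points_eqI:
  fixes q r :: "'k::field poly poly"
  assumes "infinite {t. poly q [:t:] = poly r [:t:]}"
  shows "q = r"
proof (rule ccontr)
  assume "q \<noteq> r"
  then have "finite {x. poly (q - r) x = 0}"
    by (intro poly_roots_finite) simp
  moreover have "(\<lambda>t. [:t:]) ` {t. poly q [:t:] = poly r [:t:]} \<subseteq> {x. poly (q - r) x = 0}"
    by auto
  ultimately have "finite ((\<lambda>t. [:t:]) ` {t. poly q [:t:] = poly r [:t:]})"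
    by (rule rev_finite_subset)
  then show False
    using assms by (simp add: finite_image_iff inj_on_def)
qed

lemma poly_const_points_eqI_cofinite:
  fixes q r :: "'k::field_char_0 poly poly"
  assumes "finite S" "\<And>t. t \<notin> S \<Longrightarrow> poly q [:t:] = poly r [:t:]"
  shows "q = r"
proof (rule poly_const_points_eqI)
  have "infinite (- S)"
    using assms(1) infinite_UNIV_char_0[where ?'a = 'k] by (simp add: finite_compl)
  then show "infinite {t. poly q [:t:] = poly r [:t:]}"
    by (rule infinite_super[rotated]) (use assms(2) in auto)
qed

section \<open>Polynomial functions of frames\<close>

type_synonym ('k, 'n) frame = "'n \<Rightarrow> 'k \<times> 'k"

text \<open>Values lie in k[Y], so that scalar functions (constant values) and families of forms
  share one notion. Monomials grow by one coordinate at a time, which makes composition with a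
  linear map of values an immediate induction; closure under products comes out of that.\<close>

inductive_set poly_maps :: "(('k::field, 'n) frame \<Rightarrow> 'k poly) set"
  where
    const: "(\<lambda>_. q) \<in> poly_maps"
  | add: "f \<in> poly_maps \<Longrightarrow> g \<in> poly_maps \<Longrightarrow> (\<lambda>c. f c + g c) \<in> poly_maps"
  | mult_fst: "f \<in> poly_maps \<Longrightarrow> (\<lambda>c. [:fst (c i):] * f c) \<in> poly_maps"
  | mult_snd: "f \<in> poly_maps \<Longrightarrow> (\<lambda>c. [:snd (c i):] * f c) \<in> poly_maps"

lemma poly_maps_linear:
  fixes h :: "'k::field poly \<Rightarrow> 'k poly"
  assumes "\<And>p q. h (p + q) = h p + h q" "\<And>a p. h ([:a:] * p) = [:a:] * h p"
    and "f \<in> poly_maps"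
  shows "(\<lambda>c. h (f c)) \<in> poly_maps"
  using assms(3)
proof induction
  case (mult_fst f i)
  show ?case
    unfolding assms(2) by (rule poly_maps.mult_fst) (rule mult_fst.IH)
next
  case (mult_snd f i)
  show ?case
    unfolding assms(2) by (rule poly_maps.mult_snd) (rule mult_snd.IH)
qed (auto simp: assms(1) intro: poly_maps.intros)

lemma poly_maps_mult:
  assumes "f \<in> poly_maps" "g \<in> poly_maps"
  shows "(\<lambda>c. f c * g c) \<in> poly_maps"
  using assms(1)
proof induction
  case (const q)
  show ?case
    by (rule poly_maps_linear) (simp_all add: algebra_simps assms(2))
next
  case (add f f')
  show ?case
    unfolding distrib_right by (rule poly_maps.add) (rule add.IH)+
next
  case (mult_fst f i)
  show ?case
    unfolding mult.assoc by (rule poly_maps.mult_fst) (rule mult_fst.IH)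
next
  case (mult_snd f i)
  show ?case
    unfolding mult.assoc by (rule poly_maps.mult_snd) (rule mult_snd.IH)
qed

lemma poly_maps_coord:
  "(\<lambda>c. [:fst (c i):]) \<in> poly_maps" "(\<lambda>c. [:snd (c i):]) \<in> poly_maps"
  using poly_maps.mult_fst[OF poly_maps.const[of 1], of i] poly_maps.mult_snd[OF poly_maps.const[of 1], of i]
  by simp_all

text \<open>Constants and coordinates generate everything as a ring. This form of induction suits
  properties that pass to products, such as being polynomial along lines or having a
  derivative.\<close>

lemma poly_maps_ring_induct [consumes 1, case_names const coord_fst coord_snd add mult]:
  assumes "f \<in> poly_maps" "\<And>q. P (\<lambda>_. q)" "\<And>i. P (\<lambda>c. [:fst (c i):])" "\<And>i. P (\<lambda>c. [:snd (c i):])"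
    "\<And>f g. P f \<Longrightarrow> P g \<Longrightarrow> P (\<lambda>c. f c + g c)" "\<And>f g. P f \<Longrightarrow> P g \<Longrightarrow> P (\<lambda>c. f c * g c)"
  shows "P f"
  using assms(1) by induction (fact assms(2) | rule assms(5,6); (assumption | rule assms(3,4)))+

lemmas poly_maps_basic_intros = poly_maps.const poly_maps_coord poly_maps.add poly_maps_mult

lemma poly_maps_uminus: "f \<in> poly_maps \<Longrightarrow> (\<lambda>c. - f c) \<in> poly_maps"
  using poly_maps_mult[OF poly_maps.const[of "-1"]] by fastforce

lemma poly_maps_diff: "f \<in> poly_maps \<Longrightarrow> g \<in> poly_maps \<Longrightarrow> (\<lambda>c. f c - g c) \<in> poly_maps"
  using poly_maps.add[of f "\<lambda>c. - g c"] by (simp add: poly_maps_uminus)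

lemma poly_maps_power: "f \<in> poly_maps \<Longrightarrow> (\<lambda>c. f c ^ n) \<in> poly_maps"
  by (induction n) (auto intro: poly_maps_basic_intros)

lemma poly_maps_sum:
  "(\<And>i. i \<in> I \<Longrightarrow> f i \<in> poly_maps) \<Longrightarrow> (\<lambda>c. \<Sum>i\<in>I. f i c) \<in> poly_maps"
  by (induction I rule: infinite_finite_induct) (auto intro: poly_maps_basic_intros)

lemma poly_maps_lin: "(\<lambda>c. lin (c i)) \<in> poly_maps"
proof -
  have "(\<lambda>c. [:fst (c i):] + [:snd (c i):] * [:0, 1:]) \<in> poly_maps"
    by (intro poly_maps_basic_intros)
  then show ?thesis
    by (simp add: lin_def)
qed

lemma poly_maps_det2: "(\<lambda>c. [:det2 (c i) (c j):]) \<in> poly_maps"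
  unfolding det2_def const_poly_simps by (intro poly_maps_diff poly_maps_basic_intros)

lemma poly_maps_coeff_pCons:
  "f \<in> poly_maps \<Longrightarrow> (\<And>k. (\<lambda>c. poly.coeff (q c) k) \<in> poly_maps) \<Longrightarrow>
    (\<lambda>c. poly.coeff (pCons (f c) (q c)) k) \<in> poly_maps"
  by (cases k) simp_all

lemmas poly_maps_intros = poly_maps_basic_intros poly_maps_diff poly_maps_power poly_maps_sum poly_maps_lin
    poly_maps_det2

section \<open>Restriction to lines and division with parameters\<close>

definition shift_frame :: "('k::field, 'n) frame \<Rightarrow> 'k \<Rightarrow> ('k, 'n) frame \<Rightarrow> ('k, 'n) frame"
  where "shift_frame c t N = (\<lambda>i. (fst (c i) + t * fst (N i), snd (c i) + t * snd (N i)))"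

text \<open>On a line in direction \<open>N\<close> the function is a polynomial in the line
  parameter whose coefficients are again polynomial functions of the base point. The degree bound is
  uniform in the base point, which the division with parameters relies on.\<close>

lemma poly_maps_along_lines:
  fixes f :: "('k::field, 'n) frame \<Rightarrow> 'k poly"
  assumes "f \<in> poly_maps"
  shows "\<exists>q. (\<forall>c t. poly (q c) [:t:] = f (shift_frame c t N)) \<and>
    (\<forall>k. (\<lambda>c. poly.coeff (q c) k) \<in> poly_maps) \<and> (\<exists>B. \<forall>c. degree (q c) \<le> B)"
  using assms
proof (induction rule: poly_maps_ring_induct)
  case (const q)
  show ?case
    by (rule exI[of _ "\<lambda>_. [:q:]"]) (auto intro: poly_maps_basic_intros)
next
  case (coord_fst i)
  have "(\<lambda>c. poly.coeff [:[:fst (c i):], [:fst (N i):]:] k) \<in> poly_maps" for k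
    by (intro poly_maps_coeff_pCons poly_maps_basic_intros)
  then show ?case
    by (intro exI[of _ "\<lambda>c. [:[:fst (c i):], [:fst (N i):]:]"] conjI exI[of _ 1]) (auto simp: shift_frame_def)
next
  case (coord_snd i)
  have "(\<lambda>c. poly.coeff [:[:snd (c i):], [:snd (N i):]:] k) \<in> poly_maps" for k
    by (intro poly_maps_coeff_pCons poly_maps_basic_intros)
  then show ?case
    by (intro exI[of _ "\<lambda>c. [:[:snd (c i):], [:snd (N i):]:]"] conjI exI[of _ 1]) (auto simp: shift_frame_def)
next
  case (add f g)
  then obtain q r B C where q: "\<forall>c t. poly (q c) [:t:] = f (shift_frame c t N)"
      "\<forall>k. (\<lambda>c. poly.coeff (q c) k) \<in> poly_maps" "\<forall>c. degree (q c) \<le> B"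
    and r: "\<forall>c t. poly (r c) [:t:] = g (shift_frame c t N)"
      "\<forall>k. (\<lambda>c. poly.coeff (r c) k) \<in> poly_maps" "\<forall>c. degree (r c) \<le> C"
    by blast
  have "degree (q c + r c) \<le> max B C" for c
    using q(3) r(3) by (meson degree_add_le max.coboundedI1 max.coboundedI2)
  then show ?case
    using q r by (intro exI[of _ "\<lambda>c. q c + r c"]) (auto intro: poly_maps_basic_intros)
next
  case (mult f g)
  then obtain q r B C where q: "\<forall>c t. poly (q c) [:t:] = f (shift_frame c t N)"
      "\<forall>k. (\<lambda>c. poly.coeff (q c) k) \<in> poly_maps" "\<forall>c. degree (q c) \<le> B"
    and r: "\<forall>c t. poly (r c) [:t:] = g (shift_frame c t N)"
      "\<forall>k. (\<lambda>c. poly.coeff (r c) k) \<in> poly_maps" "\<forall>c. degree (r c) \<le> C"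
    by blast
  have "degree (q c * r c) \<le> B + C" for c
    using q(3) r(3) by (meson degree_mult_le add_mono order.trans)
  then show ?case
    using q r by (intro exI[of _ "\<lambda>c. q c * r c"]) (auto intro!: poly_maps_intros simp: coeff_mult)
qed

text \<open>On the line from \<open>c\<close> to \<open>c0\<close> both functions become polynomials
  in t over the domain k[Y] with zero product, and the second is nonzero because its value at t = 1
  is. So the first vanishes identically, in particular at t = 0.\<close>

lemma poly_maps_no_zero_divisors:
  fixes f g :: "('k::field_char_0, 'n) frame \<Rightarrow> 'k poly"
  assumes "f \<in> poly_maps" "g \<in> poly_maps" and fg: "\<And>c. f c * g c = 0" and "g c0 \<noteq> 0"
  shows "f c = 0"
proof -
  define N where "N = (\<lambda>i. (fst (c0 i) - fst (c i), snd (c0 i) - snd (c i)))"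
  obtain q where q: "\<And>c t. poly (q c) [:t:] = f (shift_frame c t N)"
    using poly_maps_along_lines[OF assms(1), of N] by blast
  obtain r where r: "\<And>c t. poly (r c) [:t:] = g (shift_frame c t N)"
    using poly_maps_along_lines[OF assms(2), of N] by blast
  have "q c * r c = 0"
    by (rule poly_const_points_eqI_cofinite[of "{}"]) (simp_all add: q r fg)
  moreover have "poly (r c) [:1:] \<noteq> 0"
    using assms(4) by (simp add: r shift_frame_def N_def)
  ultimately have "poly (q c) [:0:] = 0"
    by auto
  then show ?thesis
    by (simp only: q) (simp add: shift_frame_def)
qed

text \<open>Long division by a family that is monic in the line parameter uses only ring operations
  on coefficients, so quotient and remainder stay polynomial in the frame. The induction runs over
  the excess \<open>B\<close> of the degree of \<open>h\<close>. The remainder is bounded by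
  vanishing coefficients because a strict degree bound could not be met for e = 0.\<close>

lemma poly_maps_monic_division:
  fixes h d :: "('k::field, 'n) frame \<Rightarrow> 'k poly poly"
  assumes d: "\<And>k. (\<lambda>c. poly.coeff (d c) k) \<in> poly_maps" "\<And>c. poly.coeff (d c) e = 1" "\<And>c. degree (d c) \<le> e"
    and h: "\<And>k. (\<lambda>c. poly.coeff (h c) k) \<in> poly_maps" "\<And>c i. i \<ge> e + B \<Longrightarrow> poly.coeff (h c) i = 0"
  shows "\<exists>q r. (\<forall>c. h c = q c * d c + r c) \<and> (\<forall>k. (\<lambda>c. poly.coeff (q c) k) \<in> poly_maps) \<and>
    (\<forall>c i. i \<ge> e \<longrightarrow> poly.coeff (r c) i = 0)"
  using h
proof (induction B arbitrary: h)
  case 0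
  then show ?case
    by (intro exI[of _ "\<lambda>_. 0"] exI[of _ h]) (auto intro: poly_maps.const)
next
  case (Suc B)
  \<comment> \<open>The next term of the quotient: as the divisor is monic, it cancels the
    coefficient at e + B without dividing.\<close>
  define g where "g c = monom (poly.coeff (h c) (e + B)) B" for c
  have g: "(\<lambda>c. poly.coeff (g c) k) \<in> poly_maps" for k
    using Suc.prems(1) by (cases "k = B") (auto simp: g_def intro: poly_maps.const)
  have gd: "poly.coeff (g c * d c) i =
      (if i < B then 0 else poly.coeff (h c) (e + B) * poly.coeff (d c) (i - B))" for c i
    by (simp add: g_def coeff_monom_mult)
  have "(\<lambda>c. poly.coeff (h c - g c * d c) k) \<in> poly_maps" for k
    unfolding coeff_diff gd using Suc.prems(1) d(1)
    by (cases "k < B") (auto intro!: poly_maps_intros)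
  moreover have "poly.coeff (h c - g c * d c) i = 0" if "i \<ge> e + B" for c i
  proof (cases "i = e + B")
    case True
    then show ?thesis
      unfolding coeff_diff gd using d(2) by simp
  next
    case False
    then have "poly.coeff (d c) (i - B) = 0"
      using that d(3)[of c] by (intro coeff_eq_0) linarith
    then show ?thesis
      unfolding coeff_diff gd using Suc.prems(2) False that by simp
  qed
  ultimately obtain q r where "\<forall>c. h c - g c * d c = q c * d c + r c"
      "\<forall>k. (\<lambda>c. poly.coeff (q c) k) \<in> poly_maps" "\<forall>c i. i \<ge> e \<longrightarrow> poly.coeff (r c) i = 0"
    using Suc.IH[of "\<lambda>c. h c - g c * d c"] by blast
  then show ?case
    using g by (intro exI[of _ "\<lambda>c. q c + g c"] exI[of _ r])
      (auto simp: algebra_simps intro: poly_maps.add)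
qed

text \<open>The function is P over a power of one minor and P' over a power of the other. On a line
  along which the first minor is constant and the second is monic in t, the division of P' by the
  power of the second minor must be exact, and the quotient at t = 0 is an expression for f without
  denominators.\<close>

lemma Hartogs_two_charts:
  fixes f :: "('k::field_char_0, 'n) frame \<Rightarrow> 'k poly"
  assumes dist: "i\<^sub>1 \<noteq> i\<^sub>3" "i\<^sub>1 \<noteq> i\<^sub>4" "i\<^sub>2 \<noteq> i\<^sub>3" "i\<^sub>2 \<noteq> i\<^sub>4" "i\<^sub>3 \<noteq> i\<^sub>4"
    and P: "P \<in> poly_maps" "\<And>c. det2 (c i\<^sub>1) (c i\<^sub>2) \<noteq> 0 \<Longrightarrow> [:det2 (c i\<^sub>1) (c i\<^sub>2):] ^ M * f c = P c"
    and P': "P' \<in> poly_maps" "\<And>c. det2 (c i\<^sub>3) (c i\<^sub>4) \<noteq> 0 \<Longrightarrow> [:det2 (c i\<^sub>3) (c i\<^sub>4):] ^ M' * f c = P' c"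
  shows "\<exists>Q\<in>poly_maps. \<forall>c. det2 (c i\<^sub>1) (c i\<^sub>2) \<noteq> 0 \<longrightarrow> f c = Q c"
proof -
  \<comment> \<open>Moving entry \<open>i\<^sub>3\<close> along (1, 0) and entry
    \<open>i\<^sub>4\<close> along (0, 1) turns the second minor into a quadratic polynomial with
    leading term t^2, while the entries \<open>i\<^sub>1\<close> and \<open>i\<^sub>2\<close> stay
    fixed.\<close>
  define N :: "('k, 'n) frame" where "N = (\<lambda>i. if i = i\<^sub>3 then (1, 0) else if i = i\<^sub>4 then (0, 1) else (0, 0))"
  obtain p where p: "\<And>c t. poly (p c) [:t:] = P (shift_frame c t N)"
    using poly_maps_along_lines[OF P(1), of N] by blast
  obtain p' B where p': "\<And>c t. poly (p' c) [:t:] = P' (shift_frame c t N)"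
      "\<And>k. (\<lambda>c. poly.coeff (p' c) k) \<in> poly_maps" "\<And>c. degree (p' c) \<le> B"
    using poly_maps_along_lines[OF P'(1), of N] by blast
  define d0 where "d0 c = [:[:fst (c i\<^sub>3):], 1:] * [:[:snd (c i\<^sub>4):], 1:] - [:[:snd (c i\<^sub>3) * fst (c i\<^sub>4):]:]"
    for c :: "('k, 'n) frame"
  have d0': "d0 c = [:[:det2 (c i\<^sub>3) (c i\<^sub>4):], [:fst (c i\<^sub>3):] + [:snd (c i\<^sub>4):], 1:]" for c
    by (simp add: d0_def det2_def)
  define d where "d c = d0 c ^ M'" for c
  have d0: "degree (d0 c) = 2" "lead_coeff (d0 c) = 1" "d0 c \<noteq> 0" for c
    by (simp_all add: d0')
  have d_degree: "degree (d c) = 2 * M'" and d_nz: "d c \<noteq> 0" for c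
    using d0 by (simp_all add: d_def degree_power_eq)
  have d_lead: "lead_coeff (d c) = 1" for c
    unfolding d_def lead_coeff_power d0(2) by simp
  have coeff_d0: "(\<lambda>c. poly.coeff (d0 c) k) \<in> poly_maps" for k
    unfolding d0' by (intro poly_maps_coeff_pCons poly_maps_intros)
  have coeff_power: "(\<lambda>c. poly.coeff (d0 c ^ n) k) \<in> poly_maps" for n k
  proof (induction n arbitrary: k)
    case (Suc n)
    then show ?case
      using coeff_d0 by (auto simp: coeff_mult intro!: poly_maps_intros)
  qed (auto intro: poly_maps.const)
  have "\<exists>q r. (\<forall>c. p' c = q c * d c + r c) \<and> (\<forall>k. (\<lambda>c. poly.coeff (q c) k) \<in> poly_maps) \<and>
    (\<forall>c i. i \<ge> 2 * M' \<longrightarrow> poly.coeff (r c) i = 0)"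
  proof (rule poly_maps_monic_division)
    show "poly.coeff (d c) (2 * M') = 1" for c
      using d_degree[of c] d_lead[of c] by simp
    show "poly.coeff (p' c) i = 0" if "i \<ge> 2 * M' + Suc B" for c i
      using that p'(3)[of c] by (intro coeff_eq_0) linarith
  qed (use coeff_power p'(2) d_degree in \<open>auto simp: d_def\<close>)
  then obtain q r where qr: "\<And>c. p' c = q c * d c + r c" "\<And>k. (\<lambda>c. poly.coeff (q c) k) \<in> poly_maps"
      "\<And>c i. i \<ge> 2 * M' \<Longrightarrow> poly.coeff (r c) i = 0"
    by blast
  have "f c = poly.coeff (q c) 0" if nz: "det2 (c i\<^sub>1) (c i\<^sub>2) \<noteq> 0" for c
  proof -
    define \<delta> where "\<delta> = [:det2 (c i\<^sub>1) (c i\<^sub>2):] ^ M"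
    have \<delta>: "\<delta> \<noteq> 0"
      using nz by (simp add: \<delta>_def)
    have N12: "det2 (shift_frame c t N i\<^sub>1) (shift_frame c t N i\<^sub>2) = det2 (c i\<^sub>1) (c i\<^sub>2)" for t
      using dist by (simp add: shift_frame_def N_def)
    have N34: "[:det2 (shift_frame c t N i\<^sub>3) (shift_frame c t N i\<^sub>4):] = poly (d0 c) [:t:]" for t
      using dist by (simp add: shift_frame_def N_def d0' det2_def algebra_simps)
    have "finite {t. poly (d0 c) [:t:] = 0}"
      using finite_vimageI[OF poly_roots_finite[OF d0(3)[of c]], of "\<lambda>t. [:t:]"]
      by (simp add: vimage_def inj_on_def)
    \<comment> \<open>Wherever the second minor is nonzero, both sides equal f on the line times the
      powers of both minors; only finitely many t are excluded.\<close>
    then have "p c * d c = [:\<delta>:] * p' c"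
    proof (rule poly_const_points_eqI_cofinite)
      fix t assume "t \<notin> {t. poly (d0 c) [:t:] = 0}"
      then have nz': "det2 (shift_frame c t N i\<^sub>3) (shift_frame c t N i\<^sub>4) \<noteq> 0"
        by (auto simp flip: N34)
      show "poly (p c * d c) [:t:] = poly ([:\<delta>:] * p' c) [:t:]"
        unfolding poly_mult d_def poly_power N34[symmetric] p p'(1) \<delta>_def poly_pCons poly_0
          P(2)[of "shift_frame c t N", unfolded N12, OF nz, symmetric] P'(2)[OF nz', symmetric]
        by (simp only: mult_zero_right mult_zero_left add_0_right mult_ac)
    qed
    then have eq: "(p c - [:\<delta>:] * q c) * d c = [:\<delta>:] * r c"
      unfolding qr(1) by (simp only: algebra_simps)
    \<comment> \<open>The right side of \<open>eq\<close> has no terms from exponent 2 M' on,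
      whereas a nonzero multiple of the monic \<open>d c\<close> has one.\<close>
    have "p c - [:\<delta>:] * q c = 0"
    proof (rule ccontr)
      assume nz': "p c - [:\<delta>:] * q c \<noteq> 0"
      have "degree ((p c - [:\<delta>:] * q c) * d c) \<ge> 2 * M'"
        using degree_mult_eq[OF nz' d_nz[of c]] d_degree[of c] by simp
      then have "poly.coeff ([:\<delta>:] * r c) (degree ((p c - [:\<delta>:] * q c) * d c)) = 0"
        using qr(3) by simp
      then have "lead_coeff ((p c - [:\<delta>:] * q c) * d c) = 0"
        unfolding eq .
      then show False
        using nz' d_nz by simp
    qed
    then have "poly (p c) [:0:] = poly ([:\<delta>:] * q c) [:0:]"
      by simp
    then have "P c = \<delta> * poly.coeff (q c) 0"
      unfolding p by (simp add: shift_frame_def poly_0_coeff_0)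
    then show ?thesis
      using P(2)[OF nz] nz by (simp add: \<delta>_def)
  qed
  then show ?thesis
    using qr(2) by (intro bexI[of _ "\<lambda>c. poly.coeff (q c) 0"]) auto
qed

section \<open>Directional derivatives\<close>

text \<open>A derivative without limits: \<open>D\<close> is the coefficient of t in the expansion
  along the line, the rest being t^2 times a polynomial in t. Over an infinite field this determines
  \<open>D\<close>.\<close>

definition has_frame_deriv ::
    "(('k::field, 'n) frame \<Rightarrow> 'k poly) \<Rightarrow> ('k, 'n) frame \<Rightarrow> ('k, 'n) frame \<Rightarrow> 'k poly \<Rightarrow> bool"
  where "has_frame_deriv f c N D \<longleftrightarrow>
    (\<exists>q. \<forall>t. f (shift_frame c t N) = f c + [:t:] * D + [:t:] ^ 2 * poly q [:t:])"

lemma has_frame_deriv_unique: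
  fixes D D' :: "'k::field_char_0 poly"
  assumes "has_frame_deriv f c N D" "has_frame_deriv f c N D'"
  shows "D = D'"
proof -
  obtain q where q: "\<And>t. f (shift_frame c t N) = f c + [:t:] * D + [:t:] ^ 2 * poly q [:t:]"
    using assms(1) by (auto simp: has_frame_deriv_def)
  obtain q' where q': "\<And>t. f (shift_frame c t N) = f c + [:t:] * D' + [:t:] ^ 2 * poly q' [:t:]"
    using assms(2) by (auto simp: has_frame_deriv_def)
  have "pCons (f c) (pCons D q) = pCons (f c) (pCons D' q')"
  proof (rule poly_const_points_eqI_cofinite[of "{}"])
    fix t
    have "poly (pCons (f c) (pCons D q)) [:t:] = f (shift_frame c t N)"
      unfolding q by (simp add: algebra_simps power2_eq_square)
    also have "\<dots> = poly (pCons (f c) (pCons D' q')) [:t:]"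
      unfolding q' by (simp add: algebra_simps power2_eq_square)
    finally show "poly (pCons (f c) (pCons D q)) [:t:] = poly (pCons (f c) (pCons D' q')) [:t:]" .
  qed simp
  then show ?thesis
    by simp
qed

lemma has_frame_deriv_add:
  assumes "has_frame_deriv f c N D" "has_frame_deriv g c N E"
  shows "has_frame_deriv (\<lambda>c. f c + g c) c N (D + E)"
proof -
  obtain q where q: "\<And>t. f (shift_frame c t N) = f c + [:t:] * D + [:t:] ^ 2 * poly q [:t:]"
    using assms(1) by (auto simp: has_frame_deriv_def)
  obtain r where r: "\<And>t. g (shift_frame c t N) = g c + [:t:] * E + [:t:] ^ 2 * poly r [:t:]"
    using assms(2) by (auto simp: has_frame_deriv_def)
  show ?thesis
    unfolding has_frame_deriv_def
    by (rule exI[of _ "q + r"]) (simp add: q r algebra_simps smult_add_right)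
qed

lemma has_frame_deriv_mult:
  assumes "has_frame_deriv f c N D" "has_frame_deriv g c N E"
  shows "has_frame_deriv (\<lambda>c. f c * g c) c N (f c * E + D * g c)"
proof -
  obtain q where q: "\<And>t. f (shift_frame c t N) = f c + [:t:] * D + [:t:] ^ 2 * poly q [:t:]"
    using assms(1) by (auto simp: has_frame_deriv_def)
  obtain r where r: "\<And>t. g (shift_frame c t N) = g c + [:t:] * E + [:t:] ^ 2 * poly r [:t:]"
    using assms(2) by (auto simp: has_frame_deriv_def)
  \<comment> \<open>Everything from t^2 on in the product of the expansions f + t D + t^2 q and g +
    t E + t^2 r, divided by t^2 and collected as a polynomial in t.\<close>
  define s where "s = [:f c:] * r + q * [:g c:] + [:D * E:] + [:0, 1:] * ([:D:] * r + q * [:E:]) + [:0, 0, 1:]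
      * q * r"
  have "poly s a = f c * poly r a + poly q a * g c + D * E + a * (D * poly r a + poly q a * E) + a ^ 2
      * poly q a * poly r a" for a
    by (simp add: s_def algebra_simps power2_eq_square)
  then show ?thesis
    unfolding has_frame_deriv_def q r
    by (intro exI[of _ s] allI) (simp only: algebra_simps power2_eq_square)
qed

lemma poly_map_poly_linear:
  fixes h :: "'k::field poly \<Rightarrow> 'k poly"
  assumes "\<And>p q. h (p + q) = h p + h q" "\<And>a p. h ([:a:] * p) = [:a:] * h p"
  shows "poly (map_poly h q) [:t:] = h (poly q [:t:])"
proof -
  have h0: "h 0 = 0"
    using assms(2)[of 0 0] by simp
  show ?thesis
  proof (induction q)
    case (pCons a q)
    then show ?case
      using assms by (simp add: map_poly_pCons h0 del: mult_pCons_left)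
  qed (simp add: h0)
qed

lemma has_frame_deriv_linear:
  fixes h :: "'k::field poly \<Rightarrow> 'k poly"
  assumes add: "\<And>p q. h (p + q) = h p + h q" and scale: "\<And>a p. h ([:a:] * p) = [:a:] * h p"
    and f: "has_frame_deriv f c N D"
  shows "has_frame_deriv (\<lambda>c. h (f c)) c N (h D)"
proof -
  obtain q where q: "\<And>t. f (shift_frame c t N) = f c + [:t:] * D + [:t:] ^ 2 * poly q [:t:]"
    using f by (auto simp: has_frame_deriv_def)
  have "h (f (shift_frame c t N)) = h (f c) + [:t:] * h D + [:t:] ^ 2 * poly (map_poly h q) [:t:]" for t
    unfolding q add scale power2_eq_square mult.assoc poly_map_poly_linear[OF add scale] ..
  then show ?thesis
    unfolding has_frame_deriv_def by blast
qed

text \<open>Yields partial derivatives that are themselves polynomial, and the derivative in any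
  direction as their linear combination. Both facts are needed to regard the derivative as a map on
  k^2 tensored with the source.\<close>

lemma poly_maps_has_frame_deriv:
  fixes f :: "('k::field, 'n::finite) frame \<Rightarrow> 'k poly"
  assumes "f \<in> poly_maps"
  shows "\<exists>d\<^sub>1 d\<^sub>2. (\<forall>i. d\<^sub>1 i \<in> poly_maps \<and> d\<^sub>2 i \<in> poly_maps) \<and>
    (\<forall>c N. has_frame_deriv f c N (\<Sum>i\<in>UNIV. [:fst (N i):] * d\<^sub>1 i c + [:snd (N i):] * d\<^sub>2 i c))"
proof -
  \<comment> \<open>Membership is carried through the induction because the product rule puts the
    factors themselves into the partial derivatives.\<close>
  have "f \<in> poly_maps \<and> ?thesis"
    using assms
  proof (induction rule: poly_maps_ring_induct)
    case (const q)
    have "has_frame_deriv (\<lambda>_. q) c N 0" for c N :: "('k, 'n) frame"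
      unfolding has_frame_deriv_def by (rule exI[of _ 0]) simp
    then show ?case
      by (auto intro!: poly_maps_intros exI[of _ "\<lambda>_ _. 0"])
  next
    case (coord_fst j)
    have 1: "has_frame_deriv (\<lambda>c. [:fst (c j):]) c N [:fst (N j):]" for c N :: "('k, 'n) frame"
      unfolding has_frame_deriv_def by (rule exI[of _ 0]) (simp add: shift_frame_def)
    have 2: "(\<Sum>i\<in>UNIV. [:fst (N i):] * (if i = j then 1 else 0) + [:snd (N i):] * 0) = [:fst (N j):]"
      for N :: "('k, 'n) frame"
      by (simp add: if_distrib[of "\<lambda>x. _ * x"] cong: if_cong)
    show ?case
      by (rule conjI[OF poly_maps_coord(1)],
          rule exI[of _ "\<lambda>i _. if i = j then 1 else 0"], rule exI[of _ "\<lambda>_ _. 0"])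
        (use 1 2 in \<open>auto intro: poly_maps.const\<close>)
  next
    case (coord_snd j)
    have 1: "has_frame_deriv (\<lambda>c. [:snd (c j):]) c N [:snd (N j):]" for c N :: "('k, 'n) frame"
      unfolding has_frame_deriv_def by (rule exI[of _ 0]) (simp add: shift_frame_def)
    have 2: "(\<Sum>i\<in>UNIV. [:fst (N i):] * 0 + [:snd (N i):] * (if i = j then 1 else 0)) = [:snd (N j):]"
      for N :: "('k, 'n) frame"
      by (simp add: if_distrib[of "\<lambda>x. _ * x"] cong: if_cong)
    show ?case
      by (rule conjI[OF poly_maps_coord(2)],
          rule exI[of _ "\<lambda>_ _. 0"], rule exI[of _ "\<lambda>i _. if i = j then 1 else 0"])
        (use 1 2 in \<open>auto intro: poly_maps.const\<close>)
  next
    case (add f g)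
    then obtain d e d' e' where d: "\<forall>i. d i \<in> poly_maps \<and> e i \<in> poly_maps"
        "\<And>c N. has_frame_deriv f c N (\<Sum>i\<in>UNIV. [:fst (N i):] * d i c + [:snd (N i):] * e i c)"
      and d': "\<forall>i. d' i \<in> poly_maps \<and> e' i \<in> poly_maps"
        "\<And>c N. has_frame_deriv g c N (\<Sum>i\<in>UNIV. [:fst (N i):] * d' i c + [:snd (N i):] * e' i c)"
      by blast
    have "has_frame_deriv (\<lambda>c. f c + g c) c N
        (\<Sum>i\<in>UNIV. [:fst (N i):] * (d i c + d' i c) + [:snd (N i):] * (e i c + e' i c))" for c N
      using has_frame_deriv_add[OF d(2) d'(2), of c N]
      by (simp add: distrib_left sum.distrib add_ac del: mult_pCons_left)
    then have "\<exists>d\<^sub>1 d\<^sub>2. (\<forall>i. d\<^sub>1 i \<in> poly_maps \<and> d\<^sub>2 i \<in> poly_maps) \<and>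
        (\<forall>c N. has_frame_deriv (\<lambda>c. f c + g c) c N (\<Sum>i\<in>UNIV. [:fst (N i):] * d\<^sub>1 i c + [:snd (N i):] * d\<^sub>2 i c))"
      using d(1) d'(1)
      by - (rule exI[of _ "\<lambda>i c. d i c + d' i c"], rule exI[of _ "\<lambda>i c. e i c + e' i c"],
          blast intro: poly_maps_intros)
    then show ?case
      using add by (blast intro: poly_maps_intros)
  next
    case (mult f g)
    then obtain d e d' e' where d: "\<forall>i. d i \<in> poly_maps \<and> e i \<in> poly_maps"
        "\<And>c N. has_frame_deriv f c N (\<Sum>i\<in>UNIV. [:fst (N i):] * d i c + [:snd (N i):] * e i c)"
      and d': "\<forall>i. d' i \<in> poly_maps \<and> e' i \<in> poly_maps"
        "\<And>c N. has_frame_deriv g c N (\<Sum>i\<in>UNIV. [:fst (N i):] * d' i c + [:snd (N i):] * e' i c)"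
      by blast
    have "has_frame_deriv (\<lambda>c. f c * g c) c N
        (\<Sum>i\<in>UNIV. [:fst (N i):] * (f c * d' i c + d i c * g c) + [:snd (N i):] * (f c * e' i c + e i c * g c))"
            for c N
      using has_frame_deriv_mult[OF d(2) d'(2), of c N]
      by (simp add: distrib_left sum.distrib sum_distrib_left sum_distrib_right mult_ac add_ac del:
          mult_pCons_left mult_pCons_right)
    then have "\<exists>d\<^sub>1 d\<^sub>2. (\<forall>i. d\<^sub>1 i \<in> poly_maps \<and> d\<^sub>2 i \<in> poly_maps) \<and>
        (\<forall>c N. has_frame_deriv (\<lambda>c. f c * g c) c N (\<Sum>i\<in>UNIV. [:fst (N i):] * d\<^sub>1 i c + [:snd (N i):] * d\<^sub>2 i c))"
      using d(1) d'(1) conjunct1[OF mult(1)] conjunct1[OF mult(2)]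
      by - (rule exI[of _ "\<lambda>i c. f c * d' i c + d i c * g c"],
          rule exI[of _ "\<lambda>i c. f c * e' i c + e i c * g c"], auto intro!: poly_maps_intros)
    then show ?case
      using mult by (blast intro: poly_maps_intros)
  qed
  then show ?thesis ..
qed

section \<open>Equivariant families\<close>

text \<open>
  Polynomial families \<open>F c\<close> of maps $\mathbb{S}^\lambda\to\mathbb{S}^\mu$, equivariant under the matrix
  with columns \<open>a\<close>, \<open>b\<close>; here $\mathbb{S}^\lambda=\det^{\lambda_2}\otimes\mathrm{Sym}^{\lambda_1-\lambda_2}$.
\<close>

definition covariant ::
    "nat \<times> nat \<Rightarrow> nat \<times> nat \<Rightarrow> (('k::field, 'n) frame \<Rightarrow> 'k poly \<Rightarrow> 'k poly) \<Rightarrow> bool"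
  where "covariant l r F \<longleftrightarrow> snd l \<le> fst l \<and> snd r \<le> fst r \<and>
    (\<forall>c p q. F c (p + q) = F c p + F c q) \<and> (\<forall>c a p. F c ([:a:] * p) = [:a:] * F c p) \<and>
    (\<forall>c p. degree (F c p) \<le> fst r - snd r) \<and> (\<forall>p. (\<lambda>c. F c p) \<in> poly_maps) \<and>
    (\<forall>a b c p. det2 a b \<noteq> 0 \<longrightarrow> degree p \<le> fst l - snd l \<longrightarrow>
      [:det2 a b:] ^ snd l * F (\<lambda>i. comb a b (c i)) (subst_form (fst l - snd l) (lin a) (lin b) p)
        = [:det2 a b:] ^ snd r * subst_form (fst r - snd r) (lin a) (lin b) (F c p))"

lemma covariantD:
  assumes "covariant l r F"
  shows "snd l \<le> fst l" "snd r \<le> fst r" "F c (p + q) = F c p + F c q" "F c ([:a:] * p) = [:a:] * F c p"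
    "degree (F c p) \<le> fst r - snd r" "(\<lambda>c. F c p) \<in> poly_maps"
    "det2 x y \<noteq> 0 \<Longrightarrow> degree p \<le> fst l - snd l \<Longrightarrow>
      [:det2 x y:] ^ snd l * F (\<lambda>i. comb x y (c i)) (subst_form (fst l - snd l) (lin x) (lin y) p)
        = [:det2 x y:] ^ snd r * subst_form (fst r - snd r) (lin x) (lin y) (F c p)"
  using assms unfolding covariant_def by blast+

text \<open>The scalar matrix s acts on det^b tensor Sym^m by s^(2b + m). With b the second entry of
  the weight and m the difference of its entries, the exponent is the size of the weight.\<close>

lemma covariant_scale_frame:
  assumes F: "covariant l r F" and "s \<noteq> 0" and p: "degree p \<le> fst l - snd l"
  shows "[:s:] ^ (fst l + snd l) * F (\<lambda>i. (s * fst (c i), s * snd (c i))) p = [:s:] ^ (fst r + snd r) * F c p"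
proof -
  let ?a = "(s, 0)" and ?b = "(0, s)" and ?c = "\<lambda>i. (s * fst (c i), s * snd (c i))"
  have det: "det2 ?a ?b = s * s" and comb: "comb ?a ?b (c i) = ?c i" for i
    by (simp_all add: det2_def comb_def mult.commute)
  have 1: "subst_form k (lin ?a) (lin ?b) q = [:s ^ k:] * q" if "degree q \<le> k" for k q
    using subst_form_scale[of k "[:s:]" 1 "[:0,1:]" q] subst_form_id[OF that]
    unfolding const_poly_simps by (simp add: lin_def del: mult_pCons_right)
  have "[:s * s:] ^ snd l * F ?c ([:s ^ (fst l - snd l):] * p) = [:s * s:] ^ snd r
      * ([:s ^ (fst r - snd r):] * F c p)"
    using covariantD(7)[OF F, of ?a ?b p c] \<open>s \<noteq> 0\<close> p
    unfolding 1[OF p] 1[OF covariantD(5)[OF F]] comb det by simp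
  then have "[:s * s:] ^ snd l * ([:s ^ (fst l - snd l):] * F ?c p) = [:s * s:] ^ snd r
      * ([:s ^ (fst r - snd r):] * F c p)"
    by (simp only: covariantD(4)[OF F])
  then have "[:s:] ^ (snd l + snd l + (fst l - snd l)) * F ?c p = [:s:] ^ (snd r + snd r + (fst r - snd r)) * F c p"
    unfolding const_poly_simps power_add by (simp only: power_mult_distrib mult_ac)
  then show ?thesis
    using covariantD(1,2)[OF F] by (simp add: add.commute)
qed

text \<open>The line through the zero frame in direction \<open>c\<close> turns the scaling law,
  known for nonzero scalars, into an identity of polynomials in t. Powers of t can then be cancelled
  and t set to 0.\<close>

lemma covariant_scale_poly:
  fixes F :: "('k::field_char_0, 'n) frame \<Rightarrow> 'k poly \<Rightarrow> 'k poly"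
  assumes F: "covariant l r F" and p: "degree p \<le> fst l - snd l"
  obtains q where "\<And>t. poly q [:t:] = F (\<lambda>i. (t * fst (c i), t * snd (c i))) p"
    and "[:0, 1:] ^ (fst l + snd l) * q = [:0, 1:] ^ (fst r + snd r) * [:F c p:]"
proof -
  obtain Q where "\<And>z t. poly (Q z) [:t:] = F (shift_frame z t c) p"
    using poly_maps_along_lines[OF covariantD(6)[OF F], of c p] by blast
  from this[of "\<lambda>_. (0, 0)"] obtain q where q: "\<And>t. poly q [:t:] = F (\<lambda>i. (t * fst (c i), t * snd (c i))) p"
    by (auto simp: shift_frame_def)
  have "[:0, 1:] ^ (fst l + snd l) * q = [:0, 1:] ^ (fst r + snd r) * [:F c p:]"
  proof (rule poly_const_points_eqI_cofinite[of "{0}"])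
    fix t :: 'k assume "t \<notin> {0}"
    then have "[:t:] ^ (fst l + snd l) * poly q [:t:] = [:t:] ^ (fst r + snd r) * F c p"
      unfolding q using covariant_scale_frame[OF F _ p, of t] by simp
    then show "poly ([:0, 1:] ^ (fst l + snd l) * q) [:t:] = poly ([:0, 1:] ^ (fst r + snd r) * [:F c p:]) [:t:]"
      by (simp add: poly_power)
  qed simp
  then show thesis
    using q that by blast
qed

lemma covariant_negative_degree:
  fixes F :: "('k::field_char_0, 'n) frame \<Rightarrow> 'k poly \<Rightarrow> 'k poly"
  assumes F: "covariant l r F" and p: "degree p \<le> fst l - snd l" and less: "fst r + snd r < fst l + snd l"
  shows "F c p = 0"
proof -
  obtain q where q: "[:0, 1:] ^ (fst l + snd l) * q = [:0, 1:] ^ (fst r + snd r) * [:F c p:]"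
    using covariant_scale_poly[OF F p] by blast
  obtain k where k: "fst l + snd l = fst r + snd r + Suc k"
    using less less_iff_Suc_add by auto
  have "[:0, 1:] ^ (fst r + snd r) * ([:0, 1:] ^ Suc k * q) = [:0, 1:] ^ (fst r + snd r) * [:F c p:]"
    using q unfolding k power_add mult.assoc .
  then have "[:0, 1:] ^ Suc k * q = [:F c p:]"
    by (subst (asm) mult_left_cancel) simp_all
  then have "poly ([:0, 1:] ^ Suc k * q) 0 = F c p"
    by simp
  then show ?thesis
    by simp
qed

lemma covariant_homogeneous:
  fixes F :: "('k::field_char_0, 'n) frame \<Rightarrow> 'k poly \<Rightarrow> 'k poly"
  assumes F: "covariant l r F" and p: "degree p \<le> fst l - snd l" and d: "fst r + snd r = fst l + snd l + d"
  shows "F (\<lambda>i. (t * fst (c i), t * snd (c i))) p = [:t:] ^ d * F c p"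
proof -
  obtain q where q: "\<And>t. poly q [:t:] = F (\<lambda>i. (t * fst (c i), t * snd (c i))) p"
    and eq: "[:0, 1:] ^ (fst l + snd l) * q = [:0, 1:] ^ (fst r + snd r) * [:F c p:]"
    using covariant_scale_poly[OF F p] by blast
  have "[:0, 1:] ^ (fst l + snd l) * q = [:0, 1:] ^ (fst l + snd l) * ([:0, 1:] ^ d * [:F c p:])"
    using eq unfolding d power_add mult.assoc .
  then have "q = [:0, 1:] ^ d * [:F c p:]"
    by (subst (asm) mult_left_cancel) simp_all
  then show ?thesis
    by (simp flip: q add: poly_power)
qed

text \<open>
  Schur's lemma: a torus element shows that the image of the highest weight vector $X^m$ is a weight
  vector, an upper unipotent one that it vanishes or is again highest, and the translates of $X^m$
  under lower unipotent elements span the module.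
\<close>

lemma covariant_degree_zero:
  fixes F :: "('k::field_char_0, 'n) frame \<Rightarrow> 'k poly \<Rightarrow> 'k poly"
  assumes F: "covariant l r F" and lr: "fst r + snd r = fst l + snd l"
  shows "\<exists>\<tau>. (\<forall>c p. degree p \<le> fst l - snd l \<longrightarrow> F c p = [:\<tau>:] * p) \<and> (l \<noteq> r \<longrightarrow> \<tau> = 0)"
proof -
  \<comment> \<open>In degree zero, scaling by t = 0 shows that the family does not depend on the
    frame. Its value at the zero frame, which every matrix fixes, is therefore an equivariant map of
    modules.\<close>
  define T where "T = F (\<lambda>_. (0, 0))"
  let ?m = "fst l - snd l" and ?m' = "fst r - snd r"
  note wl = covariantD(1)[OF F] and wr = covariantD(2)[OF F]
  have FT: "F c p = T p" if "degree p \<le> ?m" for c p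
    using covariant_homogeneous[OF F that, of 0 0 c] lr by (simp add: T_def)
  have T: "T (p + q) = T p + T q" "T ([:a:] * p) = [:a:] * T p" "degree (T p) \<le> ?m'" for p q a
    unfolding T_def by (fact covariantD(3-5)[OF F])+
  have comb0: "comb a b (0, 0) = (0, 0)" for a b :: "'k \<times> 'k"
    by (simp add: comb_def)
  have T_equi: "[:det2 a b:] ^ snd l * T (subst_form ?m (lin a) (lin b) p)
      = [:det2 a b:] ^ snd r * subst_form ?m' (lin a) (lin b) (T p)"
    if "det2 a b \<noteq> 0" "degree p \<le> ?m" for a b p
    using covariantD(7)[OF F that, of "\<lambda>_. (0, 0)"] unfolding comb0 T_def .
  \<comment> \<open>Equivariance under the diagonal matrix with entries 2 and 1: X^m has weight
    2^(fst l), and the monomial with exponent j in Y has weight 2^(fst r - j) in the target. In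
    characteristic zero equal powers of 2 have equal exponents.\<close>
  have weight: "fst l = fst r - j" if "poly.coeff (T 1) j \<noteq> 0" for j
  proof -
    have j: "j \<le> ?m'"
      using T(3)[of 1] that by (meson coeff_eq_0 le_trans linorder_not_le)
    have [simp]: "det2 (2, 0) (0, 1) = (2::'k)"
      by (simp add: det2_def)
    have [simp]: "lin (2, 0) = [:2::'k:]" "lin (0,1) = [:0, 1::'k:]"
      by (simp_all add: lin_def)
    have 1: "subst_form ?m [:2::'k:] [:0, 1:] 1 = [:2 ^ ?m:]"
      using subst_form_power[of 0 ?m "[:2::'k:]"] by (simp add: const_poly_simps)
    have "[:2:] ^ snd l * ([:2 ^ ?m:] * T 1) = [:2:] ^ snd r * subst_form ?m' [:2:] [:0, 1:] (T 1)"
      using T_equi[of "(2, 0)" "(0, 1)" 1] T(2)[of _ 1] by (simp add: 1 del: mult_pCons_left)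
    then have "poly.coeff ([:2 ^ snd l:] * ([:2 ^ ?m:] * T 1)) j
        = poly.coeff ([:2 ^ snd r:] * subst_form ?m' [:2:] [:0, 1:] (T 1)) j"
      unfolding const_poly_simps by simp
    moreover have "poly.coeff (subst_form ?m' [:2:] [:0, 1:] (T 1)) j = 2 ^ (?m' - j) * poly.coeff (T 1) j"
    proof -
      have "subst_form ?m' [:2:] [:0, 1:] (T 1) = (\<Sum>i\<le>?m'. monom (2 ^ (?m' - i) * poly.coeff (T 1) i) i)"
        unfolding subst_form_def
        by (rule sum.cong) (simp_all add: monom_altdef const_poly_simps mult_ac flip: const_poly_simps)
      then show ?thesis
        using j by (simp add: coeff_sum)
    qed
    ultimately have "2 ^ (snd l + ?m) * poly.coeff (T 1) j = 2 ^ (snd r + (?m' - j)) * poly.coeff (T 1) j"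
      by (simp add: power_add mult_ac)
    then have "(2::'k) ^ (snd l + ?m) = 2 ^ (snd r + (?m' - j))"
      using that by simp
    then have "of_nat (2 ^ (snd l + ?m)) = (of_nat (2 ^ (snd r + (?m' - j))) :: 'k)"
      by simp
    then have "2 ^ (snd l + ?m) = (2::nat) ^ (snd r + (?m' - j))"
      by (simp only: of_nat_eq_iff)
    then have "snd l + ?m = snd r + (?m' - j)"
      by simp
    then show ?thesis
      using wl wr j by simp
  qed
  \<comment> \<open>The polynomial 1 stands for X^m. Weights leave a single monomial Y^j in its
    image; substituting X + Y for Y fixes X^m, hence also this image, and comparing values at Y = 0
    gives j = 0. Then both entries of the weights agree.\<close>
  have "T 1 = 0" if "l \<noteq> r"
  proof (rule ccontr)
    assume "T 1 \<noteq> 0"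
    then have "lead_coeff (T 1) \<noteq> 0"
      by simp
    define j where "j = degree (T 1)"
    have j: "fst l = fst r - j" "j \<le> ?m'"
      using weight[of j] \<open>lead_coeff (T 1) \<noteq> 0\<close> T(3) by (simp_all add: j_def)
    have others: "poly.coeff (T 1) i = 0" if "i \<noteq> j" "i \<le> ?m'" for i
      using weight[of i] that j by fastforce
    have "T 1 = (\<Sum>i\<le>?m'. [:poly.coeff (T 1) i:] * [:0,1:] ^ i)"
      by (rule poly_eq_sum_powers) (rule T(3))
    also have "\<dots> = (\<Sum>i\<in>{j}. [:poly.coeff (T 1) i:] * [:0,1:] ^ i)"
      using others j by (intro sum.mono_neutral_right) auto
    finally have T1: "T 1 = [:lead_coeff (T 1):] * [:0, 1:] ^ j"
      by (simp add: j_def)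
    have [simp]: "det2 (1, 0) (1, 1) = (1::'k)" "lin (1, 0) = (1 :: 'k poly)" "lin (1, 1) = [:1, 1::'k:]"
      by (simp_all add: det2_def lin_def)
    have "subst_form ?m 1 [:1, 1::'k:] 1 = 1"
      using subst_form_power[of 0 ?m 1 "[:1, 1::'k:]"] by simp
    then have "T 1 = subst_form ?m' 1 [:1, 1:] (T 1)"
      using T_equi[of "(1, 0)" "(1, 1)" 1] by (simp add: one_pCons[symmetric])
    then have "[:lead_coeff (T 1):] * [:0, 1:] ^ j = [:lead_coeff (T 1):] * [:1, 1:] ^ j"
      by (subst (asm) (1 2) T1) (use j in \<open>simp add: subst_form_const_mult subst_form_power del: mult_pCons_left\<close>)
    then have "[:0, 1:] ^ j = [:1, 1::'k:] ^ j"
      using \<open>lead_coeff (T 1) \<noteq> 0\<close> by (subst (asm) mult_left_cancel) simp_all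
    then have "poly ([:0, 1:] ^ j) 0 = poly ([:1, 1::'k:] ^ j) 0"
      by simp
    then have "j = 0"
      by (cases j) (simp_all add: poly_power)
    then show False
      using j lr \<open>l \<noteq> r\<close> by (simp add: prod_eq_iff)
  qed
  moreover have "T 1 = [:poly.coeff (T 1) 0:]" if "l = r"
  proof -
    have "degree (T 1) = 0"
    proof (rule ccontr)
      assume nz: "degree (T 1) \<noteq> 0"
      then have "poly.coeff (T 1) (degree (T 1)) \<noteq> 0"
        by (metis degree_0 leading_coeff_0_iff)
      then have "fst l = fst r - degree (T 1)"
        by (rule weight)
      moreover have "degree (T 1) \<le> fst r - snd r"
        by (rule T(3))
      ultimately show False
        using nz that by simp
    qed
    then show ?thesis
      by (metis degree_0_id)
  qed
  ultimately obtain \<tau> where \<tau>: "T 1 = [:\<tau>:]" "l \<noteq> r \<Longrightarrow> \<tau> = 0"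
    by (cases "l = r") auto
  have "T p = [:\<tau>:] * p" if p: "degree p \<le> ?m" for p
  proof -
    \<comment> \<open>The defect of \<open>T\<close> from the scalar. It vanishes on every (X +
      sY)^m, a translate of X^m under a lower unipotent matrix; expanding in powers of s kills each
      monomial because binomial coefficients are nonzero in characteristic zero.\<close>
    define h where "h x = T x - [:\<tau>:] * x" for x
    have h: "h (x + y) = h x + h y" "h ([:a:] * x) = [:a:] * h x" for x y a
      unfolding h_def T(1,2) by (simp_all only: algebra_simps)
    have h0: "h 0 = 0"
      using h(2)[of 0 0] by simp
    have h_sum: "h (sum f I) = (\<Sum>i\<in>I. h (f i))" for f :: "nat \<Rightarrow> 'k poly" and I
      by (induction I rule: infinite_finite_induct) (simp_all add: h h0)
    have h_pow: "h ([:1, s:] ^ ?m) = 0" for s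
    proof -
      have [simp]: "det2 (1, s) (0, 1) = 1" "lin (1, s) = [:1, s:]" "lin (0, 1) = [:0, 1::'k:]"
        by (simp_all add: det2_def lin_def)
      have [simp]: "[:1::'k:] ^ n = 1" for n
        by (simp add: pCons_one)
      have 1: "subst_form ?m [:1, s:] [:0, 1:] 1 = [:1, s:] ^ ?m"
        using subst_form_power[of 0 ?m "[:1, s:]" "[:0, 1:]"] by simp
      have "T ([:1, s:] ^ ?m) = subst_form ?m' [:1, s:] [:0, 1:] (T 1)"
        using T_equi[of "(1, s)" "(0, 1)" 1] by (simp add: 1)
      also have "\<dots> = [:\<tau>:] * [:1, s:] ^ ?m'"
        using subst_form_const_mult[of ?m' "[:1, s:]" "[:0, 1:]" \<tau> 1] subst_form_power[of 0 ?m' "[:1, s:]" "[:0, 1:]"]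
        by (simp add: \<tau>(1))
      also have "\<dots> = [:\<tau>:] * [:1, s:] ^ ?m"
        using \<tau>(2) by (cases "l = r") auto
      finally show ?thesis
        by (simp add: h_def)
    qed
    define Q where "Q = (\<Sum>j\<le>?m. monom (of_nat (?m choose j) * h ([:0, 1:] ^ j)) j)"
    have "Q = 0"
    proof (rule poly_const_points_eqI_cofinite[of "{}"])
      fix s :: 'k
      have "[:1, s:] ^ ?m = ([:s:] * [:0, 1:] + 1) ^ ?m"
        by (simp add: one_pCons)
      also have "\<dots> = (\<Sum>j\<le>?m. [:of_nat (?m choose j) * s ^ j:] * [:0, 1:] ^ j)"
        unfolding binomial_ring const_poly_simps
        by (rule sum.cong) (simp_all only: power_mult_distrib mult_ac power_one mult_1_left)
      finally have "h ([:1, s:] ^ ?m) = (\<Sum>j\<le>?m. [:of_nat (?m choose j) * s ^ j:] * h ([:0, 1:] ^ j))"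
        by (simp only: h_sum h(2))
      also have "\<dots> = poly Q [:s:]"
        unfolding Q_def poly_sum poly_monom const_poly_simps by (simp add: mult_ac)
      finally show "poly Q [:s:] = poly 0 [:s:]"
        using h_pow by simp
    qed simp
    have "h ([:0, 1:] ^ j) = 0" if "j \<le> ?m" for j
    proof -
      have "poly.coeff Q j = of_nat (?m choose j) * h ([:0, 1:] ^ j)"
        using that by (simp add: Q_def coeff_sum)
      then show ?thesis
        using \<open>Q = 0\<close> that by simp
    qed
    then have "h (\<Sum>j\<le>?m. [:poly.coeff p j:] * [:0, 1:] ^ j) = 0"
      unfolding h_sum h(2) by simp
    then have "h p = 0"
      using poly_eq_sum_powers[OF p] by simp
    then show ?thesis
      by (simp add: h_def)
  qed
  then show ?thesis
    using FT \<tau>(2) by (intro exI[of _ \<tau>]) (simp del: mult_pCons_left)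
qed

section \<open>Euler's identity and the Pieri decomposition\<close>

definition frame_deriv :: "(('k::field, 'n) frame \<Rightarrow> 'k poly) \<Rightarrow> ('k, 'n) frame \<Rightarrow> ('k, 'n) frame \<Rightarrow> 'k poly"
  where "frame_deriv f c N = (THE D. has_frame_deriv f c N D)"

lemma frame_deriv_eqI:
  fixes D :: "'k::field_char_0 poly"
  shows "has_frame_deriv f c N D \<Longrightarrow> frame_deriv f c N = D"
  unfolding frame_deriv_def by (blast intro: has_frame_deriv_unique)

lemma has_frame_deriv_frame_deriv:
  fixes f :: "('k::field_char_0, 'n::finite) frame \<Rightarrow> 'k poly"
  assumes "f \<in> poly_maps"
  shows "has_frame_deriv f c N (frame_deriv f c N)"
proof -
  obtain D where "has_frame_deriv f c N D"
    using poly_maps_has_frame_deriv[OF assms] by blast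
  then show ?thesis
    using frame_deriv_eqI by metis
qed

definition single_dir :: "'n \<Rightarrow> 'k \<times> 'k \<Rightarrow> ('k::field, 'n) frame"
  where "single_dir i y = (\<lambda>j. if j = i then y else (0, 0))"

lemma sum_single_dir:
  "(\<Sum>j\<in>UNIV. [:fst (single_dir i y j):] * d j + [:snd (single_dir i y j):] * e j)
    = [:fst y:] * d (i :: 'n::finite) + [:snd y:] * e i"
proof -
  have "(\<Sum>j\<in>UNIV. [:fst (single_dir i y j):] * d j + [:snd (single_dir i y j):] * e j)
      = (\<Sum>j\<in>{i}. [:fst (single_dir i y j):] * d j + [:snd (single_dir i y j):] * e j)"
    by (rule sum.mono_neutral_right) (auto simp: single_dir_def)
  then show ?thesis
    by (simp add: single_dir_def)
qed

lemma frame_deriv_single_dir: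
  fixes f :: "('k::field_char_0, 'n::finite) frame \<Rightarrow> 'k poly"
  assumes "f \<in> poly_maps"
  shows "frame_deriv f c (single_dir i y)
      = [:fst y:] * frame_deriv f c (single_dir i (1, 0)) + [:snd y:] * frame_deriv f c (single_dir i (0, 1))"
    and "(\<lambda>c. frame_deriv f c (single_dir i y)) \<in> poly_maps"
    and "frame_deriv f c N = (\<Sum>i\<in>UNIV. frame_deriv f c (single_dir i (N i)))"
proof -
  obtain d e where de: "\<And>i. d i \<in> poly_maps" "\<And>i. e i \<in> poly_maps"
    and D: "\<And>c N. has_frame_deriv f c N (\<Sum>i\<in>UNIV. [:fst (N i):] * d i c + [:snd (N i):] * e i c)"
    using poly_maps_has_frame_deriv[OF assms] by blast
  have 1: "frame_deriv f c (single_dir i y) = [:fst y:] * d i c + [:snd y:] * e i c" for i y c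
    using frame_deriv_eqI[OF D[of c "single_dir i y"]] unfolding sum_single_dir .
  show "frame_deriv f c (single_dir i y)
      = [:fst y:] * frame_deriv f c (single_dir i (1, 0)) + [:snd y:] * frame_deriv f c (single_dir i (0, 1))"
    unfolding 1 by simp
  show "(\<lambda>c. frame_deriv f c (single_dir i y)) \<in> poly_maps"
    unfolding 1 using de by (auto intro!: poly_maps_intros simp del: mult_pCons_left)
  show "frame_deriv f c N = (\<Sum>i\<in>UNIV. frame_deriv f c (single_dir i (N i)))"
    unfolding 1 by (rule frame_deriv_eqI) (rule D)
qed

lemma comb_shift_frame:
  "(\<lambda>i. comb a b (shift_frame c t N i)) = shift_frame (\<lambda>i. comb a b (c i)) t (\<lambda>i. comb a b (N i))"
  by (rule ext) (simp add: comb_def shift_frame_def algebra_simps)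

lemma comb_single_dir: "(\<lambda>j. comb a b (single_dir i y j)) = single_dir i (comb a b y)"
  by (rule ext) (simp add: comb_def single_dir_def)

lemma has_frame_deriv_comb:
  "has_frame_deriv f (\<lambda>i. comb a b (c i)) (\<lambda>i. comb a b (N i)) D \<Longrightarrow>
    has_frame_deriv (\<lambda>c. f (\<lambda>i. comb a b (c i))) c N D"
  unfolding has_frame_deriv_def comb_shift_frame .

text \<open>
  The analogue of \<open>covariant\<close> for maps $\Bbbk^2\otimes\mathbb{S}^\lambda\to\mathbb{S}^\mu$, with
  \<open>B y c p\<close> the image of $y\otimes p$.
\<close>

definition covariant_pairing ::
    "nat \<times> nat \<Rightarrow> nat \<times> nat \<Rightarrow> ('k \<times> 'k \<Rightarrow> ('k::field, 'n) frame \<Rightarrow> 'k poly \<Rightarrow> 'k poly) \<Rightarrow> bool"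
  where "covariant_pairing l r B \<longleftrightarrow> snd l \<le> fst l \<and> snd r \<le> fst r \<and>
    (\<forall>y c p. B y c p = [:fst y:] * B (1, 0) c p + [:snd y:] * B (0, 1) c p) \<and>
    (\<forall>y c p q. B y c (p + q) = B y c p + B y c q) \<and> (\<forall>y c a p. B y c ([:a:] * p) = [:a:] * B y c p) \<and>
    (\<forall>y c p. degree (B y c p) \<le> fst r - snd r) \<and> (\<forall>y p. (\<lambda>c. B y c p) \<in> poly_maps) \<and>
    (\<forall>a b y c p. det2 a b \<noteq> 0 \<longrightarrow> degree p \<le> fst l - snd l \<longrightarrow>
      [:det2 a b:] ^ snd l * B (comb a b y) (\<lambda>i. comb a b (c i)) (subst_form (fst l - snd l) (lin a) (lin b) p)
        = [:det2 a b:] ^ snd r * subst_form (fst r - snd r) (lin a) (lin b) (B y c p))"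

text \<open>The defining identities hold at all frames and can be differentiated. Matrices act
  linearly on frames, so the derivative at a transformed frame in the transformed direction is the
  transformed derivative; the other properties pass over by uniqueness of derivatives.\<close>

lemma covariant_pairing_frame_deriv:
  fixes F :: "('k::field_char_0, 'n::finite) frame \<Rightarrow> 'k poly \<Rightarrow> 'k poly"
  assumes F: "covariant l r F"
  shows "covariant_pairing l r (\<lambda>y c p. frame_deriv (\<lambda>c. F c p) c (single_dir i y))"
proof -
  note D = has_frame_deriv_frame_deriv[OF covariantD(6)[OF F]]
  have 1: "frame_deriv (\<lambda>c. F c (p + q)) c N = frame_deriv (\<lambda>c. F c p) c N + frame_deriv (\<lambda>c. F c q) c N" for p q c N
    by (rule frame_deriv_eqI) (use has_frame_deriv_add[OF D D] covariantD(3)[OF F] in simp)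
  have 2: "frame_deriv (\<lambda>c. F c ([:a:] * p)) c N = [:a:] * frame_deriv (\<lambda>c. F c p) c N" for a p c N
    unfolding covariantD(4)[OF F]
    by (rule frame_deriv_eqI, rule has_frame_deriv_linear[where h = "\<lambda>q. [:a:] * q" and f = "\<lambda>c. F c p", OF _ _ D])
      (simp_all only: distrib_left mult.left_commute)
  \<comment> \<open>Taking the coefficient at Y^j is linear and gives zero on the whole family, so
    it gives zero on the derivative.\<close>
  have 3: "degree (frame_deriv (\<lambda>c. F c p) c N) \<le> fst r - snd r" for p c N
  proof (rule degree_le, intro allI impI)
    fix j assume j: "fst r - snd r < j"
    let ?h = "\<lambda>p. [:poly.coeff p j:]"
    have h0: "?h (F c p) = 0" for c
      using covariantD(5)[OF F, of c p] j by (simp add: coeff_eq_0)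
    have "has_frame_deriv (\<lambda>c. ?h (F c p)) c N (?h (frame_deriv (\<lambda>c. F c p) c N))"
      by (rule has_frame_deriv_linear[where h = ?h and f = "\<lambda>c. F c p", OF _ _ D]) simp_all
    then have "has_frame_deriv (\<lambda>_. 0) c N (?h (frame_deriv (\<lambda>c. F c p) c N))"
      unfolding h0 .
    moreover have "has_frame_deriv (\<lambda>_. 0) c N 0"
      unfolding has_frame_deriv_def by (rule exI[of _ 0]) simp
    ultimately have "?h (frame_deriv (\<lambda>c. F c p) c N) = 0"
      by (rule has_frame_deriv_unique)
    then show "poly.coeff (frame_deriv (\<lambda>c. F c p) c N) j = 0"
      by simp
  qed
  have 4: "[:det2 a b:] ^ snd l * frame_deriv (\<lambda>c. F c (subst_form (fst l - snd l) (lin a) (lin b) p))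
        (\<lambda>i. comb a b (c i)) (\<lambda>i. comb a b (N i))
      = [:det2 a b:] ^ snd r * subst_form (fst r - snd r) (lin a) (lin b) (frame_deriv (\<lambda>c. F c p) c N)"
    if "det2 a b \<noteq> 0" "degree p \<le> fst l - snd l" for a b p c N
  proof (rule has_frame_deriv_unique[where c = c and N = N and
        f = "\<lambda>c. [:det2 a b:] ^ snd l * F (\<lambda>i. comb a b (c i)) (subst_form (fst l - snd l) (lin a) (lin b) p)"])
    show "has_frame_deriv (\<lambda>c. [:det2 a b:] ^ snd l
        * F (\<lambda>i. comb a b (c i)) (subst_form (fst l - snd l) (lin a) (lin b) p)) c N
      ([:det2 a b:] ^ snd l * frame_deriv (\<lambda>c. F c (subst_form (fst l - snd l) (lin a) (lin b) p))
        (\<lambda>i. comb a b (c i)) (\<lambda>i. comb a b (N i)))"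
    proof (rule has_frame_deriv_linear[where h = "\<lambda>q. [:det2 a b:] ^ snd l * q"])
      show "has_frame_deriv (\<lambda>c. F (\<lambda>i. comb a b (c i)) (subst_form (fst l - snd l) (lin a) (lin b) p)) c N
          (frame_deriv (\<lambda>c. F c (subst_form (fst l - snd l) (lin a) (lin b) p)) (\<lambda>i. comb a b (c i))
              (\<lambda>i. comb a b (N i)))"
        by (rule has_frame_deriv_comb[where f = "\<lambda>c. F c (subst_form (fst l - snd l) (lin a) (lin b) p)"]) (rule D)
    qed (simp_all only: distrib_left mult.left_commute)
    show "has_frame_deriv (\<lambda>c. [:det2 a b:] ^ snd l
        * F (\<lambda>i. comb a b (c i)) (subst_form (fst l - snd l) (lin a) (lin b) p)) c N
      ([:det2 a b:] ^ snd r * subst_form (fst r - snd r) (lin a) (lin b) (frame_deriv (\<lambda>c. F c p) c N))"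
      unfolding covariantD(7)[OF F that]
      by (rule has_frame_deriv_linear[where h =
          "\<lambda>q. [:det2 a b:] ^ snd r * subst_form (fst r - snd r) (lin a) (lin b) q" and f = "\<lambda>c. F c p", OF _ _ D])
        (simp_all only: subst_form_add subst_form_const_mult distrib_left mult.left_commute)
  qed
  show ?thesis
    unfolding covariant_pairing_def comb_single_dir[symmetric]
    by (intro conjI allI impI)
      (assumption | rule 1 2 3 4 covariantD(1,2)[OF F] frame_deriv_single_dir(1,2)[OF covariantD(6)[OF F]])+
qed

text \<open>The direction is the frame itself: by homogeneity the value at (1 + t) c is (1 + t)^d
  times the value at c, and the coefficient of t in (1 + t)^d is d.\<close>

lemma covariant_Euler:
  fixes F :: "('k::field_char_0, 'n::finite) frame \<Rightarrow> 'k poly \<Rightarrow> 'k poly"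
  assumes F: "covariant l r F" and p: "degree p \<le> fst l - snd l" and d: "fst r + snd r = fst l + snd l + d"
  shows "(\<Sum>i\<in>UNIV. frame_deriv (\<lambda>c. F c p) c (single_dir i (c i))) = of_nat d * F c p"
proof -
  have "has_frame_deriv (\<lambda>c. F c p) c c (of_nat d * F c p)"
  proof -
    have "\<exists>q. [:1, 1:] ^ d = [:1, of_nat d:] + [:0, 0, 1:] * (q :: 'k poly poly)"
    proof (induction d)
      case (Suc d)
      then obtain q :: "'k poly poly" where "[:1, 1:] ^ d = [:1, of_nat d:] + [:0, 0, 1:] * q"
        by blast
      then have "[:1, 1:] ^ Suc d = [:1, of_nat (Suc d):] + [:0, 0, 1:] * ([:of_nat d:] + [:1, 1:] * q)"
        by (simp add: algebra_simps)
      then show ?case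
        by blast
    qed (auto intro: exI[of _ 0] simp: one_pCons)
    then obtain q :: "'k poly poly" where q: "[:1, 1:] ^ d = [:1, of_nat d:] + [:0, 0, 1:] * q"
      by blast
    have "F (shift_frame c t c) p = F c p + [:t:] * (of_nat d * F c p) + [:t:] ^ 2 * poly (q * [:F c p:]) [:t:]" for t
    proof -
      have "shift_frame c t c = (\<lambda>i. ((1 + t) * fst (c i), (1 + t) * snd (c i)))"
        by (rule ext) (simp add: shift_frame_def algebra_simps)
      then have "F (shift_frame c t c) p = poly ([:1, 1:] ^ d) [:t:] * F c p"
        using covariant_homogeneous[OF F p d, of "1 + t" c] by (simp add: poly_power one_pCons)
      then show ?thesis
        unfolding q by (simp add: algebra_simps power2_eq_square)
    qed
    then show ?thesis
      unfolding has_frame_deriv_def by blast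
  qed
  from frame_deriv_eqI[OF this] show ?thesis
    unfolding frame_deriv_single_dir(3)[OF covariantD(6)[OF F], of p c c] .
qed

lemma wedge_comb:
  "wedge m y p = [:fst y:] * wedge m (1, 0) p + [:snd y:] * wedge m (0, 1) p"
  by (simp add: wedge_def algebra_simps)

text \<open>On a product of linear forms the contraction only produces numbers
  \<open>det2 y z\<close>, each of which picks up one determinant. Such products include the
  monomials, and these span.\<close>

lemma subst_form_wedge:
  assumes p: "degree p \<le> Suc m"
  shows "wedge (Suc m) (comb a b z) (subst_form (Suc m) (lin a) (lin b) p)
    = [:det2 a b:] * subst_form m (lin a) (lin b) (wedge (Suc m) z p)"
proof -
  have prods: "wedge (Suc m) (comb a b z) (subst_form (Suc m) (lin a) (lin b) (prod_list (map lin ys)))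
      = [:det2 a b:] * subst_form m (lin a) (lin b) (wedge (Suc m) z (prod_list (map lin ys)))"
    if ys: "length ys = Suc m" for ys
  proof -
    have 1: "subst_form (Suc m) (lin a) (lin b) (prod_list (map lin ys)) = prod_list (map lin (map (comb a b) ys))"
      using subst_form_prod_list[of ys "lin a" "lin b"] by (simp add: ys lin_comb o_def)
    have 2: "subst_form m (lin a) (lin b) (prod_list (map lin (take k ys @ drop (Suc k) ys)))
        = prod_list (map lin (take k (map (comb a b) ys) @ drop (Suc k) (map (comb a b) ys)))" if "k < Suc m" for k
      using subst_form_prod_list[of "take k ys @ drop (Suc k) ys" "lin a" "lin b"] that ys
      by (simp add: lin_comb o_def take_map drop_map)
    show ?thesis
      unfolding 1 using wedge_prod_list[of "map (comb a b) ys" "comb a b z"] wedge_prod_list[of ys z]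
      by (simp add: ys subst_form_sum subst_form_const_mult 2 det2_comb sum_distrib_left const_poly_simps mult_ac
          del: mult_pCons_left mult_pCons_right map_append map_map sum.lessThan_Suc)
  qed
  have powers: "wedge (Suc m) (comb a b z) (subst_form (Suc m) (lin a) (lin b) ([:0, 1:] ^ j))
      = [:det2 a b:] * subst_form m (lin a) (lin b) (wedge (Suc m) z ([:0, 1:] ^ j))" if "j \<le> Suc m" for j
    using prods[of "replicate (Suc m - j) (1, 0) @ replicate j (0, 1)"] that
    by (simp add: map_replicate_const lin_unit)
  have wsum: "wedge k y (sum f I) = (\<Sum>i\<in>I. wedge k y (f i))" for k y I and f :: "nat \<Rightarrow> 'a poly"
    by (induction I rule: infinite_finite_induct) (simp_all add: wedge_add, simp_all add: wedge_def)
  show ?thesis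
    apply (subst (1 2) poly_eq_sum_powers[OF p])
    unfolding subst_form_sum wsum subst_form_const_mult wedge_const_mult sum_distrib_left
    by (rule sum.cong) (simp_all add: powers mult.left_commute del: mult_pCons_left)
qed

text \<open>
  The two projections of $\Bbbk^2\otimes\mathrm{Sym}^m\cong\mathrm{Sym}^{m+1}\oplus(\mathrm{Sym}^{m-1}\otimes\det)$:
  $(m+1)\,y\otimes p = \iota_1(yp)-\iota_2(p\wedge y)$ with
  $\iota_1(q)=e_1\otimes(q\wedge e_2)-e_2\otimes(q\wedge e_1)$ and $\iota_2(q)=e_1\otimes e_2q-e_2\otimes e_1q$.
\<close>

lemma Pieri_identity:
  fixes B :: "'k \<times> 'k \<Rightarrow> 'k::field_char_0 poly \<Rightarrow> 'k poly"
  assumes B: "\<And>y p. B y p = [:fst y:] * B (1, 0) p + [:snd y:] * B (0, 1) p"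
    "\<And>y p q. B y (p + q) = B y p + B y q" "\<And>y a p. B y ([:a:] * p) = [:a:] * B y p"
  shows "of_nat (Suc m) * B y p = B (1, 0) (wedge (Suc m) (0, 1) (lin y * p))
      - B (0, 1) (wedge (Suc m) (1, 0) (lin y * p))
    - (B (1, 0) (lin (0, 1) * wedge m y p) - B (0, 1) (lin (1, 0) * wedge m y p))"
proof -
  have diff: "B y (p - q) = B y p - B y q" for y p q
    using B(2)[of y "p - q" q] by simp
  have B_of_nat: "B y (of_nat n * p) = of_nat n * B y p" for y n p
    using B(3)[of y "of_nat n" p] by (simp add: of_nat_poly)
  \<comment> \<open>With the X-derivative defined through Euler's identity, X and Y times the two
    derivatives of \<open>p\<close> add up to m times \<open>p\<close>; the product rule on
    \<open>lin y * p\<close> contributes the remaining copy.\<close>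
  have 1: "wedge (Suc m) (0, 1) (lin y * p) - lin (0, 1) * wedge m y p = of_nat (Suc m) * ([:fst y:] * p)"
    unfolding wedge_Suc_lin_mult by
        (simp add: det2_def wedge_def lin_def algebra_simps smult_diff_right smult_add_right)
  have 2: "lin (1, 0) * wedge m y p - wedge (Suc m) (1, 0) (lin y * p) = of_nat (Suc m) * ([:snd y:] * p)"
    unfolding wedge_Suc_lin_mult by
        (simp add: det2_def wedge_def lin_def algebra_simps smult_diff_right smult_add_right)
  have "B (1, 0) (of_nat (Suc m) * ([:fst y:] * p)) + B (0, 1) (of_nat (Suc m) * ([:snd y:] * p)) =
      of_nat (Suc m) * B y p"
    unfolding B(1)[of y p] B_of_nat B(3) by (simp only: distrib_left)
  then show ?thesis
    unfolding 1[symmetric] 2[symmetric] diff by (simp only: algebra_simps)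
qed

lemma covariant_pairingD:
  assumes "covariant_pairing l r B"
  shows "snd l \<le> fst l" "snd r \<le> fst r" "B y c p = [:fst y:] * B (1, 0) c p + [:snd y:] * B (0, 1) c p"
    "B y c (p + q) = B y c p + B y c q" "B y c ([:a:] * p) = [:a:] * B y c p"
    "degree (B y c p) \<le> fst r - snd r" "(\<lambda>c. B y c p) \<in> poly_maps"
    "det2 x z \<noteq> 0 \<Longrightarrow> degree p \<le> fst l - snd l \<Longrightarrow>
      [:det2 x z:] ^ snd l * B (comb x z y) (\<lambda>i. comb x z (c i)) (subst_form (fst l - snd l) (lin x) (lin z) p)
        = [:det2 x z:] ^ snd r * subst_form (fst r - snd r) (lin x) (lin z) (B y c p)"
proof -
  note A = assms[unfolded covariant_pairing_def]
  note A0 = A[THEN conjunct1]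
  note A1 = A[THEN conjunct2, THEN conjunct1]
  note A2 = A[THEN conjunct2, THEN conjunct2, THEN conjunct1]
  note A3 = A[THEN conjunct2, THEN conjunct2, THEN conjunct2, THEN conjunct1]
  note A4 = A[THEN conjunct2, THEN conjunct2, THEN conjunct2, THEN conjunct2, THEN conjunct1]
  note A5 = A[THEN conjunct2, THEN conjunct2, THEN conjunct2, THEN conjunct2, THEN conjunct2, THEN conjunct1]
  note A6 = A[THEN conjunct2, THEN conjunct2, THEN conjunct2, THEN conjunct2, THEN conjunct2, THEN conjunct2,
      THEN conjunct1]
  note A7 = A[THEN conjunct2, THEN conjunct2, THEN conjunct2, THEN conjunct2, THEN conjunct2, THEN conjunct2,
      THEN conjunct2]
  show "snd l \<le> fst l" "snd r \<le> fst r"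
    by (rule A0 A1)+
  show "B y c p = [:fst y:] * B (1, 0) c p + [:snd y:] * B (0, 1) c p"
    by (rule A2[rule_format])
  show "B y c (p + q) = B y c p + B y c q"
    by (rule A3[rule_format])
  show "B y c ([:a:] * p) = [:a:] * B y c p"
    by (rule A4[rule_format])
  show "degree (B y c p) \<le> fst r - snd r"
    by (rule A5[rule_format])
  show "(\<lambda>c. B y c p) \<in> poly_maps"
    by (rule A6[rule_format])
  show "[:det2 x z:] ^ snd l * B (comb x z y) (\<lambda>i. comb x z (c i)) (subst_form (fst l - snd l) (lin x) (lin z) p)
        = [:det2 x z:] ^ snd r * subst_form (fst r - snd r) (lin x) (lin z) (B y c p)"
    if "det2 x z \<noteq> 0" "degree p \<le> fst l - snd l"
    using that by (rule A7[rule_format])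
qed

lemma comb_unit: "comb a b (1, 0) = a" "comb a b (0, 1) = b"
  by (simp_all add: comb_def)

text \<open>The left side is bilinear and alternating in \<open>a\<close> and \<open>b\<close>,
  hence \<open>det2 a b\<close> times its value at the standard basis. It replaces the basis in the
  Pieri inclusions by the columns of a matrix, at the cost of one determinant.\<close>

lemma covariant_pairing_antisym:
  assumes "covariant_pairing l r B"
  shows "B a c ([:fst b:] * p + [:snd b:] * q) - B b c ([:fst a:] * p + [:snd a:] * q)
    = [:det2 a b:] * (B (1, 0) c q - B (0, 1) c p)"
  unfolding covariant_pairingD(4,5)[OF assms]
  unfolding covariant_pairingD(3)[OF assms, of a] covariant_pairingD(3)[OF assms, of b] det2_def const_poly_simps
  by (simp only: algebra_simps)

lemma subst_form_diff: "subst_form m A B (p - q) = subst_form m A B p - subst_form m A B q"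
  using subst_form_add[of m A B "p - q" q] by simp

text \<open>The pairing composed with the inclusion of Sym^(m+1). Passing to the basis
  \<open>a\<close>, \<open>b\<close> costs one determinant and the contraction supplies one; they
  cancel, so the second entry of the weight is unchanged.\<close>

lemma covariant_sym_part:
  fixes B :: "'k \<times> 'k \<Rightarrow> ('k::field, 'n) frame \<Rightarrow> 'k poly \<Rightarrow> 'k poly"
  assumes B: "covariant_pairing l r B"
  defines "m \<equiv> fst l - snd l"
  shows "covariant (Suc (fst l), snd l) r
    (\<lambda>c q. B (1, 0) c (wedge (Suc m) (0, 1) q) - B (0, 1) c (wedge (Suc m) (1, 0) q))"
proof -
  note D = covariant_pairingD[OF B]
  have m: "Suc (fst l) - snd l = Suc m"
    using D(1) by (simp add: m_def)
  have equi: "[:det2 a b:] ^ snd l *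
      (B (1, 0) c' (wedge (Suc m) (0, 1) s) - B (0, 1) c' (wedge (Suc m) (1, 0) s))
    = [:det2 a b:] ^ snd r * subst_form (fst r - snd r) (lin a) (lin b)
      (B (1, 0) c (wedge (Suc m) (0, 1) p) - B (0, 1) c (wedge (Suc m) (1, 0) p))"
    if det: "det2 a b \<noteq> 0" and p: "degree p \<le> Suc m" and c': "c' = (\<lambda>i. comb a b (c i))"
      and s: "s = subst_form (Suc m) (lin a) (lin b) p" for a b c c' p s
  proof -
    let ?S = "subst_form m (lin a) (lin b)" and ?S' = "subst_form (fst r - snd r) (lin a) (lin b)" and ?\<delta> =
        "[:det2 a b:]"
    have w: "wedge (Suc m) a s = ?\<delta> * ?S (wedge (Suc m) (1, 0) p)"
      "wedge (Suc m) b s = ?\<delta> * ?S (wedge (Suc m) (0, 1) p)"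
      unfolding s using subst_form_wedge[OF p, of a b] by (metis comb_unit)+
    have e: "?\<delta> ^ snd l * B a c' (?S (wedge (Suc m) (0, 1) p)) = ?\<delta> ^ snd r
        * ?S' (B (1, 0) c (wedge (Suc m) (0, 1) p))"
      "?\<delta> ^ snd l * B b c' (?S (wedge (Suc m) (1, 0) p)) = ?\<delta> ^ snd r * ?S' (B (0, 1) c (wedge (Suc m) (1, 0) p))"
      using D(8)[OF det degree_wedge[OF p, unfolded m_def], of "(1, 0)" c "(0, 1)"]
        D(8)[OF det degree_wedge[OF p, unfolded m_def], of "(0, 1)" c "(1, 0)"]
      unfolding c' comb_unit m_def .
    have "?\<delta> * (B (1, 0) c' (wedge (Suc m) (0, 1) s) - B (0, 1) c' (wedge (Suc m) (1, 0) s))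
        = B a c' (wedge (Suc m) b s) - B b c' (wedge (Suc m) a s)"
      unfolding covariant_pairing_antisym[OF B, symmetric] wedge_comb[of _ a] wedge_comb[of _ b] ..
    also have "\<dots> = ?\<delta> * (B a c' (?S (wedge (Suc m) (0, 1) p)) - B b c' (?S (wedge (Suc m) (1, 0) p)))"
      unfolding w D(5) by (simp only: right_diff_distrib)
    finally have "B (1, 0) c' (wedge (Suc m) (0, 1) s) - B (0, 1) c' (wedge (Suc m) (1, 0) s)
        = B a c' (?S (wedge (Suc m) (0, 1) p)) - B b c' (?S (wedge (Suc m) (1, 0) p))"
      by (subst (asm) mult_left_cancel) (use det in simp_all)
    then show ?thesis
      using e by (simp only: right_diff_distrib subst_form_diff)
  qed
  show ?thesis
    unfolding covariant_def fst_conv snd_conv m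
  proof (intro conjI allI impI)
    show "degree (B (1, 0) c (wedge (Suc m) (0, 1) p) - B (0, 1) c (wedge (Suc m) (1, 0) p)) \<le> fst r - snd r" for c p
      by (rule degree_diff_le) (rule D(6))+
    show "snd l \<le> Suc (fst l)" "snd r \<le> fst r"
      using D(1,2) by simp_all
    show "B (1, 0) c (wedge (Suc m) (0, 1) (p + q)) - B (0, 1) c (wedge (Suc m) (1, 0) (p + q)) =
       B (1, 0) c (wedge (Suc m) (0, 1) p) - B (0, 1) c (wedge (Suc m) (1, 0) p) +
       (B (1, 0) c (wedge (Suc m) (0, 1) q) - B (0, 1) c (wedge (Suc m) (1, 0) q))" for c p q
      unfolding wedge_add D(4) by (simp only: algebra_simps)
    show "B (1, 0) c (wedge (Suc m) (0, 1) ([:a:] * p)) - B (0, 1) c (wedge (Suc m) (1, 0) ([:a:] * p)) =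
       [:a:] * (B (1, 0) c (wedge (Suc m) (0, 1) p) - B (0, 1) c (wedge (Suc m) (1, 0) p))" for c a p
      unfolding wedge_const_mult D(5) by (simp only: right_diff_distrib)
  qed (intro poly_maps_diff D(7) | rule equi | simp)+
qed

text \<open>This inclusion multiplies by linear forms, which transform without a determinant. The
  single determinant from the change of basis remains and accounts for
  \<open>Suc (snd l)\<close>.\<close>

lemma covariant_wedge_part:
  fixes B :: "'k \<times> 'k \<Rightarrow> ('k::field, 'n) frame \<Rightarrow> 'k poly \<Rightarrow> 'k poly"
  assumes B: "covariant_pairing l r B" and less: "snd l < fst l"
  shows "covariant (fst l, Suc (snd l)) r (\<lambda>c q. B (1, 0) c (lin (0, 1) * q) - B (0, 1) c (lin (1, 0) * q))"
proof -
  note D = covariant_pairingD[OF B]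
  define k where "k = fst l - Suc (snd l)"
  have m: "fst l - snd l = Suc k"
    using less by (simp add: k_def)
  have equi: "[:det2 a b:] ^ Suc (snd l) * (B (1, 0) c' (lin (0, 1) * s) - B (0, 1) c' (lin (1, 0) * s))
    = [:det2 a b:] ^ snd r * subst_form (fst r - snd r) (lin a) (lin b)
      (B (1, 0) c (lin (0, 1) * p) - B (0, 1) c (lin (1, 0) * p))"
    if det: "det2 a b \<noteq> 0" and p: "degree p \<le> k" and c': "c' = (\<lambda>i. comb a b (c i))"
      and s: "s = subst_form k (lin a) (lin b) p" for a b c c' p s
  proof -
    let ?S = "subst_form (Suc k) (lin a) (lin b)" and ?S' = "subst_form (fst r - snd r) (lin a) (lin b)" and ?\<delta>
        = "[:det2 a b:]"
    have l: "?S (lin (1, 0) * p) = lin a * s" "?S (lin (0, 1) * p) = lin b * s"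
      unfolding s subst_form_lin_mult[OF p] by simp_all
    have d: "degree (lin y * p) \<le> fst l - snd l" for y
      unfolding m using degree_mult_le[of "lin y" p] degree_lin[of y] p by linarith
    have e: "?\<delta> ^ snd l * B a c' (lin b * s) = ?\<delta> ^ snd r * ?S' (B (1, 0) c (lin (0, 1) * p))"
      "?\<delta> ^ snd l * B b c' (lin a * s) = ?\<delta> ^ snd r * ?S' (B (0, 1) c (lin (1, 0) * p))"
      using D(8)[OF det d, of "(1, 0)" c "(0, 1)"] D(8)[OF det d, of "(0, 1)" c "(1, 0)"]
      unfolding c' comb_unit m l .
    have lc: "lin y * s = [:fst y:] * (lin (1, 0) * s) + [:snd y:] * (lin (0, 1) * s)" for y
      by (simp add: lin_def algebra_simps)
    have "?\<delta> * (B (1, 0) c' (lin (0, 1) * s) - B (0, 1) c' (lin (1, 0) * s))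
        = B a c' (lin b * s) - B b c' (lin a * s)"
      unfolding covariant_pairing_antisym[OF B, symmetric] lc[of a] lc[of b] ..
    then have "?\<delta> ^ Suc (snd l) * (B (1, 0) c' (lin (0, 1) * s) - B (0, 1) c' (lin (1, 0) * s))
        = ?\<delta> ^ snd l * (B a c' (lin b * s) - B b c' (lin a * s))"
      by (simp only: power_Suc2 mult.assoc)
    then show ?thesis
      using e by (simp only: right_diff_distrib subst_form_diff)
  qed
  show ?thesis
    unfolding covariant_def fst_conv snd_conv k_def[symmetric]
  proof (intro conjI allI impI)
    show "degree (B (1, 0) c (lin (0, 1) * p) - B (0, 1) c (lin (1, 0) * p)) \<le> fst r - snd r" for c p
      by (rule degree_diff_le) (rule D(6))+
    show "Suc (snd l) \<le> fst l" "snd r \<le> fst r"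
      using less D(2) by simp_all
    show "B (1, 0) c (lin (0, 1) * (p + q)) - B (0, 1) c (lin (1, 0) * (p + q)) =
       B (1, 0) c (lin (0, 1) * p) - B (0, 1) c (lin (1, 0) * p) +
       (B (1, 0) c (lin (0, 1) * q) - B (0, 1) c (lin (1, 0) * q))" for c p q
      unfolding distrib_left D(4) by (simp only: algebra_simps)
    show "B (1, 0) c (lin (0, 1) * ([:a:] * p)) - B (0, 1) c (lin (1, 0) * ([:a:] * p)) =
       [:a:] * (B (1, 0) c (lin (0, 1) * p) - B (0, 1) c (lin (1, 0) * p))" for c a p
      unfolding mult.left_commute[of _ "[:a:]"] D(5) by (simp only: right_diff_distrib)
  qed (intro poly_maps_diff D(7) | rule equi | simp)+
qed

lemma covariant_const_mult:
  assumes F: "covariant l r F"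
  shows "covariant l r (\<lambda>c p. [:a:] * F c p)"
proof -
  note D = covariantD[OF F]
  have deg: "degree ([:a:] * F c p) \<le> fst r - snd r" for c p
    using degree_mult_le[of "[:a:]" "F c p"] D(5)[of c p] by simp
  have equi: "[:det2 x y:] ^ snd l * ([:a:] * F (\<lambda>i. comb x y (c i)) (subst_form (fst l - snd l) (lin x) (lin y) p))
      = [:det2 x y:] ^ snd r * subst_form (fst r - snd r) (lin x) (lin y) ([:a:] * F c p)"
    if "det2 x y \<noteq> 0" "degree p \<le> fst l - snd l" for x y c p
    unfolding subst_form_const_mult mult.left_commute[of _ "[:a:]"] D(7)[OF that] ..
  show ?thesis
    unfolding covariant_def D(3,4) distrib_left mult.left_commute[of "[:a:]" "[:_:]"]
    by (intro conjI allI impI poly_maps_mult poly_maps.const D(1,2,6)) (assumption | rule refl deg equi)+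
qed

text \<open>The derivatives give one pairing for every index i. Euler's identity recovers the family
  by inserting the entries \<open>c i\<close>, and the Pieri identity splits each term through
  multiplication and contraction by \<open>c i\<close>.\<close>

lemma covariant_decomposition:
  fixes F :: "('k::field_char_0, 'n::finite) frame \<Rightarrow> 'k poly \<Rightarrow> 'k poly"
  assumes F: "covariant l r F" and d: "fst r + snd r = Suc (fst l + snd l + d)"
  obtains G H where "\<And>i. covariant (Suc (fst l), snd l) r (G i)"
    and "\<And>i. snd l < fst l \<Longrightarrow> covariant (fst l, Suc (snd l)) r (H i)"
    and "\<And>c p. degree p \<le> fst l - snd l \<Longrightarrow>
      F c p = (\<Sum>i\<in>UNIV. G i c (lin (c i) * p)) +
        (if snd l < fst l then \<Sum>i\<in>UNIV. H i c (wedge (fst l - snd l) (c i) p) else 0)"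
proof -
  define B where "B i y c p = frame_deriv (\<lambda>c. F c p) c (single_dir i y)" for i y c p
  have B: "covariant_pairing l r (B i)" for i
    unfolding B_def by (rule covariant_pairing_frame_deriv[OF F])
  note D = covariant_pairingD[OF B]
  define m where "m = fst l - snd l"
  \<comment> \<open>Compensates the factor d + 1 of Euler's identity and the factor m + 1 of the
    Pieri identity; \<open>H\<close> below takes over the minus sign of the latter.\<close>
  define a :: 'k where "a = 1 / (of_nat (Suc d) * of_nat (Suc m))"
  define G where "G i c q = [:a:]
      * (B i (1, 0) c (wedge (Suc m) (0, 1) q) - B i (0, 1) c (wedge (Suc m) (1, 0) q))" for i c q
  define H where "H i c q = [:- a:] * (B i (1, 0) c (lin (0, 1) * q) - B i (0, 1) c (lin (1, 0) * q))" for i c q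
  have G: "covariant (Suc (fst l), snd l) r (G i)" for i
    unfolding G_def m_def by (intro covariant_const_mult covariant_sym_part B)
  have H: "covariant (fst l, Suc (snd l)) r (H i)" if "snd l < fst l" for i
    unfolding H_def by (intro covariant_const_mult covariant_wedge_part B that)
  have "F c p = (\<Sum>i\<in>UNIV. G i c (lin (c i) * p)) +
      (if snd l < fst l then \<Sum>i\<in>UNIV. H i c (wedge m (c i) p) else 0)" if p: "degree p \<le> m" for c p
  proof -
    \<comment> \<open>For equal entries of the weight there is no intermediate weight for
      \<open>H\<close>. Then m = 0, contraction kills constants, and the term disappears.\<close>
    have H0: "H i c (wedge m (c i) p) = 0" if "\<not> snd l < fst l" for i
    proof -
      have m0: "m = 0"
        using that by (simp add: m_def)
      have "wedge m (c i) p = 0"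
        unfolding m0 by (rule wedge_degree_0) (use p m0 in simp)
      then show ?thesis
        using D(5)[of i _ c 0 0] by (simp add: H_def)
    qed
    have [simp]: "of_nat (Suc d) \<noteq> (0::'k)" "of_nat (Suc m) \<noteq> (0::'k)"
      by (rule of_nat_neq_0)+
    have "[:a:] * (of_nat (Suc d) * of_nat (Suc m)) = [:1:]"
      unfolding const_poly_simps(6)[symmetric] const_poly_simps(4)[symmetric] by (simp add: a_def del: of_nat_Suc)
    then have "F c p = [:a:] * of_nat (Suc m) * (of_nat (Suc d) * F c p)"
      by (simp add: mult_ac pCons_one flip: mult.assoc)
    also have "of_nat (Suc d) * F c p = (\<Sum>i\<in>UNIV. B i (c i) c p)"
      unfolding B_def by (rule covariant_Euler[OF F, symmetric]) (use p d in \<open>simp_all add: m_def\<close>)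
    also have "[:a:] * of_nat (Suc m) * \<dots> = (\<Sum>i\<in>UNIV. [:a:] * (of_nat (Suc m) * B i (c i) c p))"
      by (simp only: sum_distrib_left mult.assoc)
    also have "\<dots> = (\<Sum>i\<in>UNIV. G i c (lin (c i) * p) + H i c (wedge m (c i) p))"
    proof (rule sum.cong)
      fix i
      have "of_nat (Suc m) * B i (c i) c p = B i (1, 0) c (wedge (Suc m) (0, 1) (lin (c i) * p))
          - B i (0, 1) c (wedge (Suc m) (1, 0) (lin (c i) * p))
        - (B i (1, 0) c (lin (0, 1) * wedge m (c i) p) - B i (0, 1) c (lin (1, 0) * wedge m (c i) p))"
        by (rule Pieri_identity[of "\<lambda>y p. B i y c p"]) (rule D)+
      moreover have "x * (u - v) = x * u + - x * v" for x u v :: "'k poly"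
        by (simp add: right_diff_distrib)
      ultimately show "[:a:] * (of_nat (Suc m) * B i (c i) c p) = G i c (lin (c i) * p) + H i c (wedge m (c i) p)"
        unfolding G_def H_def const_poly_simps by simp
    qed simp
    also have "\<dots> = (\<Sum>i\<in>UNIV. G i c (lin (c i) * p)) + (\<Sum>i\<in>UNIV. H i c (wedge m (c i) p))"
      by (rule sum.distrib)
    also have "(\<Sum>i\<in>UNIV. H i c (wedge m (c i) p)) = (if snd l < fst l then \<Sum>i\<in>UNIV. H i c (wedge m (c i) p) else 0)"
      using H0 by simp
    finally show ?thesis .
  qed
  from that[OF G H this[unfolded m_def]] show ?thesis .
qed

text \<open>Induction on the difference of the sizes. Both intermediate weights of the decomposition
  have first entry at least that of \<open>l\<close>, so it still exceeds the first entry of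
  \<open>r\<close>; at difference zero the weights are distinct and Schur's lemma applies.\<close>

lemma covariant_eq_0:
  fixes F :: "('k::field_char_0, 'n::finite) frame \<Rightarrow> 'k poly \<Rightarrow> 'k poly"
  assumes "covariant l r F" "fst r < fst l" "degree p \<le> fst l - snd l"
  shows "F c p = 0"
  using assms
proof (induction "fst r + snd r - (fst l + snd l)" arbitrary: l F p)
  case 0
  then consider "fst r + snd r < fst l + snd l" | "fst r + snd r = fst l + snd l"
    by linarith
  then show ?case
  proof cases
    case 1
    then show ?thesis
      using covariant_negative_degree 0 by blast
  next
    case 2
    obtain \<tau> where \<tau>: "\<forall>c p. degree p \<le> fst l - snd l \<longrightarrow> F c p = [:\<tau>:] * p" "l \<noteq> r \<longrightarrow> \<tau> = 0"
      using covariant_degree_zero[OF 0(2) 2] by (elim exE conjE)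
    have "\<tau> = 0"
      using \<tau>(2) 0(3) by auto
    then show ?thesis
      using \<tau>(1) 0(4) by simp
  qed
next
  case (Suc d)
  then have d: "fst r + snd r = Suc (fst l + snd l + d)"
    by linarith
  show ?case
  proof (rule covariant_decomposition[OF Suc.prems(1) d])
    fix G H
    assume G: "\<And>i. covariant (Suc (fst l), snd l) r (G i)"
      and H: "\<And>i. snd l < fst l \<Longrightarrow> covariant (fst l, Suc (snd l)) r (H i)"
      and F: "\<And>c p. degree p \<le> fst l - snd l \<Longrightarrow>
        F c p = (\<Sum>i\<in>UNIV. G i c (lin (c i) * p)) +
          (if snd l < fst l then \<Sum>i\<in>UNIV. H i c (wedge (fst l - snd l) (c i) p) else 0)"
    have l: "snd l \<le> fst l"
      using covariantD(1)[OF Suc.prems(1)] .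
    have "G i c (lin (c i) * p) = 0" for i
    proof (rule Suc.hyps(1)[OF _ G])
      show "degree (lin (c i) * p) \<le> fst (Suc (fst l), snd l) - snd (Suc (fst l), snd l)"
        using degree_mult_le[of "lin (c i)" p] degree_lin[of "c i"] Suc.prems(3) l by simp
    qed (use d Suc.prems(2) in simp_all)
    moreover have "H i c (wedge (fst l - snd l) (c i) p) = 0" if less: "snd l < fst l" for i
    proof (rule Suc.hyps(1)[OF _ H[OF less]])
      obtain k where "fst l - snd l = Suc k"
        using less by (metis Suc_diff_Suc)
      then show "degree (wedge (fst l - snd l) (c i) p) \<le> fst (fst l, Suc (snd l)) - snd (fst l, Suc (snd l))"
        using degree_wedge[of p k "c i"] Suc.prems(3) by simp
    qed (use d Suc.prems(2) in simp_all)
    ultimately show "F c p = 0"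
      using F[OF Suc.prems(3)] by simp
  qed
qed

lemma poly_maps_comb:
  assumes "f \<in> poly_maps"
  shows "(\<lambda>c. f (\<lambda>i. comb a b (c i))) \<in> poly_maps"
  using assms
proof (induction rule: poly_maps_ring_induct)
  case (coord_fst i)
  show ?case
    unfolding comb_def fst_conv const_poly_simps by (intro poly_maps_intros)
next
  case (coord_snd i)
  show ?case
    unfolding comb_def snd_conv const_poly_simps by (intro poly_maps_intros)
qed (auto intro: poly_maps_intros)

section \<open>Extension from nondegenerate frames\<close>

definition nondegenerate :: "('k::field, 'n) frame \<Rightarrow> bool"
  where "nondegenerate c \<longleftrightarrow> (\<exists>i j. det2 (c i) (c j) \<noteq> 0)"

text \<open>The product of f with the minor vanishes identically, and the minor is not the zero
  function, as the frame with (1, 0) at \<open>i\<close> and (0, 1) elsewhere shows.\<close>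

lemma poly_maps_eq_0_dense:
  fixes f :: "('k::field_char_0, 'n) frame \<Rightarrow> 'k poly"
  assumes f: "f \<in> poly_maps" and "i \<noteq> j" and 0: "\<And>c. det2 (c i) (c j) \<noteq> 0 \<Longrightarrow> f c = 0"
  shows "f c = 0"
proof (rule poly_maps_no_zero_divisors[OF f poly_maps_det2[of i j]])
  show "f c * [:det2 (c i) (c j):] = 0" for c
    using 0[of c] by (cases "det2 (c i) (c j) = 0") simp_all
  show "[:det2 ((\<lambda>k. if k = i then (1, 0) else (0, 1)) i) ((\<lambda>k. if k = i then (1, 0) else (0, 1)) j):] \<noteq>
      (0 :: 'k poly)"
    using \<open>i \<noteq> j\<close> by (simp add: det2_def)
qed

text \<open>The frame version of regularity on charts: where a minor is invertible, regular
  functions are polynomials over powers of that minor.\<close>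

definition locally_regular :: "(('k::field, 'n) frame \<Rightarrow> 'k poly) \<Rightarrow> bool"
  where "locally_regular f \<longleftrightarrow> (\<forall>i j. \<exists>N. \<exists>P\<in>poly_maps. \<forall>c.
    det2 (c i) (c j) \<noteq> 0 \<longrightarrow> [:det2 (c i) (c j):] ^ N * f c = P c)"

text \<open>Four distinct indices give two disjoint minors for the Hartogs step. The resulting
  polynomial agrees with f where the first minor is nonzero; on any other chart it is compared with
  the local numerator, and density finishes.\<close>

lemma locally_regular_extends:
  fixes f :: "('k::field_char_0, 'n::finite) frame \<Rightarrow> 'k poly"
  assumes card: "CARD('n) \<ge> 4" and f: "locally_regular f"
  shows "\<exists>Q\<in>poly_maps. \<forall>c. nondegenerate c \<longrightarrow> f c = Q c"
proof -
  obtain S :: "'n set" where "card S = 4"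
    using obtain_subset_with_card_n[OF card] by blast
  then obtain i\<^sub>1 i\<^sub>2 i\<^sub>3 i\<^sub>4 :: 'n where dist: "i\<^sub>1 \<noteq> i\<^sub>2" "i\<^sub>1 \<noteq> i\<^sub>3" "i\<^sub>1 \<noteq> i\<^sub>4" "i\<^sub>2 \<noteq> i\<^sub>3" "i\<^sub>2 \<noteq> i\<^sub>4"
      "i\<^sub>3 \<noteq> i\<^sub>4"
    by (auto simp: card_Suc_eq numeral_eq_Suc)
  obtain M P where P: "P \<in> poly_maps" "\<And>c. det2 (c i\<^sub>1) (c i\<^sub>2) \<noteq> 0 \<Longrightarrow> [:det2 (c i\<^sub>1) (c i\<^sub>2):] ^ M * f c = P c"
    using f unfolding locally_regular_def by blast
  obtain M' P' where P': "P' \<in> poly_maps" "\<And>c. det2 (c i\<^sub>3) (c i\<^sub>4) \<noteq> 0 \<Longrightarrow> [:det2 (c i\<^sub>3) (c i\<^sub>4):] ^ M' * f c = P' c"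
    using f unfolding locally_regular_def by blast
  obtain Q where Q: "Q \<in> poly_maps" "\<And>c. det2 (c i\<^sub>1) (c i\<^sub>2) \<noteq> 0 \<Longrightarrow> f c = Q c"
    using Hartogs_two_charts[OF dist(2-6) P P'] by blast
  have "f c = Q c" if nd: "nondegenerate c" for c
  proof -
    obtain i j where ij: "det2 (c i) (c j) \<noteq> 0"
      using nd unfolding nondegenerate_def by blast
    then have "i \<noteq> j"
      by (auto simp: det2_def)
    obtain N R where R: "R \<in> poly_maps" "\<And>c. det2 (c i) (c j) \<noteq> 0 \<Longrightarrow> [:det2 (c i) (c j):] ^ N * f c = R c"
      using f unfolding locally_regular_def by blast
    \<comment> \<open>The last factor makes the expression vanish also where the minor of
      \<open>i\<close>, \<open>j\<close> is zero and the numerator \<open>R\<close> is not tied to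
      f.\<close>
    let ?h = "\<lambda>c. ([:det2 (c i) (c j):] ^ N * Q c - R c) * [:det2 (c i) (c j):]"
    have h: "?h \<in> poly_maps"
      by (intro poly_maps_intros Q R)
    have "?h c = 0"
    proof (rule poly_maps_eq_0_dense[OF h dist(1)])
      show "?h c = 0" if "det2 (c i\<^sub>1) (c i\<^sub>2) \<noteq> 0" for c
        using Q(2)[OF that] R(2)[of c] by (cases "det2 (c i) (c j) = 0") simp_all
    qed
    then have "[:det2 (c i) (c j):] ^ N * Q c = [:det2 (c i) (c j):] ^ N * f c"
      using ij R(2)[OF ij] by simp
    then show ?thesis
      using ij by simp
  qed
  then show ?thesis
    using Q(1) by blast
qed

text \<open>Only the values on the finitely many monomials are extended over the degenerate frames,
  and the family is rebuilt by linearity. Equivariance persists because both sides are polynomial in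
  the frame and agree where a minor is nonzero.\<close>

lemma covariant_extension:
  fixes T :: "('k::field_char_0, 'n::finite) frame \<Rightarrow> 'k poly \<Rightarrow> 'k poly"
  assumes card: "CARD('n) \<ge> 4" and wl: "snd l \<le> fst l" and wr: "snd r \<le> fst r"
    and add: "\<And>c p q. nondegenerate c \<Longrightarrow> degree p \<le> fst l - snd l \<Longrightarrow> degree q \<le> fst l - snd l \<Longrightarrow> T c (p + q) =
        T c p + T c q"
    and scale: "\<And>c a p. nondegenerate c \<Longrightarrow> degree p \<le> fst l - snd l \<Longrightarrow> T c ([:a:] * p) = [:a:] * T c p"
    and deg: "\<And>c p. nondegenerate c \<Longrightarrow> degree p \<le> fst l - snd l \<Longrightarrow> degree (T c p) \<le> fst r - snd r"
    and reg: "\<And>p. degree p \<le> fst l - snd l \<Longrightarrow> locally_regular (\<lambda>c. T c p)"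
    and equi: "\<And>a b c p. nondegenerate c \<Longrightarrow> det2 a b \<noteq> 0 \<Longrightarrow> degree p \<le> fst l - snd l \<Longrightarrow>
      [:det2 a b:] ^ snd l * T (\<lambda>i. comb a b (c i)) (subst_form (fst l - snd l) (lin a) (lin b) p)
        = [:det2 a b:] ^ snd r * subst_form (fst r - snd r) (lin a) (lin b) (T c p)"
  shows "\<exists>F. covariant l r F \<and> (\<forall>c p. nondegenerate c \<longrightarrow> degree p \<le> fst l - snd l \<longrightarrow> F c p = T c p)"
proof -
  let ?m = "fst l - snd l" and ?m' = "fst r - snd r"
  have degX: "degree ([:0, 1::'k:] ^ j) \<le> ?m" if "j \<le> ?m" for j
    using that by (simp add: degree_power_eq)
  have "\<forall>j. \<exists>Q. j \<le> ?m \<longrightarrow> Q \<in> poly_maps \<and> (\<forall>c. nondegenerate c \<longrightarrow> T c ([:0, 1:] ^ j) = Q c)"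
    using locally_regular_extends[OF card reg[OF degX]] by blast
  from choice[OF this] obtain Q where
    "\<forall>j. j \<le> ?m \<longrightarrow> Q j \<in> poly_maps \<and> (\<forall>c. nondegenerate c \<longrightarrow> T c ([:0, 1:] ^ j) = Q j c)" ..
  then have Q: "\<And>j. j \<le> ?m \<Longrightarrow> Q j \<in> poly_maps"
      "\<And>j c. j \<le> ?m \<Longrightarrow> nondegenerate c \<Longrightarrow> T c ([:0, 1:] ^ j) = Q j c"
    by blast+
  \<comment> \<open>Truncation to degree \<open>?m'\<close>. It changes nothing at nondegenerate
    frames and makes the degree bound hold at all others too.\<close>
  define tr where "tr = subst_form ?m' 1 [:0, 1::'k:]"
  define F where "F c p = (\<Sum>j\<le>?m. [:poly.coeff p j:] * tr (Q j c))" for c p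
  have tr_pm: "(\<lambda>c. tr (f c)) \<in> poly_maps" if "f \<in> poly_maps" for f :: "('k, 'n) frame \<Rightarrow> 'k poly"
    by (rule poly_maps_linear[OF _ _ that]) (simp_all only: tr_def subst_form_add subst_form_const_mult)
  have F_pm: "(\<lambda>c. F c p) \<in> poly_maps" for p
    unfolding F_def using Q(1) by (auto intro!: poly_maps_sum poly_maps_mult poly_maps.const tr_pm simp del:
        mult_pCons_left)
  have F_eq: "F c p = T c p" if c: "nondegenerate c" and p: "degree p \<le> ?m" for c p
  proof -
    have T_sum: "T c (\<Sum>j\<in>I. [:a j:] * [:0, 1:] ^ j) = (\<Sum>j\<in>I. [:a j:] * T c ([:0, 1:] ^ j))"
      if "finite I" "I \<subseteq> {..?m}" for a I
      using that
    proof (induction I)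
      case empty
      show ?case
        using scale[OF c, of 0 0] by simp
    next
      case (insert j I)
      have j: "degree ([:a i:] * [:0, 1:] ^ i) \<le> ?m" if "i \<in> insert j I" for i
        using degree_mult_le[of "[:a i:]" "[:0, 1:] ^ i"] degX[of i] insert.prems that by fastforce
      then have "degree (\<Sum>i\<in>I. [:a i:] * [:0, 1:] ^ i) \<le> ?m"
        by (intro degree_sum_le insert.hyps) blast
      then have "T c (\<Sum>i\<in>insert j I. [:a i:] * [:0, 1:] ^ i) = T c ([:a j:] * [:0, 1:] ^ j)
          + T c (\<Sum>i\<in>I. [:a i:] * [:0, 1:] ^ i)"
        unfolding sum.insert[OF insert.hyps] by (intro add[OF c] j) simp_all
      moreover have "T c ([:a j:] * [:0, 1:] ^ j) = [:a j:] * T c ([:0, 1:] ^ j)"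
        by (rule scale[OF c]) (use degX insert.prems in auto)
      moreover have "I \<subseteq> {..?m}"
        using insert.prems by blast
      ultimately show ?case
        using insert.IH unfolding sum.insert[OF insert.hyps] by simp
    qed
    have "T c p = T c (\<Sum>j\<le>?m. [:poly.coeff p j:] * [:0, 1:] ^ j)"
      using poly_eq_sum_powers[OF p] by simp
    also have "\<dots> = F c p"
      unfolding F_def T_sum[OF finite_atMost subset_refl]
    proof (rule sum.cong)
      fix j assume "j \<in> {..?m}"
      then have j: "j \<le> ?m"
        by simp
      have "tr (Q j c) = Q j c"
        unfolding tr_def Q(2)[OF j c, symmetric] by (rule subst_form_id) (rule deg[OF c degX[OF j]])
      then show "[:poly.coeff p j:] * T c ([:0, 1:] ^ j) = [:poly.coeff p j:] * tr (Q j c)"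
        using Q(2)[OF j c] by simp
    qed simp
    finally show ?thesis ..
  qed
  obtain S :: "'n set" where "card S = 2"
    using obtain_subset_with_card_n[of 2 "UNIV :: 'n set"] card by auto
  then obtain i\<^sub>1 i\<^sub>2 :: 'n where ne: "i\<^sub>1 \<noteq> i\<^sub>2"
    by (auto simp: card_Suc_eq numeral_eq_Suc)
  have F_equi: "[:det2 a b:] ^ snd l * F (\<lambda>i. comb a b (c i)) (subst_form ?m (lin a) (lin b) p)
        = [:det2 a b:] ^ snd r * subst_form ?m' (lin a) (lin b) (F c p)"
    if det: "det2 a b \<noteq> 0" and p: "degree p \<le> ?m" for a b c p
  proof -
    let ?h = "\<lambda>c. [:det2 a b:] ^ snd l * F (\<lambda>i. comb a b (c i)) (subst_form ?m (lin a) (lin b) p)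
        - [:det2 a b:] ^ snd r * subst_form ?m' (lin a) (lin b) (F c p)"
    have "(\<lambda>c. subst_form ?m' (lin a) (lin b) (F c p)) \<in> poly_maps"
      by (rule poly_maps_linear[OF _ _ F_pm]) (simp_all only: subst_form_add subst_form_const_mult)
    moreover have "(\<lambda>c. F (\<lambda>i. comb a b (c i)) (subst_form ?m (lin a) (lin b) p)) \<in> poly_maps"
      using poly_maps_comb[OF F_pm] .
    ultimately have h: "?h \<in> poly_maps"
      by (intro poly_maps_diff poly_maps_mult poly_maps_power poly_maps.const)
    have "?h c = 0"
    proof (rule poly_maps_eq_0_dense[OF h ne])
      fix c :: "('k, 'n) frame" assume nz: "det2 (c i\<^sub>1) (c i\<^sub>2) \<noteq> 0"
      then have c: "nondegenerate c"
        by (auto simp: nondegenerate_def)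
      have c': "nondegenerate (\<lambda>i. comb a b (c i))"
        unfolding nondegenerate_def det2_comb using nz det by auto
      have "degree (subst_form ?m (lin a) (lin b) p) \<le> ?m"
        by (rule degree_subst_form) (rule degree_lin)+
      then show "?h c = 0"
        unfolding F_eq[OF c p] using F_eq[OF c'] equi[OF c det p] by simp
    qed
    then show ?thesis
      by simp
  qed
  have "covariant l r F"
    unfolding covariant_def
  proof (intro conjI allI impI F_equi F_pm wl wr)
    show "F c (p + q) = F c p + F c q" for c p q
      unfolding F_def coeff_add const_poly_simps distrib_right sum.distrib ..
    show "F c ([:a:] * p) = [:a:] * F c p" for c a p
      unfolding F_def sum_distrib_left by (rule sum.cong) (simp_all add: mult_ac)
    show "degree (F c p) \<le> ?m'" for c p
      unfolding F_def
    proof (rule degree_sum_le)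
      fix j
      have "degree (tr (Q j c)) \<le> ?m'"
        unfolding tr_def by (rule degree_subst_form) simp_all
      then show "degree ([:poly.coeff p j:] * tr (Q j c)) \<le> ?m'"
        using degree_mult_le[of "[:poly.coeff p j:]" "tr (Q j c)"] by simp
    qed simp
  qed
  then show ?thesis
    using F_eq by blast
qed

section \<open>Schur powers of a plane as binary forms\<close>

text \<open>In the coordinates \<open>\<psi>\<close> a wedge factor becomes its determinant and a
  symmetric factor its linear form. On generators this is the identification of the Schur power of a
  plane with det^b tensor Sym^m.\<close>

definition ev_word :: "('u \<Rightarrow> 'k \<times> 'k) \<Rightarrow> 'u word_tensor \<Rightarrow> 'k::field poly"
  where "ev_word \<psi> t = [:prod_list (map (\<lambda>(x, x'). det2 (\<psi> x) (\<psi> x')) (fst t)):]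
      * prod_list (map lin (map \<psi> (snd t)))"

definition ev_tensor :: "('u \<Rightarrow> 'k \<times> 'k) \<Rightarrow> ('u word_tensor \<Rightarrow>\<^sub>0 'k) \<Rightarrow> 'k::field poly"
  where "ev_tensor \<psi> p = (\<Sum>t\<in>Poly_Mapping.keys p. [:Poly_Mapping.lookup p t:] * ev_word \<psi> t)"

lemma keys_pm_scale: "Poly_Mapping.keys (pm_scale a p) \<subseteq> Poly_Mapping.keys p"
  by (auto simp: in_keys_iff)

lemma ev_tensor_superset:
  "finite S \<Longrightarrow> Poly_Mapping.keys p \<subseteq> S \<Longrightarrow> ev_tensor \<psi> p = (\<Sum>t\<in>S. [:Poly_Mapping.lookup p t:] * ev_word \<psi> t)"
  unfolding ev_tensor_def by (rule sum.mono_neutral_left) (auto simp: in_keys_iff)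

lemma ev_tensor_add: "ev_tensor \<psi> (p + q) = ev_tensor \<psi> p + ev_tensor \<psi> q"
proof -
  let ?S = "Poly_Mapping.keys p \<union> Poly_Mapping.keys q"
  have "Poly_Mapping.keys (p + q) \<subseteq> ?S"
    by (rule Poly_Mapping.keys_add)
  then show ?thesis
    using ev_tensor_superset[of ?S "p + q" \<psi>] ev_tensor_superset[of ?S p \<psi>] ev_tensor_superset[of ?S q \<psi>]
    by (simp only: finite_Un finite_keys Un_upper1 Un_upper2 lookup_add const_poly_simps distrib_right sum.distrib)
qed

lemma ev_tensor_scale: "ev_tensor \<psi> (pm_scale a p) = [:a:] * ev_tensor \<psi> p"
  by (subst ev_tensor_superset[OF finite_keys keys_pm_scale])
    (simp only: ev_tensor_def sum_distrib_left lookup_pm_scale const_poly_simps mult.assoc)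

lemma ev_tensor_diff: "ev_tensor \<psi> (p - q) = ev_tensor \<psi> p - ev_tensor \<psi> q"
  using ev_tensor_add[of \<psi> "p - q" q] by simp

lemma ev_tensor_0 [simp]: "ev_tensor \<psi> 0 = 0"
  by (simp add: ev_tensor_def)

lemma ev_tensor_sum: "ev_tensor \<psi> (sum f I) = (\<Sum>i\<in>I. ev_tensor \<psi> (f i))"
  by (induction I rule: infinite_finite_induct) (simp_all add: ev_tensor_add)

lemma ev_tensor_gen [simp]: "ev_tensor \<psi> (Poly_Mapping.single t 1) = ev_word \<psi> t"
  by (simp add: ev_tensor_def pCons_one)

lemma ev_tensor_linear_extension:
  "ev_tensor \<psi> (linear_extension h p) = (\<Sum>t\<in>Poly_Mapping.keys p. [:Poly_Mapping.lookup p t:] * ev_tensor \<psi> (h t))"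
  unfolding linear_extension_def ev_tensor_sum ev_tensor_scale ..

lemma prod_list_map_mset_cong:
  fixes f :: "'u \<Rightarrow> 'r::comm_monoid_mult"
  assumes "mset xs = mset ys"
  shows "prod_list (map f xs) = prod_list (map f ys)"
proof -
  have "prod_mset (mset (map f xs)) = prod_mset (mset (map f ys))"
    using assms by simp
  then show ?thesis
    by (simp only: prod_mset_prod_list)
qed

lemma prod_list_map_conv_nth: "prod_list (map f xs) = (\<Prod>i<length xs. f (xs ! i))"
  by (simp add: prod.list_conv_set_nth atLeast0LessThan)

lemma prod_list_map_update:
  assumes "a < length xs"
  shows "prod_list (map f (xs[a := w])) = f w * (\<Prod>i\<in>{..<length xs} - {a}. f (xs ! i))"
proof -
  have "prod_list (map f (xs[a := w])) = f (xs[a := w] ! a) * (\<Prod>i\<in>{..<length xs} - {a}. f (xs[a := w] ! i))"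
    unfolding prod_list_map_conv_nth length_list_update using assms by (intro prod.remove) auto
  also have "(\<Prod>i\<in>{..<length xs} - {a}. f (xs[a := w] ! i)) = (\<Prod>i\<in>{..<length xs} - {a}. f (xs ! i))"
    by (rule prod.cong) auto
  finally show ?thesis
    using assms by simp
qed

lemma prod_list_map_update2:
  assumes "a < length xs" "b < length xs" "a \<noteq> b"
  shows "prod_list (map f (xs[a := w, b := w'])) = f w * f w' * (\<Prod>i\<in>{..<length xs} - {a, b}. f (xs ! i))"
proof -
  have "prod_list (map f (xs[a := w, b := w'])) = f w' * (\<Prod>i\<in>{..<length xs} - {b}. f (xs[a := w] ! i))"
    using prod_list_map_update[of b "xs[a := w]" f w'] assms(2) by simp
  also have "(\<Prod>i\<in>{..<length xs} - {b}. f (xs[a := w] ! i))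
      = f (xs[a := w] ! a) * (\<Prod>i\<in>{..<length xs} - {b} - {a}. f (xs[a := w] ! i))"
    using assms by (intro prod.remove) auto
  also have "{..<length xs} - {b} - {a} = {..<length xs} - {a, b}"
    by auto
  also have "(\<Prod>i\<in>{..<length xs} - {a, b}. f (xs[a := w] ! i)) = (\<Prod>i\<in>{..<length xs} - {a, b}. f (xs ! i))"
    by (rule prod.cong) auto
  finally show ?thesis
    using assms by (simp add: mult_ac)
qed

section \<open>The Schur power as an explicit quotient\<close>

lemma a_r_coset_eq: "N +>\<^bsub>G\<^esub> p = {h \<oplus>\<^bsub>G\<^esub> p | h. h \<in> N}"
  by (auto simp: a_r_coset_def r_coset_def)

lemma free_module_simps [simp]:
  "carrier (free_module X) = {p. Poly_Mapping.keys p \<subseteq> X}" "p \<oplus>\<^bsub>free_module X\<^esub> q = p + q"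
  "a \<odot>\<^bsub>free_module X\<^esub> p = pm_scale a p"
  by (simp_all add: free_module_def vector_module_def)

lemma schur_class_eq: "schur_class l U p = {h + p | h. h \<in> schur_rels l U}"
  by (simp add: schur_class_def a_r_coset_eq)

lemma schur_simps:
  "carrier (schur l U) = schur_class l U ` {p. Poly_Mapping.keys p \<subseteq> schur_gens l U}"
  "\<zero>\<^bsub>schur l U\<^esub> = schur_rels l U"
  "C \<oplus>\<^bsub>schur l U\<^esub> D = {x + y | x y. x \<in> C \<and> y \<in> D}"
  "a \<odot>\<^bsub>schur l U\<^esub> C = (\<Union>x\<in>C. schur_class l U (pm_scale a x))"
proof -
  let ?F = "free_module (schur_gens l U)" and ?N = "schur_rels l U"
  have "a_rcosets\<^bsub>?F\<^esub> ?N = (\<lambda>p. ?N +>\<^bsub>?F\<^esub> p) ` carrier ?F"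
    unfolding A_RCOSETS_def RCOSETS_def a_r_coset_def by auto
  then show "carrier (schur l U) = schur_class l U ` {p. Poly_Mapping.keys p \<subseteq> schur_gens l U}"
    by (simp add: schur_def quot_module_def vector_module_def schur_class_def)
  show "\<zero>\<^bsub>schur l U\<^esub> = ?N"
    by (simp add: schur_def quot_module_def vector_module_def)
  have "C <+>\<^bsub>?F\<^esub> D = {x + y | x y. x \<in> C \<and> y \<in> D}"
    unfolding set_add_def set_mult_def by auto
  then show "C \<oplus>\<^bsub>schur l U\<^esub> D = {x + y | x y. x \<in> C \<and> y \<in> D}"
    by (simp add: schur_def quot_module_def vector_module_def)
  show "a \<odot>\<^bsub>schur l U\<^esub> C = (\<Union>x\<in>C. schur_class l U (pm_scale a x))"
    by (simp add: schur_def quot_module_def vector_module_def schur_class_def)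
qed

lemma multilinear_cancel:
  fixes x y :: "'r::comm_ring"
  shows "(x + c * y) * r * s - x * r * s - c * (y * r * s) = 0"
    "r * ((x + c * y) * s) - r * (x * s) - c * (r * (y * s)) = 0"
    "(x * y + c * r) * s * t - (x * y * s * t + c * r * s * t) = 0"
  by (simp_all add: algebra_simps)

text \<open>\<open>U\<close> is merely a record, so its vector space laws come by transport along
  the coordinate bijection \<open>\<psi>\<close>, given closure of the carrier and linearity of
  \<open>\<psi>\<close>.\<close>

locale plane =
  fixes U :: "('k::field, 'u) module" and \<psi> :: "'u \<Rightarrow> 'k \<times> 'k"
  assumes bij: "bij_betw \<psi> (carrier U) UNIV"
    and add_closed: "x \<in> carrier U \<Longrightarrow> y \<in> carrier U \<Longrightarrow> x \<oplus>\<^bsub>U\<^esub> y \<in> carrier U"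
    and smult_closed: "x \<in> carrier U \<Longrightarrow> a \<odot>\<^bsub>U\<^esub> x \<in> carrier U"
    and \<psi>_add: "x \<in> carrier U \<Longrightarrow> y \<in> carrier U \<Longrightarrow> \<psi> (x \<oplus>\<^bsub>U\<^esub> y) = \<psi> x + \<psi> y"
    and \<psi>_smult: "x \<in> carrier U \<Longrightarrow> \<psi> (a \<odot>\<^bsub>U\<^esub> x) = (a * fst (\<psi> x), a * snd (\<psi> x))"
begin

lemma det2_\<psi>_linear:
  assumes "x \<in> carrier U" "x' \<in> carrier U"
  shows "det2 (\<psi> (x \<oplus>\<^bsub>U\<^esub> a \<odot>\<^bsub>U\<^esub> x')) z = det2 (\<psi> x) z + a * det2 (\<psi> x') z"
    "det2 z (\<psi> (x \<oplus>\<^bsub>U\<^esub> a \<odot>\<^bsub>U\<^esub> x')) = det2 z (\<psi> x) + a * det2 z (\<psi> x')"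
    "lin (\<psi> (x \<oplus>\<^bsub>U\<^esub> a \<odot>\<^bsub>U\<^esub> x')) = lin (\<psi> x) + [:a:] * lin (\<psi> x')"
  using assms by (simp_all add: \<psi>_add \<psi>_smult smult_closed det2_def lin_def algebra_simps)

text \<open>Cramer's rule: three vectors of a plane satisfy a linear relation with 2 by 2
  determinants as coefficients. This is what exchange relation (E1) becomes in coordinates.\<close>

lemma Pluecker_lin: "[:det2 x y:] * lin z = [:det2 z y:] * lin x + [:det2 x z:] * lin (y :: 'k \<times> 'k)"
  by (simp add: det2_def lin_def algebra_simps)

lemma Pluecker_det2: "det2 x y * det2 z w = det2 z y * det2 x w + det2 x z * det2 y (w :: 'k \<times> 'k)"
  by (simp add: det2_def algebra_simps)

text \<open>The linearity rules hold by multilinearity of determinants and linear forms,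
  \<open>sym\<close> and (E2) because products commute, and the three cases of (E1) are Pluecker
  relations. The untouched factors are split off as a common product each time.\<close>

lemma ev_schur_relators:
  assumes "p \<in> schur_relators l U"
  shows "ev_tensor \<psi> p = 0"
  using assms
proof induction
  case (lin_left xs ys a x x' z c)
  let ?D = "\<lambda>(x, x'). det2 (\<psi> x) (\<psi> x')"
  define R where "R = (\<Prod>i\<in>{..<length xs} - {a}. ?D (xs ! i))"
  have X: "prod_list (map ?D (xs[a := w])) = ?D w * R" for w
    unfolding R_def by (rule prod_list_map_update) fact
  show ?case
    unfolding ev_tensor_diff ev_tensor_scale ev_tensor_gen ev_word_def fst_conv snd_conv X prod.case
      det2_\<psi>_linear(1)[OF lin_left(3,4)] const_poly_simps
    by (rule multilinear_cancel)
next
  case (lin_right xs ys a x x' z c)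
  let ?D = "\<lambda>(x, x'). det2 (\<psi> x) (\<psi> x')"
  define R where "R = (\<Prod>i\<in>{..<length xs} - {a}. ?D (xs ! i))"
  have X: "prod_list (map ?D (xs[a := w])) = ?D w * R" for w
    unfolding R_def by (rule prod_list_map_update) fact
  show ?case
    unfolding ev_tensor_diff ev_tensor_scale ev_tensor_gen ev_word_def fst_conv snd_conv X prod.case
      det2_\<psi>_linear(2)[OF lin_right(3,4)] const_poly_simps
    by (rule multilinear_cancel)
next
  case (alt xs ys a x)
  then show ?case
    by (simp add: ev_word_def prod_list_map_update det2_def mult.commute)
next
  case (lin_sym xs ys k y y' c)
  define S where "S = (\<Prod>i\<in>{..<length ys} - {k}. (lin \<circ> \<psi>) (ys ! i))"
  have Y: "prod_list (map (lin \<circ> \<psi>) (ys[k := y])) = (lin \<circ> \<psi>) y * S" for y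
    unfolding S_def by (rule prod_list_map_update) fact
  show ?case
    unfolding ev_tensor_diff ev_tensor_scale ev_tensor_gen ev_word_def fst_conv snd_conv map_map Y o_apply
      det2_\<psi>_linear(3)[OF lin_sym(3,4)]
    by (rule multilinear_cancel)
next
  case (sym xs ys ys')
  have "prod_list (map lin (map \<psi> ys)) = prod_list (map lin (map \<psi> ys'))"
    unfolding map_map by (rule prod_list_map_mset_cong) (rule sym(2)[symmetric])
  then show ?case
    by (simp add: ev_tensor_diff ev_word_def)
next
  case (E1_sym xs ys a x\<^sub>1 x\<^sub>2 k)
  let ?D = "\<lambda>(x, x'). det2 (\<psi> x) (\<psi> x')" and ?L = "\<lambda>y. lin (\<psi> y)"
  define R where "R = (\<Prod>i\<in>{..<length xs} - {a}. ?D (xs ! i))"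
  define S where "S = (\<Prod>i\<in>{..<length ys} - {k}. ?L (ys ! i))"
  have X: "prod_list (map ?D (xs[a := w])) = ?D w * R" for w
    unfolding R_def by (rule prod_list_map_update) fact
  have Y: "prod_list (map ?L (ys[k := y])) = ?L y * S" for y
    unfolding S_def by (rule prod_list_map_update) fact
  have "xs = xs[a := (x\<^sub>1, x\<^sub>2)]" "ys = ys[k := ys ! k]"
    using E1_sym(3) by (simp_all flip: E1_sym(3))
  then have X0: "prod_list (map ?D xs) = det2 (\<psi> x\<^sub>1) (\<psi> x\<^sub>2) * R" and Y0: "prod_list (map ?L ys) = ?L (ys ! k) * S"
    using X[of "(x\<^sub>1, x\<^sub>2)"] Y[of "ys ! k"] by simp_all
  have ev: "ev_word \<psi> (as, bs) = [:prod_list (map ?D as):] * prod_list (map ?L bs)" for as bs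
    by (simp add: ev_word_def o_def)
  have "[:det2 (\<psi> x\<^sub>1) (\<psi> x\<^sub>2) * R:] * (?L (ys ! k) * S) = [:R:] * S * ([:det2 (\<psi> x\<^sub>1) (\<psi> x\<^sub>2):] * ?L (ys ! k))"
    unfolding const_poly_simps by (simp only: mult_ac)
  also have "\<dots> = [:det2 (\<psi> (ys ! k)) (\<psi> x\<^sub>2) * R:] * (?L x\<^sub>1 * S) + [:det2 (\<psi> x\<^sub>1) (\<psi> (ys ! k)) * R:] * (?L x\<^sub>2 * S)"
    unfolding Pluecker_lin[of "\<psi> x\<^sub>1" "\<psi> x\<^sub>2" "\<psi> (ys ! k)"] const_poly_simps by (simp only: algebra_simps)
  finally show ?case
    unfolding ev_tensor_diff ev_tensor_add ev_tensor_gen ev X Y X0 Y0 by simp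
next
  case (E1_left xs ys a b x\<^sub>1 x\<^sub>2 z\<^sub>1 z\<^sub>2)
  let ?D = "\<lambda>(x, x'). det2 (\<psi> x) (\<psi> x')"
  define R where "R = (\<Prod>i\<in>{..<length xs} - {a, b}. ?D (xs ! i))"
  have X: "prod_list (map ?D (xs[a := w, b := w'])) = ?D w * ?D w' * R" for w w'
    unfolding R_def by (rule prod_list_map_update2) (use E1_left in simp_all)
  have "xs = xs[a := (x\<^sub>1, x\<^sub>2), b := (z\<^sub>1, z\<^sub>2)]"
    by (simp flip: E1_left(4,5))
  then have X0: "prod_list (map ?D xs) = det2 (\<psi> x\<^sub>1) (\<psi> x\<^sub>2) * det2 (\<psi> z\<^sub>1) (\<psi> z\<^sub>2) * R"
    using X[of "(x\<^sub>1, x\<^sub>2)" "(z\<^sub>1, z\<^sub>2)"] by simp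
  show ?case
    unfolding ev_tensor_diff ev_tensor_add ev_tensor_gen ev_word_def fst_conv snd_conv X X0 prod.case
      Pluecker_det2[of "\<psi> x\<^sub>1" "\<psi> x\<^sub>2" "\<psi> z\<^sub>1" "\<psi> z\<^sub>2"] const_poly_simps
    by (rule multilinear_cancel)
next
  case (E1_right xs ys a b x\<^sub>1 x\<^sub>2 z\<^sub>1 z\<^sub>2)
  let ?D = "\<lambda>(x, x'). det2 (\<psi> x) (\<psi> x')"
  define R where "R = (\<Prod>i\<in>{..<length xs} - {a, b}. ?D (xs ! i))"
  have X: "prod_list (map ?D (xs[a := w, b := w'])) = ?D w * ?D w' * R" for w w'
    unfolding R_def by (rule prod_list_map_update2) (use E1_right in simp_all)
  have "xs = xs[a := (x\<^sub>1, x\<^sub>2), b := (z\<^sub>1, z\<^sub>2)]"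
    by (simp flip: E1_right(4,5))
  then have X0: "prod_list (map ?D xs) = det2 (\<psi> x\<^sub>1) (\<psi> x\<^sub>2) * det2 (\<psi> z\<^sub>1) (\<psi> z\<^sub>2) * R"
    using X[of "(x\<^sub>1, x\<^sub>2)" "(z\<^sub>1, z\<^sub>2)"] by simp
  \<comment> \<open>The Pluecker relation for moving \<open>z\<^sub>2\<close>, with the sign of
    every second determinant reversed so that \<open>z\<^sub>1\<close> keeps its place.\<close>
  have P: "det2 (\<psi> x\<^sub>1) (\<psi> x\<^sub>2) * det2 (\<psi> z\<^sub>1) (\<psi> z\<^sub>2)
      = det2 (\<psi> z\<^sub>2) (\<psi> x\<^sub>2) * det2 (\<psi> z\<^sub>1) (\<psi> x\<^sub>1) + det2 (\<psi> x\<^sub>1) (\<psi> z\<^sub>2) * det2 (\<psi> z\<^sub>1) (\<psi> x\<^sub>2)"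
    by (simp add: det2_def algebra_simps)
  show ?case
    unfolding ev_tensor_diff ev_tensor_add ev_tensor_gen ev_word_def fst_conv snd_conv X X0 prod.case P
        const_poly_simps
    by (rule multilinear_cancel)
next
  case (E2 xs ys a b)
  have "mset (xs[a := xs ! b, b := xs ! a]) = mset xs"
    using mset_swap[of b xs a] E2 by simp
  then have "prod_list (map f (xs[a := xs ! b, b := xs ! a])) = prod_list (map f xs)" for f :: "'u \<times> 'u \<Rightarrow> 'k"
    by (rule prod_list_map_mset_cong)
  then show ?case
    by (simp add: ev_tensor_diff ev_word_def)
qed

lemma ev_schur_rels:
  assumes "p \<in> schur_rels l U"
  shows "ev_tensor \<psi> p = 0"
proof -
  have "p \<in> pm.span (schur_relators l U)"
    using assms by (simp only: schur_rels_def)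
  then show ?thesis
  proof (rule pm.span_induct_alt[where h = "\<lambda>p. ev_tensor \<psi> p = 0"])
    fix a x y
    assume "x \<in> schur_relators l U" "ev_tensor \<psi> y = 0"
    then show "ev_tensor \<psi> (pm_scale a x + y) = 0"
      by (simp add: ev_tensor_add ev_tensor_scale ev_schur_relators)
  qed simp
qed

section \<open>Normal forms modulo the relations\<close>

definition \<psi>_inv :: "'k \<times> 'k \<Rightarrow> 'u"
  where "\<psi>_inv = the_inv_into (carrier U) \<psi>"

lemma \<psi>_inv [simp]: "\<psi>_inv y \<in> carrier U" "\<psi> (\<psi>_inv y) = y" "x \<in> carrier U \<Longrightarrow> \<psi>_inv (\<psi> x) = x"
  unfolding \<psi>_inv_def
  using bij_betw_the_inv_into[OF bij] f_the_inv_into_f_bij_betw[OF bij]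
      the_inv_into_f_f[OF bij_betw_imp_inj_on[OF bij]]
  by (simp_all add: bij_betw_apply)

definition eqv :: "nat \<times> nat \<Rightarrow> ('u word_tensor \<Rightarrow>\<^sub>0 'k) \<Rightarrow> ('u word_tensor \<Rightarrow>\<^sub>0 'k) \<Rightarrow> bool"
  where "eqv l p q \<longleftrightarrow> p - q \<in> schur_rels l U"

lemma eqv_refl [simp]: "eqv l p p"
  by (simp add: eqv_def schur_rels_def pm.span_zero)

lemma eqv_sym: "eqv l p q \<Longrightarrow> eqv l q p"
  unfolding eqv_def schur_rels_def using pm.span_neg[of "p - q"] by simp

lemma eqv_trans [trans]: "eqv l p q \<Longrightarrow> eqv l q r \<Longrightarrow> eqv l p r"
  unfolding eqv_def schur_rels_def using pm.span_add[of "p - q" _ "q - r"] by simp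

lemma eqv_add: "eqv l p q \<Longrightarrow> eqv l p' q' \<Longrightarrow> eqv l (p + p') (q + q')"
  unfolding eqv_def schur_rels_def add_diff_add by (rule pm.span_add)

lemma eqv_scale: "eqv l p q \<Longrightarrow> eqv l (pm_scale a p) (pm_scale a q)"
  unfolding eqv_def schur_rels_def pm.scale_right_diff_distrib[symmetric] by (rule pm.span_scale)

lemma eqv_sum: "(\<And>i. i \<in> I \<Longrightarrow> eqv l (f i) (g i)) \<Longrightarrow> eqv l (sum f I) (sum g I)"
  by (induction I rule: infinite_finite_induct) (auto intro: eqv_add)

lemma eqv_relator: "p - q \<in> schur_relators l U \<Longrightarrow> eqv l p q"
  unfolding eqv_def schur_rels_def by (rule pm.span_base)

lemma eqv_lin_left:
  "(xs, ys) \<in> schur_gens l U \<Longrightarrow> a < length xs \<Longrightarrow> x \<in> carrier U \<Longrightarrow> x' \<in> carrier U \<Longrightarrow> z \<in> carrier U \<Longrightarrow>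
    eqv l (gen (xs[a := (x \<oplus>\<^bsub>U\<^esub> c \<odot>\<^bsub>U\<^esub> x', z)]) ys) (gen (xs[a := (x, z)]) ys
        + pm_scale c (gen (xs[a := (x', z)]) ys))"
  by (rule eqv_relator) (simp only: diff_diff_eq[symmetric] schur_relators.lin_left)

lemma eqv_lin_right:
  "(xs, ys) \<in> schur_gens l U \<Longrightarrow> a < length xs \<Longrightarrow> x \<in> carrier U \<Longrightarrow> x' \<in> carrier U \<Longrightarrow> z \<in> carrier U \<Longrightarrow>
    eqv l (gen (xs[a := (z, x \<oplus>\<^bsub>U\<^esub> c \<odot>\<^bsub>U\<^esub> x')]) ys) (gen (xs[a := (z, x)]) ys
        + pm_scale c (gen (xs[a := (z, x')]) ys))"
  by (rule eqv_relator) (simp only: diff_diff_eq[symmetric] schur_relators.lin_right)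

lemma eqv_lin_sym:
  "(xs, ys) \<in> schur_gens l U \<Longrightarrow> k < length ys \<Longrightarrow> y \<in> carrier U \<Longrightarrow> y' \<in> carrier U \<Longrightarrow>
    eqv l (gen xs (ys[k := y \<oplus>\<^bsub>U\<^esub> c \<odot>\<^bsub>U\<^esub> y'])) (gen xs (ys[k := y]) + pm_scale c (gen xs (ys[k := y'])))"
  by (rule eqv_relator) (simp only: diff_diff_eq[symmetric] schur_relators.lin_sym)

abbreviation "e\<^sub>1 \<equiv> \<psi>_inv (1, 0)"
abbreviation "e\<^sub>2 \<equiv> \<psi>_inv (0, 1)"

text \<open>
  The relations only provide \<open>G (x + c x') \<approx> G x + c G x'\<close>, so the expansion of $x$ in the basis is
  written as $(e_1+(x_1-1)e_1)+x_2e_2$.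
\<close>

lemma eqv_expand:
  assumes G: "\<And>x x' c. x \<in> carrier U \<Longrightarrow> x' \<in> carrier U \<Longrightarrow> eqv l (G (x \<oplus>\<^bsub>U\<^esub> c \<odot>\<^bsub>U\<^esub> x')) (G x + pm_scale c (G x'))"
    and x: "x \<in> carrier U"
  shows "eqv l (G x) (pm_scale (fst (\<psi> x)) (G e\<^sub>1) + pm_scale (snd (\<psi> x)) (G e\<^sub>2))"
proof -
  define y where "y = e\<^sub>1 \<oplus>\<^bsub>U\<^esub> (fst (\<psi> x) - 1) \<odot>\<^bsub>U\<^esub> e\<^sub>1"
  have y: "y \<in> carrier U"
    by (simp add: y_def add_closed smult_closed)
  have "\<psi> (y \<oplus>\<^bsub>U\<^esub> snd (\<psi> x) \<odot>\<^bsub>U\<^esub> e\<^sub>2) = \<psi> x"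
    by (simp add: y_def \<psi>_add \<psi>_smult add_closed smult_closed prod_eq_iff)
  then have "y \<oplus>\<^bsub>U\<^esub> snd (\<psi> x) \<odot>\<^bsub>U\<^esub> e\<^sub>2 = x"
    by (rule inj_onD[OF bij_betw_imp_inj_on[OF bij]]) (simp_all add: x y add_closed smult_closed)
  then have "eqv l (G x) (G y + pm_scale (snd (\<psi> x)) (G e\<^sub>2))"
    using G[OF y \<psi>_inv(1), of "snd (\<psi> x)" "(0, 1)"] by simp
  also have "eqv l \<dots> (G e\<^sub>1 + pm_scale (fst (\<psi> x) - 1) (G e\<^sub>1) + pm_scale (snd (\<psi> x)) (G e\<^sub>2))"
    unfolding y_def by (intro eqv_add G eqv_refl \<psi>_inv)
  also have "G e\<^sub>1 + pm_scale (fst (\<psi> x) - 1) (G e\<^sub>1) = pm_scale (fst (\<psi> x)) (G e\<^sub>1)"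
    by (simp add: pm.scale_left_diff_distrib)
  finally show ?thesis .
qed

lemma schur_gens_update:
  assumes "(xs, ys) \<in> schur_gens l U" "x \<in> carrier U" "z \<in> carrier U"
  shows "(xs[a := (x, z)], ys) \<in> schur_gens l U"
proof -
  have "set (xs[a := (x, z)]) \<subseteq> carrier U \<times> carrier U"
    by (rule order.trans[OF set_update_subset_insert]) (use assms in \<open>simp add: schur_gens_def\<close>)
  then show ?thesis
    using assms(1) by (simp add: schur_gens_def)
qed

text \<open>The exterior square of a plane is spanned by one element: both entries are expanded in
  the basis, the diagonal terms vanish by alternation, and the two mixed terms combine to the
  determinant.\<close>

lemma eqv_wedge_factor:
  assumes g: "(xs, ys) \<in> schur_gens l U" and a: "a < length xs" and xs_a: "xs ! a = (x, z)"
  shows "eqv l (gen xs ys) (pm_scale (det2 (\<psi> x) (\<psi> z)) (gen (xs[a := (e\<^sub>1, e\<^sub>2)]) ys))"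
proof -
  define H where "H x z = (gen (xs[a := (x, z)]) ys :: 'u word_tensor \<Rightarrow>\<^sub>0 'k)" for x z
  have "(x, z) \<in> set xs"
    using a xs_a by (metis nth_mem)
  then have x: "x \<in> carrier U" and z: "z \<in> carrier U"
    using g by (auto simp: schur_gens_def)
  have left: "eqv l (H x z) (pm_scale (fst (\<psi> x)) (H e\<^sub>1 z) + pm_scale (snd (\<psi> x)) (H e\<^sub>2 z))"
    if "x \<in> carrier U" "z \<in> carrier U" for x z
    unfolding H_def by (rule eqv_expand[of l "\<lambda>x. gen (xs[a := (x, z)]) ys"])
        (rule eqv_lin_left that g a | assumption)+
  have right: "eqv l (H x z) (pm_scale (fst (\<psi> z)) (H x e\<^sub>1) + pm_scale (snd (\<psi> z)) (H x e\<^sub>2))"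
    if "x \<in> carrier U" "z \<in> carrier U" for x z
    unfolding H_def by (rule eqv_expand[of l "\<lambda>z. gen (xs[a := (x, z)]) ys"])
        (rule eqv_lin_right that g a | assumption)+
  have alt: "eqv l (H x x) 0" if "x \<in> carrier U" for x
    unfolding H_def by (rule eqv_relator) (simp add: schur_relators.alt[OF g a that])
  have four: "eqv l (H x z)
      (pm_scale (fst (\<psi> x) * fst (\<psi> z)) (H e\<^sub>1 e\<^sub>1) + pm_scale (fst (\<psi> x) * snd (\<psi> z)) (H e\<^sub>1 e\<^sub>2)
      + (pm_scale (snd (\<psi> x) * fst (\<psi> z)) (H e\<^sub>2 e\<^sub>1) + pm_scale (snd (\<psi> x) * snd (\<psi> z)) (H e\<^sub>2 e\<^sub>2)))"
    if "x \<in> carrier U" "z \<in> carrier U" for x z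
  proof (rule eqv_trans[OF left[OF that]])
    have "eqv l (pm_scale (fst (\<psi> x)) (H e\<^sub>1 z) + pm_scale (snd (\<psi> x)) (H e\<^sub>2 z))
      (pm_scale (fst (\<psi> x)) (pm_scale (fst (\<psi> z)) (H e\<^sub>1 e\<^sub>1) + pm_scale (snd (\<psi> z)) (H e\<^sub>1 e\<^sub>2))
        + pm_scale (snd (\<psi> x)) (pm_scale (fst (\<psi> z)) (H e\<^sub>2 e\<^sub>1) + pm_scale (snd (\<psi> z)) (H e\<^sub>2 e\<^sub>2)))"
      by (intro eqv_add eqv_scale right that \<psi>_inv)
    then show "eqv l (pm_scale (fst (\<psi> x)) (H e\<^sub>1 z) + pm_scale (snd (\<psi> x)) (H e\<^sub>2 z))
      (pm_scale (fst (\<psi> x) * fst (\<psi> z)) (H e\<^sub>1 e\<^sub>1) + pm_scale (fst (\<psi> x) * snd (\<psi> z)) (H e\<^sub>1 e\<^sub>2)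
      + (pm_scale (snd (\<psi> x) * fst (\<psi> z)) (H e\<^sub>2 e\<^sub>1) + pm_scale (snd (\<psi> x) * snd (\<psi> z)) (H e\<^sub>2 e\<^sub>2)))"
      by (simp add: pm.scale_right_distrib)
  qed
  have three: "eqv l (H x z) (pm_scale (fst (\<psi> x) * snd (\<psi> z)) (H e\<^sub>1 e\<^sub>2)
      + pm_scale (snd (\<psi> x) * fst (\<psi> z)) (H e\<^sub>2 e\<^sub>1))"
    if "x \<in> carrier U" "z \<in> carrier U" for x z
  proof (rule eqv_trans[OF four[OF that]])
    have "eqv l (pm_scale (fst (\<psi> x) * fst (\<psi> z)) (H e\<^sub>1 e\<^sub>1) + pm_scale (fst (\<psi> x) * snd (\<psi> z)) (H e\<^sub>1 e\<^sub>2)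
        + (pm_scale (snd (\<psi> x) * fst (\<psi> z)) (H e\<^sub>2 e\<^sub>1) + pm_scale (snd (\<psi> x) * snd (\<psi> z)) (H e\<^sub>2 e\<^sub>2)))
      (pm_scale (fst (\<psi> x) * fst (\<psi> z)) 0 + pm_scale (fst (\<psi> x) * snd (\<psi> z)) (H e\<^sub>1 e\<^sub>2)
        + (pm_scale (snd (\<psi> x) * fst (\<psi> z)) (H e\<^sub>2 e\<^sub>1) + pm_scale (snd (\<psi> x) * snd (\<psi> z)) 0))"
      by (intro eqv_add eqv_scale eqv_refl alt \<psi>_inv)
    then show "eqv l (pm_scale (fst (\<psi> x) * fst (\<psi> z)) (H e\<^sub>1 e\<^sub>1) + pm_scale (fst (\<psi> x) * snd (\<psi> z)) (H e\<^sub>1 e\<^sub>2)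
        + (pm_scale (snd (\<psi> x) * fst (\<psi> z)) (H e\<^sub>2 e\<^sub>1) + pm_scale (snd (\<psi> x) * snd (\<psi> z)) (H e\<^sub>2 e\<^sub>2)))
      (pm_scale (fst (\<psi> x) * snd (\<psi> z)) (H e\<^sub>1 e\<^sub>2) + pm_scale (snd (\<psi> x) * fst (\<psi> z)) (H e\<^sub>2 e\<^sub>1))"
      by simp
  qed
  \<comment> \<open>Antisymmetry is obtained by polarisation, from alternation at the vector with
    coordinates (1, 1).\<close>
  have "eqv l (H e\<^sub>1 e\<^sub>2 + H e\<^sub>2 e\<^sub>1) 0"
    using eqv_trans[OF eqv_sym[OF three[OF \<psi>_inv(1)[of "(1, 1)"] \<psi>_inv(1)[of "(1, 1)"]]] alt[OF \<psi>_inv(1)]] by simp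
  then have anti: "eqv l (H e\<^sub>2 e\<^sub>1) (pm_scale (- 1) (H e\<^sub>1 e\<^sub>2))"
    by (simp add: eqv_def add.commute)
  have "eqv l (H x z) (pm_scale (fst (\<psi> x) * snd (\<psi> z)) (H e\<^sub>1 e\<^sub>2)
      + pm_scale (snd (\<psi> x) * fst (\<psi> z)) (pm_scale (- 1) (H e\<^sub>1 e\<^sub>2)))"
    by (rule eqv_trans[OF three[OF x z]]) (intro eqv_add eqv_scale eqv_refl anti)
  also have "pm_scale (fst (\<psi> x) * snd (\<psi> z)) (H e\<^sub>1 e\<^sub>2)
      + pm_scale (snd (\<psi> x) * fst (\<psi> z)) (pm_scale (- 1) (H e\<^sub>1 e\<^sub>2))
      = pm_scale (det2 (\<psi> x) (\<psi> z)) (H e\<^sub>1 e\<^sub>2)"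
    by (simp add: det2_def pm.scale_left_diff_distrib)
  finally show ?thesis
    by (simp add: H_def flip: xs_a)
qed

lemma eqv_wedge_factors:
  assumes g: "(xs, ys) \<in> schur_gens l U"
  shows "eqv l (gen xs ys)
    (pm_scale (prod_list (map (\<lambda>(x, x'). det2 (\<psi> x) (\<psi> x')) xs)) (gen (replicate (length xs) (e\<^sub>1, e\<^sub>2)) ys))"
proof -
  let ?D = "\<lambda>(x, x'). det2 (\<psi> x) (\<psi> x')"
  have "(replicate k (e\<^sub>1, e\<^sub>2) @ drop k xs, ys) \<in> schur_gens l U \<and>
    eqv l (gen xs ys) (pm_scale (prod_list (map ?D (take k xs))) (gen (replicate k (e\<^sub>1, e\<^sub>2) @ drop k xs) ys))"
    if "k \<le> length xs" for k
    using that
  proof (induction k)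
    case 0
    then show ?case
      using g by simp
  next
    case (Suc k)
    obtain x z where xz: "xs ! k = (x, z)"
      by fastforce
    let ?zs = "replicate k (e\<^sub>1, e\<^sub>2) @ drop k xs"
    from Suc have IH: "(?zs, ys) \<in> schur_gens l U"
        "eqv l (gen xs ys) (pm_scale (prod_list (map ?D (take k xs))) (gen ?zs ys))" and k: "k < length xs"
      by simp_all
    have nth: "?zs ! k = (x, z)"
      using k xz by (simp add: nth_append)
    have upd: "?zs[k := (e\<^sub>1, e\<^sub>2)] = replicate (Suc k) (e\<^sub>1, e\<^sub>2) @ drop (Suc k) xs"
      using k by (simp add: list_update_append replicate_append_same flip: Cons_nth_drop_Suc)
    have "eqv l (gen ?zs ys) (pm_scale (det2 (\<psi> x) (\<psi> z)) (gen (?zs[k := (e\<^sub>1, e\<^sub>2)]) ys))"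
      by (rule eqv_wedge_factor[OF IH(1) _ nth]) (use k in simp)
    from eqv_trans[OF IH(2) eqv_scale[OF this]] show ?case
      using schur_gens_update[OF IH(1), of e\<^sub>1 e\<^sub>2 k] k xz unfolding upd
      by (simp add: take_Suc_conv_app_nth mult_ac)
  qed
  from this[of "length xs"] show ?thesis
    by simp
qed

text \<open>Induction over the part \<open>zs\<close> that is not yet expanded: its first vector is
  written in the basis, and commutativity moves each basis vector into its block. The first basis
  vector leaves the exponent of Y alone and the second raises it, which is multiplication by the
  linear form of the vector.\<close>

lemma eqv_sym_factors:
  assumes "(xs, replicate i e\<^sub>1 @ replicate j e\<^sub>2 @ zs) \<in> schur_gens l U"
    and "m = i + j + length zs"
  shows "eqv l (gen xs (replicate i e\<^sub>1 @ replicate j e\<^sub>2 @ zs))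
    (\<Sum>k\<le>m. pm_scale (poly.coeff ([:0, 1:] ^ j * prod_list (map lin (map \<psi> zs))) k)
      (gen xs (replicate (m - k) e\<^sub>1 @ replicate k e\<^sub>2)))"
  using assms
proof (induction zs arbitrary: i j m)
  case Nil
  have X: "[:0, 1:] ^ j = (monom 1 j :: 'k poly)"
    by (simp add: monom_altdef)
  have "(\<Sum>k\<le>i + j. pm_scale (poly.coeff (monom (1::'k) j) k) (gen xs (replicate (i + j - k) e\<^sub>1 @ replicate k e\<^sub>2)))
      = (\<Sum>k\<in>{j}. pm_scale (poly.coeff (monom (1::'k) j) k) (gen xs (replicate (i + j - k) e\<^sub>1 @ replicate k e\<^sub>2)))"
    by (rule sum.mono_neutral_right) auto
  also have "\<dots> = gen xs (replicate i e\<^sub>1 @ replicate j e\<^sub>2)"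
    by simp
  finally show ?case
    by (simp add: Nil(2) X)
next
  case (Cons z zs)
  let ?ys = "replicate i e\<^sub>1 @ replicate j e\<^sub>2 @ z # zs"
  define B where "B k = (gen xs (replicate (Suc (i + j + length zs) - k) e\<^sub>1
      @ replicate k e\<^sub>2) :: 'u word_tensor \<Rightarrow>\<^sub>0 'k)" for k
  define G where "G y = (gen xs (replicate i e\<^sub>1 @ replicate j e\<^sub>2 @ y # zs) :: 'u word_tensor \<Rightarrow>\<^sub>0 'k)" for y
  let ?P = "prod_list (map lin (map \<psi> zs))"
  have z: "z \<in> carrier U"
    using Cons.prems(1) by (simp add: schur_gens_def)
  have gens: "(xs, ys) \<in> schur_gens l U" if "length ys = length ?ys"
      "set ys \<subseteq> insert e\<^sub>1 (insert e\<^sub>2 (set ?ys))" for ys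
  proof -
    have "set ?ys \<subseteq> carrier U"
      using Cons.prems(1) by (simp add: schur_gens_def)
    then have "set ys \<subseteq> carrier U"
      using that(2) \<psi>_inv(1) by blast
    then show ?thesis
      using Cons.prems(1) that(1) by (simp add: schur_gens_def)
  qed
  have G_upd: "gen xs (?ys[i + j := y]) = G y" for y
    by (simp add: G_def list_update_append)
  have "eqv l (G (x \<oplus>\<^bsub>U\<^esub> c \<odot>\<^bsub>U\<^esub> x')) (G x + pm_scale c (G x'))" if "x \<in> carrier U" "x' \<in> carrier U" for x x' c
    using eqv_lin_sym[OF Cons.prems(1) _ that, of "i + j" c] unfolding G_upd by simp
  from eqv_expand[of l G, OF this z]
  have "eqv l (G z) (pm_scale (fst (\<psi> z)) (G e\<^sub>1) + pm_scale (snd (\<psi> z)) (G e\<^sub>2))" .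
  also have "eqv l \<dots> (pm_scale (fst (\<psi> z))
      (\<Sum>k\<le>Suc (i + j + length zs). pm_scale (poly.coeff ([:0, 1:] ^ j * ?P) k) (B k))
      + pm_scale (snd (\<psi> z)) (\<Sum>k\<le>Suc (i + j + length zs). pm_scale (poly.coeff ([:0, 1:] ^ Suc j * ?P) k) (B k)))"
  proof (intro eqv_add eqv_scale)
    have "(xs, replicate (Suc i) e\<^sub>1 @ replicate j e\<^sub>2 @ zs) \<in> schur_gens l U"
      by (rule gens) auto
    from Cons.IH[OF this refl]
    have 1: "eqv l (gen xs (replicate (Suc i) e\<^sub>1 @ replicate j e\<^sub>2 @ zs))
        (\<Sum>k\<le>Suc (i + j + length zs). pm_scale (poly.coeff ([:0, 1:] ^ j * ?P) k) (B k))"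
      by (simp only: B_def add_Suc)
    have "gen xs (replicate i e\<^sub>1 @ replicate j e\<^sub>2 @ e\<^sub>1 # zs)
        - gen xs (replicate (Suc i) e\<^sub>1 @ replicate j e\<^sub>2 @ zs) \<in> schur_relators l U"
      by (rule schur_relators.sym) (auto intro: gens)
    from eqv_trans[OF eqv_relator[OF this] 1]
    show "eqv l (G e\<^sub>1) (\<Sum>k\<le>Suc (i + j + length zs). pm_scale (poly.coeff ([:0, 1:] ^ j * ?P) k) (B k))"
      unfolding G_def .
    have "(xs, replicate i e\<^sub>1 @ replicate (Suc j) e\<^sub>2 @ zs) \<in> schur_gens l U"
      by (rule gens) auto
    from Cons.IH[OF this refl]
    have 2: "eqv l (gen xs (replicate i e\<^sub>1 @ replicate (Suc j) e\<^sub>2 @ zs))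
        (\<Sum>k\<le>Suc (i + j + length zs). pm_scale (poly.coeff ([:0, 1:] ^ Suc j * ?P) k) (B k))"
      by (simp only: B_def add_Suc add_Suc_right)
    have "gen xs (replicate i e\<^sub>1 @ replicate j e\<^sub>2 @ e\<^sub>2 # zs)
        - gen xs (replicate i e\<^sub>1 @ replicate (Suc j) e\<^sub>2 @ zs) \<in> schur_relators l U"
      by (rule schur_relators.sym) (auto intro: gens)
    from eqv_trans[OF eqv_relator[OF this] 2]
    show "eqv l (G e\<^sub>2) (\<Sum>k\<le>Suc (i + j + length zs). pm_scale (poly.coeff ([:0, 1:] ^ Suc j * ?P) k) (B k))"
      unfolding G_def .
  qed
  also have "pm_scale (fst (\<psi> z)) (\<Sum>k\<le>Suc (i + j + length zs). pm_scale (poly.coeff ([:0, 1:] ^ j * ?P) k) (B k))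
      + pm_scale (snd (\<psi> z)) (\<Sum>k\<le>Suc (i + j + length zs). pm_scale (poly.coeff ([:0, 1:] ^ Suc j * ?P) k) (B k))
      = (\<Sum>k\<le>Suc (i + j + length zs). pm_scale
          (poly.coeff ([:0, 1:] ^ j * prod_list (map lin (map \<psi> (z # zs)))) k) (B k))"
  proof -
    have "lin (\<psi> z) = [:fst (\<psi> z):] + [:snd (\<psi> z):] * [:0, 1:]"
      by (simp add: lin_def)
    then have "[:0, 1:] ^ j * prod_list (map lin (map \<psi> (z # zs))) = [:fst (\<psi> z):] * ([:0, 1:] ^ j * ?P)
        + [:snd (\<psi> z):] * ([:0, 1:] ^ Suc j * ?P)"
      by (simp only: list.map prod_list.Cons power_Suc algebra_simps)
    then have "poly.coeff ([:0, 1:] ^ j * prod_list (map lin (map \<psi> (z # zs)))) k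
        = fst (\<psi> z) * poly.coeff ([:0, 1:] ^ j * ?P) k + snd (\<psi> z) * poly.coeff ([:0, 1:] ^ Suc j * ?P) k" for k
      by (simp del: power_Suc)
    then show ?thesis
      by (simp only: pm.scale_sum_right pm.scale_scale pm.scale_left_distrib sum.distrib)
  qed
  finally show ?case
    unfolding Cons.prems(2) B_def G_def by simp
qed

text \<open>The tensor whose form is the monomial with exponent k in Y. Combining these makes
  \<open>of_form\<close> a section of the evaluation.\<close>

definition schur_basis :: "nat \<times> nat \<Rightarrow> nat \<Rightarrow> ('u word_tensor \<Rightarrow>\<^sub>0 'k)"
  where "schur_basis l k = gen (replicate (snd l) (e\<^sub>1, e\<^sub>2)) (replicate (fst l - snd l - k) e\<^sub>1 @ replicate k e\<^sub>2)"

definition of_form :: "nat \<times> nat \<Rightarrow> 'k poly \<Rightarrow> ('u word_tensor \<Rightarrow>\<^sub>0 'k)"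
  where "of_form l f = (\<Sum>k\<le>fst l - snd l. pm_scale (poly.coeff f k) (schur_basis l k))"

lemma of_form_linear: "of_form l (f + g) = of_form l f + of_form l g"
    "of_form l ([:a:] * f) = pm_scale a (of_form l f)"
  by (simp_all add: of_form_def pm.scale_left_distrib sum.distrib pm.scale_sum_right)

lemma of_form_0 [simp]: "of_form l 0 = 0"
  by (simp add: of_form_def)

lemma of_form_sum: "of_form l (sum f I) = (\<Sum>i\<in>I. of_form l (f i))"
  by (induction I rule: infinite_finite_induct) (simp_all add: of_form_linear)

lemma eqv_gen:
  assumes g: "t \<in> schur_gens l U"
  shows "eqv l (Poly_Mapping.single t 1) (of_form l (ev_word \<psi> t))"
proof -
  obtain xs ys where t: "t = (xs, ys)"
    by (cases t)
  let ?d = "prod_list (map (\<lambda>(x, x'). det2 (\<psi> x) (\<psi> x')) xs)"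
  have len: "length xs = snd l" "length ys = fst l - snd l" and ys: "set ys \<subseteq> carrier U"
    using g by (simp_all add: t schur_gens_def)
  have g': "(replicate (length xs) (e\<^sub>1, e\<^sub>2), replicate 0 e\<^sub>1 @ replicate 0 e\<^sub>2 @ ys) \<in> schur_gens l U"
    using len ys by (cases xs) (simp_all add: schur_gens_def)
  have "eqv l (gen (replicate (length xs) (e\<^sub>1, e\<^sub>2)) ys) (of_form l (prod_list (map lin (map \<psi> ys))))"
    using eqv_sym_factors[OF g' refl] by (simp add: of_form_def schur_basis_def len)
  from eqv_trans[OF eqv_wedge_factors[OF g[unfolded t]] eqv_scale[OF this]] show ?thesis
    by (simp add: t ev_word_def flip: of_form_linear(2) del: mult_pCons_left)
qed

lemma eqv_of_form:
  assumes "Poly_Mapping.keys p \<subseteq> schur_gens l U"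
  shows "eqv l p (of_form l (ev_tensor \<psi> p))"
proof -
  have "p = (\<Sum>t\<in>Poly_Mapping.keys p. pm_scale (Poly_Mapping.lookup p t) (Poly_Mapping.single t 1))"
  proof (rule poly_mapping_eqI)
    fix s
    have "Poly_Mapping.lookup (\<Sum>t\<in>Poly_Mapping.keys p. pm_scale (Poly_Mapping.lookup p t) (Poly_Mapping.single t 1)) s
        = (\<Sum>t\<in>Poly_Mapping.keys p. if t = s then Poly_Mapping.lookup p t else 0)"
      unfolding lookup_sum by (rule sum.cong) (simp_all add: lookup_single when_def)
    then show "Poly_Mapping.lookup p s
        = Poly_Mapping.lookup (\<Sum>t\<in>Poly_Mapping.keys p. pm_scale (Poly_Mapping.lookup p t)
            (Poly_Mapping.single t 1)) s"
      by (simp add: in_keys_iff)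
  qed
  moreover have "eqv l (\<Sum>t\<in>Poly_Mapping.keys p. pm_scale (Poly_Mapping.lookup p t) (Poly_Mapping.single t 1))
      (of_form l (ev_tensor \<psi> p))"
    unfolding ev_tensor_def of_form_sum of_form_linear(2) using assms
    by (intro eqv_sum eqv_scale eqv_gen) auto
  ultimately show ?thesis
    by simp
qed

text \<open>Evaluation kills relations. Conversely a tensor is congruent to the normal form of its
  evaluation, which is zero here. So the Schur power of a plane embeds into binary forms, and
  \<open>ev_of_form\<close> gives surjectivity in the right degree.\<close>

lemma schur_rels_iff:
  assumes "Poly_Mapping.keys p \<subseteq> schur_gens l U"
  shows "p \<in> schur_rels l U \<longleftrightarrow> ev_tensor \<psi> p = 0"
  using ev_schur_rels[of p l] eqv_of_form[OF assms] by (auto simp: eqv_def)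

lemma keys_subset_intros:
  "Poly_Mapping.keys p \<subseteq> X \<Longrightarrow> Poly_Mapping.keys q \<subseteq> X \<Longrightarrow> Poly_Mapping.keys (p + q) \<subseteq> X"
  "Poly_Mapping.keys p \<subseteq> X \<Longrightarrow> Poly_Mapping.keys r \<subseteq> X \<Longrightarrow> Poly_Mapping.keys (p - r) \<subseteq> X"
  "Poly_Mapping.keys s \<subseteq> X \<Longrightarrow> Poly_Mapping.keys (pm_scale a s) \<subseteq> X"
  "t \<in> X \<Longrightarrow> Poly_Mapping.keys (Poly_Mapping.single t b) \<subseteq> X"
  by (rule order.trans[OF Poly_Mapping.keys_add], blast) (rule order.trans[OF keys_diff], blast,
      rule order.trans[OF keys_pm_scale], assumption, simp)

lemma keys_sum_subset:
  fixes f :: "'i \<Rightarrow> ('t \<Rightarrow>\<^sub>0 'k)"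
  shows "(\<And>i. i \<in> I \<Longrightarrow> Poly_Mapping.keys (f i) \<subseteq> X) \<Longrightarrow> Poly_Mapping.keys (sum f I) \<subseteq> X"
proof (induction I rule: infinite_finite_induct)
  case (insert i I)
  have "Poly_Mapping.keys (f i + sum f I) \<subseteq> X"
    by (rule keys_subset_intros(1)) (simp_all add: insert.IH insert.prems)
  then show ?case
    using insert.hyps by simp
qed simp_all

lemma keys_of_form: "Poly_Mapping.keys (of_form l f) \<subseteq> schur_gens l U"
  unfolding of_form_def
proof (rule keys_sum_subset)
  fix k assume k: "k \<in> {..fst l - snd l}"
  have "set (replicate (snd l) (e\<^sub>1, e\<^sub>2)) \<subseteq> carrier U \<times> carrier U"
    by (simp add: set_replicate_conv_if)
  moreover have "set (replicate (fst l - snd l - k) e\<^sub>1 @ replicate k e\<^sub>2) \<subseteq> carrier U"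
    by (auto simp: set_replicate_conv_if)
  ultimately have "(replicate (snd l) (e\<^sub>1, e\<^sub>2), replicate (fst l - snd l - k) e\<^sub>1 @ replicate k e\<^sub>2)
      \<in> schur_gens l U"
    using k by (simp add: schur_gens_def)
  then show "Poly_Mapping.keys (pm_scale (poly.coeff f k) (schur_basis l k)) \<subseteq> schur_gens l U"
    using keys_pm_scale[of "poly.coeff f k" "schur_basis l k"] by (auto simp: schur_basis_def)
qed

lemma ev_of_form:
  assumes "degree f \<le> fst l - snd l"
  shows "ev_tensor \<psi> (of_form l f) = f"
proof -
  have "prod_list (replicate n (1::'k)) = 1" for n
    by (induction n) simp_all
  then have "ev_tensor \<psi> (schur_basis l k) = [:0, 1:] ^ k" for k
    by (simp add: schur_basis_def ev_word_def det2_def lin_unit pCons_one map_replicate_const)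
  then show ?thesis
    unfolding of_form_def ev_tensor_sum ev_tensor_scale using poly_eq_sum_powers[OF assms] by simp
qed

lemma degree_ev_tensor:
  assumes "Poly_Mapping.keys p \<subseteq> schur_gens l U"
  shows "degree (ev_tensor \<psi> p) \<le> fst l - snd l"
  unfolding ev_tensor_def
proof (rule degree_sum_le)
  fix t assume "t \<in> Poly_Mapping.keys p"
  then have "length (snd t) = fst l - snd l"
    using assms by (auto simp: schur_gens_def)
  then have "degree (prod_list (map lin (map \<psi> (snd t)))) \<le> fst l - snd l"
    using degree_prod_list_lin[of "map \<psi> (snd t)"] by simp
  then have "degree ([:a:] * ([:b:] * prod_list (map lin (map \<psi> (snd t))))) \<le> fst l - snd l" for a b
    using degree_mult_le[of "[:a:]" "[:b:] * prod_list (map lin (map \<psi> (snd t)))"]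
      degree_mult_le[of "[:b:]" "prod_list (map lin (map \<psi> (snd t)))"]
    by (simp del: mult_pCons_left)
  then show "degree ([:Poly_Mapping.lookup p t:] * ev_word \<psi> t) \<le> fst l - snd l"
    unfolding ev_word_def .
qed simp

section \<open>The vector space structure transported to forms\<close>

lemma in_schur_class: "p \<in> schur_class l U p"
proof -
  have "0 \<in> schur_rels l U"
    unfolding schur_rels_def by (rule pm.span_zero)
  then show ?thesis
    unfolding schur_class_eq by force
qed

lemma schur_class_eq_iff:
  assumes "Poly_Mapping.keys p \<subseteq> schur_gens l U" "Poly_Mapping.keys q \<subseteq> schur_gens l U"
  shows "schur_class l U p = schur_class l U q \<longleftrightarrow> ev_tensor \<psi> p = ev_tensor \<psi> q"
proof -
  have keys: "Poly_Mapping.keys (p - q) \<subseteq> schur_gens l U"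
    using keys_diff[of p q] assms by blast
  have "schur_class l U p = schur_class l U q \<longleftrightarrow> p - q \<in> schur_rels l U"
  proof
    assume "schur_class l U p = schur_class l U q"
    moreover have "p \<in> schur_class l U p"
      by (rule in_schur_class)
    ultimately obtain h where "h \<in> schur_rels l U" "p = h + q"
      by (auto simp: schur_class_eq)
    then show "p - q \<in> schur_rels l U"
      by simp
  next
    assume pq: "p - q \<in> schur_rels l U"
    have "schur_class l U p \<subseteq> schur_class l U q" if "p - q \<in> schur_rels l U" for p q
    proof
      fix x assume "x \<in> schur_class l U p"
      then obtain h where h: "h \<in> schur_rels l U" "x = h + p"
        by (auto simp: schur_class_eq)
      have "h + (p - q) \<in> schur_rels l U"
        using h that unfolding schur_rels_def by (intro pm.span_add)
      moreover have "x = h + (p - q) + q"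
        using h by simp
      ultimately show "x \<in> schur_class l U q"
        unfolding schur_class_eq by blast
    qed
    moreover have "q - p \<in> schur_rels l U"
      using pq eqv_sym by (simp add: eqv_def)
    ultimately show "schur_class l U p = schur_class l U q"
      using pq by blast
  qed
  then show ?thesis
    using schur_rels_iff[OF keys] by (simp add: ev_tensor_diff)
qed

text \<open>An arbitrary representative serves, since evaluation is constant on a class.\<close>

definition ev_class :: "('u word_tensor \<Rightarrow>\<^sub>0 'k) set \<Rightarrow> 'k poly"
  where "ev_class C = ev_tensor \<psi> (SOME p. p \<in> C)"

definition of_class :: "nat \<times> nat \<Rightarrow> 'k poly \<Rightarrow> ('u word_tensor \<Rightarrow>\<^sub>0 'k) set"
  where "of_class l f = schur_class l U (of_form l f)"

lemma ev_in_schur_class: "q \<in> schur_class l U p \<Longrightarrow> ev_tensor \<psi> q = ev_tensor \<psi> p"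
  by (auto simp: schur_class_eq ev_tensor_add ev_schur_rels)

lemma ev_schur_class [simp]: "ev_class (schur_class l U p) = ev_tensor \<psi> p"
  unfolding ev_class_def by (rule ev_in_schur_class) (rule someI, rule in_schur_class)

lemma schur_class_add:
  "schur_class l U p \<oplus>\<^bsub>schur l U\<^esub> schur_class l U q = schur_class l U (p + q)"
proof (intro subset_antisym subsetI)
  fix x assume "x \<in> schur_class l U p \<oplus>\<^bsub>schur l U\<^esub> schur_class l U q"
  then obtain h h' where h: "h \<in> schur_rels l U" "h' \<in> schur_rels l U" "x = h + p + (h' + q)"
    by (auto simp: schur_simps schur_class_eq)
  then have "h + h' \<in> schur_rels l U" "x = (h + h') + (p + q)"
    unfolding schur_rels_def by (auto intro: pm.span_add)
  then show "x \<in> schur_class l U (p + q)"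
    unfolding schur_class_eq by blast
next
  fix x assume "x \<in> schur_class l U (p + q)"
  then obtain h where h: "h \<in> schur_rels l U" "x = (h + p) + q"
    by (auto simp: schur_class_eq add.assoc)
  then have "h + p \<in> schur_class l U p"
    by (auto simp: schur_class_eq)
  then show "x \<in> schur_class l U p \<oplus>\<^bsub>schur l U\<^esub> schur_class l U q"
    using in_schur_class[of q l] h(2) unfolding schur_simps by blast
qed

lemma schur_gens_update_sym:
  assumes "(xs, ys) \<in> schur_gens l U" "y \<in> carrier U"
  shows "(xs, ys[k := y]) \<in> schur_gens l U"
proof -
  have "set (ys[k := y]) \<subseteq> carrier U"
    by (rule order.trans[OF set_update_subset_insert]) (use assms in \<open>simp add: schur_gens_def\<close>)
  then show ?thesis
    using assms(1) by (simp add: schur_gens_def)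
qed

lemma schur_gens_nth:
  assumes "(xs, ys) \<in> schur_gens l U"
  shows "a < length xs \<Longrightarrow> xs ! a = (x, z) \<Longrightarrow> x \<in> carrier U \<and> z \<in> carrier U"
    "k < length ys \<Longrightarrow> ys ! k \<in> carrier U"
proof -
  have sub: "set xs \<subseteq> carrier U \<times> carrier U" "set ys \<subseteq> carrier U"
    using assms by (simp_all add: schur_gens_def)
  show "x \<in> carrier U \<and> z \<in> carrier U" if "a < length xs" "xs ! a = (x, z)"
    using subsetD[OF sub(1) nth_mem[OF that(1)]] that(2) by simp
  show "ys ! k \<in> carrier U" if "k < length ys"
    using subsetD[OF sub(2) nth_mem[OF that]] .
qed

text \<open>Cosets are formed in the type of all finitely supported functions. This ensures that
  they do not leave the free module on the generators, so that every member of a class is a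
  legitimate representative.\<close>

lemma keys_schur_relators:
  assumes "p \<in> schur_relators l U"
  shows "Poly_Mapping.keys p \<subseteq> schur_gens l U"
  using assms
proof induction
  case (lin_left xs ys a x x' z c)
  then show ?case
    by (intro keys_subset_intros schur_gens_update add_closed smult_closed)
next
  case (lin_right xs ys a x x' z c)
  then show ?case
    by (intro keys_subset_intros schur_gens_update add_closed smult_closed)
next
  case (alt xs ys a x)
  then show ?case
    by (intro keys_subset_intros schur_gens_update)
next
  case (lin_sym xs ys k y y' c)
  then show ?case
    by (intro keys_subset_intros schur_gens_update_sym add_closed smult_closed)
next
  case (sym xs ys ys')
  have "(xs, ys') \<in> schur_gens l U"
    using sym mset_eq_setD[OF sym(2)] mset_eq_length[OF sym(2)] by (simp add: schur_gens_def)
  then show ?case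
    using sym(1) by (intro keys_subset_intros)
next
  case (E1_sym xs ys a x\<^sub>1 x\<^sub>2 k)
  then show ?case
    using schur_gens_nth(1)[OF E1_sym(1-3)] schur_gens_nth(2)[OF E1_sym(1,4)]
    by (intro keys_subset_intros schur_gens_update schur_gens_update_sym) simp_all
next
  case (E1_left xs ys a b x\<^sub>1 x\<^sub>2 z\<^sub>1 z\<^sub>2)
  have "x\<^sub>1 \<in> carrier U \<and> x\<^sub>2 \<in> carrier U" "z\<^sub>1 \<in> carrier U \<and> z\<^sub>2 \<in> carrier U"
    using schur_gens_nth(1)[OF E1_left(1) _ E1_left(4)] schur_gens_nth(1)[OF E1_left(1,3,5)] E1_left(2,3) by simp_all
  then show ?case
    using E1_left(1) by (intro keys_subset_intros schur_gens_update) simp_all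
next
  case (E1_right xs ys a b x\<^sub>1 x\<^sub>2 z\<^sub>1 z\<^sub>2)
  have "x\<^sub>1 \<in> carrier U \<and> x\<^sub>2 \<in> carrier U" "z\<^sub>1 \<in> carrier U \<and> z\<^sub>2 \<in> carrier U"
    using schur_gens_nth(1)[OF E1_right(1) _ E1_right(4)] schur_gens_nth(1)[OF E1_right(1,3,5)] E1_right(2,3)
        by simp_all
  then show ?case
    using E1_right(1) by (intro keys_subset_intros schur_gens_update) simp_all
next
  case (E2 xs ys a b)
  obtain x z x' z' where xz: "xs ! a = (x, z)" "xs ! b = (x', z')"
    by (cases "xs ! a", cases "xs ! b")
  then show ?case
    using E2(1) schur_gens_nth(1)[OF E2(1,2) xz(1)] schur_gens_nth(1)[OF E2(1,3) xz(2)] unfolding xz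
    by (intro keys_subset_intros schur_gens_update) simp_all
qed

lemma keys_in_schur_class:
  assumes p: "Poly_Mapping.keys p \<subseteq> schur_gens l U" and q: "q \<in> schur_class l U p"
  shows "Poly_Mapping.keys q \<subseteq> schur_gens l U"
proof -
  have "Poly_Mapping.keys h \<subseteq> schur_gens l U" if "h \<in> schur_rels l U" for h :: "'u word_tensor \<Rightarrow>\<^sub>0 'k"
    using that unfolding schur_rels_def
  proof (rule pm.span_induct_alt[where h = "\<lambda>h. Poly_Mapping.keys h \<subseteq> schur_gens l U"])
    fix a and x y :: "'u word_tensor \<Rightarrow>\<^sub>0 'k"
    assume "x \<in> schur_relators l U" "Poly_Mapping.keys y \<subseteq> schur_gens l U"
    then show "Poly_Mapping.keys (pm_scale a x + y) \<subseteq> schur_gens l U"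
      by (simp add: keys_subset_intros keys_schur_relators)
  qed simp
  moreover obtain h where "h \<in> schur_rels l U" "q = h + p"
    using q by (auto simp: schur_class_eq)
  ultimately show ?thesis
    using p by (simp add: keys_subset_intros)
qed

lemma schur_class_smult:
  assumes "Poly_Mapping.keys p \<subseteq> schur_gens l U"
  shows "a \<odot>\<^bsub>schur l U\<^esub> schur_class l U p = schur_class l U (pm_scale a p)"
proof -
  have "schur_class l U (pm_scale a x) = schur_class l U (pm_scale a p)" if "x \<in> schur_class l U p" for x
    using keys_in_schur_class[OF assms that] assms ev_in_schur_class[OF that]
    by (subst schur_class_eq_iff) (simp_all add: keys_subset_intros(3) ev_tensor_scale)
  then show ?thesis
    using in_schur_class[of p l] unfolding schur_simps by blast
qed

lemma schur_carrierE:
  assumes "C \<in> carrier (schur l U)"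
  obtains p where "Poly_Mapping.keys p \<subseteq> schur_gens l U" "C = schur_class l U p"
  using assms by (auto simp: schur_simps)

lemma schur_class_carrier: "Poly_Mapping.keys p \<subseteq> schur_gens l U \<Longrightarrow> schur_class l U p \<in> carrier (schur l U)"
  by (simp add: schur_simps)

lemma of_class_carrier [simp]: "of_class l f \<in> carrier (schur l U)"
  unfolding of_class_def by (rule schur_class_carrier) (rule keys_of_form)

lemma ev_of_class [simp]: "degree f \<le> fst l - snd l \<Longrightarrow> ev_class (of_class l f) = f"
  by (simp add: of_class_def ev_of_form)

lemma degree_ev_class: "C \<in> carrier (schur l U) \<Longrightarrow> degree (ev_class C) \<le> fst l - snd l"
  by (elim schur_carrierE) (simp add: degree_ev_tensor)

lemma schur_eqI:
  assumes "C \<in> carrier (schur l U)" "D \<in> carrier (schur l U)" "ev_class C = ev_class D"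
  shows "C = D"
  using assms by (elim schur_carrierE) (simp add: schur_class_eq_iff)

lemma schur_add_closed: "C \<in> carrier (schur l U) \<Longrightarrow> D \<in> carrier (schur l U) \<Longrightarrow> C \<oplus>\<^bsub>schur l U\<^esub> D \<in> carrier (schur l U)"
  by (elim schur_carrierE) (simp add: schur_class_add schur_class_carrier keys_subset_intros)

lemma ev_class_add: "C \<in> carrier (schur l U) \<Longrightarrow> D \<in> carrier (schur l U) \<Longrightarrow>
    ev_class (C \<oplus>\<^bsub>schur l U\<^esub> D) = ev_class C + ev_class D"
  by (elim schur_carrierE) (simp add: schur_class_add ev_tensor_add)

lemma schur_smult_closed: "C \<in> carrier (schur l U) \<Longrightarrow> a \<odot>\<^bsub>schur l U\<^esub> C \<in> carrier (schur l U)"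
  by (elim schur_carrierE) (simp add: schur_class_smult schur_class_carrier keys_subset_intros)

lemma ev_class_smult: "C \<in> carrier (schur l U) \<Longrightarrow> ev_class (a \<odot>\<^bsub>schur l U\<^esub> C) = [:a:] * ev_class C"
  by (elim schur_carrierE) (simp add: schur_class_smult ev_tensor_scale)

lemma schur_zero: "\<zero>\<^bsub>schur l U\<^esub> = schur_class l U 0"
  by (simp add: schur_simps schur_class_eq)

lemma schur_zero_carrier [simp]: "\<zero>\<^bsub>schur l U\<^esub> \<in> carrier (schur l U)"
  unfolding schur_zero by (rule schur_class_carrier) simp

lemma ev_class_zero [simp]: "ev_class \<zero>\<^bsub>schur l U\<^esub> = 0"
  by (simp add: schur_zero)

text \<open>If \<open>h\<close> is given on forms by a linear \<open>\<theta>\<close>, the class of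
  its extension depends only on the form of the representative. The union over representatives is
  then one class, and no relator has to be inspected.\<close>

lemma schur_induced:
  assumes h: "\<And>t. t \<in> schur_gens l U \<Longrightarrow> Poly_Mapping.keys (h t) \<subseteq> schur_gens r U"
    and ev_h: "\<And>t. t \<in> schur_gens l U \<Longrightarrow> ev_tensor \<psi> (h t) = \<theta> (ev_word \<psi> t)"
    and \<theta>: "\<And>p q. \<theta> (p + q) = \<theta> p + \<theta> q" "\<And>a p. \<theta> ([:a:] * p) = [:a:] * \<theta> p"
    and p: "Poly_Mapping.keys p \<subseteq> schur_gens l U"
  shows "schur_induced l r U h (schur_class l U p) = schur_class r U (linear_extension h p)"
    and "Poly_Mapping.keys (linear_extension h p) \<subseteq> schur_gens r U"
    and "ev_tensor \<psi> (linear_extension h p) = \<theta> (ev_tensor \<psi> p)"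
proof -
  have \<theta>0: "\<theta> 0 = 0"
    using \<theta>(2)[of 0 0] by simp
  have \<theta>_sum: "\<theta> (sum f I) = (\<Sum>i\<in>I. \<theta> (f i))" for f :: "'u word_tensor \<Rightarrow> 'k poly" and I
    by (induction I rule: infinite_finite_induct) (simp_all add: \<theta>(1) \<theta>0)
  have keys: "Poly_Mapping.keys (linear_extension h p) \<subseteq> schur_gens r U"
      if "Poly_Mapping.keys p \<subseteq> schur_gens l U" for p
    unfolding linear_extension_def
  proof (rule keys_sum_subset)
    fix t assume "t \<in> Poly_Mapping.keys p"
    then have "Poly_Mapping.keys (h t) \<subseteq> schur_gens r U"
      using that h by blast
    then show "Poly_Mapping.keys (pm_scale (Poly_Mapping.lookup p t) (h t)) \<subseteq> schur_gens r U"
      by (rule keys_subset_intros(3))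
  qed
  have ev: "ev_tensor \<psi> (linear_extension h p) = \<theta> (ev_tensor \<psi> p)" if "Poly_Mapping.keys p \<subseteq> schur_gens l U" for p
    unfolding ev_tensor_linear_extension ev_tensor_def[of _ p] \<theta>_sum \<theta>(2)
  proof (rule sum.cong[OF refl])
    fix t assume "t \<in> Poly_Mapping.keys p"
    then have "t \<in> schur_gens l U"
      using that by blast
    then show "[:Poly_Mapping.lookup p t:] * ev_tensor \<psi> (h t) = [:Poly_Mapping.lookup p t:] * \<theta> (ev_word \<psi> t)"
      by (simp only: ev_h)
  qed
  show "Poly_Mapping.keys (linear_extension h p) \<subseteq> schur_gens r U"
    by (rule keys[OF p])
  show "ev_tensor \<psi> (linear_extension h p) = \<theta> (ev_tensor \<psi> p)"
    by (rule ev[OF p])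
  have "schur_class r U (linear_extension h q) = schur_class r U (linear_extension h p)"
    if q: "q \<in> schur_class l U p" for q
    using keys[OF p] keys[OF keys_in_schur_class[OF p q]] ev[OF p] ev[OF keys_in_schur_class[OF p q]]
        ev_in_schur_class[OF q]
    by (simp add: schur_class_eq_iff)
  then have "(\<Union>q\<in>schur_class l U p. schur_class r U (linear_extension h q))
      = (\<Union>q\<in>schur_class l U p. schur_class r U (linear_extension h p))"
    by simp
  also have "\<dots> = schur_class r U (linear_extension h p)"
    using in_schur_class[of p l] by blast
  finally show "schur_induced l r U h (schur_class l U p) = schur_class r U (linear_extension h p)"
    using schur_class_carrier[OF p] by (simp add: schur_induced_def)
qed

lemma schur_induced_class:
  assumes "\<And>t. t \<in> schur_gens l U \<Longrightarrow> Poly_Mapping.keys (h t) \<subseteq> schur_gens r U"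
    and "\<And>t. t \<in> schur_gens l U \<Longrightarrow> ev_tensor \<psi> (h t) = \<theta> (ev_word \<psi> t)"
    and "\<And>p q. \<theta> (p + q) = \<theta> p + \<theta> q" "\<And>a p. \<theta> ([:a:] * p) = [:a:] * \<theta> p"
    and "C \<in> carrier (schur l U)"
  shows "schur_induced l r U h C \<in> carrier (schur r U)" "ev_class (schur_induced l r U h C) = \<theta> (ev_class C)"
proof -
  obtain p where p: "Poly_Mapping.keys p \<subseteq> schur_gens l U" "C = schur_class l U p"
    using assms(5) by (rule schur_carrierE)
  have \<theta>: "\<And>p q. \<theta> (p + q) = \<theta> p + \<theta> q" "\<And>a p. \<theta> ([:a:] * p) = [:a:] * \<theta> p"
    by (rule assms(3), rule assms(4))
  have ind: "schur_induced l r U h (schur_class l U p) = schur_class r U (linear_extension h p)"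
    "Poly_Mapping.keys (linear_extension h p) \<subseteq> schur_gens r U"
    "ev_tensor \<psi> (linear_extension h p) = \<theta> (ev_tensor \<psi> p)"
    by (rule schur_induced[where h = h and l = l and \<theta> = \<theta>, OF assms(1,2) \<theta> p(1)], assumption+)+
  show "schur_induced l r U h C \<in> carrier (schur r U)"
    unfolding p(2) ind(1) by (rule schur_class_carrier) (rule ind(2))
  show "ev_class (schur_induced l r U h C) = \<theta> (ev_class C)"
    unfolding p(2) ind(1) ev_schur_class by (rule ind(3))
qed

lemma schur_f_map:
  assumes z: "z \<in> carrier U" and C: "C \<in> carrier (schur l U)" and l: "snd l \<le> fst l"
  defines "h \<equiv> \<lambda>(xs, ys). gen xs (ys @ [z])"
  shows "schur_induced l (l + unit_weight 1) U h C \<in> carrier (schur (l + unit_weight 1) U)"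
    "ev_class (schur_induced l (l + unit_weight 1) U h C) = lin (\<psi> z) * ev_class C"
proof -
  have 1: "Poly_Mapping.keys (h t) \<subseteq> schur_gens (l + unit_weight 1) U" if "t \<in> schur_gens l U" for t
  proof -
    obtain xs ys where t: "t = (xs, ys)"
      by (cases t)
    have "(xs, ys @ [z]) \<in> schur_gens (l + unit_weight 1) U"
      using that z l by (simp add: t schur_gens_def unit_weight_def Suc_diff_le)
    then show ?thesis
      by (simp add: t h_def)
  qed
  have 2: "ev_tensor \<psi> (h t) = lin (\<psi> z) * ev_word \<psi> t" for t
    unfolding h_def prod.case_eq_if ev_tensor_gen ev_word_def fst_conv snd_conv
    by (simp only: map_append prod_list.append list.map prod_list.Cons prod_list.Nil mult_1_left mult_1_right mult_ac)
  show "schur_induced l (l + unit_weight 1) U h C \<in> carrier (schur (l + unit_weight 1) U)"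
    "ev_class (schur_induced l (l + unit_weight 1) U h C) = lin (\<psi> z) * ev_class C"
    by (rule schur_induced_class[where \<theta> = "\<lambda>p. lin (\<psi> z) * p" and h = h,
        OF 1 2 distrib_left mult.left_commute C], assumption)+
qed

text \<open>The sum over the factor moved into a new wedge is the Leibniz expansion of the
  contraction with \<open>\<psi> z\<close>.\<close>

lemma schur_g_map:
  assumes z: "z \<in> carrier U" and C: "C \<in> carrier (schur l U)" and l: "snd l < fst l"
  defines "h \<equiv> \<lambda>(xs, ys). \<Sum>k<length ys. gen (xs @ [(ys ! k, z)]) (take k ys @ drop (Suc k) ys)"
  shows "schur_induced l (l + unit_weight 2) U h C \<in> carrier (schur (l + unit_weight 2) U)"
    "ev_class (schur_induced l (l + unit_weight 2) U h C) = wedge (fst l - snd l) (\<psi> z) (ev_class C)"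
proof -
  have 1: "Poly_Mapping.keys (h t) \<subseteq> schur_gens (l + unit_weight 2) U" if "t \<in> schur_gens l U" for t
  proof -
    obtain xs ys where t: "t = (xs, ys)"
      by (cases t)
    show ?thesis
      unfolding h_def t prod.case
    proof (rule keys_sum_subset)
      fix k assume k: "k \<in> {..<length ys}"
      then have "ys ! k \<in> carrier U"
        using schur_gens_nth(2)[of xs ys l k] that by (simp add: t)
      moreover have "set (take k ys @ drop (Suc k) ys) \<subseteq> carrier U"
        using that order.trans[OF set_take_subset, of ys "carrier U" k] order.trans[OF set_drop_subset,
            of ys "carrier U" "Suc k"]
        by (simp add: t schur_gens_def)
      moreover have "length (take k ys @ drop (Suc k) ys) = length ys - 1"
        using k by simp
      ultimately have "(xs @ [(ys ! k, z)], take k ys @ drop (Suc k) ys) \<in> schur_gens (l + unit_weight 2) U"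
        using that z by (simp add: t schur_gens_def unit_weight_def)
      then show "Poly_Mapping.keys (gen (xs @ [(ys ! k, z)]) (take k ys @ drop (Suc k) ys) :: 'u word_tensor \<Rightarrow>\<^sub>0 'k)
          \<subseteq> schur_gens (l + unit_weight 2) U"
        by simp
    qed
  qed
  have 2: "ev_tensor \<psi> (h t) = wedge (fst l - snd l) (\<psi> z) (ev_word \<psi> t)" if "t \<in> schur_gens l U" for t
  proof -
    obtain xs ys where t: "t = (xs, ys)"
      by (cases t)
    have len: "fst l - snd l = length (map \<psi> ys)"
      using that by (simp add: t schur_gens_def)
    let ?d = "prod_list (map (\<lambda>(x, x'). det2 (\<psi> x) (\<psi> x')) xs)"
    have ev_snoc: "ev_word \<psi> (xs @ [(a, b)], zs) = [:?d:]
        * ([:det2 (\<psi> a) (\<psi> b):] * prod_list (map lin (map \<psi> zs)))" for a b zs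
      by (simp add: ev_word_def mult.commute)
    have "ev_tensor \<psi> (h t) = (\<Sum>k<length ys. [:?d:]
        * ([:det2 (\<psi> (ys ! k)) (\<psi> z):] * prod_list (map lin (map \<psi> (take k ys @ drop (Suc k) ys)))))"
      unfolding h_def t prod.case ev_tensor_sum ev_tensor_gen ev_snoc ..
    also have "\<dots> = [:?d:] * wedge (length (map \<psi> ys)) (\<psi> z) (prod_list (map lin (map \<psi> ys)))"
      unfolding wedge_prod_list sum_distrib_left
      by (rule sum.cong) (simp_all add: take_map drop_map del: mult_pCons_left mult_pCons_right)
    finally show ?thesis
      unfolding len by (simp only: t ev_word_def wedge_const_mult fst_conv snd_conv)
  qed
  show "schur_induced l (l + unit_weight 2) U h C \<in> carrier (schur (l + unit_weight 2) U)"
    "ev_class (schur_induced l (l + unit_weight 2) U h C) = wedge (fst l - snd l) (\<psi> z) (ev_class C)"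
    by (rule schur_induced_class[where \<theta> = "wedge (fst l - snd l) (\<psi> z)" and h = h,
        OF 1 2 wedge_add wedge_const_mult C], assumption+)+
qed

end

section \<open>Fibres of the tautological quotient bundle\<close>

lemma module_simps [simp]:
  "carrier V_module = UNIV" "x \<oplus>\<^bsub>V_module\<^esub> y = x + y" "a \<odot>\<^bsub>V_module\<^esub> x = a *s x" "\<zero>\<^bsub>V_module\<^esub> = 0"
  by (simp_all add: V_module_def vector_module_def)

lemma z_section_eq: "z_section v K = {k + v | k. k \<in> K}"
  by (simp add: z_section_def a_r_coset_eq)

lemma W_fibre_simps:
  "carrier (W_fibre K) = range (\<lambda>v. z_section v K)"
  "C \<oplus>\<^bsub>W_fibre K\<^esub> D = {x + y | x y. x \<in> C \<and> y \<in> D}"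
  "a \<odot>\<^bsub>W_fibre K\<^esub> C = (\<Union>x\<in>C. z_section (a *s x) K)"
proof -
  have "a_rcosets\<^bsub>V_module\<^esub> K = (\<lambda>v. K +>\<^bsub>V_module\<^esub> v) ` UNIV"
    unfolding A_RCOSETS_def RCOSETS_def a_r_coset_def by (auto simp: V_module_def vector_module_def)
  then show "carrier (W_fibre K) = range (\<lambda>v. z_section v K)"
    by (simp add: W_fibre_def quot_module_def vector_module_def z_section_def)
  have "C <+>\<^bsub>V_module\<^esub> D = {x + y | x y. x \<in> C \<and> y \<in> D}"
    unfolding set_add_def set_mult_def by (auto simp: V_module_def vector_module_def)
  then show "C \<oplus>\<^bsub>W_fibre K\<^esub> D = {x + y | x y. x \<in> C \<and> y \<in> D}"
    by (simp add: W_fibre_def quot_module_def vector_module_def)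
  show "a \<odot>\<^bsub>W_fibre K\<^esub> C = (\<Union>x\<in>C. z_section (a *s x) K)"
    by (simp add: W_fibre_def quot_module_def vector_module_def z_section_def)
qed

lemma z_section_add:
  assumes "vec.subspace K"
  shows "z_section v K \<oplus>\<^bsub>W_fibre K\<^esub> z_section w K = z_section (v + w) K"
proof (intro subset_antisym subsetI)
  fix x assume "x \<in> z_section v K \<oplus>\<^bsub>W_fibre K\<^esub> z_section w K"
  then obtain k k' where "k \<in> K" "k' \<in> K" "x = (k + v) + (k' + w)"
    unfolding W_fibre_simps z_section_eq by blast
  then have "k + k' \<in> K" "x = (k + k') + (v + w)"
    using vec.subspace_add[OF assms] by (simp_all add: algebra_simps)
  then show "x \<in> z_section (v + w) K"
    unfolding z_section_eq by blast
next
  fix x assume "x \<in> z_section (v + w) K"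
  then obtain k where k: "k \<in> K" "x = (k + v) + (0 + w)"
    unfolding z_section_eq by (auto simp: algebra_simps)
  then show "x \<in> z_section v K \<oplus>\<^bsub>W_fibre K\<^esub> z_section w K"
    unfolding W_fibre_simps z_section_eq using vec.subspace_0[OF assms] by blast
qed

lemma z_section_eqI:
  assumes "vec.subspace K" "v - w \<in> K"
  shows "z_section v K = z_section w K"
proof -
  have "z_section v K \<subseteq> z_section w K" if "v - w \<in> K" for v w
  proof
    fix x assume "x \<in> z_section v K"
    then obtain k where "k \<in> K" "x = k + v"
      by (auto simp: z_section_eq)
    then have "k + (v - w) \<in> K" "x = (k + (v - w)) + w"
      using vec.subspace_add[OF assms(1)] that by simp_all
    then show "x \<in> z_section w K"
      unfolding z_section_eq by blast
  qed
  moreover have "w - v \<in> K"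
    using vec.subspace_neg[OF assms] by simp
  ultimately show ?thesis
    using assms(2) by blast
qed

lemma z_section_smult:
  assumes "vec.subspace K"
  shows "a \<odot>\<^bsub>W_fibre K\<^esub> z_section v K = z_section (a *s v) K"
proof -
  have "z_section (a *s x) K = z_section (a *s v) K" if x: "x \<in> z_section v K" for x
  proof (rule z_section_eqI[OF assms])
    obtain k where "k \<in> K" "x = k + v"
      using x by (auto simp: z_section_eq)
    then show "a *s x - a *s v \<in> K"
      using vec.subspace_scale[OF assms] by (simp add: vec.scale_right_distrib)
  qed
  moreover have "v \<in> z_section v K"
    using vec.subspace_0[OF assms] by (force simp: z_section_eq)
  ultimately show ?thesis
    unfolding W_fibre_simps by blast
qed

section \<open>Frames and points of the Grassmannian\<close>

locale ordered_basis =
  fixes u :: "'n::finite \<Rightarrow> 'k::field_char_0 ^ 'n"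
  assumes inj_u: "inj u" and indep_u: "vec.independent (range u)" and span_u: "vec.span (range u) = UNIV"
begin

text \<open>A frame amounts to a linear map from V to k^2 with prescribed values on the basis
  \<open>u\<close>. This is that map; its kernel is the point of the Grassmannian over which the
  frame lies.\<close>

definition quot :: "('k, 'n) frame \<Rightarrow> 'k ^ 'n \<Rightarrow> 'k \<times> 'k"
  where "quot c v = (\<Sum>i\<in>UNIV. vec.representation (range u) v (u i) * fst (c i),
    \<Sum>i\<in>UNIV. vec.representation (range u) v (u i) * snd (c i))"

definition ker :: "('k, 'n) frame \<Rightarrow> ('k ^ 'n) set"
  where "ker c = {v. quot c v = (0, 0)}"

lemma quot_add: "quot c (v + w) = quot c v + quot c w"
  by (simp add: quot_def vec.representation_add[OF indep_u] span_u algebra_simps sum.distrib)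

lemma quot_scale: "quot c (a *s v) = (a * fst (quot c v), a * snd (quot c v))"
  by (simp add: quot_def vec.representation_scale[OF indep_u] span_u sum_distrib_left mult.assoc)

lemma quot_diff: "quot c (v - w) = quot c v - quot c w"
  using quot_add[of c "v - w" w] by simp

lemma quot_0: "quot c 0 = 0"
  using quot_add[of c 0 0] by simp

lemma quot_u [simp]: "quot c (u i) = c i"
proof -
  have "vec.representation (range u) (u i) (u j) = (if j = i then 1 else 0)" for j
    using vec.representation_basis[OF indep_u, of "u i"] inj_u by (simp add: inj_eq)
  then show ?thesis
    by (simp add: quot_def if_distrib[of "\<lambda>x. x * _"] cong: if_cong)
qed

lemma quot_eqI:
  assumes add: "\<And>v w. f (v + w) = f v + f w" and scale: "\<And>a v. f (a *s v) = (a * fst (f v), a * snd (f v))"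
  shows "quot (\<lambda>i. f (u i)) v = (f v :: 'k \<times> 'k)"
proof -
  have f0: "f 0 = 0"
    using scale[of 0 0] by (simp add: zero_prod_def)
  have f_sum: "f (sum g I) = (\<Sum>i\<in>I. f (g i))" for g :: "'n \<Rightarrow> 'k ^ 'n" and I
    by (induction I rule: infinite_finite_induct) (simp_all add: f0 add)
  have "v = (\<Sum>b\<in>range u. vec.representation (range u) v b *s b)"
    by (rule vec.sum_representation_eq[symmetric, OF indep_u]) (simp_all add: span_u)
  also have "\<dots> = (\<Sum>i\<in>UNIV. vec.representation (range u) v (u i) *s u i)"
    by (simp add: sum.reindex[OF inj_u])
  finally have "f v = (\<Sum>i\<in>UNIV. f (vec.representation (range u) v (u i) *s u i))"
    by (metis f_sum)
  also have "\<dots> = quot (\<lambda>i. f (u i)) v"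
    unfolding scale quot_def by (simp add: prod_eq_iff fst_sum snd_sum)
  finally show ?thesis ..
qed

lemma quot_comb: "quot (\<lambda>i. comb a b (c i)) v = comb a b (quot c v)"
  using quot_eqI[of "\<lambda>v. comb a b (quot c v)" v]
  by (simp add: quot_add quot_scale comb_def algebra_simps)

lemma subspace_ker: "vec.subspace (ker c)"
  by (rule vec.subspaceI) (auto simp: ker_def quot_0 quot_add quot_scale zero_prod_def)

lemma z_section_ker_eq_iff: "z_section v (ker c) = z_section w (ker c) \<longleftrightarrow> quot c v = quot c w"
proof
  assume "z_section v (ker c) = z_section w (ker c)"
  moreover have "v \<in> z_section v (ker c)"
    using vec.subspace_0[OF subspace_ker, of c] by (force simp: z_section_eq)
  ultimately obtain k where "k \<in> ker c" "v = k + w"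
    by (auto simp: z_section_eq)
  then show "quot c v = quot c w"
    by (simp add: quot_add ker_def zero_prod_def[symmetric])
next
  assume "quot c v = quot c w"
  then have "v - w \<in> ker c"
    by (simp add: ker_def quot_diff zero_prod_def)
  then show "z_section v (ker c) = z_section w (ker c)"
    by (rule z_section_eqI[OF subspace_ker])
qed

text \<open>Applying \<open>quot c\<close> turns the membership into a 2 by 2 linear system, solved
  by Cramer's rule.\<close>

lemma quot_solve:
  assumes "det2 (quot c a) (quot c b) \<noteq> 0"
  shows "v - (fst p *s a + snd p *s b) \<in> ker c \<longleftrightarrow>
    p = (det2 (quot c v) (quot c b) / det2 (quot c a) (quot c b),
        det2 (quot c a) (quot c v) / det2 (quot c a) (quot c b))"
proof -
  obtain a\<^sub>1 a\<^sub>2 b\<^sub>1 b\<^sub>2 v\<^sub>1 v\<^sub>2 p\<^sub>1 p\<^sub>2 where eqs: "quot c a = (a\<^sub>1, a\<^sub>2)" "quot c b = (b\<^sub>1, b\<^sub>2)"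
      "quot c v = (v\<^sub>1, v\<^sub>2)" "p = (p\<^sub>1, p\<^sub>2)"
    by (metis surj_pair)
  have nz: "a\<^sub>1 * b\<^sub>2 - a\<^sub>2 * b\<^sub>1 \<noteq> 0"
    using assms by (simp add: eqs det2_def)
  have "v - (fst p *s a + snd p *s b) \<in> ker c \<longleftrightarrow> v\<^sub>1 = p\<^sub>1 * a\<^sub>1 + p\<^sub>2 * b\<^sub>1 \<and> v\<^sub>2 = p\<^sub>1 * a\<^sub>2 + p\<^sub>2 * b\<^sub>2"
    by (simp add: ker_def quot_diff quot_add quot_scale eqs)
  also have "\<dots> \<longleftrightarrow> p\<^sub>1 = (v\<^sub>1 * b\<^sub>2 - v\<^sub>2 * b\<^sub>1) / (a\<^sub>1 * b\<^sub>2 - a\<^sub>2 * b\<^sub>1) \<and> p\<^sub>2 =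
      (a\<^sub>1 * v\<^sub>2 - a\<^sub>2 * v\<^sub>1) / (a\<^sub>1 * b\<^sub>2 - a\<^sub>2 * b\<^sub>1)"
  proof
    assume "v\<^sub>1 = p\<^sub>1 * a\<^sub>1 + p\<^sub>2 * b\<^sub>1 \<and> v\<^sub>2 = p\<^sub>1 * a\<^sub>2 + p\<^sub>2 * b\<^sub>2"
    then have "v\<^sub>1 * b\<^sub>2 - v\<^sub>2 * b\<^sub>1 = p\<^sub>1 * (a\<^sub>1 * b\<^sub>2 - a\<^sub>2 * b\<^sub>1)"
        "a\<^sub>1 * v\<^sub>2 - a\<^sub>2 * v\<^sub>1 = p\<^sub>2 * (a\<^sub>1 * b\<^sub>2 - a\<^sub>2 * b\<^sub>1)"
      by (simp_all add: algebra_simps)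
    then show "p\<^sub>1 = (v\<^sub>1 * b\<^sub>2 - v\<^sub>2 * b\<^sub>1) / (a\<^sub>1 * b\<^sub>2 - a\<^sub>2 * b\<^sub>1) \<and> p\<^sub>2 =
        (a\<^sub>1 * v\<^sub>2 - a\<^sub>2 * v\<^sub>1) / (a\<^sub>1 * b\<^sub>2 - a\<^sub>2 * b\<^sub>1)"
      using nz by simp
  next
    assume "p\<^sub>1 = (v\<^sub>1 * b\<^sub>2 - v\<^sub>2 * b\<^sub>1) / (a\<^sub>1 * b\<^sub>2 - a\<^sub>2 * b\<^sub>1) \<and> p\<^sub>2 =
        (a\<^sub>1 * v\<^sub>2 - a\<^sub>2 * v\<^sub>1) / (a\<^sub>1 * b\<^sub>2 - a\<^sub>2 * b\<^sub>1)"
    then have p: "p\<^sub>1 * (a\<^sub>1 * b\<^sub>2 - a\<^sub>2 * b\<^sub>1) = v\<^sub>1 * b\<^sub>2 - v\<^sub>2 * b\<^sub>1"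
        "p\<^sub>2 * (a\<^sub>1 * b\<^sub>2 - a\<^sub>2 * b\<^sub>1) = a\<^sub>1 * v\<^sub>2 - a\<^sub>2 * v\<^sub>1"
      using nz by simp_all
    have "(p\<^sub>1 * a\<^sub>1 + p\<^sub>2 * b\<^sub>1) * (a\<^sub>1 * b\<^sub>2 - a\<^sub>2 * b\<^sub>1) = a\<^sub>1 * (p\<^sub>1 * (a\<^sub>1 * b\<^sub>2 - a\<^sub>2 * b\<^sub>1)) + b\<^sub>1
        * (p\<^sub>2 * (a\<^sub>1 * b\<^sub>2 - a\<^sub>2 * b\<^sub>1))"
      by (simp only: algebra_simps)
    also have "\<dots> = v\<^sub>1 * (a\<^sub>1 * b\<^sub>2 - a\<^sub>2 * b\<^sub>1)"
      unfolding p by (simp add: algebra_simps)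
    finally have e1: "(p\<^sub>1 * a\<^sub>1 + p\<^sub>2 * b\<^sub>1) * (a\<^sub>1 * b\<^sub>2 - a\<^sub>2 * b\<^sub>1) = v\<^sub>1 * (a\<^sub>1 * b\<^sub>2 - a\<^sub>2 * b\<^sub>1)" .
    have "(p\<^sub>1 * a\<^sub>2 + p\<^sub>2 * b\<^sub>2) * (a\<^sub>1 * b\<^sub>2 - a\<^sub>2 * b\<^sub>1) = a\<^sub>2 * (p\<^sub>1 * (a\<^sub>1 * b\<^sub>2 - a\<^sub>2 * b\<^sub>1)) + b\<^sub>2
        * (p\<^sub>2 * (a\<^sub>1 * b\<^sub>2 - a\<^sub>2 * b\<^sub>1))"
      by (simp only: algebra_simps)
    also have "\<dots> = v\<^sub>2 * (a\<^sub>1 * b\<^sub>2 - a\<^sub>2 * b\<^sub>1)"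
      unfolding p by (simp add: algebra_simps)
    finally have e2: "(p\<^sub>1 * a\<^sub>2 + p\<^sub>2 * b\<^sub>2) * (a\<^sub>1 * b\<^sub>2 - a\<^sub>2 * b\<^sub>1) = v\<^sub>2 * (a\<^sub>1 * b\<^sub>2 - a\<^sub>2 * b\<^sub>1)" .
    from e1 e2 show "v\<^sub>1 = p\<^sub>1 * a\<^sub>1 + p\<^sub>2 * b\<^sub>1 \<and> v\<^sub>2 = p\<^sub>1 * a\<^sub>2 + p\<^sub>2 * b\<^sub>2"
      using nz by simp
  qed
  finally show ?thesis
    by (simp add: eqs det2_def)
qed

text \<open>If the minor at i, j is nonzero, Cramer's rule shows that the kernel and the span of
  \<open>u i\<close>, \<open>u j\<close> are complementary, and the dimension formula gives
  codimension two.\<close>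

lemma ker_in_Gr2:
  assumes "nondegenerate c"
  shows "ker c \<in> Gr2"
proof -
  obtain i j where ij: "det2 (c i) (c j) \<noteq> 0"
    using assms unfolding nondegenerate_def by blast
  then have ne: "u i \<noteq> u j"
    using inj_u by (auto simp: det2_def inj_eq)
  let ?T = "vec.span {u i, u j}"
  have indep: "vec.independent {u i, u j}"
    by (rule vec.independent_mono[OF indep_u]) auto
  have decomp: "\<exists>x\<in>ker c. \<exists>y\<in>?T. v = x + y" for v
  proof -
    have "\<exists>p. v - (fst p *s u i + snd p *s u j) \<in> ker c"
      using quot_solve[of c "u i" "u j" v] ij by auto
    then obtain p where p: "v - (fst p *s u i + snd p *s u j) \<in> ker c" ..
    have "fst p *s u i + snd p *s u j \<in> ?T"
      by (intro vec.span_add vec.span_scale vec.span_base) auto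
    then show ?thesis
      using p by (intro bexI[of _ "v - (fst p *s u i + snd p *s u j)"] bexI[of _ "fst p *s u i + snd p *s u j"])
          simp_all
  qed
  then have 1: "{x + y | x y. x \<in> ker c \<and> y \<in> ?T} = UNIV"
    by blast
  have "x = 0" if x_mem: "x \<in> ker c" "x \<in> ?T" for x
  proof -
    obtain s t where x: "x = s *s u i + t *s u j"
    proof -
      obtain s where "x - s *s u i \<in> vec.span {u j}"
        using x_mem(2) vec.span_breakdown_eq by blast
      then obtain t where "x - s *s u i = t *s u j"
        by (auto simp: vec.span_singleton)
      then show thesis
        using that[of s t] by (simp add: algebra_simps)
    qed
    have "0 - (fst (- s, - t) *s u i + snd (- s, - t) *s u j) \<in> ker c"
        and 0: "0 - (fst (0, 0) *s u i + snd (0, 0) *s u j) \<in> ker c"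
      using x_mem(1) x vec.subspace_0[OF subspace_ker] by (simp_all add: add.commute)
    moreover have "det2 (quot c (u i)) (quot c (u j)) \<noteq> 0"
      using ij by simp
    ultimately have "(- s, - t) = (0, 0 :: 'k)"
      using iffD1[OF quot_solve[of c "u i" "u j" 0 "(- s, - t)"]] iffD1[OF quot_solve[of c "u i" "u j" 0 "(0, 0)"]]
      by (auto simp del: quot_u)
    then show ?thesis
      by (simp add: x)
  qed
  then have 2: "ker c \<inter> ?T = {0}"
    using vec.subspace_0[OF subspace_ker] vec.span_zero by blast
  have "vec.dim ?T = 2"
    using vec.dim_span_eq_card_independent[OF indep] ne by simp
  then have "vec.dim (ker c) + 2 = CARD('n)"
    using vec.dim_sums_Int[OF subspace_ker vec.subspace_span, of c "{u i, u j}"] unfolding 1 2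
    by (simp add: vec.dim_UNIV card_cart_basis)
  then show ?thesis
    by (simp add: Gr2_def subspace_ker)
qed

text \<open>A basis of K is extended to a basis of V. Two vectors are added, and the coordinates
  along them form a linear map to k^2 with kernel K.\<close>

lemma Gr2_is_ker:
  assumes "K \<in> Gr2"
  shows "\<exists>c. nondegenerate c \<and> K = ker c"
proof -
  have K: "vec.subspace K" "vec.dim K + 2 = CARD('n)"
    using assms by (simp_all add: Gr2_def)
  obtain B where B: "B \<subseteq> K" "vec.independent B" "K \<subseteq> vec.span B" "card B = vec.dim K"
    using vec.basis_exists by blast
  have spanB: "vec.span B = K"
    using B(1,3) K(1) vec.span_minimal by blast
  define E where "E = vec.extend_basis B"
  have E: "B \<subseteq> E" "vec.independent E" "vec.span E = UNIV"
    using B(2) by (simp_all add: E_def vec.extend_basis_superset vec.independent_extend_basis vec.span_extend_basis)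
  have finE: "finite E"
    using vec.finiteI_independent[OF E(2)] .
  have "card E = CARD('n)"
    using vec.dim_span_eq_card_independent[OF E(2)] E(3) by (simp add: vec.dim_UNIV card_cart_basis)
  then have "card (E - B) = 2"
    using card_Diff_subset[OF finite_subset[OF E(1) finE] E(1)] B(4) K(2) by simp
  then obtain a b where ab: "E - B = {a, b}" "a \<noteq> b"
    by (auto simp: card_2_iff)
  let ?R = "vec.representation E"
  define f where "f v = (?R v a, ?R v b)" for v
  have f: "f (v + w) = f v + f w" "f (s *s v) = (s * fst (f v), s * snd (f v))" for v w s
    using vec.representation_add[OF E(2), of w v] vec.representation_scale[OF E(2), of v s] E(3) by
        (simp_all add: f_def)
  define c where "c i = f (u i)" for i
  have quot: "quot c = f"
    unfolding c_def using quot_eqI[of f, OF f] by auto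
  have "a \<in> E" "b \<in> E"
    using ab(1) by blast+
  then have f_ab: "f a = (1, 0)" "f b = (0, 1)"
    using vec.representation_basis[OF E(2), of a] vec.representation_basis[OF E(2), of b] ab by (auto simp: f_def)
  have "K = ker c"
  proof (intro subset_antisym subsetI)
    fix v assume "v \<in> K"
    then have v: "v \<in> vec.span B"
      by (simp add: spanB)
    have R: "?R v = vec.representation B v"
      by (rule vec.representation_extend[OF E(2) v E(1)])
    have "vec.representation B v a = 0" "vec.representation B v b = 0"
      using vec.representation_ne_zero ab(1) by blast+
    then show "v \<in> ker c"
      by (simp add: ker_def quot f_def R)
  next
    fix v assume "v \<in> ker c"
    then have 0: "?R v a = 0" "?R v b = 0"
      by (simp_all add: ker_def quot f_def)
    have "v = (\<Sum>e\<in>E. ?R v e *s e)"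
      by (rule vec.sum_representation_eq[symmetric, OF E(2)]) (simp_all add: E(3) finE)
    also have "\<dots> = (\<Sum>e\<in>B. ?R v e *s e)"
    proof (rule sum.mono_neutral_right[OF finE E(1)])
      show "\<forall>e\<in>E - B. ?R v e *s e = 0"
        unfolding ab(1) using 0 by simp
    qed
    also have "\<dots> \<in> vec.span B"
      by (intro vec.span_sum vec.span_scale vec.span_base)
    finally show "v \<in> K"
      by (simp add: spanB)
  qed
  \<comment> \<open>If all minors of the frame vanished, bilinearity would make the determinant
    vanish on the images of all pairs of vectors, yet the two added basis vectors go to (1, 0) and
    (0, 1).\<close>
  moreover have "nondegenerate c"
  proof (rule ccontr)
    assume "\<not> nondegenerate c"
    then have deg: "det2 (c i) (c j) = 0" for i j
      by (auto simp: nondegenerate_def)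
    have "det2 (quot c v) (c j) = 0" for v j
    proof -
      have "det2 (quot c v) (c j) = (\<Sum>i\<in>UNIV. vec.representation (range u) v (u i) * det2 (c i) (c j))"
        unfolding quot_def det2_def fst_conv snd_conv sum_distrib_right sum_subtractf[symmetric]
        by (rule sum.cong) (simp_all add: algebra_simps)
      then show ?thesis
        by (simp add: deg)
    qed
    then have "det2 (quot c v) (quot c w) = 0" for v w
    proof -
      have "det2 (quot c v) (quot c w) = (\<Sum>j\<in>UNIV. vec.representation (range u) w (u j) * det2 (quot c v) (c j))"
        by (subst (2) quot_def) (simp add: det2_def sum_distrib_left sum_subtractf algebra_simps)
      then show ?thesis
        using \<open>\<And>v j. det2 (quot c v) (c j) = 0\<close> by simp
    qed
    from this[of a b] show False
      by (simp add: quot f_ab det2_def)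
  qed
  ultimately show ?thesis
    by blast
qed

subsection \<open>Regular sections\<close>

text \<open>The coordinates that a frame provides on the fibre of W over its kernel; they do not
  depend on the representative of the class.\<close>

definition fib :: "('k, 'n) frame \<Rightarrow> ('k ^ 'n) set \<Rightarrow> 'k \<times> 'k"
  where "fib c C = quot c (SOME v. v \<in> C)"

lemma in_z_section: "v \<in> z_section v (ker c)"
  using vec.subspace_0[OF subspace_ker, of c] by (force simp: z_section_eq)

lemma fib_z_section [simp]: "fib c (z_section v (ker c)) = quot c v"
proof -
  have *: "quot c w = quot c v" if "w \<in> z_section v (ker c)" for w
    using that by (auto simp: z_section_eq quot_add ker_def zero_prod_def[symmetric])
  show ?thesis
    unfolding fib_def by (rule *) (rule someI, rule in_z_section)
qed

lemma quot_surj: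
  assumes "nondegenerate c"
  shows "\<exists>v. quot c v = y"
proof -
  obtain i j where ij: "det2 (c i) (c j) \<noteq> 0"
    using assms unfolding nondegenerate_def by blast
  let ?\<Delta> = "det2 (c i) (c j)"
  let ?v = "(det2 y (c j) / ?\<Delta>) *s u i + (det2 (c i) y / ?\<Delta>) *s u j"
  have "?\<Delta> * fst (quot c ?v) = ?\<Delta> * fst y" "?\<Delta> * snd (quot c ?v) = ?\<Delta> * snd y"
    using ij by (simp_all add: quot_add quot_scale distrib_left) (simp_all add: det2_def algebra_simps)
  then have "quot c ?v = y"
    using ij by (simp add: prod_eq_iff)
  then show ?thesis ..
qed

lemma plane_W:
  assumes "nondegenerate c"
  shows "plane (W_fibre (ker c)) (fib c)"
proof
  note K = subspace_ker[of c]
  show "bij_betw (fib c) (carrier (W_fibre (ker c))) UNIV"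
  proof (rule bij_betw_imageI)
    show "inj_on (fib c) (carrier (W_fibre (ker c)))"
      unfolding W_fibre_simps(1) by (rule inj_onI) (elim rangeE, simp add: z_section_ker_eq_iff)
    have "y \<in> fib c ` carrier (W_fibre (ker c))" for y
      using quot_surj[OF assms, of y] by (auto simp: W_fibre_simps(1) image_iff)
    then show "fib c ` carrier (W_fibre (ker c)) = UNIV"
      by blast
  qed
  show "x \<oplus>\<^bsub>W_fibre (ker c)\<^esub> y \<in> carrier (W_fibre (ker c))" "fib c (x \<oplus>\<^bsub>W_fibre (ker c)\<^esub> y) = fib c x + fib c y"
    if xy: "x \<in> carrier (W_fibre (ker c))" "y \<in> carrier (W_fibre (ker c))" for x y
  proof -
    obtain v w where "x = z_section v (ker c)" "y = z_section w (ker c)"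
      using xy unfolding W_fibre_simps(1) by blast
    then show "x \<oplus>\<^bsub>W_fibre (ker c)\<^esub> y \<in> carrier (W_fibre (ker c))"
        "fib c (x \<oplus>\<^bsub>W_fibre (ker c)\<^esub> y) = fib c x + fib c y"
      by (simp_all add: z_section_add[OF K] quot_add) (simp add: W_fibre_simps(1))
  qed
  show "a \<odot>\<^bsub>W_fibre (ker c)\<^esub> x \<in> carrier (W_fibre (ker c))"
    "fib c (a \<odot>\<^bsub>W_fibre (ker c)\<^esub> x) = (a * fst (fib c x), a * snd (fib c x))"
    if x: "x \<in> carrier (W_fibre (ker c))" for x a
  proof -
    obtain v where "x = z_section v (ker c)"
      using x unfolding W_fibre_simps(1) by blast
    then show "a \<odot>\<^bsub>W_fibre (ker c)\<^esub> x \<in> carrier (W_fibre (ker c))"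
      "fib c (a \<odot>\<^bsub>W_fibre (ker c)\<^esub> x) = (a * fst (fib c x), a * snd (fib c x))"
      by (simp_all add: z_section_smult[OF K] quot_scale) (simp add: W_fibre_simps(1))
  qed
qed

section \<open>Fibres of the Schur bundles read in a frame\<close>

definition ev :: "('k, 'n) frame \<Rightarrow> ('k, 'n) schur_elem \<Rightarrow> 'k poly"
  where "ev c = plane.ev_class (fib c)"

definition iv :: "('k, 'n) frame \<Rightarrow> nat \<times> nat \<Rightarrow> 'k poly \<Rightarrow> ('k, 'n) schur_elem"
  where "iv c = plane.of_class (W_fibre (ker c)) (fib c)"

lemma
  assumes "nondegenerate c"
  shows iv_carrier: "iv c l f \<in> carrier (S_fibre l (ker c))"
    and ev_iv: "degree f \<le> fst l - snd l \<Longrightarrow> ev c (iv c l f) = f"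
    and degree_ev: "C \<in> carrier (S_fibre l (ker c)) \<Longrightarrow> degree (ev c C) \<le> fst l - snd l"
    and ev_eqI: "C \<in> carrier (S_fibre l (ker c)) \<Longrightarrow> D \<in> carrier (S_fibre l (ker c)) \<Longrightarrow> ev c C = ev c D \<Longrightarrow> C = D"
    and S_add_closed: "C \<in> carrier (S_fibre l (ker c)) \<Longrightarrow> D \<in> carrier (S_fibre l (ker c)) \<Longrightarrow>
      C \<oplus>\<^bsub>S_fibre l (ker c)\<^esub> D \<in> carrier (S_fibre l (ker c))"
    and ev_add: "C \<in> carrier (S_fibre l (ker c)) \<Longrightarrow> D \<in> carrier (S_fibre l (ker c)) \<Longrightarrow>
      ev c (C \<oplus>\<^bsub>S_fibre l (ker c)\<^esub> D) = ev c C + ev c D"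
    and S_smult_closed: "C \<in> carrier (S_fibre l (ker c)) \<Longrightarrow> x \<odot>\<^bsub>S_fibre l (ker c)\<^esub> C \<in> carrier (S_fibre l (ker c))"
    and ev_smult: "C \<in> carrier (S_fibre l (ker c)) \<Longrightarrow> ev c (x \<odot>\<^bsub>S_fibre l (ker c)\<^esub> C) = [:x:] * ev c C"
    and S_zero_carrier: "\<zero>\<^bsub>S_fibre l (ker c)\<^esub> \<in> carrier (S_fibre l (ker c))"
    and ev_zero: "ev c \<zero>\<^bsub>S_fibre l (ker c)\<^esub> = 0"
proof -
  interpret P: plane "W_fibre (ker c)" "fib c"
    by (rule plane_W[OF assms])
  note defs = ev_def iv_def S_fibre_def
  show "iv c l f \<in> carrier (S_fibre l (ker c))" "degree f \<le> fst l - snd l \<Longrightarrow> ev c (iv c l f) = f"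
    "C \<in> carrier (S_fibre l (ker c)) \<Longrightarrow> degree (ev c C) \<le> fst l - snd l"
    "\<zero>\<^bsub>S_fibre l (ker c)\<^esub> \<in> carrier (S_fibre l (ker c))" "ev c \<zero>\<^bsub>S_fibre l (ker c)\<^esub> = 0"
    unfolding defs by (simp_all add: P.degree_ev_class)
  show "C \<in> carrier (S_fibre l (ker c)) \<Longrightarrow> D \<in> carrier (S_fibre l (ker c)) \<Longrightarrow> ev c C = ev c D \<Longrightarrow> C = D"
    unfolding defs by (rule P.schur_eqI)
  show "C \<in> carrier (S_fibre l (ker c)) \<Longrightarrow> D \<in> carrier (S_fibre l (ker c)) \<Longrightarrow>
      C \<oplus>\<^bsub>S_fibre l (ker c)\<^esub> D \<in> carrier (S_fibre l (ker c))"
    unfolding defs by (rule P.schur_add_closed)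
  show "C \<in> carrier (S_fibre l (ker c)) \<Longrightarrow> D \<in> carrier (S_fibre l (ker c)) \<Longrightarrow>
      ev c (C \<oplus>\<^bsub>S_fibre l (ker c)\<^esub> D) = ev c C + ev c D"
    unfolding defs by (rule P.ev_class_add)
  show "C \<in> carrier (S_fibre l (ker c)) \<Longrightarrow> x \<odot>\<^bsub>S_fibre l (ker c)\<^esub> C \<in> carrier (S_fibre l (ker c))"
    unfolding defs by (rule P.schur_smult_closed)
  show "C \<in> carrier (S_fibre l (ker c)) \<Longrightarrow> ev c (x \<odot>\<^bsub>S_fibre l (ker c)\<^esub> C) = [:x:] * ev c C"
    unfolding defs by (rule P.ev_class_smult)
qed

lemma z_section_carrier [simp]: "z_section v K \<in> carrier (W_fibre K)"
  by (simp add: W_fibre_simps(1))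

lemma f_map_ev:
  assumes "nondegenerate c" "C \<in> carrier (S_fibre l (ker c))" "snd l \<le> fst l"
  shows "f_map l v (ker c) C \<in> carrier (S_fibre (l + unit_weight 1) (ker c))"
    "ev c (f_map l v (ker c) C) = lin (quot c v) * ev c C"
proof -
  interpret P: plane "W_fibre (ker c)" "fib c"
    by (rule plane_W[OF assms(1)])
  show "f_map l v (ker c) C \<in> carrier (S_fibre (l + unit_weight 1) (ker c))"
    "ev c (f_map l v (ker c) C) = lin (quot c v) * ev c C"
    using P.schur_f_map[OF z_section_carrier, of C l v] assms(2,3) unfolding ev_def S_fibre_def f_map_def by simp_all
qed

lemma g_map_ev:
  assumes "nondegenerate c" "C \<in> carrier (S_fibre l (ker c))" "snd l < fst l"
  shows "g_map l v (ker c) C \<in> carrier (S_fibre (l + unit_weight 2) (ker c))"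
    "ev c (g_map l v (ker c) C) = wedge (fst l - snd l) (quot c v) (ev c C)"
proof -
  interpret P: plane "W_fibre (ker c)" "fib c"
    by (rule plane_W[OF assms(1)])
  show "g_map l v (ker c) C \<in> carrier (S_fibre (l + unit_weight 2) (ker c))"
    "ev c (g_map l v (ker c) C) = wedge (fst l - snd l) (quot c v) (ev c C)"
    using P.schur_g_map[OF z_section_carrier, of C l v] assms(2,3) unfolding ev_def S_fibre_def g_map_def by simp_all
qed

definition const_section :: "nat \<times> nat \<Rightarrow> ('k ^ 'n) word_tensor \<Rightarrow> ('k ^ 'n) set \<Rightarrow> ('k, 'n) schur_elem"
  where "const_section l t K = schur_class l (W_fibre K)
    (gen (map (\<lambda>(x, x'). (z_section x K, z_section x' K)) (fst t)) (map (\<lambda>y. z_section y K) (snd t)))"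

lemma const_section_regular:
  "t \<in> schur_gens l V_module \<Longrightarrow> const_section l t \<in> regular_schur_sections a b l"
  unfolding const_section_def by (cases t) (auto intro: regular_schur_sections.const)

lemma const_section_ev:
  assumes "nondegenerate c" "t \<in> schur_gens l V_module"
  shows "const_section l t (ker c) \<in> carrier (S_fibre l (ker c))"
      "ev c (const_section l t (ker c)) = ev_word (quot c) t"
proof -
  interpret P: plane "W_fibre (ker c)" "fib c"
    by (rule plane_W[OF assms(1)])
  obtain xs ys where t: "t = (xs, ys)"
    by (cases t)
  let ?xs = "map (\<lambda>(x, x'). (z_section x (ker c), z_section x' (ker c))) xs" and ?ys =
      "map (\<lambda>y. z_section y (ker c)) ys"
  have "(?xs, ?ys) \<in> schur_gens l (W_fibre (ker c))"
    using assms(2) by (auto simp: t schur_gens_def)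
  then show "const_section l t (ker c) \<in> carrier (S_fibre l (ker c))"
    unfolding const_section_def S_fibre_def t fst_conv snd_conv by (intro P.schur_class_carrier) simp
  have "ev_word (fib c) (?xs, ?ys) = ev_word (quot c) (xs, ys)"
    by (simp add: ev_word_def o_def case_prod_unfold)
  then show "ev c (const_section l t (ker c)) = ev_word (quot c) t"
    unfolding const_section_def ev_def t fst_conv snd_conv P.ev_schur_class by simp
qed

lemma ker_comb:
  assumes "det2 a b \<noteq> 0"
  shows "ker (\<lambda>i. comb a b (c i)) = ker c"
proof -
  have "comb a b y = (0, 0) \<longleftrightarrow> y = (0, 0)" for y
  proof
    assume 0: "comb a b y = (0, 0)"
    have "det2 a b * fst y = snd b * fst (comb a b y) - fst b * snd (comb a b y)"
      "det2 a b * snd y = fst a * snd (comb a b y) - snd a * fst (comb a b y)"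
      by (simp_all add: comb_def det2_def algebra_simps)
    then show "y = (0, 0)"
      using assms by (simp add: 0 prod_eq_iff)
  qed (simp add: comb_def)
  then show ?thesis
    by (simp add: ker_def quot_comb)
qed

lemma nondegenerate_comb: "nondegenerate c \<Longrightarrow> det2 a b \<noteq> 0 \<Longrightarrow> nondegenerate (\<lambda>i. comb a b (c i))"
  unfolding nondegenerate_def det2_comb by simp

text \<open>Frames that differ by an invertible matrix lie over the same point. On generators the
  wedge factors contribute the power of \<open>det2 a b\<close> and the linear forms undergo the
  substitution; this is the source of the equivariance of blocks.\<close>

lemma ev_comb:
  assumes c: "nondegenerate c" and ab: "det2 a b \<noteq> 0" and C: "C \<in> carrier (S_fibre l (ker c))"
  shows "ev (\<lambda>i. comb a b (c i)) C = [:det2 a b:] ^ snd l * subst_form (fst l - snd l) (lin a) (lin b) (ev c C)"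
proof -
  let ?c = "\<lambda>i. comb a b (c i)"
  interpret P: plane "W_fibre (ker c)" "fib c"
    by (rule plane_W[OF c])
  interpret P': plane "W_fibre (ker ?c)" "fib ?c"
    by (rule plane_W[OF nondegenerate_comb[OF c ab]])
  obtain p where p: "Poly_Mapping.keys p \<subseteq> schur_gens l (W_fibre (ker c))" "C = schur_class l (W_fibre (ker c)) p"
    using C unfolding S_fibre_def by (rule P.schur_carrierE)
  have fib: "fib ?c x = comb a b (fib c x)" for x
    by (simp add: fib_def quot_comb)
  have word: "ev_word (fib ?c) t = [:det2 a b:] ^ snd l
      * subst_form (fst l - snd l) (lin a) (lin b) (ev_word (fib c) t)"
    if "t \<in> schur_gens l (W_fibre (ker c))" for t
  proof -
    have len: "length (fst t) = snd l" "fst l - snd l = length (map (fib c) (snd t))"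
      using that by (auto simp: schur_gens_def)
    have "prod_list (map (\<lambda>(x, x'). det2 (fib ?c x) (fib ?c x')) xs)
        = det2 a b ^ length xs * prod_list (map (\<lambda>(x, x'). det2 (fib c x) (fib c x')) xs)" for xs
      by (induction xs) (auto simp: fib det2_comb mult_ac)
    moreover have "subst_form (fst l - snd l) (lin a) (lin b) (prod_list (map lin (map (fib c) (snd t))))
        = prod_list (map lin (map (fib ?c) (snd t)))"
      unfolding len(2) subst_form_prod_list by (simp add: lin_comb fib o_def)
    ultimately show ?thesis
      unfolding ev_word_def subst_form_const_mult by (simp only: len(1) const_poly_simps mult.assoc)
  qed
  have "ev_tensor (fib ?c) p = [:det2 a b:] ^ snd l
      * subst_form (fst l - snd l) (lin a) (lin b) (ev_tensor (fib c) p)"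
    unfolding ev_tensor_def subst_form_sum subst_form_const_mult sum_distrib_left
  proof (rule sum.cong[OF refl])
    fix t assume "t \<in> Poly_Mapping.keys p"
    then have "t \<in> schur_gens l (W_fibre (ker c))"
      using p(1) by blast
    then show "[:Poly_Mapping.lookup p t:] * ev_word (fib ?c) t
        = [:det2 a b:] ^ snd l * ([:Poly_Mapping.lookup p t:]
            * subst_form (fst l - snd l) (lin a) (lin b) (ev_word (fib c) t))"
      by (simp only: word mult.left_commute)
  qed
  then show ?thesis
    using P'.ev_schur_class[of l p] unfolding ev_def p(2) P.ev_schur_class ker_comb[OF ab] by simp
qed

lemma poly_maps_quot: "(\<lambda>c. [:fst (quot c v):]) \<in> poly_maps" "(\<lambda>c. [:snd (quot c v):]) \<in> poly_maps"
proof -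
  have const_sum: "[:\<Sum>i\<in>I. f i:] = (\<Sum>i\<in>I. [:f i:])" for f :: "'n \<Rightarrow> 'k" and I
    by (induction I rule: infinite_finite_induct) (simp_all add: const_poly_simps(1) del: add_pCons)
  show "(\<lambda>c. [:fst (quot c v):]) \<in> poly_maps" "(\<lambda>c. [:snd (quot c v):]) \<in> poly_maps"
    unfolding quot_def fst_conv snd_conv const_sum const_poly_simps by (intro poly_maps_intros)+
qed

lemma poly_maps_det2_quot: "(\<lambda>c. [:det2 (quot c v) (quot c w):]) \<in> poly_maps"
  unfolding det2_def const_poly_simps by (intro poly_maps_diff poly_maps_mult poly_maps_quot)

lemma poly_maps_ev_word: "(\<lambda>c. ev_word (quot c) t) \<in> poly_maps"
proof -
  have lin: "(\<lambda>c. lin (quot c v)) \<in> poly_maps" for v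
  proof -
    have "(\<lambda>c. [:fst (quot c v):] + [:snd (quot c v):] * [:0, 1:]) \<in> poly_maps"
      by (intro poly_maps_intros poly_maps_quot)
    then show ?thesis
      by (simp add: lin_def)
  qed
  have "(\<lambda>c. [:prod_list (map (\<lambda>(x, x'). det2 (quot c x) (quot c x')) xs):]) \<in> poly_maps" for xs
  proof (induction xs)
    case (Cons x xs)
    then show ?case
      unfolding list.map prod_list.Cons const_poly_simps case_prod_unfold
      by (intro poly_maps_mult poly_maps_det2_quot)
  qed (auto intro: poly_maps.const)
  moreover have "(\<lambda>c. prod_list (map lin (map (quot c) ys))) \<in> poly_maps" for ys
    by (induction ys) (auto intro: poly_maps.const poly_maps_mult lin)
  ultimately show ?thesis
    unfolding ev_word_def by (intro poly_maps_mult)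
qed

text \<open>By Cramer's rule the chart coordinates, pulled back to frames, are quotients of minors
  with one fixed denominator.\<close>

lemma chart_if_det2:
  assumes "det2 (c i) (c j) \<noteq> 0"
  shows "ker c \<in> chart (u i) (u j)"
    "chart_coord (u i) (u j) v (ker c) =
        (det2 (quot c v) (c j) / det2 (c i) (c j), det2 (c i) (quot c v) / det2 (c i) (c j))"
proof -
  have solve: "v - (fst p *s u i + snd p *s u j) \<in> ker c \<longleftrightarrow>
      p = (det2 (quot c v) (c j) / det2 (c i) (c j), det2 (c i) (quot c v) / det2 (c i) (c j))" for v p
    using quot_solve[of c "u i" "u j" v p] assms by simp
  have "nondegenerate c"
    using assms unfolding nondegenerate_def by blast
  then show "ker c \<in> chart (u i) (u j)"
    using ker_in_Gr2 by (simp add: chart_def solve)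
  show "chart_coord (u i) (u j) v (ker c) =
      (det2 (quot c v) (c j) / det2 (c i) (c j), det2 (c i) (quot c v) / det2 (c i) (c j))"
    unfolding chart_coord_def solve by simp
qed

text \<open>Coordinate functions have the minor of the chart as denominator; sums and products are
  brought to a common power of it.\<close>

lemma regular_functions_on_frames:
  assumes "f \<in> regular_functions (u i) (u j)"
  shows "\<exists>N. \<exists>P\<in>poly_maps. \<forall>c. det2 (c i) (c j) \<noteq> 0 \<longrightarrow> [:det2 (c i) (c j):] ^ N * [:f (ker c):] = P c"
  using assms
proof induction
  case (const x)
  then show ?case
    by (intro exI[of _ 0] bexI[of _ "\<lambda>_. [:x:]"]) (auto intro: poly_maps.const)
next
  case (coord_fst v)
  have "(\<lambda>c. [:det2 (quot c v) (c j):]) \<in> poly_maps"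
    using poly_maps_det2_quot[of v "u j"] by simp
  then show ?case
    by (intro exI[of _ 1] bexI[of _ "\<lambda>c. [:det2 (quot c v) (c j):]"]) (auto simp: chart_if_det2)
next
  case (coord_snd v)
  have "(\<lambda>c. [:det2 (c i) (quot c v):]) \<in> poly_maps"
    using poly_maps_det2_quot[of "u i" v] by simp
  then show ?case
    by (intro exI[of _ 1] bexI[of _ "\<lambda>c. [:det2 (c i) (quot c v):]"]) (auto simp: chart_if_det2)
next
  case (add f g)
  then obtain M N P Q where P: "P \<in> poly_maps"
      "\<And>c. det2 (c i) (c j) \<noteq> 0 \<Longrightarrow> [:det2 (c i) (c j):] ^ M * [:f (ker c):] = P c"
    and Q: "Q \<in> poly_maps" "\<And>c. det2 (c i) (c j) \<noteq> 0 \<Longrightarrow> [:det2 (c i) (c j):] ^ N * [:g (ker c):] = Q c"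
    by blast
  have mem: "(\<lambda>c. [:det2 (c i) (c j):] ^ N * P c + [:det2 (c i) (c j):] ^ M * Q c) \<in> poly_maps"
    by (intro poly_maps_intros P Q)
  have eq: "[:det2 (c i) (c j):] ^ (M + N) * [:f (ker c) + g (ker c):]
      = [:det2 (c i) (c j):] ^ N * P c + [:det2 (c i) (c j):] ^ M * Q c" if "det2 (c i) (c j) \<noteq> 0" for c
    unfolding P(2)[OF that, symmetric] Q(2)[OF that, symmetric] power_add const_poly_simps by
        (simp only: algebra_simps)
  show ?case
    by (rule exI[of _ "M + N"], rule bexI[OF _ mem], intro allI impI, rule eq)
next
  case (mult f g)
  then obtain M N P Q where P: "P \<in> poly_maps"
      "\<And>c. det2 (c i) (c j) \<noteq> 0 \<Longrightarrow> [:det2 (c i) (c j):] ^ M * [:f (ker c):] = P c"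
    and Q: "Q \<in> poly_maps" "\<And>c. det2 (c i) (c j) \<noteq> 0 \<Longrightarrow> [:det2 (c i) (c j):] ^ N * [:g (ker c):] = Q c"
    by blast
  have mem: "(\<lambda>c. P c * Q c) \<in> poly_maps"
    by (intro poly_maps_intros P Q)
  have eq: "[:det2 (c i) (c j):] ^ (M + N) * [:f (ker c) * g (ker c):] = P c * Q c" if "det2 (c i) (c j) \<noteq> 0" for c
    unfolding P(2)[OF that, symmetric] Q(2)[OF that, symmetric] power_add const_poly_simps by (simp only: mult_ac)
  show ?case
    by (rule exI[of _ "M + N"], rule bexI[OF _ mem], intro allI impI, rule eq)
qed

lemma regular_section_carrier:
  assumes "t \<in> regular_schur_sections a b l" "nondegenerate c"
  shows "t (ker c) \<in> carrier (S_fibre l (ker c))"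
  using assms(1)
proof induction
  case (const xs ys)
  then show ?case
    using const_section_ev(1)[OF assms(2) const] by (simp add: const_section_def)
qed (auto intro: S_add_closed S_smult_closed assms(2))

lemma regular_sections_on_frames:
  assumes "t \<in> regular_schur_sections (u i) (u j) l"
  shows "\<exists>N. \<exists>P\<in>poly_maps. \<forall>c. det2 (c i) (c j) \<noteq> 0 \<longrightarrow> [:det2 (c i) (c j):] ^ N * ev c (t (ker c)) = P c"
  using assms
proof induction
  case (const xs ys)
  have "ev c (const_section l (xs, ys) (ker c)) = ev_word (quot c) (xs, ys)" if "det2 (c i) (c j) \<noteq> 0" for c
    by (rule const_section_ev(2)[OF _ const]) (use that in \<open>auto simp only: nondegenerate_def\<close>)
  then show ?case
    by (intro exI[of _ 0] bexI[of _ "\<lambda>c. ev_word (quot c) (xs, ys)"]) (auto simp: const_section_def poly_maps_ev_word)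
next
  case (add s t)
  then obtain M N P Q where P: "P \<in> poly_maps"
      "\<And>c. det2 (c i) (c j) \<noteq> 0 \<Longrightarrow> [:det2 (c i) (c j):] ^ M * ev c (s (ker c)) = P c"
    and Q: "Q \<in> poly_maps" "\<And>c. det2 (c i) (c j) \<noteq> 0 \<Longrightarrow> [:det2 (c i) (c j):] ^ N * ev c (t (ker c)) = Q c"
    by blast
  have mem: "(\<lambda>c. [:det2 (c i) (c j):] ^ N * P c + [:det2 (c i) (c j):] ^ M * Q c) \<in> poly_maps"
    by (intro poly_maps_intros P Q)
  have eq: "[:det2 (c i) (c j):] ^ (M + N) * ev c (s (ker c) \<oplus>\<^bsub>S_fibre l (ker c)\<^esub> t (ker c))
      = [:det2 (c i) (c j):] ^ N * P c + [:det2 (c i) (c j):] ^ M * Q c" if det: "det2 (c i) (c j) \<noteq> 0" for c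
  proof -
    have c: "nondegenerate c"
      using det unfolding nondegenerate_def by blast
    have "ev c (s (ker c) \<oplus>\<^bsub>S_fibre l (ker c)\<^esub> t (ker c)) = ev c (s (ker c)) + ev c (t (ker c))"
      by (rule ev_add[OF c]) (rule regular_section_carrier[OF add(1) c], rule regular_section_carrier[OF add(2) c])
    then show ?thesis
      unfolding P(2)[OF det, symmetric] Q(2)[OF det, symmetric] power_add by (simp only: algebra_simps)
  qed
  show ?case
    by (rule exI[of _ "M + N"], rule bexI[OF _ mem], intro allI impI, rule eq)
next
  case (smult p t)
  obtain M P where P: "P \<in> poly_maps" "\<And>c. det2 (c i) (c j) \<noteq> 0 \<Longrightarrow> [:det2 (c i) (c j):] ^ M * [:p (ker c):] = P c"
    using regular_functions_on_frames[OF smult(1)] by blast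
  obtain N Q where Q: "Q \<in> poly_maps" "\<And>c. det2 (c i) (c j) \<noteq> 0 \<Longrightarrow> [:det2 (c i) (c j):] ^ N * ev c (t (ker c)) = Q c"
    using smult.IH by blast
  have mem: "(\<lambda>c. P c * Q c) \<in> poly_maps"
    by (intro poly_maps_intros P Q)
  have eq: "[:det2 (c i) (c j):] ^ (M + N) * ev c (p (ker c) \<odot>\<^bsub>S_fibre l (ker c)\<^esub> t (ker c)) = P c * Q c"
    if det: "det2 (c i) (c j) \<noteq> 0" for c
  proof -
    have c: "nondegenerate c"
      using det unfolding nondegenerate_def by blast
    have "ev c (p (ker c) \<odot>\<^bsub>S_fibre l (ker c)\<^esub> t (ker c)) = [:p (ker c):] * ev c (t (ker c))"
      by (rule ev_smult[OF c]) (rule regular_section_carrier[OF smult(2) c])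
    then show ?thesis
      unfolding P(2)[OF det, symmetric] Q(2)[OF det, symmetric] power_add by (simp only: mult_ac)
  qed
  show ?case
    by (rule exI[of _ "M + N"], rule bexI[OF _ mem], intro allI impI, rule eq)
qed

subsection \<open>Blocks of endomorphisms\<close>

lemma finite_young: "finite (young m)"
proof (rule finite_subset)
  show "young m \<subseteq> {..m} \<times> {..m}"
    by (auto simp: young_def)
qed simp

lemma E_fibre_simps:
  "carrier (E_fibre K :: ('k, nat \<times> nat \<Rightarrow> ('k, 'n) schur_elem) module) =
      (\<Pi>\<^sub>E l\<in>young (CARD('n) - 2). carrier (S_fibre l K))"
  "\<zero>\<^bsub>E_fibre K :: ('k, nat \<times> nat \<Rightarrow> ('k, 'n) schur_elem) module\<^esub> = (\<lambda>l\<in>young (CARD('n) - 2). \<zero>\<^bsub>S_fibre l K\<^esub>)"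
  "s \<oplus>\<^bsub>E_fibre K :: ('k, nat \<times> nat \<Rightarrow> ('k, 'n) schur_elem) module\<^esub> t =
      (\<lambda>l\<in>young (CARD('n) - 2). s l \<oplus>\<^bsub>S_fibre l K\<^esub> t l)"
  "a \<odot>\<^bsub>E_fibre K :: ('k, nat \<times> nat \<Rightarrow> ('k, 'n) schur_elem) module\<^esub> s = (\<lambda>l\<in>young (CARD('n) - 2). a \<odot>\<^bsub>S_fibre l K\<^esub> s l)"
  by (simp_all add: E_fibre_def direct_sum_def vector_module_def)

text \<open>One form for each summand of E, set to zero off the index set. Equality of families then
  is equality of functions, and families can be added pointwise.\<close>

definition forms :: "(nat \<times> nat \<Rightarrow> 'k poly) set"
  where "forms = {f. \<forall>l. (l \<in> young (CARD('n) - 2) \<longrightarrow> degree (f l) \<le> fst l - snd l) \<and>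
      (l \<notin> young (CARD('n) - 2) \<longrightarrow> f l = 0)}"

lemma formsI:
  "(\<And>l. l \<in> young (CARD('n) - 2) \<Longrightarrow> degree (f l) \<le> fst l - snd l) \<Longrightarrow> (\<And>l. l \<notin> young (CARD('n) - 2) \<Longrightarrow> f l = 0) \<Longrightarrow> f
      \<in> forms"
  unfolding forms_def by blast

lemma formsD:
  assumes "f \<in> forms"
  shows "l \<in> young (CARD('n) - 2) \<Longrightarrow> degree (f l) \<le> fst l - snd l" "l \<notin> young (CARD('n) - 2) \<Longrightarrow> f l = 0"
  using assms unfolding forms_def by blast+

definition EV :: "('k, 'n) frame \<Rightarrow> (nat \<times> nat \<Rightarrow> ('k, 'n) schur_elem) \<Rightarrow> nat \<times> nat \<Rightarrow> 'k poly"
  where "EV c s = (\<lambda>l. if l \<in> young (CARD('n) - 2) then ev c (s l) else 0)"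

definition IV :: "('k, 'n) frame \<Rightarrow> (nat \<times> nat \<Rightarrow> 'k poly) \<Rightarrow> nat \<times> nat \<Rightarrow> ('k, 'n) schur_elem"
  where "IV c f = (\<lambda>l\<in>young (CARD('n) - 2). iv c l (f l))"

lemma E_carrier_component:
  fixes K :: "('k ^ 'n) set"
  shows "s \<in> carrier (E_fibre K) \<Longrightarrow> l \<in> young (CARD('n) - 2) \<Longrightarrow> s l \<in> carrier (S_fibre l K)"
  by (simp add: E_fibre_simps(1) PiE_iff)

lemma IV_carrier: "nondegenerate c \<Longrightarrow> IV c f \<in> carrier (E_fibre (ker c))"
  by (simp add: E_fibre_simps IV_def iv_carrier)

lemma EV_IV:
  assumes "nondegenerate c" "f \<in> forms"
  shows "EV c (IV c f) = f"
proof
  fix l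
  show "EV c (IV c f) l = f l"
    using ev_iv[OF assms(1) formsD(1)[OF assms(2)], of l] formsD(2)[OF assms(2), of l]
    by (cases "l \<in> young (CARD('n) - 2)") (simp_all add: EV_def IV_def)
qed

lemma EV_forms: "nondegenerate c \<Longrightarrow> s \<in> carrier (E_fibre (ker c)) \<Longrightarrow> EV c s \<in> forms"
  by (rule formsI) (simp_all add: EV_def degree_ev E_carrier_component)

lemma EV_eqI:
  assumes c: "nondegenerate c" and s: "s \<in> carrier (E_fibre (ker c))" and t: "t \<in> carrier (E_fibre (ker c))"
    and eq: "\<And>l. l \<in> young (CARD('n) - 2) \<Longrightarrow> EV c s l = EV c t l"
  shows "s = t"
proof (rule PiE_ext[OF s[unfolded E_fibre_simps] t[unfolded E_fibre_simps]])
  fix l :: "nat \<times> nat" assume l: "l \<in> young (CARD('n) - 2)"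
  show "s l = t l"
    by (rule ev_eqI[OF c E_carrier_component[OF s l] E_carrier_component[OF t l]])
        (use eq[OF l] l in \<open>simp add: EV_def\<close>)
qed

lemma IV_EV:
  assumes c: "nondegenerate c" and s: "s \<in> carrier (E_fibre (ker c))"
  shows "IV c (EV c s) = s"
  by (rule EV_eqI[OF c IV_carrier[OF c] s]) (simp only: EV_IV[OF c EV_forms[OF c s]])

lemma E_add_closed:
  "nondegenerate c \<Longrightarrow> s \<in> carrier (E_fibre (ker c)) \<Longrightarrow> t \<in> carrier (E_fibre (ker c)) \<Longrightarrow>
    s \<oplus>\<^bsub>E_fibre (ker c)\<^esub> t \<in> carrier (E_fibre (ker c))"
  unfolding E_fibre_simps(1,3) by (auto intro!: restrict_PiE S_add_closed)

lemma EV_add: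
  "nondegenerate c \<Longrightarrow> s \<in> carrier (E_fibre (ker c)) \<Longrightarrow> t \<in> carrier (E_fibre (ker c)) \<Longrightarrow>
    EV c (s \<oplus>\<^bsub>E_fibre (ker c)\<^esub> t) l = EV c s l + EV c t l"
  by (simp add: EV_def E_fibre_simps(3) ev_add E_carrier_component)

lemma E_smult_closed:
  "nondegenerate c \<Longrightarrow> s \<in> carrier (E_fibre (ker c)) \<Longrightarrow> a \<odot>\<^bsub>E_fibre (ker c)\<^esub> s \<in> carrier (E_fibre (ker c))"
  unfolding E_fibre_simps(1,4) by (auto intro!: restrict_PiE S_smult_closed)

lemma EV_smult:
  "nondegenerate c \<Longrightarrow> s \<in> carrier (E_fibre (ker c)) \<Longrightarrow> EV c (a \<odot>\<^bsub>E_fibre (ker c)\<^esub> s) l = [:a:] * EV c s l"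
  by (simp add: EV_def E_fibre_simps(4) ev_smult E_carrier_component)

definition single_form :: "nat \<times> nat \<Rightarrow> 'k poly \<Rightarrow> nat \<times> nat \<Rightarrow> 'k poly"
  where "single_form l p = (\<lambda>l'. if l' = l then p else 0)"

lemma single_form_forms: "l \<in> young (CARD('n) - 2) \<Longrightarrow> degree p \<le> fst l - snd l \<Longrightarrow> single_form l p \<in> forms"
  by (rule formsI) (auto simp: single_form_def)

text \<open>The component from summand l to summand r of an endomorphism of the fibre of E, read on
  the forms that the frame c provides.\<close>

definition block ::
    "((nat \<times> nat \<Rightarrow> ('k, 'n) schur_elem) \<Rightarrow> (nat \<times> nat \<Rightarrow> ('k, 'n) schur_elem)) \<Rightarrow> nat \<times> nat \<Rightarrow> nat \<times> nat
      \<Rightarrow> ('k, 'n) frame \<Rightarrow> 'k poly \<Rightarrow> 'k poly"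
  where "block h l r c p = EV c (h (IV c (single_form l p))) r"

lemma linear_mapsD:
  assumes "h \<in> linear_maps M N"
  shows "x \<in> carrier M \<Longrightarrow> h x \<in> carrier N"
    "x \<in> carrier M \<Longrightarrow> y \<in> carrier M \<Longrightarrow> h (x \<oplus>\<^bsub>M\<^esub> y) = h x \<oplus>\<^bsub>N\<^esub> h y"
    "x \<in> carrier M \<Longrightarrow> h (a \<odot>\<^bsub>M\<^esub> x) = a \<odot>\<^bsub>N\<^esub> h x"
  using assms by (auto simp: linear_maps_def dest: PiE_mem)

lemma linear_map_EV:
  assumes c: "nondegenerate c" and h: "h \<in> linear_maps (E_fibre (ker c)) (E_fibre (ker c))"
    and f: "f \<in> forms" and g: "g \<in> forms"
  shows "EV c (h (IV c (\<lambda>l. f l + g l))) r = EV c (h (IV c f)) r + EV c (h (IV c g)) r"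
    "EV c (h (IV c (\<lambda>l. [:a:] * f l))) r = [:a:] * EV c (h (IV c f)) r"
proof -
  have fg: "(\<lambda>l. f l + g l) \<in> forms"
    by (rule formsI) (simp_all add: formsD[OF f] formsD[OF g] degree_add_le)
  have af: "(\<lambda>l. [:a:] * f l) \<in> forms"
    by (rule formsI) (simp_all add: formsD[OF f] order.trans[OF degree_smult_le])
  note car = IV_carrier[OF c]
  have 1: "IV c (\<lambda>l. f l + g l) = IV c f \<oplus>\<^bsub>E_fibre (ker c)\<^esub> IV c g"
    by (rule EV_eqI[OF c car E_add_closed[OF c car car]]) (simp add: EV_add[OF c car car] EV_IV[OF c] f g fg)
  have 2: "IV c (\<lambda>l. [:a:] * f l) = a \<odot>\<^bsub>E_fibre (ker c)\<^esub> IV c f"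
    by (rule EV_eqI[OF c car E_smult_closed[OF c car]]) (simp only: EV_smult[OF c car] EV_IV[OF c] f af)
  show "EV c (h (IV c (\<lambda>l. f l + g l))) r = EV c (h (IV c f)) r + EV c (h (IV c g)) r"
    unfolding 1 linear_mapsD(2)[OF h car car] by (rule EV_add[OF c]) (rule linear_mapsD(1)[OF h car])+
  show "EV c (h (IV c (\<lambda>l. [:a:] * f l))) r = [:a:] * EV c (h (IV c f)) r"
    unfolding 2 linear_mapsD(3)[OF h car] by (rule EV_smult[OF c]) (rule linear_mapsD(1)[OF h car])
qed

lemma zero_forms: "(\<lambda>_. 0) \<in> forms"
  by (simp add: forms_def)

lemma linear_map_zero:
  assumes c: "nondegenerate c" and h: "h \<in> linear_maps (E_fibre (ker c)) (E_fibre (ker c))"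
  shows "EV c (h (IV c (\<lambda>_. 0))) r = 0"
  using linear_map_EV(2)[OF c h zero_forms zero_forms, of 0 r] by simp

text \<open>A family of forms is the sum of its single components. They are split off one at a time,
  so that additivity for two families suffices.\<close>

lemma linear_map_blocks:
  assumes c: "nondegenerate c" and h: "h \<in> linear_maps (E_fibre (ker c)) (E_fibre (ker c))"
    and s: "s \<in> carrier (E_fibre (ker c))"
  shows "EV c (h s) r = (\<Sum>l\<in>young (CARD('n) - 2). block h l r c (EV c s l))"
proof -
  define f where "f = EV c s"
  have f: "f \<in> forms"
    unfolding f_def by (rule EV_forms[OF c s])
  have "EV c (h (IV c (\<lambda>l. if l \<in> A then f l else 0))) r = (\<Sum>l\<in>A. block h l r c (f l))"
    if "finite A" "A \<subseteq> young (CARD('n) - 2)" for A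
    using that
  proof (induction A)
    case empty
    then show ?case
      using linear_map_zero[OF c h] by simp
  next
    case (insert l A)
    have "(\<lambda>l'. if l' \<in> insert l A then f l' else 0) = (\<lambda>l'. single_form l (f l) l' + (if l' \<in> A then f l' else 0))"
      using insert.hyps by (auto simp: single_form_def)
    moreover have "single_form l (f l) \<in> forms"
      using insert.prems by (intro single_form_forms formsD(1)[OF f]) auto
    moreover have "(\<lambda>l'. if l' \<in> A then f l' else 0) \<in> forms"
      by (rule formsI) (simp_all add: formsD[OF f])
    ultimately have "EV c (h (IV c (\<lambda>l'. if l' \<in> insert l A then f l' else 0))) r
        = block h l r c (f l) + EV c (h (IV c (\<lambda>l'. if l' \<in> A then f l' else 0))) r"
      using linear_map_EV(1)[OF c h] by (simp add: block_def)
    then show ?case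
      using insert by simp
  qed
  from this[of "young (CARD('n) - 2)"] have "EV c (h (IV c (\<lambda>l. if l \<in> young (CARD('n) - 2) then f l else 0))) r
      = (\<Sum>l\<in>young (CARD('n) - 2). block h l r c (f l))"
    using finite_young by simp
  moreover have "(\<lambda>l. if l \<in> young (CARD('n) - 2) then f l else 0) = f"
    using formsD(2)[OF f] by auto
  ultimately show ?thesis
    using IV_EV[OF c s] by (simp add: f_def)
qed

lemma block_linear:
  assumes c: "nondegenerate c" and h: "h \<in> linear_maps (E_fibre (ker c)) (E_fibre (ker c))"
    and l: "l \<in> young (CARD('n) - 2)" and r: "r \<in> young (CARD('n) - 2)"
  shows "degree p \<le> fst l - snd l \<Longrightarrow> degree q \<le> fst l - snd l \<Longrightarrow> block h l r c (p + q) = block h l r c p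
      + block h l r c q"
    "degree p \<le> fst l - snd l \<Longrightarrow> block h l r c ([:a:] * p) = [:a:] * block h l r c p"
    "degree (block h l r c p) \<le> fst r - snd r"
proof -
  show "block h l r c (p + q) = block h l r c p + block h l r c q"
    if "degree p \<le> fst l - snd l" "degree q \<le> fst l - snd l"
  proof -
    have "single_form l (p + q) = (\<lambda>l'. single_form l p l' + single_form l q l')"
      by (auto simp: single_form_def)
    then show ?thesis
      unfolding block_def using linear_map_EV(1)[OF c h single_form_forms[OF l that(1)]
          single_form_forms[OF l that(2)]] by simp
  qed
  show "block h l r c ([:a:] * p) = [:a:] * block h l r c p" if p: "degree p \<le> fst l - snd l"
  proof -
    have "single_form l ([:a:] * p) = (\<lambda>l'. [:a:] * single_form l p l')"
      by (auto simp: single_form_def)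
    then show ?thesis
      unfolding block_def using linear_map_EV(2)[OF c h single_form_forms[OF l p] zero_forms] by simp
  qed
  have "EV c (h (IV c (single_form l p))) \<in> forms"
    by (rule EV_forms[OF c]) (rule linear_mapsD(1)[OF h IV_carrier[OF c]])
  then show "degree (block h l r c p) \<le> fst r - snd r"
    unfolding block_def using r by (rule formsD(1))
qed

text \<open>The endomorphism depends on the point and not on the frame. One element of the fibre is
  read in the frame \<open>c\<close> and in its transform, and the change of reading is known on
  source and target.\<close>

lemma block_equivariant:
  assumes c: "nondegenerate c" and h: "h \<in> linear_maps (E_fibre (ker c)) (E_fibre (ker c))"
    and l: "l \<in> young (CARD('n) - 2)" and r: "r \<in> young (CARD('n) - 2)" and ab: "det2 a b \<noteq> 0"
        and p: "degree p \<le> fst l - snd l"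
  shows "[:det2 a b:] ^ snd l * block h l r (\<lambda>i. comb a b (c i)) (subst_form (fst l - snd l) (lin a) (lin b) p)
    = [:det2 a b:] ^ snd r * subst_form (fst r - snd r) (lin a) (lin b) (block h l r c p)"
proof -
  let ?c = "\<lambda>i. comb a b (c i)" and ?S = "subst_form (fst l - snd l) (lin a) (lin b) p"
  have c': "nondegenerate ?c"
    by (rule nondegenerate_comb[OF c ab])
  note K = ker_comb[OF ab, of c]
  have h': "h \<in> linear_maps (E_fibre (ker ?c)) (E_fibre (ker ?c))"
    using h by (simp only: K)
  have S: "degree ?S \<le> fst l - snd l"
    by (rule degree_subst_form) (rule degree_lin)+
  define s where "s = IV c (single_form l p)"
  define s' where "s' = IV ?c (single_form l ?S)"
  have s: "s \<in> carrier (E_fibre (ker ?c))"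
    unfolding s_def K by (rule IV_carrier[OF c])
  have s': "s' \<in> carrier (E_fibre (ker ?c))"
    unfolding s'_def by (rule IV_carrier[OF c'])
  have EV_comb: "EV ?c t l = [:det2 a b:] ^ snd l * subst_form (fst l - snd l) (lin a) (lin b) (EV c t l)"
    if t: "t \<in> carrier (E_fibre (ker c))" for t l
    using ev_comb[OF c ab E_carrier_component[OF t]] by (simp add: EV_def)
  \<comment> \<open>In the new frame the element with old form p has the substituted form times a
    determinant power, so it is a scalar multiple of the element built from the substituted
    form.\<close>
  have "s = (det2 a b ^ snd l) \<odot>\<^bsub>E_fibre (ker ?c)\<^esub> s'"
  proof (rule EV_eqI[OF c' s E_smult_closed[OF c' s']])
    fix l' :: "nat \<times> nat"
    show "EV ?c s l' = EV ?c ((det2 a b ^ snd l) \<odot>\<^bsub>E_fibre (ker ?c)\<^esub> s') l'"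
      unfolding EV_smult[OF c' s'] EV_comb[OF s[unfolded K]]
      unfolding s_def s'_def EV_IV[OF c single_form_forms[OF l p]] EV_IV[OF c' single_form_forms[OF l S]]
      by (simp add: single_form_def const_poly_simps(5) del: mult_pCons_left)
  qed
  then have "EV ?c (h s) r = [:det2 a b ^ snd l:] * EV ?c (h s') r"
    using EV_smult[OF c' linear_mapsD(1)[OF h' s']] by (simp only: linear_mapsD(3)[OF h' s'])
  moreover have "EV ?c (h s) r = [:det2 a b:] ^ snd r * subst_form (fst r - snd r) (lin a) (lin b) (EV c (h s) r)"
    by (rule EV_comb) (rule linear_mapsD(1)[OF h s[unfolded K]])
  ultimately show ?thesis
    unfolding block_def s_def[symmetric] s'_def[symmetric] const_poly_simps by simp
qed

lemma End_E_linear: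
  fixes \<phi> :: "('k, 'n) E_endo"
  shows "\<phi> \<in> carrier End_E \<Longrightarrow> nondegenerate c \<Longrightarrow> \<phi> (ker c) \<in> linear_maps (E_fibre (ker c)) (E_fibre (ker c))"
  using ker_in_Gr2 by (auto simp: End_E_def dest: PiE_mem)

text \<open>Regular sections are generated by constant tensors, sums and multiples, so zero has to
  be produced as the function 0 times some constant tensor.\<close>

definition zero_section :: "nat \<times> nat \<Rightarrow> ('k ^ 'n) set \<Rightarrow> ('k, 'n) schur_elem"
  where "zero_section l = (\<lambda>K. 0 \<odot>\<^bsub>S_fibre l K\<^esub> const_section l (replicate (snd l) (0, 0),
      replicate (fst l - snd l) 0) K)"

lemma zero_section_gens: "(replicate (snd l) (0, 0), replicate (fst l - snd l) 0) \<in> schur_gens l V_module"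
  by (simp add: schur_gens_def)

lemma zero_section_regular: "zero_section l \<in> regular_schur_sections a b l"
  unfolding zero_section_def
  by (rule regular_schur_sections.smult[OF regular_functions.const const_section_regular[OF zero_section_gens]])

lemma zero_section_eq:
  assumes c: "nondegenerate c"
  shows "zero_section l (ker c) = \<zero>\<^bsub>S_fibre l (ker c)\<^esub>"
proof -
  note const = const_section_ev(1)[OF c zero_section_gens]
  show ?thesis
    unfolding zero_section_def
    by (rule ev_eqI[OF c S_smult_closed[OF c const] S_zero_carrier[OF c]])
      (simp add: ev_smult[OF c const] ev_zero[OF c])
qed

lemma chart_subset_Gr2: "chart a b \<subseteq> Gr2"
  by (auto simp: chart_def)

text \<open>A form that is constant in the frame is not a section, so \<phi> cannot be applied to it
  directly. Constant tensors in \<open>u i\<close> and \<open>u j\<close> are sections, with forms a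
  determinant power times the products \<open>L c k\<close>. Their images are regular, and p is
  recovered from the \<open>L c k\<close> after multiplication by a power of the minor.\<close>

lemma block_locally_regular:
  assumes \<phi>: "\<phi> \<in> carrier End_E" and l: "l \<in> young (CARD('n) - 2)" and r: "r \<in> young (CARD('n) - 2)"
      and p: "degree p \<le> fst l - snd l"
  shows "locally_regular (\<lambda>c. block (\<phi> (ker c)) l r c p)"
  unfolding locally_regular_def
proof (intro allI)
  fix i j :: 'n
  let ?m = "fst l - snd l"
  let ?t = "\<lambda>k. (replicate (snd l) (u i, u j), replicate (?m - k) (u i) @ replicate k (u j))"
  define L where "L c k = lin (c i) ^ (?m - k) * lin (c j) ^ k" for c :: "('k, 'n) frame" and k
  have nd: "nondegenerate c" if "det2 (c i) (c j) \<noteq> 0" for c :: "('k, 'n) frame"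
    using that unfolding nondegenerate_def by blast
  have degL: "degree (L c k) \<le> ?m" if "k \<le> ?m" for c k
    using degree_prod_list_lin[of "replicate (?m - k) (c i) @ replicate k (c j)"] that
    by (simp add: L_def map_replicate_const)
  have gens: "?t k \<in> schur_gens l V_module" if "k \<le> ?m" for k
    using that by (simp add: schur_gens_def)
  have word: "ev_word (quot c) (?t k) = [:det2 (c i) (c j) ^ snd l:] * L c k" for c k
    by (simp add: ev_word_def L_def map_replicate_const)
  have "\<exists>N. \<exists>P\<in>poly_maps. \<forall>c. det2 (c i) (c j) \<noteq> 0 \<longrightarrow>
      [:det2 (c i) (c j):] ^ N * block (\<phi> (ker c)) l r c (L c k) = P c" if k: "k \<le> ?m" for k
  proof -
    \<comment> \<open>The constant tensor placed in summand l and completed by zeros, as a section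
      of E over the chart.\<close>
    define \<sigma> where "\<sigma> = (\<lambda>K\<in>chart (u i) (u j). \<lambda>l'\<in>young (CARD('n) - 2). if l' =
        l then const_section l (?t k) K else \<zero>\<^bsub>S_fibre l' K\<^esub>)"
    have \<sigma>_ker: "\<sigma> (ker c) \<in> carrier (E_fibre (ker c))" if "nondegenerate c" "ker c \<in> chart (u i) (u j)" for c
      using that const_section_ev(1)[OF _ gens[OF k]] S_zero_carrier unfolding E_fibre_simps \<sigma>_def by auto
    have "\<sigma> \<in> E_sections (u i) (u j)"
      unfolding E_sections_def
    proof (intro CollectI conjI ballI)
      show "\<sigma> \<in> (\<Pi>\<^sub>E K\<in>chart (u i) (u j). carrier (E_fibre K))"
      proof (rule PiE_I)
        fix K assume K: "K \<in> chart (u i) (u j)"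
        then obtain c where "nondegenerate c" "K = ker c"
          using Gr2_is_ker chart_subset_Gr2 by blast
        then show "\<sigma> K \<in> carrier (E_fibre K)"
          using \<sigma>_ker K by blast
      qed (simp add: \<sigma>_def)
      fix l' :: "nat \<times> nat" assume l': "l' \<in> young (CARD('n) - 2)"
      show "\<exists>t\<in>regular_schur_sections (u i) (u j) l'. \<forall>K\<in>chart (u i) (u j). \<sigma> K l' = t K"
      proof (cases "l' = l")
        case True
        show ?thesis
          unfolding True by (rule bexI[OF _ const_section_regular[OF gens[OF k]]]) (use l in \<open>simp add: \<sigma>_def\<close>)
      next
        case False
        have "\<sigma> K l' = zero_section l' K" if K: "K \<in> chart (u i) (u j)" for K
        proof -
          obtain c where "nondegenerate c" "K = ker c"
            using Gr2_is_ker chart_subset_Gr2 K by blast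
          then show ?thesis
            using False K l' by (simp add: \<sigma>_def zero_section_eq)
        qed
        then show ?thesis
          by (intro bexI[OF _ zero_section_regular]) simp
      qed
    qed
    then have "(\<lambda>K\<in>chart (u i) (u j). \<phi> K (\<sigma> K)) \<in> E_sections (u i) (u j)"
      using \<phi> by (simp add: End_E_def)
    then obtain t where t: "t \<in> regular_schur_sections (u i) (u j) r" "\<And>K. K \<in> chart (u i) (u j) \<Longrightarrow> \<phi> K (\<sigma> K) r = t K"
      using r unfolding E_sections_def by fastforce
    obtain N P where P: "P \<in> poly_maps" "\<And>c. det2 (c i) (c j) \<noteq> 0 \<Longrightarrow> [:det2 (c i) (c j):] ^ N * ev c (t (ker c)) = P c"
      using regular_sections_on_frames[OF t(1)] by blast
    have "[:det2 (c i) (c j):] ^ (N + snd l) * block (\<phi> (ker c)) l r c (L c k) = P c"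
        if det: "det2 (c i) (c j) \<noteq> 0" for c
    proof -
      note c = nd[OF det] and ch = chart_if_det2(1)[OF det]
      note h = End_E_linear[OF \<phi> c]
      have d: "degree ([:det2 (c i) (c j) ^ snd l:] * L c k) \<le> ?m"
        using degree_mult_le[of "[:det2 (c i) (c j) ^ snd l:]" "L c k"] degL[OF k, of c] by simp
      have "\<sigma> (ker c) = IV c (single_form l ([:det2 (c i) (c j) ^ snd l:] * L c k))"
      proof (rule EV_eqI[OF c \<sigma>_ker[OF c ch] IV_carrier[OF c]])
        fix l' :: "nat \<times> nat" assume "l' \<in> young (CARD('n) - 2)"
        then show "EV c (\<sigma> (ker c)) l' = EV c (IV c (single_form l ([:det2 (c i) (c j) ^ snd l:] * L c k))) l'"
          unfolding EV_IV[OF c single_form_forms[OF l d]]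
          by (simp add: EV_def \<sigma>_def ch single_form_def const_section_ev(2)[OF c gens[OF k]] word ev_zero[OF c]
              del: diff_diff_left)
      qed
      then have "block (\<phi> (ker c)) l r c ([:det2 (c i) (c j) ^ snd l:] * L c k) = ev c (t (ker c))"
        using t(2)[OF ch] r by (simp add: block_def EV_def)
      from trans[OF block_linear(2)[OF c h l r degL[OF k], symmetric] this]
      have "[:det2 (c i) (c j):] ^ snd l * block (\<phi> (ker c)) l r c (L c k) = ev c (t (ker c))"
        unfolding const_poly_simps .
      then show ?thesis
        using P(2)[OF det] by (simp only: power_add mult.assoc)
    qed
    then show ?thesis
      using P(1) by blast
  qed
  then have "\<forall>k. \<exists>N P. k \<le> ?m \<longrightarrow> P \<in> poly_maps \<and> (\<forall>c. det2 (c i) (c j) \<noteq> 0 \<longrightarrow>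
      [:det2 (c i) (c j):] ^ N * block (\<phi> (ker c)) l r c (L c k) = P c)"
    by blast
  then obtain N P where "\<forall>k. k \<le> ?m \<longrightarrow> P k \<in> poly_maps \<and> (\<forall>c. det2 (c i) (c j) \<noteq> 0 \<longrightarrow>
      [:det2 (c i) (c j):] ^ N k * block (\<phi> (ker c)) l r c (L c k) = P k c)"
    by metis
  then have P: "\<And>k. k \<le> ?m \<Longrightarrow> P k \<in> poly_maps"
    "\<And>k c. k \<le> ?m \<Longrightarrow> det2 (c i) (c j) \<noteq> 0 \<Longrightarrow> [:det2 (c i) (c j):] ^ N k * block (\<phi> (ker c)) l r c (L c k) = P k c"
    by blast+
  \<comment> \<open>A common exponent for the denominators of all k; the sum bounds each of
    them.\<close>
  define M where "M = (\<Sum>k\<le>?m. N k)"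
  have NM: "N k \<le> M" if "k \<le> ?m" for k
    unfolding M_def by (rule member_le_sum) (use that in simp_all)
  text \<open>The adjugate expresses a constant form through the frame, up to a power of the determinant.\<close>
  define a' where "a' c = (snd (c j), - snd (c i))" for c :: "('k, 'n) frame"
  define b' where "b' c = (- fst (c j), fst (c i))" for c :: "('k, 'n) frame"
  define q where "q c = subst_form ?m (lin (a' c)) (lin (b' c)) p" for c
  have "(\<lambda>c. lin (a' c)) \<in> poly_maps" "(\<lambda>c. lin (b' c)) \<in> poly_maps"
  proof -
    have "(\<lambda>c. [:snd (c j):] + (- [:snd (c i):]) * [:0, 1:]) \<in> poly_maps"
        "(\<lambda>c. - [:fst (c j):] + [:fst (c i):] * [:0, 1:]) \<in> poly_maps"
      by (intro poly_maps_intros poly_maps_uminus)+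
    then show "(\<lambda>c. lin (a' c)) \<in> poly_maps" "(\<lambda>c. lin (b' c)) \<in> poly_maps"
      by (simp_all add: a'_def b'_def lin_def)
  qed
  then have "q \<in> poly_maps"
    unfolding q_def subst_form_def by (intro poly_maps_intros)
  then have q_coeff: "(\<lambda>c. [:poly.coeff (q c) k:]) \<in> poly_maps" for k
    by (rule poly_maps_linear[rotated 2]) simp_all
  have adj: "[:det2 (c i) (c j):] ^ ?m * p = (\<Sum>k\<le>?m. [:poly.coeff (q c) k:] * L c k)" for c
  proof -
    have "(\<Sum>k\<le>?m. [:poly.coeff (q c) k:] * L c k) = subst_form ?m (lin (c i)) (lin (c j)) (q c)"
      by (simp add: subst_form_def L_def mult.assoc)
    also have "\<dots> = subst_form ?m ([:det2 (c i) (c j):] * 1) ([:det2 (c i) (c j):] * [:0, 1:]) p"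
      unfolding q_def subst_form_subst_form
      by (rule arg_cong2[where f = "\<lambda>A B. subst_form ?m A B p"])
        (simp_all add: a'_def b'_def lin_def det2_def algebra_simps)
    finally show ?thesis
      by (simp only: subst_form_scale subst_form_id[OF p])
  qed
  have mem: "(\<lambda>c. \<Sum>k\<le>?m. [:poly.coeff (q c) k:] * ([:det2 (c i) (c j):] ^ (M - N k) * P k c)) \<in> poly_maps"
    using q_coeff P(1) by (intro poly_maps_sum poly_maps_mult poly_maps_power poly_maps_det2) auto
  \<comment> \<open>\<open>M\<close> clears the denominators of the images, and \<open>?m\<close> is
    the determinant power that the adjugate costs.\<close>
  have eq: "[:det2 (c i) (c j):] ^ (M + ?m) * block (\<phi> (ker c)) l r c p
      = (\<Sum>k\<le>?m. [:poly.coeff (q c) k:] * ([:det2 (c i) (c j):] ^ (M - N k) * P k c))"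
          if det: "det2 (c i) (c j) \<noteq> 0" for c
  proof -
    note c = nd[OF det]
    note h = End_E_linear[OF \<phi> c]
    note B = block_linear[OF c h l r]
    have Bsum: "block (\<phi> (ker c)) l r c (\<Sum>k\<in>I. [:a k:] * L c k) = (\<Sum>k\<in>I. [:a k:] * block (\<phi> (ker c)) l r c (L c k))"
      if "finite I" "I \<subseteq> {..?m}" for I a
      using that
    proof (induction I)
      case empty
      show ?case
        using B(2)[of 0 0] by simp
    next
      case (insert k I)
      have d: "degree ([:a k:] * L c k) \<le> ?m" if "k \<le> ?m" for k
        using degree_mult_le[of "[:a k:]" "L c k"] degL[OF that, of c] by simp
      have k: "k \<le> ?m" and I: "I \<subseteq> {..?m}"
        using insert.prems by simp_all
      have "degree (\<Sum>k\<in>I. [:a k:] * L c k) \<le> ?m"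
        by (rule degree_sum_le[OF insert.hyps(1)], rule d) (use I in auto)
      then show ?case
        unfolding sum.insert[OF insert.hyps] B(1)[OF d[OF k]] B(2)[OF degL[OF k]] insert.IH[OF I]
        by (simp only: B(1)[OF d[OF k]] B(2)[OF degL[OF k]] insert.IH[OF I])
    qed
    have "[:det2 (c i) (c j):] ^ ?m * block (\<phi> (ker c)) l r c p =
        block (\<phi> (ker c)) l r c ([:det2 (c i) (c j):] ^ ?m * p)"
      using B(2)[OF p, of "det2 (c i) (c j) ^ ?m"] unfolding const_poly_simps by simp
    also have "\<dots> = (\<Sum>k\<le>?m. [:poly.coeff (q c) k:] * block (\<phi> (ker c)) l r c (L c k))"
      unfolding adj by (rule Bsum) simp_all
    finally have "[:det2 (c i) (c j):] ^ (M + ?m) * block (\<phi> (ker c)) l r c p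
        = (\<Sum>k\<le>?m. [:poly.coeff (q c) k:] * ([:det2 (c i) (c j):] ^ M * block (\<phi> (ker c)) l r c (L c k)))"
      by (simp only: power_add mult.assoc sum_distrib_left mult.left_commute)
    also have "\<dots> = (\<Sum>k\<le>?m. [:poly.coeff (q c) k:] * ([:det2 (c i) (c j):] ^ (M - N k) * P k c))"
    proof (rule sum.cong[OF refl])
      fix k assume "k \<in> {..?m}"
      then have k: "k \<le> ?m"
        by simp
      have "M = (M - N k) + N k"
        using NM[OF k] by simp
      then have "[:det2 (c i) (c j):] ^ M = [:det2 (c i) (c j):] ^ (M - N k) * [:det2 (c i) (c j):] ^ N k"
        by (metis power_add)
      then show "[:poly.coeff (q c) k:] * ([:det2 (c i) (c j):] ^ M * block (\<phi> (ker c)) l r c (L c k))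
          = [:poly.coeff (q c) k:] * ([:det2 (c i) (c j):] ^ (M - N k) * P k c)"
        unfolding P(2)[OF k det, symmetric] by (simp only: mult.assoc)
    qed
    finally show ?thesis .
  qed
  show "\<exists>N. \<exists>P\<in>poly_maps. \<forall>c. det2 (c i) (c j) \<noteq> 0 \<longrightarrow> [:det2 (c i) (c j):] ^ N * block (\<phi> (ker c)) l r c p = P c"
    by (rule exI[of _ "M + ?m"], rule bexI[OF _ mem], intro allI impI, rule eq)
qed

lemma block_covariant:
  assumes card: "CARD('n) \<ge> 4" and \<phi>: "\<phi> \<in> carrier End_E" and l: "l \<in> young (CARD('n) - 2)"
      and r: "r \<in> young (CARD('n) - 2)"
  shows "\<exists>F. covariant l r F \<and>
    (\<forall>c p. nondegenerate c \<longrightarrow> degree p \<le> fst l - snd l \<longrightarrow> F c p = block (\<phi> (ker c)) l r c p)"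
proof (rule covariant_extension[OF card])
  show "snd l \<le> fst l" "snd r \<le> fst r"
    using l r by (simp_all add: young_def)
  show "locally_regular (\<lambda>c. block (\<phi> (ker c)) l r c p)" if "degree p \<le> fst l - snd l" for p
    by (rule block_locally_regular[OF \<phi> l r that])
  fix c :: "('k, 'n) frame"
  assume c: "nondegenerate c"
  note h = End_E_linear[OF \<phi> c]
  show "degree p \<le> fst l - snd l \<Longrightarrow> degree q \<le> fst l - snd l \<Longrightarrow>
      block (\<phi> (ker c)) l r c (p + q) = block (\<phi> (ker c)) l r c p + block (\<phi> (ker c)) l r c q"
    "degree p \<le> fst l - snd l \<Longrightarrow> block (\<phi> (ker c)) l r c ([:a:] * p) = [:a:] * block (\<phi> (ker c)) l r c p"
    "degree (block (\<phi> (ker c)) l r c p) \<le> fst r - snd r" for p q a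
    by (fact block_linear[OF c h l r])+
  show "[:det2 a b:] ^ snd l * block (\<phi> (ker (\<lambda>i. comb a b (c i)))) l r (\<lambda>i. comb a b (c i))
        (subst_form (fst l - snd l) (lin a) (lin b) p)
      = [:det2 a b:] ^ snd r * subst_form (fst r - snd r) (lin a) (lin b) (block (\<phi> (ker c)) l r c p)"
    if "det2 a b \<noteq> 0" "degree p \<le> fst l - snd l" for a b p
    unfolding ker_comb[OF that(1)] by (rule block_equivariant[OF c h l r that])
qed

subsection \<open>Endomorphisms given on forms\<close>

lemma End_E_simps:
  "\<phi> \<otimes>\<^bsub>End_E\<^esub> \<psi> = (\<lambda>K\<in>Gr2. compose (carrier (E_fibre K)) (\<phi> K) (\<psi> K))"
  "\<one>\<^bsub>End_E\<^esub> = (\<lambda>K\<in>Gr2. \<lambda>s\<in>carrier (E_fibre K). s)"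
  "\<phi> \<oplus>\<^bsub>End_E\<^esub> \<psi> = (\<lambda>K\<in>Gr2. \<lambda>s\<in>carrier (E_fibre K). \<phi> K s \<oplus>\<^bsub>E_fibre K\<^esub> \<psi> K s)"
  "a \<odot>\<^bsub>End_E\<^esub> \<phi> = (\<lambda>K\<in>Gr2. \<lambda>s\<in>carrier (E_fibre K). a \<odot>\<^bsub>E_fibre K\<^esub> \<phi> K s)"
  by (simp_all add: End_E_def)

lemma linear_mapsI_EV:
  assumes c: "nondegenerate c" and h: "h \<in> extensional (carrier (E_fibre (ker c)))"
    and closed: "\<And>s. s \<in> carrier (E_fibre (ker c)) \<Longrightarrow> h s \<in> carrier (E_fibre (ker c))"
    and add: "\<And>s t l. s \<in> carrier (E_fibre (ker c)) \<Longrightarrow> t \<in> carrier (E_fibre (ker c)) \<Longrightarrow> l \<in> young (CARD('n) - 2) \<Longrightarrow>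
      EV c (h (s \<oplus>\<^bsub>E_fibre (ker c)\<^esub> t)) l = EV c (h s) l + EV c (h t) l"
    and scale: "\<And>a s l. s \<in> carrier (E_fibre (ker c)) \<Longrightarrow> l \<in> young (CARD('n) - 2) \<Longrightarrow>
      EV c (h (a \<odot>\<^bsub>E_fibre (ker c)\<^esub> s)) l = [:a:] * EV c (h s) l"
  shows "h \<in> linear_maps (E_fibre (ker c)) (E_fibre (ker c))"
proof -
  have "h (s \<oplus>\<^bsub>E_fibre (ker c)\<^esub> t) = h s \<oplus>\<^bsub>E_fibre (ker c)\<^esub> h t"
    if s: "s \<in> carrier (E_fibre (ker c))" and t: "t \<in> carrier (E_fibre (ker c))" for s t
    by (rule EV_eqI[OF c closed[OF E_add_closed[OF c s t]] E_add_closed[OF c closed[OF s] closed[OF t]]])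
      (simp only: add[OF s t] EV_add[OF c closed[OF s] closed[OF t]])
  moreover have "h (a \<odot>\<^bsub>E_fibre (ker c)\<^esub> s) = a \<odot>\<^bsub>E_fibre (ker c)\<^esub> h s"
    if s: "s \<in> carrier (E_fibre (ker c))" for a s
    by (rule EV_eqI[OF c closed[OF E_smult_closed[OF c s]] E_smult_closed[OF c closed[OF s]]])
      (simp only: scale[OF s] EV_smult[OF c closed[OF s]])
  moreover have "h \<in> carrier (E_fibre (ker c)) \<rightarrow>\<^sub>E carrier (E_fibre (ker c))"
    using h closed by (simp add: PiE_def)
  ultimately show ?thesis
    unfolding linear_maps_def by blast
qed

text \<open>Every point is the kernel of a nondegenerate frame, so linearity only has to be checked
  over such kernels, where it can be read off on forms.\<close>

lemma End_EI:
  fixes \<phi> :: "('k, 'n) E_endo"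
  assumes "\<phi> \<in> extensional Gr2"
    and lin: "\<And>c. nondegenerate c \<Longrightarrow> \<phi> (ker c) \<in> linear_maps (E_fibre (ker c)) (E_fibre (ker c))"
    and reg: "\<And>a b s r. s \<in> E_sections a b \<Longrightarrow> r \<in> young (CARD('n) - 2) \<Longrightarrow>
      \<exists>t\<in>regular_schur_sections a b r. \<forall>K\<in>chart a b. \<phi> K (s K) r = t K"
  shows "\<phi> \<in> carrier End_E"
proof -
  have \<phi>: "\<phi> K \<in> linear_maps (E_fibre K) (E_fibre K)" if "K \<in> Gr2" for K
    using Gr2_is_ker[OF that] lin by blast
  have "(\<lambda>K\<in>chart a b. \<phi> K (s K)) \<in> E_sections a b" if s: "s \<in> E_sections a b" for a b s
  proof -
    have "\<phi> K (s K) \<in> carrier (E_fibre K)" if K: "K \<in> chart a b" for K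
    proof (rule linear_mapsD(1)[OF \<phi>])
      show "K \<in> Gr2"
        using K chart_subset_Gr2 by blast
      show "s K \<in> carrier (E_fibre K)"
        using s K unfolding E_sections_def by (auto dest: PiE_mem)
    qed
    moreover have "\<exists>t\<in>regular_schur_sections a b r. \<forall>K\<in>chart a b. (\<lambda>K\<in>chart a b. \<phi> K (s K)) K r = t K"
      if "r \<in> young (CARD('n) - 2)" for r
      using reg[OF s that] by simp
    ultimately show ?thesis
      unfolding E_sections_def by simp
  qed
  moreover have "\<phi> \<in> (\<Pi>\<^sub>E K\<in>Gr2. linear_maps (E_fibre K) (E_fibre K))"
    using assms(1) \<phi> by (simp add: PiE_def)
  ultimately show ?thesis
    by (simp add: End_E_def)
qed

lemma End_E_extensional: "\<phi> \<in> carrier End_E \<Longrightarrow> \<phi> \<in> extensional Gr2"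
  by (simp add: End_E_def PiE_def)

lemma End_E_sections:
  "\<phi> \<in> carrier End_E \<Longrightarrow> s \<in> E_sections a b \<Longrightarrow> (\<lambda>K\<in>chart a b. \<phi> K (s K)) \<in> E_sections a b"
  by (simp add: End_E_def)

lemma End_E_regular:
  fixes \<phi> :: "('k, 'n) E_endo"
  assumes \<phi>: "\<phi> \<in> carrier End_E" and s: "s \<in> E_sections a b" and r: "r \<in> young (CARD('n) - 2)"
  obtains t where "t \<in> regular_schur_sections a b r" "\<And>K. K \<in> chart a b \<Longrightarrow> \<phi> K (s K) r = t K"
  using End_E_sections[OF \<phi> s] r unfolding E_sections_def by fastforce

lemma E_sections_carrier:
  fixes s :: "('k ^ 'n) set \<Rightarrow> nat \<times> nat \<Rightarrow> ('k, 'n) schur_elem"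
  shows "s \<in> E_sections a b \<Longrightarrow> K \<in> chart a b \<Longrightarrow> s K \<in> carrier (E_fibre K)"
  unfolding E_sections_def by (auto dest: PiE_mem)

lemma chart_is_ker:
  fixes K :: "('k ^ 'n) set"
  assumes "K \<in> chart a b"
  obtains c where "nondegenerate c" "K = ker c" "K \<in> Gr2"
  using assms chart_subset_Gr2 Gr2_is_ker by blast

lemma End_E_mult_closed:
  fixes \<phi> \<psi> :: "('k, 'n) E_endo"
  assumes \<phi>: "\<phi> \<in> carrier End_E" and \<psi>: "\<psi> \<in> carrier End_E"
  shows "\<phi> \<otimes>\<^bsub>End_E\<^esub> \<psi> \<in> carrier End_E"
proof (rule End_EI)
  show "\<phi> \<otimes>\<^bsub>End_E\<^esub> \<psi> \<in> extensional Gr2"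
    by (simp add: End_E_simps)
  show "(\<phi> \<otimes>\<^bsub>End_E\<^esub> \<psi>) (ker c) \<in> linear_maps (E_fibre (ker c)) (E_fibre (ker c))" if c: "nondegenerate c" for c
  proof -
    note D = linear_mapsD[OF End_E_linear[OF \<phi> c]] and D' = linear_mapsD[OF End_E_linear[OF \<psi> c]]
    have eq: "(\<phi> \<otimes>\<^bsub>End_E\<^esub> \<psi>) (ker c) s = \<phi> (ker c) (\<psi> (ker c) s)" if "s \<in> carrier (E_fibre (ker c))" for s
      using ker_in_Gr2[OF c] that by (simp add: End_E_simps compose_def)
    have ext: "(\<phi> \<otimes>\<^bsub>End_E\<^esub> \<psi>) (ker c) \<in> extensional (carrier (E_fibre (ker c)))"
      using ker_in_Gr2[OF c] by (simp add: End_E_simps compose_def)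
    show ?thesis
      by (rule linear_mapsI_EV[OF c ext])
        (simp_all add: eq D D' E_add_closed[OF c] E_smult_closed[OF c] EV_add[OF c] EV_smult[OF c])
  qed
  fix a b :: "'k ^ 'n" and s r
  assume s: "s \<in> E_sections a b" and r: "r \<in> young (CARD('n) - 2)"
  obtain t where t: "t \<in> regular_schur_sections a b r"
    "\<And>K. K \<in> chart a b \<Longrightarrow> \<phi> K ((\<lambda>K\<in>chart a b. \<psi> K (s K)) K) r = t K"
    by (rule End_E_regular[OF \<phi> End_E_sections[OF \<psi> s] r]) blast
  have "(\<phi> \<otimes>\<^bsub>End_E\<^esub> \<psi>) K (s K) r = t K" if K: "K \<in> chart a b" for K
  proof -
    have "(\<phi> \<otimes>\<^bsub>End_E\<^esub> \<psi>) K (s K) = \<phi> K (\<psi> K (s K))"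
      using K chart_subset_Gr2[of a b] E_sections_carrier[OF s K] by (auto simp: End_E_simps compose_def)
    then show ?thesis
      using t(2)[OF K] K by simp
  qed
  then show "\<exists>t\<in>regular_schur_sections a b r. \<forall>K\<in>chart a b. (\<phi> \<otimes>\<^bsub>End_E\<^esub> \<psi>) K (s K) r = t K"
    using t(1) by blast
qed

lemma End_E_add_closed:
  fixes \<phi> \<psi> :: "('k, 'n) E_endo"
  assumes \<phi>: "\<phi> \<in> carrier End_E" and \<psi>: "\<psi> \<in> carrier End_E"
  shows "\<phi> \<oplus>\<^bsub>End_E\<^esub> \<psi> \<in> carrier End_E"
proof (rule End_EI)
  show "\<phi> \<oplus>\<^bsub>End_E\<^esub> \<psi> \<in> extensional Gr2"
    by (simp add: End_E_simps)
  show "(\<phi> \<oplus>\<^bsub>End_E\<^esub> \<psi>) (ker c) \<in> linear_maps (E_fibre (ker c)) (E_fibre (ker c))" if c: "nondegenerate c" for c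
  proof -
    note D = linear_mapsD[OF End_E_linear[OF \<phi> c]] and D' = linear_mapsD[OF End_E_linear[OF \<psi> c]]
    have eq: "(\<phi> \<oplus>\<^bsub>End_E\<^esub> \<psi>) (ker c) s = \<phi> (ker c) s \<oplus>\<^bsub>E_fibre (ker c)\<^esub> \<psi> (ker c) s"
        if "s \<in> carrier (E_fibre (ker c))" for s
      using ker_in_Gr2[OF c] that by (simp add: End_E_simps)
    have ext: "(\<phi> \<oplus>\<^bsub>End_E\<^esub> \<psi>) (ker c) \<in> extensional (carrier (E_fibre (ker c)))"
      using ker_in_Gr2[OF c] by (simp add: End_E_simps)
    show ?thesis
      by (rule linear_mapsI_EV[OF c ext])
        (simp_all add: eq D D' E_add_closed[OF c] E_smult_closed[OF c] EV_add[OF c] EV_smult[OF c]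
          smult_add_right add_ac)
  qed
  fix a b :: "'k ^ 'n" and s r
  assume s: "s \<in> E_sections a b" and r: "r \<in> young (CARD('n) - 2)"
  obtain t where t: "t \<in> regular_schur_sections a b r" "\<And>K. K \<in> chart a b \<Longrightarrow> \<phi> K (s K) r = t K"
    by (rule End_E_regular[OF \<phi> s r]) blast
  obtain t' where t': "t' \<in> regular_schur_sections a b r" "\<And>K. K \<in> chart a b \<Longrightarrow> \<psi> K (s K) r = t' K"
    by (rule End_E_regular[OF \<psi> s r]) blast
  have "(\<phi> \<oplus>\<^bsub>End_E\<^esub> \<psi>) K (s K) r = t K \<oplus>\<^bsub>S_fibre r K\<^esub> t' K" if K: "K \<in> chart a b" for K
    using K chart_subset_Gr2[of a b] E_sections_carrier[OF s K] t(2)[OF K] t'(2)[OF K] r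
    by (auto simp: End_E_simps E_fibre_simps(3))
  then show "\<exists>t\<in>regular_schur_sections a b r. \<forall>K\<in>chart a b. (\<phi> \<oplus>\<^bsub>End_E\<^esub> \<psi>) K (s K) r = t K"
    by (intro bexI[OF _ regular_schur_sections.add[OF t(1) t'(1)]]) blast
qed

lemma End_E_smult_closed:
  fixes \<phi> :: "('k, 'n) E_endo"
  assumes \<phi>: "\<phi> \<in> carrier End_E"
  shows "x \<odot>\<^bsub>End_E\<^esub> \<phi> \<in> carrier End_E"
proof (rule End_EI)
  show "x \<odot>\<^bsub>End_E\<^esub> \<phi> \<in> extensional Gr2"
    by (simp add: End_E_simps)
  show "(x \<odot>\<^bsub>End_E\<^esub> \<phi>) (ker c) \<in> linear_maps (E_fibre (ker c)) (E_fibre (ker c))" if c: "nondegenerate c" for c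
  proof -
    note D = linear_mapsD[OF End_E_linear[OF \<phi> c]]
    have eq: "(x \<odot>\<^bsub>End_E\<^esub> \<phi>) (ker c) s = x \<odot>\<^bsub>E_fibre (ker c)\<^esub> \<phi> (ker c) s" if "s \<in> carrier (E_fibre (ker c))" for s
      using ker_in_Gr2[OF c] that by (simp add: End_E_simps)
    have ext: "(x \<odot>\<^bsub>End_E\<^esub> \<phi>) (ker c) \<in> extensional (carrier (E_fibre (ker c)))"
      using ker_in_Gr2[OF c] by (simp add: End_E_simps)
    show ?thesis
      by (rule linear_mapsI_EV[OF c ext])
        (simp_all add: eq D E_add_closed[OF c] E_smult_closed[OF c] EV_add[OF c] EV_smult[OF c] smult_add_right
            mult.commute)
  qed
  fix a b :: "'k ^ 'n" and s r
  assume s: "s \<in> E_sections a b" and r: "r \<in> young (CARD('n) - 2)"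
  obtain t where t: "t \<in> regular_schur_sections a b r" "\<And>K. K \<in> chart a b \<Longrightarrow> \<phi> K (s K) r = t K"
    by (rule End_E_regular[OF \<phi> s r]) blast
  have "(x \<odot>\<^bsub>End_E\<^esub> \<phi>) K (s K) r = x \<odot>\<^bsub>S_fibre r K\<^esub> t K" if K: "K \<in> chart a b" for K
    using K chart_subset_Gr2[of a b] E_sections_carrier[OF s K] t(2)[OF K] r
    by (auto simp: End_E_simps E_fibre_simps(4))
  then show "\<exists>t\<in>regular_schur_sections a b r. \<forall>K\<in>chart a b. (x \<odot>\<^bsub>End_E\<^esub> \<phi>) K (s K) r = t K"
    by (intro bexI[OF _ regular_schur_sections.smult[OF regular_functions.const t(1)]]) blast
qed

text \<open>Abstracts what f, g and the identity have in common: in every frame they are linear on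
  forms, and they take constant tensors to regular sections. The last condition concerns generators
  only, because linearity extends it to all regular sections.\<close>

definition fibre_form_map ::
    "nat \<times> nat \<Rightarrow> nat \<times> nat \<Rightarrow> (('k ^ 'n) set \<Rightarrow> ('k, 'n) schur_elem \<Rightarrow> ('k, 'n) schur_elem)
      \<Rightarrow> (('k, 'n) frame \<Rightarrow> 'k poly \<Rightarrow> 'k poly) \<Rightarrow> bool"
  where "fibre_form_map l m h \<theta> \<longleftrightarrow>
    (\<forall>c C. nondegenerate c \<longrightarrow> C \<in> carrier (S_fibre l (ker c)) \<longrightarrow>
      h (ker c) C \<in> carrier (S_fibre m (ker c)) \<and> ev c (h (ker c) C) = \<theta> c (ev c C)) \<and>
    (\<forall>c p q. \<theta> c (p + q) = \<theta> c p + \<theta> c q) \<and> (\<forall>c a p. \<theta> c ([:a:] * p) = [:a:] * \<theta> c p) \<and>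
    (\<forall>a b t. t \<in> schur_gens l V_module \<longrightarrow>
      (\<exists>t'\<in>regular_schur_sections a b m. \<forall>c. nondegenerate c \<longrightarrow> ev c (t' (ker c)) = \<theta> c (ev_word (quot c) t)))"

lemma fibre_form_mapD:
  assumes "fibre_form_map l m h \<theta>"
  shows "nondegenerate c \<Longrightarrow> C \<in> carrier (S_fibre l (ker c)) \<Longrightarrow> h (ker c) C \<in> carrier (S_fibre m (ker c))"
    "nondegenerate c \<Longrightarrow> C \<in> carrier (S_fibre l (ker c)) \<Longrightarrow> ev c (h (ker c) C) = \<theta> c (ev c C)"
    "\<theta> c (p + q) = \<theta> c p + \<theta> c q" "\<theta> c ([:a:] * p) = [:a:] * \<theta> c p"
    "t \<in> schur_gens l V_module \<Longrightarrow>
      \<exists>t'\<in>regular_schur_sections v w m. \<forall>c. nondegenerate c \<longrightarrow> ev c (t' (ker c)) = \<theta> c (ev_word (quot c) t)"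
  using assms unfolding fibre_form_map_def by blast+

lemma fibre_form_map_regular:
  assumes h: "fibre_form_map l m h \<theta>" and t: "t \<in> regular_schur_sections a b l"
  shows "\<exists>t'\<in>regular_schur_sections a b m. \<forall>c. nondegenerate c \<longrightarrow> h (ker c) (t (ker c)) = t' (ker c)"
proof -
  note D = fibre_form_mapD[OF h]
  have "\<exists>t'\<in>regular_schur_sections a b m. \<forall>c. nondegenerate c \<longrightarrow> ev c (t' (ker c)) = \<theta> c (ev c (t (ker c)))"
    using t
  proof induction
    case (const xs ys)
    have "ev c (schur_class l (W_fibre (ker c)) (gen (map (\<lambda>(x, x'). (z_section x (ker c), z_section x' (ker c))) xs)
        (map (\<lambda>y. z_section y (ker c)) ys))) = ev_word (quot c) (xs, ys)" if "nondegenerate c" for c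
      using const_section_ev(2)[OF that const] by (simp add: const_section_def)
    then show ?case
      using D(5)[OF const] by simp
  next
    case (add s t)
    then obtain s' t' where s': "s' \<in> regular_schur_sections a b m"
        "\<And>c. nondegenerate c \<Longrightarrow> ev c (s' (ker c)) = \<theta> c (ev c (s (ker c)))"
      and t': "t' \<in> regular_schur_sections a b m" "\<And>c. nondegenerate c \<Longrightarrow> ev c (t' (ker c)) = \<theta> c (ev c (t (ker c)))"
      by blast
    have "ev c (s' (ker c) \<oplus>\<^bsub>S_fibre m (ker c)\<^esub> t' (ker c)) = \<theta> c (ev c (s (ker c) \<oplus>\<^bsub>S_fibre l (ker c)\<^esub> t (ker c)))"
      if c: "nondegenerate c" for c
      unfolding ev_add[OF c regular_section_carrier[OF s'(1) c] regular_section_carrier[OF t'(1) c]] D(3)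
          s'(2)[OF c] t'(2)[OF c]
        ev_add[OF c regular_section_carrier[OF add.hyps(1) c] regular_section_carrier[OF add.hyps(2) c]] ..
    then show ?case
      by (intro bexI[OF _ regular_schur_sections.add[OF s'(1) t'(1)]]) blast
  next
    case (smult p t)
    then obtain t' where t': "t' \<in> regular_schur_sections a b m"
        "\<And>c. nondegenerate c \<Longrightarrow> ev c (t' (ker c)) = \<theta> c (ev c (t (ker c)))"
      by blast
    have "ev c (p (ker c) \<odot>\<^bsub>S_fibre m (ker c)\<^esub> t' (ker c)) = \<theta> c (ev c (p (ker c) \<odot>\<^bsub>S_fibre l (ker c)\<^esub> t (ker c)))"
      if c: "nondegenerate c" for c
      unfolding ev_smult[OF c regular_section_carrier[OF t'(1) c]]
          ev_smult[OF c regular_section_carrier[OF smult.hyps(2) c]]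
        D(4) t'(2)[OF c] ..
    then show ?case
      by (intro bexI[OF _ regular_schur_sections.smult[OF smult.hyps(1) t'(1)]]) blast
  qed
  then obtain t' where t': "t' \<in> regular_schur_sections a b m"
      "\<And>c. nondegenerate c \<Longrightarrow> ev c (t' (ker c)) = \<theta> c (ev c (t (ker c)))"
    by blast
  have "h (ker c) (t (ker c)) = t' (ker c)" if c: "nondegenerate c" for c
  proof (rule ev_eqI[OF c _ regular_section_carrier[OF t'(1) c]])
    note car = regular_section_carrier[OF t c]
    show "h (ker c) (t (ker c)) \<in> carrier (S_fibre m (ker c))"
      by (rule D(1)[OF c car])
    show "ev c (h (ker c) (t (ker c))) = ev c (t' (ker c))"
      unfolding D(2)[OF c car] t'(2)[OF c] ..
  qed
  then show ?thesis
    using t'(1) by blast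
qed

lemma summand_endo_EV:
  assumes h: "fibre_form_map l m h \<theta>" and l: "l \<in> young (CARD('n) - 2)" and m: "m \<in> young (CARD('n) - 2)"
    and c: "nondegenerate c" and s: "s \<in> carrier (E_fibre (ker c))"
  shows "summand_endo l m h (ker c) s \<in> carrier (E_fibre (ker c))"
    "r \<in> young (CARD('n) - 2) \<Longrightarrow> EV c (summand_endo l m h (ker c) s) r = single_form m (\<theta> c (EV c s l)) r"
proof -
  note car = fibre_form_mapD(1)[OF h c E_carrier_component[OF s l]]
  have eq: "summand_endo l m h (ker c) s =
      (\<lambda>r\<in>young (CARD('n) - 2). if r = m then h (ker c) (s l) else \<zero>\<^bsub>S_fibre r (ker c)\<^esub>)"
    using ker_in_Gr2[OF c] s by (simp add: summand_endo_def)
  show "summand_endo l m h (ker c) s \<in> carrier (E_fibre (ker c))"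
    unfolding eq E_fibre_simps(1) using car S_zero_carrier[OF c] by auto
  show "EV c (summand_endo l m h (ker c) s) r = single_form m (\<theta> c (EV c s l)) r" if "r \<in> young (CARD('n) - 2)"
    unfolding eq using that fibre_form_mapD(2)[OF h c E_carrier_component[OF s l]] ev_zero[OF c] l
    by (simp add: EV_def single_form_def)
qed

lemma summand_endo_closed:
  assumes h: "fibre_form_map l m h \<theta>" and l: "l \<in> young (CARD('n) - 2)" and m: "m \<in> young (CARD('n) - 2)"
  shows "summand_endo l m h \<in> carrier End_E"
proof (rule End_EI)
  show "summand_endo l m h \<in> extensional Gr2"
    by (simp add: summand_endo_def)
  show "summand_endo l m h (ker c) \<in> linear_maps (E_fibre (ker c)) (E_fibre (ker c))" if c: "nondegenerate c" for c
  proof (rule linear_mapsI_EV[OF c])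
    note EVs = summand_endo_EV[OF h l m c]
    show "summand_endo l m h (ker c) \<in> extensional (carrier (E_fibre (ker c)))"
      using ker_in_Gr2[OF c] by (simp add: summand_endo_def)
    show "summand_endo l m h (ker c) s \<in> carrier (E_fibre (ker c))" if "s \<in> carrier (E_fibre (ker c))" for s
      by (rule EVs(1)[OF that])
    show "EV c (summand_endo l m h (ker c) (s \<oplus>\<^bsub>E_fibre (ker c)\<^esub> t)) r
        = EV c (summand_endo l m h (ker c) s) r + EV c (summand_endo l m h (ker c) t) r"
      if s: "s \<in> carrier (E_fibre (ker c))" and t: "t \<in> carrier (E_fibre (ker c))"
          and r: "r \<in> young (CARD('n) - 2)" for s t r
      unfolding EVs(2)[OF s r] EVs(2)[OF t r] EVs(2)[OF E_add_closed[OF c s t] r] EV_add[OF c s t]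
      by (simp add: single_form_def fibre_form_mapD(3)[OF h])
    show "EV c (summand_endo l m h (ker c) (a \<odot>\<^bsub>E_fibre (ker c)\<^esub> s)) r = [:a:]
        * EV c (summand_endo l m h (ker c) s) r"
      if s: "s \<in> carrier (E_fibre (ker c))" and r: "r \<in> young (CARD('n) - 2)" for a s r
      unfolding EVs(2)[OF s r] EVs(2)[OF E_smult_closed[OF c s] r] EV_smult[OF c s]
      by (simp add: single_form_def fibre_form_mapD(4)[OF h] del: mult_pCons_left)
  qed
  fix a b :: "'k ^ 'n" and s r
  assume s: "s \<in> E_sections a b" and r: "r \<in> young (CARD('n) - 2)"
  have eq: "summand_endo l m h K (s K) r = (if r = m then h K (s K l) else \<zero>\<^bsub>S_fibre r K\<^esub>)"
      if K: "K \<in> chart a b" for K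
    using K chart_subset_Gr2[of a b] E_sections_carrier[OF s K] r by (auto simp: summand_endo_def)
  show "\<exists>t\<in>regular_schur_sections a b r. \<forall>K\<in>chart a b. summand_endo l m h K (s K) r = t K"
  proof (cases "r = m")
    case True
    obtain t where t: "t \<in> regular_schur_sections a b l" "\<And>K. K \<in> chart a b \<Longrightarrow> s K l = t K"
      using s l unfolding E_sections_def by blast
    obtain t' where t': "t' \<in> regular_schur_sections a b m" "\<And>c. nondegenerate c \<Longrightarrow> h (ker c) (t (ker c)) = t' (ker c)"
      using fibre_form_map_regular[OF h t(1)] by blast
    have "summand_endo l m h K (s K) r = t' K" if K: "K \<in> chart a b" for K
      by (rule chart_is_ker[OF K]) (use eq[OF K] t(2)[OF K] t'(2) True in simp)
    then show ?thesis
      using t'(1) True by blast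
  next
    case False
    have "summand_endo l m h K (s K) r = zero_section r K" if K: "K \<in> chart a b" for K
      by (rule chart_is_ker[OF K]) (use eq[OF K] False zero_section_eq in simp)
    then show ?thesis
      using zero_section_regular by blast
  qed
qed

lemma fibre_form_map_id: "fibre_form_map l l (\<lambda>K C. C) (\<lambda>c p. p)"
proof -
  have "\<exists>t'\<in>regular_schur_sections a b l. \<forall>c. nondegenerate c \<longrightarrow> ev c (t' (ker c)) = ev_word (quot c) t"
    if "t \<in> schur_gens l V_module" for a b t
    by (rule bexI[OF _ const_section_regular[OF that]]) (simp add: const_section_ev that)
  then show ?thesis
    unfolding fibre_form_map_def by blast
qed

lemma fibre_form_map_f:
  assumes l: "snd l \<le> fst l"
  shows "fibre_form_map l (l + unit_weight 1) (f_map l v) (\<lambda>c p. lin (quot c v) * p)"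
proof -
  have const: "\<exists>t'\<in>regular_schur_sections a b (l + unit_weight 1).
      \<forall>c. nondegenerate c \<longrightarrow> ev c (t' (ker c)) = lin (quot c v) * ev_word (quot c) t"
    if t: "t \<in> schur_gens l V_module" for a b t
  proof -
    have gens: "(fst t, snd t @ [v]) \<in> schur_gens (l + unit_weight 1) V_module"
      using t l by (cases t) (simp add: schur_gens_def unit_weight_def Suc_diff_le)
    have "ev_word (quot c) (fst t, snd t @ [v]) = lin (quot c v) * ev_word (quot c) t" for c
      unfolding ev_word_def fst_conv snd_conv
      by (simp only: map_append prod_list.append list.map prod_list.Cons prod_list.Nil mult_1_left mult_1_right
          mult_ac)
    then show ?thesis
      by (intro bexI[OF _ const_section_regular[OF gens]]) (simp add: const_section_ev(2)[OF _ gens] del: One_nat_def)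
  qed
  show ?thesis
    unfolding fibre_form_map_def
    by (intro conjI allI impI const f_map_ev l distrib_left mult.left_commute) assumption+
qed

text \<open>The map g sends a constant tensor to a sum of constant tensors, which has to be
  recognised as a regular section; the empty sum is the zero section.\<close>

lemma regular_const_sum:
  assumes "finite I" "\<And>i. i \<in> I \<Longrightarrow> t i \<in> schur_gens l V_module"
  shows "\<exists>t'\<in>regular_schur_sections a b l. \<forall>c. nondegenerate c \<longrightarrow> ev c (t' (ker c)) = (\<Sum>i\<in>I. ev_word (quot c) (t i))"
  using assms
proof (induction I)
  case empty
  show ?case
    by (rule bexI[OF _ zero_section_regular]) (simp add: zero_section_eq ev_zero)
next
  case (insert i I)
  then obtain t' where t': "t' \<in> regular_schur_sections a b l"
      "\<And>c. nondegenerate c \<Longrightarrow> ev c (t' (ker c)) = (\<Sum>i\<in>I. ev_word (quot c) (t i))"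
    by (metis insertCI)
  have gens: "t i \<in> schur_gens l V_module"
    using insert.prems by simp
  have "ev c (const_section l (t i) (ker c) \<oplus>\<^bsub>S_fibre l (ker c)\<^esub> t' (ker c)) =
      (\<Sum>i\<in>insert i I. ev_word (quot c) (t i))"
    if c: "nondegenerate c" for c
    using insert.hyps
    by (simp add: ev_add[OF c const_section_ev(1)[OF c gens] regular_section_carrier[OF t'(1) c]]
        const_section_ev(2)[OF c gens] t'(2)[OF c])
  then show ?case
    by (intro bexI[OF _ regular_schur_sections.add[OF const_section_regular[OF gens] t'(1)]]) blast
qed

lemma fibre_form_map_g:
  assumes l: "snd l < fst l"
  shows "fibre_form_map l (l + unit_weight 2) (g_map l v) (\<lambda>c. wedge (fst l - snd l) (quot c v))"
proof -
  have const: "\<exists>t'\<in>regular_schur_sections a b (l + unit_weight 2).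
      \<forall>c. nondegenerate c \<longrightarrow> ev c (t' (ker c)) = wedge (fst l - snd l) (quot c v) (ev_word (quot c) t)"
    if t: "t \<in> schur_gens l V_module" for a b t
  proof -
    obtain xs ys where xy: "t = (xs, ys)"
      by (cases t)
    let ?t = "\<lambda>k. (xs @ [(ys ! k, v)], take k ys @ drop (Suc k) ys)"
    have len: "length ys = fst l - snd l" "fst l - snd l = length (map (quot c) ys)" for c
      using t by (simp_all add: xy schur_gens_def)
    have gens: "?t k \<in> schur_gens (l + unit_weight 2) V_module" if "k \<in> {..<length ys}" for k
    proof -
      have "length (take k ys @ drop (Suc k) ys) = length ys - 1"
        using that by simp
      then show ?thesis
        using t by (simp add: xy schur_gens_def unit_weight_def)
    qed
    have "(\<Sum>k<length ys. ev_word (quot c) (?t k)) = wedge (fst l - snd l) (quot c v) (ev_word (quot c) t)" for c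
    proof -
      let ?d = "prod_list (map (\<lambda>(x, x'). det2 (quot c x) (quot c x')) xs)"
      have snoc: "ev_word (quot c) (xs @ [(x, v)], zs)
          = [:?d:] * ([:det2 (quot c x) (quot c v):] * prod_list (map lin (map (quot c) zs)))" for x zs
        by (simp add: ev_word_def mult.commute)
      show ?thesis
        unfolding xy ev_word_def[of _ "(xs, ys)"] fst_conv snd_conv wedge_const_mult snoc len(2)[of c]
            wedge_prod_list sum_distrib_left
        by (rule sum.cong) (simp_all add: take_map drop_map del: mult_pCons_left mult_pCons_right)
    qed
    then show ?thesis
      using regular_const_sum[of "{..<length ys}" ?t "l + unit_weight 2" a b, OF _ gens] by simp
  qed
  show ?thesis
    unfolding fibre_form_map_def
    by (intro conjI allI impI const g_map_ev l wedge_add wedge_const_mult) assumption+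
qed

end

section \<open>The representation of the path algebra on forms\<close>

definition arrow_op :: "('k::field, 'n) frame \<Rightarrow> 'n arrow \<Rightarrow> 'k poly \<Rightarrow> 'k poly"
  where "arrow_op c = (\<lambda>(l, i, \<rho>) q. if i = 1 then lin (c \<rho>) * q else wedge (fst l - snd l) (c \<rho>) q)"

text \<open>Walks list their arcs in order of traversal, which is the order in which
  \<open>fold\<close> applies them. The input is taken at the start vertex and the result is placed
  at the end vertex, with zero elsewhere.\<close>

definition path_op ::
    "('k::field, 'n) frame \<Rightarrow> (nat \<times> nat, 'n arrow) path \<Rightarrow> (nat \<times> nat \<Rightarrow> 'k poly) \<Rightarrow> nat \<times> nat \<Rightarrow> 'k poly"
  where "path_op c = (\<lambda>(v, p, w) f r. if r = w then fold (arrow_op c) p (f v) else 0)"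

definition alg_op ::
    "('k::field, 'n) frame \<Rightarrow> ((nat \<times> nat, 'n arrow) path \<Rightarrow>\<^sub>0 'k) \<Rightarrow> (nat \<times> nat \<Rightarrow> 'k poly) \<Rightarrow> nat \<times> nat \<Rightarrow> 'k poly"
  where "alg_op c x f r = (\<Sum>k\<in>Poly_Mapping.keys x. [:Poly_Mapping.lookup x k:] * path_op c k f r)"

lemma arrow_op_linear:
  "arrow_op c a (p + q) = arrow_op c a p + arrow_op c a q" "arrow_op c a ([:s:] * p) = [:s:] * arrow_op c a p"
  by (simp_all only: arrow_op_def case_prod_unfold wedge_add wedge_const_mult distrib_left mult.left_commute
      if_split_eq2 if_True if_False split: if_split) simp_all

lemma fold_arrow_op_linear:
  "fold (arrow_op c) w (p + q) = fold (arrow_op c) w p + fold (arrow_op c) w q"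
  "fold (arrow_op c) w ([:s:] * p) = [:s:] * fold (arrow_op c) w p"
  by (induction w arbitrary: p q) (simp_all add: arrow_op_linear del: mult_pCons_left)

lemma fold_arrow_op_sum: "fold (arrow_op c) w (sum g I) = (\<Sum>i\<in>I. fold (arrow_op c) w (g i))"
proof -
  have "fold (arrow_op c) w 0 = 0"
    using fold_arrow_op_linear(2)[of c w 0 0] by simp
  then show ?thesis
    by (induction I rule: infinite_finite_induct) (simp_all add: fold_arrow_op_linear(1))
qed

lemma alg_op_superset:
  "finite S \<Longrightarrow> Poly_Mapping.keys x \<subseteq> S \<Longrightarrow> alg_op c x f r = (\<Sum>k\<in>S. [:Poly_Mapping.lookup x k:] * path_op c k f r)"
  unfolding alg_op_def by (rule sum.mono_neutral_left) (auto simp: in_keys_iff)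

lemma alg_op_add: "alg_op c (x + y) f r = alg_op c x f r + alg_op c y f r"
proof -
  let ?S = "Poly_Mapping.keys x \<union> Poly_Mapping.keys y"
  have "Poly_Mapping.keys (x + y) \<subseteq> ?S"
    by (rule Poly_Mapping.keys_add)
  then show ?thesis
    using alg_op_superset[of ?S "x + y" c f r] alg_op_superset[of ?S x c f r] alg_op_superset[of ?S y c f r]
    by (simp only: finite_Un finite_keys Un_upper1 Un_upper2 lookup_add const_poly_simps distrib_right sum.distrib)
qed

lemma alg_op_scale: "alg_op c (pm_scale a x) f r = [:a:] * alg_op c x f r"
  by (subst alg_op_superset[OF finite_keys keys_pm_scale])
    (simp only: alg_op_def sum_distrib_left lookup_pm_scale const_poly_simps mult.assoc)

lemma alg_op_0 [simp]: "alg_op c 0 f r = 0"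
  by (simp add: alg_op_def)

lemma alg_op_sum: "alg_op c (sum g I) f r = (\<Sum>i\<in>I. alg_op c (g i) f r)"
  by (induction I rule: infinite_finite_induct) (simp_all add: alg_op_add)

lemma alg_op_single: "alg_op c (Poly_Mapping.single k a) f r = [:a:] * path_op c k f r"
  using alg_op_superset[of "{k}" "Poly_Mapping.single k a" c f r] by simp

lemma kQ_simps:
  "carrier kQ = {x. \<forall>(v, p, w)\<in>Poly_Mapping.keys x. pre_digraph.awalk tilting_quiver v p w}"
  "x \<otimes>\<^bsub>kQ\<^esub> y = (\<Sum>(u', p', v')\<in>Poly_Mapping.keys x. \<Sum>(u, p, v)\<in>Poly_Mapping.keys y.
       if v = u' then Poly_Mapping.single (u, p @ p', v')
         (Poly_Mapping.lookup x (u', p', v') * Poly_Mapping.lookup y (u, p, v)) else 0)"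
  "x \<oplus>\<^bsub>kQ\<^esub> y = x + y" "a \<odot>\<^bsub>kQ\<^esub> x = pm_scale a x" "\<zero>\<^bsub>kQ\<^esub> = 0"
  by (simp_all add: kQ_def path_algebra_def)

lemma kQ_one:
  "\<one>\<^bsub>kQ\<^esub> = (\<Sum>v\<in>young (CARD('n) - 2). Poly_Mapping.single (v, [], v) 1 :: (nat \<times> nat,
      'n::finite arrow) path \<Rightarrow>\<^sub>0 'k::field)"
  by (simp add: kQ_def path_algebra_def tilting_quiver_def)

text \<open>The walk of the right factor is traversed first, so folding over the concatenation
  composes the operators. If the endpoints do not match, the inner operator is zero at the start of
  the outer path, in accordance with the product.\<close>

lemma alg_op_mult: "alg_op c (x \<otimes>\<^bsub>kQ\<^esub> y) f r = alg_op c x (alg_op c y f) r"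
proof -
  have 1: "alg_op c (case k of (u', p', v') \<Rightarrow> \<Sum>(u, p, v)\<in>Poly_Mapping.keys y.
        if v = u' then Poly_Mapping.single (u, p @ p', v')
          (Poly_Mapping.lookup x (u', p', v') * Poly_Mapping.lookup y (u, p, v)) else 0) f r
      = [:Poly_Mapping.lookup x k:] * path_op c k (alg_op c y f) r" for k
  proof -
    obtain u' p' v' where k: "k = (u', p', v')"
      by (cases k)
    have "alg_op c (case j of (u, p, v) \<Rightarrow> if v = u' then Poly_Mapping.single (u, p @ p', v')
          (Poly_Mapping.lookup x (u', p', v') * Poly_Mapping.lookup y (u, p, v)) else 0) f r
        = (if r = v' then [:Poly_Mapping.lookup x k:]
            * fold (arrow_op c) p' ([:Poly_Mapping.lookup y j:] * path_op c j f u') else 0)" for j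
    proof -
      obtain u p v where j: "j = (u, p, v)"
        by (cases j)
      show ?thesis
        unfolding fold_arrow_op_linear(2) using fold_arrow_op_linear(2)[of c p' 0 0]
        by (simp add: j k alg_op_single path_op_def mult.commute)
    qed
    then show ?thesis
      unfolding k prod.case alg_op_sum
      by (simp add: path_op_def alg_op_def[of c y f] fold_arrow_op_sum sum_distrib_left del: mult_pCons_left)
  qed
  show ?thesis
    unfolding kQ_simps(2) alg_op_sum 1 alg_op_def[of c x] ..
qed

section \<open>Walks of the tilting quiver and generators of its path algebra\<close>

lemma tilting_quiver_simps:
  "verts (tilting_quiver :: (_, 'n::finite arrow) pre_digraph) = young (CARD('n) - 2)"
  "(l, i, \<rho> :: 'n) \<in> arcs tilting_quiver \<longleftrightarrow> i \<in> {1, 2} \<and> l \<in> young (CARD('n) - 2) \<and> l + unit_weight i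
      \<in> young (CARD('n) - 2)"
  "tail tilting_quiver (l, i, \<rho> :: 'n) = l" "head tilting_quiver (l, i, \<rho> :: 'n) = l + unit_weight i"
  by (simp_all add: tilting_quiver_def)

lemma wf_tilting_quiver: "wf_digraph tilting_quiver"
  by unfold_locales (auto simp: tilting_quiver_def)

lemmas tilting_awalk_simps =
  wf_digraph.awalk_Nil_iff[OF wf_tilting_quiver] wf_digraph.awalk_Cons_iff[OF wf_tilting_quiver]

lemma tilting_awalk_append:
  "pre_digraph.awalk tilting_quiver v p w \<Longrightarrow> pre_digraph.awalk tilting_quiver w q z \<Longrightarrow>
    pre_digraph.awalk tilting_quiver v (p @ q) z"
  by (induction p arbitrary: v) (auto simp: tilting_awalk_simps)

lemma kQ_add_closed:
  "x \<in> carrier kQ \<Longrightarrow> y \<in> carrier kQ \<Longrightarrow> x + y \<in> carrier (kQ :: ('k::field, _) module)"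
  using Poly_Mapping.keys_add[of x y] by (auto simp: kQ_simps(1))

lemma kQ_carrier_sum: "(\<And>i. i \<in> I \<Longrightarrow> g i \<in> carrier kQ) \<Longrightarrow> sum g I \<in> carrier (kQ :: ('k::field, _) module)"
proof (induction I rule: infinite_finite_induct)
  case (insert i I)
  then show ?case
    by (simp add: kQ_add_closed)
qed (simp_all add: kQ_simps(1))

lemma
  shows kQ_scale_closed: "x \<in> carrier kQ \<Longrightarrow> pm_scale a x \<in> carrier kQ"
    and kQ_single_closed: "pre_digraph.awalk tilting_quiver v p w \<Longrightarrow> Poly_Mapping.single (v, p, w) a \<in> carrier kQ"
    and kQ_mult_closed: "x \<in> carrier kQ \<Longrightarrow> y \<in> carrier kQ \<Longrightarrow> x \<otimes>\<^bsub>kQ\<^esub> y \<in> carrier (kQ :: ('k::field, _) module)"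
proof -
  show "pm_scale a x \<in> carrier kQ" if "x \<in> carrier kQ"
    using that keys_pm_scale[of a x] by (auto simp: kQ_simps(1))
  show single: "Poly_Mapping.single (v, p, w) a \<in> carrier kQ" if "pre_digraph.awalk tilting_quiver v p w"
      for v p w and a :: 'k
    using that by (auto simp: kQ_simps(1))
  show "x \<otimes>\<^bsub>kQ\<^esub> y \<in> carrier kQ" if x: "x \<in> carrier kQ" and y: "y \<in> carrier kQ"
    unfolding kQ_simps(2)
  proof (intro kQ_carrier_sum, unfold split_paired_all prod.case, intro kQ_carrier_sum,
      unfold split_paired_all prod.case)
    fix u' p' v' u p v
    assume "(u', p', v') \<in> Poly_Mapping.keys x" "(u, p, v) \<in> Poly_Mapping.keys y"
    then have "pre_digraph.awalk tilting_quiver u' p' v'" "pre_digraph.awalk tilting_quiver u p v"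
      using x y by (auto simp: kQ_simps(1))
    then show "(if v = u' then Poly_Mapping.single (u, p @ p', v')
        (Poly_Mapping.lookup x (u', p', v') * Poly_Mapping.lookup y (u, p, v)) else 0) \<in> carrier kQ"
      by (simp add: single tilting_awalk_append) (simp add: kQ_simps(1))
  qed
qed

lemma poly_mapping_eq_sum: "x =
    (\<Sum>k\<in>Poly_Mapping.keys x. pm_scale (Poly_Mapping.lookup x k) (Poly_Mapping.single k 1))"
proof (rule poly_mapping_eqI)
  fix s
  have "Poly_Mapping.lookup (\<Sum>t\<in>Poly_Mapping.keys x. pm_scale (Poly_Mapping.lookup x t) (Poly_Mapping.single t 1)) s
      = (\<Sum>t\<in>Poly_Mapping.keys x. if t = s then Poly_Mapping.lookup x t else 0)"
    unfolding lookup_sum by (rule sum.cong) (simp_all add: lookup_single when_def)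
  then show "Poly_Mapping.lookup x s
      = Poly_Mapping.lookup (\<Sum>t\<in>Poly_Mapping.keys x. pm_scale (Poly_Mapping.lookup x t) (Poly_Mapping.single t 1)) s"
    by (simp add: in_keys_iff)
qed

text \<open>Idempotents and arrows generate the path algebra: the first arrow of a walk is split off
  as a right factor. This serves both the uniqueness of the homomorphism and the regularity of its
  values.\<close>

lemma kQ_induct [consumes 1, case_names vertex arrow mult add scale]:
  fixes x :: "(nat \<times> nat, 'n::finite arrow) path \<Rightarrow>\<^sub>0 'k::field"
  assumes x: "x \<in> carrier kQ"
    and vertex: "\<And>l. l \<in> verts (tilting_quiver :: (_, 'n arrow) pre_digraph) \<Longrightarrow> P (vertex_idem l)"
    and arrow: "\<And>l i \<rho>. (l, i, \<rho>) \<in> arcs tilting_quiver \<Longrightarrow> P (arrow_elem tilting_quiver (l, i, \<rho>))"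
    and mult: "\<And>x y. x \<in> carrier kQ \<Longrightarrow> y \<in> carrier kQ \<Longrightarrow> P x \<Longrightarrow> P y \<Longrightarrow> P (x \<otimes>\<^bsub>kQ\<^esub> y)"
    and add: "\<And>x y. x \<in> carrier kQ \<Longrightarrow> y \<in> carrier kQ \<Longrightarrow> P x \<Longrightarrow> P y \<Longrightarrow> P (x + y)"
    and scale: "\<And>a x. x \<in> carrier kQ \<Longrightarrow> P x \<Longrightarrow> P (pm_scale a x)"
  shows "P x"
proof -
  have path: "P (Poly_Mapping.single (v, p, w) 1)"
      if "pre_digraph.awalk (tilting_quiver :: (_, 'n arrow) pre_digraph) v p w" for v p w
    using that
  proof (induction p arbitrary: v)
    case Nil
    then have "v = w" "v \<in> verts (tilting_quiver :: (_, 'n arrow) pre_digraph)"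
      by (auto simp: tilting_awalk_simps)
    then show ?case
      using vertex[of v] by (simp add: vertex_idem_def)
  next
    case (Cons a p)
    let ?h = "head tilting_quiver a"
    have a: "a \<in> arcs tilting_quiver" "v = tail tilting_quiver a" "pre_digraph.awalk tilting_quiver ?h p w"
      using Cons.prems by (simp_all add: tilting_awalk_simps)
    have "P (arrow_elem tilting_quiver a)"
      using arrow a(1) by (cases a) blast
    moreover have "(arrow_elem tilting_quiver a :: _ \<Rightarrow>\<^sub>0 'k) \<in> carrier kQ"
      unfolding arrow_elem_def using a wf_digraph.head_in_verts[OF wf_tilting_quiver a(1)]
      by (intro kQ_single_closed) (simp add: tilting_awalk_simps)
    ultimately have "P (Poly_Mapping.single (?h, p, w) 1 \<otimes>\<^bsub>kQ\<^esub> arrow_elem tilting_quiver a)"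
      using mult Cons.IH[OF a(3)] kQ_single_closed[OF a(3)] by blast
    moreover have "Poly_Mapping.single (?h, p, w) 1 \<otimes>\<^bsub>kQ\<^esub> arrow_elem tilting_quiver a
        = (Poly_Mapping.single (v, a # p, w) 1 :: _ \<Rightarrow>\<^sub>0 'k)"
      by (simp add: kQ_simps(2) arrow_elem_def a(2))
    ultimately show ?case
      by simp
  qed
  \<comment> \<open>The empty sum is the zero multiple of the idempotent at (0, 0), which always is
    a vertex.\<close>
  have P0: "P 0"
  proof -
    have 0: "(0, 0) \<in> verts (tilting_quiver :: (_, 'n arrow) pre_digraph)"
      by (simp add: tilting_quiver_simps young_def)
    then have "P (pm_scale 0 (vertex_idem (0, 0)))"
      using vertex by (intro scale) (auto simp: vertex_idem_def tilting_awalk_simps intro: kQ_single_closed)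
    then show ?thesis
      by simp
  qed
  have "(\<Sum>k\<in>A. pm_scale (Poly_Mapping.lookup x k) (Poly_Mapping.single k 1)) \<in> carrier kQ \<and>
      P (\<Sum>k\<in>A. pm_scale (Poly_Mapping.lookup x k) (Poly_Mapping.single k 1))"
    if "finite A" "A \<subseteq> Poly_Mapping.keys x" for A
    using that
  proof (induction A)
    case empty
    then show ?case
      using P0 by (simp add: kQ_simps(1))
  next
    case (insert k A)
    obtain v p w where k: "k = (v, p, w)"
      by (cases k)
    have w: "pre_digraph.awalk tilting_quiver v p w"
      using x insert.prems by (auto simp: k kQ_simps(1))
    have "pm_scale (Poly_Mapping.lookup x k) (Poly_Mapping.single k 1) \<in> carrier kQ"
      "P (pm_scale (Poly_Mapping.lookup x k) (Poly_Mapping.single k 1))"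
      unfolding k by (intro kQ_scale_closed kQ_single_closed w scale path)+
    then show ?case
      using insert by (simp add: add kQ_add_closed)
  qed
  from this[OF finite_keys order.refl] show ?thesis
    using poly_mapping_eq_sum[of x] by simp
qed

lemma alg_hom_unique:
  fixes x :: "(nat \<times> nat, 'n::finite arrow) path \<Rightarrow>\<^sub>0 'k::field"
  assumes "tilting_hom u \<Phi>" "tilting_hom u \<Psi>" "x \<in> carrier kQ"
  shows "\<Psi> x = \<Phi> x"
  using assms(3)
proof (induction rule: kQ_induct)
  case (vertex l)
  then show ?case
    using assms(1,2) by (simp add: tilting_hom_def)
next
  case (arrow l i \<rho>)
  then consider "i = 1" | "i = 2"
    by (auto simp: tilting_quiver_simps)
  then show ?case
  proof cases
    case 1
    then show ?thesis
      using assms(1,2) arrow unfolding tilting_hom_def 1 by metis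
  next
    case 2
    then show ?thesis
      using assms(1,2) arrow unfolding tilting_hom_def 2 by metis
  qed
next
  case (mult x y)
  then show ?case
    using assms(1,2) by (simp add: tilting_hom_def alg_hom_def ring_hom_def)
next
  case (add x y)
  have "\<Psi> (x \<oplus>\<^bsub>kQ\<^esub> y) = \<Psi> x \<oplus>\<^bsub>End_E\<^esub> \<Psi> y" "\<Phi> (x \<oplus>\<^bsub>kQ\<^esub> y) = \<Phi> x \<oplus>\<^bsub>End_E\<^esub> \<Phi> y"
    using assms(1,2) add(1,2) by (simp_all add: tilting_hom_def alg_hom_def ring_hom_def)
  then show ?case
    using add(3,4) by (simp add: kQ_simps)
next
  case (scale a x)
  have "\<Psi> (a \<odot>\<^bsub>kQ\<^esub> x) = a \<odot>\<^bsub>End_E\<^esub> \<Psi> x" "\<Phi> (a \<odot>\<^bsub>kQ\<^esub> x) = a \<odot>\<^bsub>End_E\<^esub> \<Phi> x"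
    using assms(1,2) scale(1) by (simp_all add: tilting_hom_def alg_hom_def)
  then show ?case
    using scale(2) by (simp add: kQ_simps)
qed

lemma add_unit_weight: "l + unit_weight (Suc 0) = (Suc (fst l), snd l)" "l + unit_weight 2 = (fst l, Suc (snd l))"
  by (simp_all add: unit_weight_def plus_prod_def)

lemma young_iff: "l \<in> young m \<longleftrightarrow> fst l \<le> m \<and> snd l \<le> fst l"
  by (simp add: young_def)

section \<open>The homomorphism from the path algebra, defined through frames\<close>

context ordered_basis
begin

lemma degree_arrow_op:
  assumes "a \<in> arcs (tilting_quiver :: (_, 'n arrow) pre_digraph)"
    and "degree p \<le> fst (tail tilting_quiver a) - snd (tail tilting_quiver a)"
  shows "degree (arrow_op c a p) \<le> fst (head tilting_quiver a) - snd (head tilting_quiver a)"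
proof -
  obtain l i \<rho> where a: "a = (l, i, \<rho>)"
    by (cases a)
  consider "i = 1" | "i = 2"
    using assms(1) by (auto simp: a tilting_quiver_simps)
  then show ?thesis
  proof cases
    case 1
    have "degree (lin (c \<rho>) * p) \<le> 1 + (fst l - snd l)"
      using degree_mult_le[of "lin (c \<rho>)" p] degree_lin[of "c \<rho>"] assms(2) by (simp add: a tilting_quiver_simps)
    moreover have "snd l \<le> fst l"
      using assms(1) by (simp add: a tilting_quiver_simps young_iff)
    ultimately show ?thesis
      by (simp add: a 1 arrow_op_def tilting_quiver_simps add_unit_weight)
  next
    case 2
    then have "snd l < fst l"
      using assms(1) by (simp add: a tilting_quiver_simps young_iff add_unit_weight)
    then obtain m where "fst l - snd l = Suc m"
      by (metis Suc_diff_Suc)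
    moreover have "degree p \<le> fst l - snd l"
      using assms(2) by (simp add: a tilting_quiver_simps)
    ultimately show ?thesis
      using degree_wedge[of p m "c \<rho>"] by (simp add: a 2 arrow_op_def tilting_quiver_simps add_unit_weight)
  qed
qed

lemma degree_fold_arrow_op:
  assumes "pre_digraph.awalk (tilting_quiver :: (_, 'n arrow) pre_digraph) v p w" "degree q \<le> fst v - snd v"
  shows "degree (fold (arrow_op c) p q) \<le> fst w - snd w"
  using assms
proof (induction p arbitrary: v q)
  case (Cons a p)
  then have "a \<in> arcs tilting_quiver" "v = tail tilting_quiver a"
      "pre_digraph.awalk tilting_quiver (head tilting_quiver a) p w"
    by (simp_all add: tilting_awalk_simps)
  then show ?case
    using Cons.IH[of "head tilting_quiver a" "arrow_op c a q"] degree_arrow_op[of a q c] Cons.prems(2) by simp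
qed (simp add: tilting_awalk_simps)

lemma alg_op_forms:
  assumes x: "x \<in> carrier (kQ :: ('k, (nat \<times> nat, 'n arrow) path \<Rightarrow>\<^sub>0 'k) module)" and f: "f \<in> forms"
  shows "alg_op c x f \<in> forms"
proof -
  have path: "degree (path_op c k f r) \<le> fst r - snd r \<and> (r \<notin> young (CARD('n) - 2) \<longrightarrow> path_op c k f r = 0)"
    if k: "k \<in> Poly_Mapping.keys x" for k r
  proof -
    obtain v p w where vpw: "k = (v, p, w)"
      by (cases k)
    have walk: "pre_digraph.awalk (tilting_quiver :: (_, 'n arrow) pre_digraph) v p w"
      using x k by (auto simp: kQ_simps(1) vpw)
    then have "v \<in> young (CARD('n) - 2)" "w \<in> young (CARD('n) - 2)"
      using wf_digraph.awalk_hd_in_verts[OF wf_tilting_quiver walk]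
          wf_digraph.awalk_last_in_verts[OF wf_tilting_quiver walk]
      by (simp_all add: tilting_quiver_simps)
    then show ?thesis
      using degree_fold_arrow_op[OF walk formsD(1)[OF f], of c] by (auto simp: vpw path_op_def)
  qed
  show ?thesis
  proof (rule formsI)
    show "degree (alg_op c x f l) \<le> fst l - snd l" for l
      unfolding alg_op_def
    proof (rule degree_sum_le)
      fix k assume "k \<in> Poly_Mapping.keys x"
      then have "degree (path_op c k f l) \<le> fst l - snd l"
        using path by blast
      then show "degree ([:Poly_Mapping.lookup x k:] * path_op c k f l) \<le> fst l - snd l"
        using degree_mult_le[of "[:Poly_Mapping.lookup x k:]" "path_op c k f l"] by (simp del: mult_pCons_left)
    qed simp
    show "alg_op c x f l = 0" if "l \<notin> young (CARD('n) - 2)" for l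
      unfolding alg_op_def using path that by simp
  qed
qed

definition frame_of :: "('k ^ 'n) set \<Rightarrow> ('k, 'n) frame"
  where "frame_of K = (SOME c. nondegenerate c \<and> K = ker c)"

lemma frame_of:
  assumes "K \<in> Gr2"
  shows "nondegenerate (frame_of K)" "ker (frame_of K) = K"
  using someI_ex[OF Gr2_is_ker[OF assms]] by (simp_all add: frame_of_def)

text \<open>An endomorphism is a family over points, so one frame over each point is fixed to
  compute it. Regularity of the result is not visible from such a choice; it is shown on generators,
  where the values are the identity and the bundle maps f and g.\<close>

definition represent :: "((nat \<times> nat, 'n arrow) path \<Rightarrow>\<^sub>0 'k) \<Rightarrow> ('k, 'n) E_endo"
  where "represent x = (\<lambda>K\<in>Gr2. \<lambda>s\<in>carrier (E_fibre K). IV (frame_of K) (alg_op (frame_of K) x (EV (frame_of K) s)))"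

text \<open>Endomorphisms are extensional over points and over fibres, so an equality needs matching
  domains besides matching forms. The forms are compared in the chosen frame alone.\<close>

lemma represent_eqI:
  fixes \<phi> :: "('k, 'n) E_endo"
  assumes x: "x \<in> carrier kQ"
    and ext: "\<phi> \<in> extensional Gr2" "\<And>K. K \<in> Gr2 \<Longrightarrow> \<phi> K \<in> extensional (carrier (E_fibre K))"
    and closed: "\<And>c s. nondegenerate c \<Longrightarrow> s \<in> carrier (E_fibre (ker c)) \<Longrightarrow> \<phi> (ker c) s \<in> carrier (E_fibre (ker c))"
    and eq: "\<And>c s r. nondegenerate c \<Longrightarrow> c = frame_of (ker c) \<Longrightarrow> s \<in> carrier (E_fibre (ker c)) \<Longrightarrow> r
        \<in> young (CARD('n) - 2) \<Longrightarrow>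
      EV c (\<phi> (ker c) s) r = alg_op c x (EV c s) r"
  shows "represent x = \<phi>"
proof (rule extensionalityI[OF _ ext(1)])
  show "represent x \<in> extensional Gr2"
    by (simp add: represent_def)
  fix K :: "('k ^ 'n) set" assume K: "K \<in> Gr2"
  define c where "c = frame_of K"
  have c: "nondegenerate c" "ker c = K"
    unfolding c_def using frame_of[OF K] by simp_all
  show "represent x K = \<phi> K"
  proof (rule extensionalityI[OF _ ext(2)[OF K]])
    show "represent x K \<in> extensional (carrier (E_fibre K))"
      using K by (simp add: represent_def)
    fix s assume s: "s \<in> carrier (E_fibre K)"
    have rep: "represent x K s = IV c (alg_op c x (EV c s))"
      using K s by (simp add: represent_def c_def)
    have s': "s \<in> carrier (E_fibre (ker c))"
      using s c by simp
    have "IV c (alg_op c x (EV c s)) = \<phi> (ker c) s"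
    proof (rule EV_eqI[OF c(1) IV_carrier[OF c(1)] closed[OF c(1) s']])
      fix r :: "nat \<times> nat" assume r: "r \<in> young (CARD('n) - 2)"
      show "EV c (IV c (alg_op c x (EV c s))) r = EV c (\<phi> (ker c) s) r"
        unfolding EV_IV[OF c(1) alg_op_forms[OF x EV_forms[OF c(1) s']]]
        by (rule eq[OF c(1) _ s' r, symmetric]) (simp add: c c_def[symmetric])
    qed
    then show "represent x K s = \<phi> K s"
      by (simp add: rep c(2))
  qed
qed

lemma represent_closed_EV:
  assumes c: "nondegenerate c" "c = frame_of (ker c)" and s: "s \<in> carrier (E_fibre (ker c))" and x: "x \<in> carrier kQ"
  shows "represent x (ker c) s \<in> carrier (E_fibre (ker c))" "EV c (represent x (ker c) s) = alg_op c x (EV c s)"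
proof -
  have eq: "represent x (ker c) s = IV c (alg_op c x (EV c s))"
    using ker_in_Gr2[OF c(1)] s c(2) by (simp add: represent_def)
  show "represent x (ker c) s \<in> carrier (E_fibre (ker c))"
    unfolding eq by (rule IV_carrier[OF c(1)])
  show "EV c (represent x (ker c) s) = alg_op c x (EV c s)"
    unfolding eq by (rule EV_IV[OF c(1) alg_op_forms[OF x EV_forms[OF c(1) s]]])
qed

lemma represent_carrier_fibre:
  assumes K: "K \<in> Gr2" and s: "s \<in> carrier (E_fibre K)"
  shows "represent x K s \<in> carrier (E_fibre K)"
  using IV_carrier[OF frame_of(1)[OF K], of "alg_op (frame_of K) x (EV (frame_of K) s)"] K s
  by (simp add: represent_def frame_of(2)[OF K])

text \<open>The intermediate element lies in the fibre over the same point, so both factors are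
  computed in the same chosen frame and the product rule for the operators applies.\<close>

lemma represent_mult:
  assumes x: "x \<in> carrier kQ" and y: "y \<in> carrier kQ"
  shows "represent (x \<otimes>\<^bsub>kQ\<^esub> y) = represent x \<otimes>\<^bsub>End_E\<^esub> represent y"
proof (rule represent_eqI[OF kQ_mult_closed[OF x y]])
  show "represent x \<otimes>\<^bsub>End_E\<^esub> represent y \<in> extensional Gr2"
    by (simp add: End_E_simps)
  show "(represent x \<otimes>\<^bsub>End_E\<^esub> represent y) K \<in> extensional (carrier (E_fibre K))" if "K \<in> Gr2" for K
    using that by (simp add: End_E_simps compose_def)
  have eq: "(represent x \<otimes>\<^bsub>End_E\<^esub> represent y) (ker c) s = represent x (ker c) (represent y (ker c) s)"
    if "nondegenerate c" "s \<in> carrier (E_fibre (ker c))" for c s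
    using ker_in_Gr2[OF that(1)] that(2) by (simp add: End_E_simps compose_def)
  show "(represent x \<otimes>\<^bsub>End_E\<^esub> represent y) (ker c) s \<in> carrier (E_fibre (ker c))"
    if "nondegenerate c" "s \<in> carrier (E_fibre (ker c))" for c s
    unfolding eq[OF that] using ker_in_Gr2[OF that(1)] that(2) by (intro represent_carrier_fibre)
  show "EV c ((represent x \<otimes>\<^bsub>End_E\<^esub> represent y) (ker c) s) r = alg_op c (x \<otimes>\<^bsub>kQ\<^esub> y) (EV c s) r"
    if c: "nondegenerate c" "c = frame_of (ker c)" and s: "s \<in> carrier (E_fibre (ker c))" for c s r
    unfolding eq[OF c(1) s] alg_op_mult represent_closed_EV(2)[OF c represent_closed_EV(1)[OF c s y] x]
      represent_closed_EV(2)[OF c s y] ..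
qed

lemma represent_add:
  assumes x: "x \<in> carrier kQ" and y: "y \<in> carrier kQ"
  shows "represent (x + y) = represent x \<oplus>\<^bsub>End_E\<^esub> represent y"
proof (rule represent_eqI[OF kQ_add_closed[OF x y]])
  show "represent x \<oplus>\<^bsub>End_E\<^esub> represent y \<in> extensional Gr2"
    by (simp add: End_E_simps)
  show "(represent x \<oplus>\<^bsub>End_E\<^esub> represent y) K \<in> extensional (carrier (E_fibre K))" if "K \<in> Gr2" for K
    using that by (simp add: End_E_simps)
  have eq: "(represent x \<oplus>\<^bsub>End_E\<^esub> represent y) (ker c) s =
      represent x (ker c) s \<oplus>\<^bsub>E_fibre (ker c)\<^esub> represent y (ker c) s"
    if "nondegenerate c" "s \<in> carrier (E_fibre (ker c))" for c s
    using ker_in_Gr2[OF that(1)] that(2) by (simp add: End_E_simps)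
  show "(represent x \<oplus>\<^bsub>End_E\<^esub> represent y) (ker c) s \<in> carrier (E_fibre (ker c))"
    if "nondegenerate c" "s \<in> carrier (E_fibre (ker c))" for c s
    unfolding eq[OF that] using ker_in_Gr2[OF that(1)] that by (intro E_add_closed represent_carrier_fibre)
  show "EV c ((represent x \<oplus>\<^bsub>End_E\<^esub> represent y) (ker c) s) r = alg_op c (x + y) (EV c s) r"
    if c: "nondegenerate c" "c = frame_of (ker c)" and s: "s \<in> carrier (E_fibre (ker c))" for c s r
    unfolding eq[OF c(1) s] EV_add[OF c(1) represent_closed_EV(1)[OF c s x] represent_closed_EV(1)[OF c s y]]
      represent_closed_EV(2)[OF c s x] represent_closed_EV(2)[OF c s y] alg_op_add ..
qed

lemma represent_scale:
  assumes x: "x \<in> carrier kQ"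
  shows "represent (pm_scale a x) = a \<odot>\<^bsub>End_E\<^esub> represent x"
proof (rule represent_eqI[OF kQ_scale_closed[OF x]])
  show "a \<odot>\<^bsub>End_E\<^esub> represent x \<in> extensional Gr2"
    by (simp add: End_E_simps)
  show "(a \<odot>\<^bsub>End_E\<^esub> represent x) K \<in> extensional (carrier (E_fibre K))" if "K \<in> Gr2" for K
    using that by (simp add: End_E_simps)
  have eq: "(a \<odot>\<^bsub>End_E\<^esub> represent x) (ker c) s = a \<odot>\<^bsub>E_fibre (ker c)\<^esub> represent x (ker c) s"
    if "nondegenerate c" "s \<in> carrier (E_fibre (ker c))" for c s
    using ker_in_Gr2[OF that(1)] that(2) by (simp add: End_E_simps)
  show "(a \<odot>\<^bsub>End_E\<^esub> represent x) (ker c) s \<in> carrier (E_fibre (ker c))"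
    if "nondegenerate c" "s \<in> carrier (E_fibre (ker c))" for c s
    unfolding eq[OF that] using ker_in_Gr2[OF that(1)] that by (intro E_smult_closed represent_carrier_fibre)
  show "EV c ((a \<odot>\<^bsub>End_E\<^esub> represent x) (ker c) s) r = alg_op c (pm_scale a x) (EV c s) r"
    if c: "nondegenerate c" "c = frame_of (ker c)" and s: "s \<in> carrier (E_fibre (ker c))" for c s r
    unfolding eq[OF c(1) s] EV_smult[OF c(1) represent_closed_EV(1)[OF c s x]]
      represent_closed_EV(2)[OF c s x] alg_op_scale ..
qed

lemma vertex_idem_carrier: "l \<in> young (CARD('n) - 2) \<Longrightarrow> (vertex_idem l :: (nat \<times> nat, 'n arrow) path \<Rightarrow>\<^sub>0 'k)
    \<in> carrier kQ"
  unfolding vertex_idem_def by (rule kQ_single_closed) (simp add: tilting_awalk_simps tilting_quiver_simps)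

lemma arrow_elem_carrier:
  assumes "(l, i, \<rho> :: 'n) \<in> arcs tilting_quiver"
  shows "(arrow_elem tilting_quiver (l, i, \<rho>) :: (nat \<times> nat, 'n arrow) path \<Rightarrow>\<^sub>0 'k) \<in> carrier kQ"
  unfolding arrow_elem_def
  using assms by (intro kQ_single_closed) (simp add: tilting_awalk_simps tilting_quiver_simps)

lemma alg_op_vertex: "alg_op c (vertex_idem l) f r = single_form l (f l) r"
  by (simp add: vertex_idem_def alg_op_single path_op_def single_form_def)

lemma alg_op_arrow:
  "alg_op c (arrow_elem tilting_quiver (l, i, \<rho>)) f r =
      single_form (l + unit_weight i) (arrow_op c (l, i, \<rho>) (f l)) r"
  by (simp add: arrow_elem_def alg_op_single path_op_def single_form_def tilting_quiver_simps)

text \<open>Identifies the image of a generator: an element that acts on forms by a single block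
  agrees in the chosen frame with the bundle map of that block.\<close>

lemma represent_summand_endo:
  assumes x: "x \<in> carrier kQ" and h: "fibre_form_map l m h \<theta>"
    and l: "l \<in> young (CARD('n) - 2)" and m: "m \<in> young (CARD('n) - 2)"
    and op: "\<And>c f r. alg_op c x f r = single_form m (\<theta> c (f l)) r"
  shows "represent x = summand_endo l m h"
proof (rule represent_eqI[OF x])
  show "summand_endo l m h \<in> extensional Gr2" "\<And>K. K \<in> Gr2 \<Longrightarrow> summand_endo l m h K \<in> extensional (carrier (E_fibre K))"
    by (simp_all add: summand_endo_def)
  show "summand_endo l m h (ker c) s \<in> carrier (E_fibre (ker c))"
    if "nondegenerate c" "s \<in> carrier (E_fibre (ker c))" for c s
    by (rule summand_endo_EV(1)[OF h l m that])
  show "EV c (summand_endo l m h (ker c) s) r = alg_op c x (EV c s) r"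
    if "nondegenerate c" "s \<in> carrier (E_fibre (ker c))" "r \<in> young (CARD('n) - 2)" for c s r
    unfolding op by (rule summand_endo_EV(2)[OF h l m that])
qed

lemma represent_vertex:
  "l \<in> young (CARD('n) - 2) \<Longrightarrow> represent (vertex_idem l) = summand_endo l l (\<lambda>K s. s)"
  by (rule represent_summand_endo[OF vertex_idem_carrier fibre_form_map_id]) (simp_all add: alg_op_vertex)

lemma represent_arrow1:
  assumes a: "(l, 1, \<rho>) \<in> arcs (tilting_quiver :: (_, 'n arrow) pre_digraph)"
  shows "represent (arrow_elem tilting_quiver (l, 1, \<rho>)) = summand_endo l (l + unit_weight 1) (f_map l (u \<rho>))"
    "fibre_form_map l (l + unit_weight 1) (f_map l (u \<rho>)) (\<lambda>c p. lin (quot c (u \<rho>)) * p)"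
proof -
  have l: "l \<in> young (CARD('n) - 2)" "l + unit_weight 1 \<in> young (CARD('n) - 2)"
    using a by (simp_all add: tilting_quiver_simps)
  then have "snd l \<le> fst l"
    by (simp add: young_iff)
  then show h: "fibre_form_map l (l + unit_weight 1) (f_map l (u \<rho>)) (\<lambda>c p. lin (quot c (u \<rho>)) * p)"
    by (rule fibre_form_map_f)
  show "represent (arrow_elem tilting_quiver (l, 1, \<rho>)) = summand_endo l (l + unit_weight 1) (f_map l (u \<rho>))"
    by (rule represent_summand_endo[OF arrow_elem_carrier[OF a] h l]) (simp add: alg_op_arrow arrow_op_def)
qed

lemma represent_arrow2:
  assumes a: "(l, 2, \<rho>) \<in> arcs (tilting_quiver :: (_, 'n arrow) pre_digraph)"
  shows "represent (arrow_elem tilting_quiver (l, 2, \<rho>)) = summand_endo l (l + unit_weight 2) (g_map l (u \<rho>))"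
    "fibre_form_map l (l + unit_weight 2) (g_map l (u \<rho>)) (\<lambda>c. wedge (fst l - snd l) (quot c (u \<rho>)))"
proof -
  have l: "l \<in> young (CARD('n) - 2)" "l + unit_weight 2 \<in> young (CARD('n) - 2)"
    using a by (simp_all add: tilting_quiver_simps)
  then have "snd l < fst l"
    by (simp add: young_iff add_unit_weight)
  then show h: "fibre_form_map l (l + unit_weight 2) (g_map l (u \<rho>)) (\<lambda>c. wedge (fst l - snd l) (quot c (u \<rho>)))"
    by (rule fibre_form_map_g)
  show "represent (arrow_elem tilting_quiver (l, 2, \<rho>)) = summand_endo l (l + unit_weight 2) (g_map l (u \<rho>))"
    by (rule represent_summand_endo[OF arrow_elem_carrier[OF a] h l]) (simp add: alg_op_arrow arrow_op_def)
qed

text \<open>Idempotents and arrows go to bundle maps already known to preserve regular sections, and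
  the operations of the endomorphism algebra keep this property.\<close>

lemma represent_closed: "x \<in> carrier kQ \<Longrightarrow> represent x \<in> carrier End_E"
proof (induction rule: kQ_induct)
  case (vertex l)
  then have l: "l \<in> young (CARD('n) - 2)"
    by (simp add: tilting_quiver_simps)
  show ?case
    unfolding represent_vertex[OF l] by (rule summand_endo_closed[OF fibre_form_map_id l l])
next
  case (arrow l i \<rho>)
  then have l: "l \<in> young (CARD('n) - 2)" "l + unit_weight i \<in> young (CARD('n) - 2)"
    by (simp_all add: tilting_quiver_simps)
  consider "i = 1" | "i = 2"
    using arrow by (auto simp: tilting_quiver_simps)
  then show ?case
  proof cases
    case 1
    then show ?thesis
      using summand_endo_closed[OF represent_arrow1(2)] represent_arrow1(1) arrow l by simp
  next
    case 2
    then show ?thesis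
      using summand_endo_closed[OF represent_arrow2(2)] represent_arrow2(1) arrow l by simp
  qed
qed (simp_all add: represent_mult represent_add represent_scale End_E_mult_closed End_E_add_closed End_E_smult_closed)

lemma represent_one: "represent \<one>\<^bsub>kQ\<^esub> = \<one>\<^bsub>End_E\<^esub>"
proof (rule represent_eqI)
  show "\<one>\<^bsub>kQ\<^esub> \<in> carrier (kQ :: ('k, (nat \<times> nat, 'n arrow) path \<Rightarrow>\<^sub>0 'k) module)"
    unfolding kQ_one by (intro kQ_carrier_sum kQ_single_closed) (simp add: tilting_awalk_simps tilting_quiver_simps)
  show "\<one>\<^bsub>End_E\<^esub> \<in> extensional Gr2" "\<And>K. K \<in> Gr2 \<Longrightarrow> \<one>\<^bsub>End_E\<^esub> K \<in> extensional (carrier (E_fibre K))"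
    by (simp_all add: End_E_simps)
  show "\<one>\<^bsub>End_E\<^esub> (ker c) s \<in> carrier (E_fibre (ker c))" if "nondegenerate c" "s \<in> carrier (E_fibre (ker c))" for c s
    using ker_in_Gr2[OF that(1)] that(2) by (simp add: End_E_simps)
  show "EV c (\<one>\<^bsub>End_E\<^esub> (ker c) s) r = alg_op c \<one>\<^bsub>kQ\<^esub> (EV c s) r"
    if c: "nondegenerate c" and s: "s \<in> carrier (E_fibre (ker c))" and r: "r \<in> young (CARD('n) - 2)" for c s r
    using ker_in_Gr2[OF c] s r
    by (simp add: End_E_simps kQ_one alg_op_sum alg_op_single path_op_def finite_young
        if_distrib[of "\<lambda>x. _ * x"] cong: if_cong)
qed

lemma represent_tilting_hom: "tilting_hom u represent"
  unfolding tilting_hom_def alg_hom_def ring_hom_def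
  using represent_vertex represent_arrow1(1) represent_arrow2(1)
  by (auto simp: represent_closed represent_mult represent_add represent_scale represent_one kQ_simps(3,4)
      tilting_quiver_simps)

text \<open>Induction on the difference of sizes. The decomposition writes the family as a sum of
  families from larger weights, each composed with the operator of an arrow. The induction
  hypothesis realises the former, and multiplication by the arrow on the right realises the
  composite.\<close>

lemma covariant_realized:
  assumes F: "covariant l r F" and l: "l \<in> young (CARD('n) - 2)" and r: "r \<in> young (CARD('n) - 2)"
  shows "\<exists>x\<in>carrier (kQ :: ('k, (nat \<times> nat, 'n arrow) path \<Rightarrow>\<^sub>0 'k) module).
    \<forall>c f q. f \<in> forms \<longrightarrow> alg_op c x f q = single_form r (F c (f l)) q"
  using F l
proof (induction "fst r + snd r - (fst l + snd l)" arbitrary: l F)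
  case 0
  then consider "fst r + snd r < fst l + snd l" | "fst r + snd r = fst l + snd l"
    by linarith
  \<comment> \<open>Both remaining cases give a scalar: zero for negative degree, the one of Schur's
    lemma for degree zero.\<close>
  then obtain \<tau> where \<tau>: "\<And>c p. degree p \<le> fst l - snd l \<Longrightarrow> F c p = [:\<tau>:] * p" "l \<noteq> r \<Longrightarrow> \<tau> = 0"
  proof cases
    case 1
    then have "F c p = [:0:] * p" if "degree p \<le> fst l - snd l" for c p
      using covariant_negative_degree[OF 0(2) that] by simp
    then show thesis
      by (rule that) simp_all
  next
    case 2
    show thesis
      using covariant_degree_zero[OF 0(2) 2] by (elim exE conjE) (rule that, blast+)
  qed
  \<comment> \<open>For l distinct from r the scalar is zero, so a multiple of the idempotent at r
    is right although the family starts at l.\<close>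
  have "alg_op c (pm_scale \<tau> (vertex_idem r)) f q = single_form r (F c (f l)) q" if f: "f \<in> forms" for c f q
    using \<tau>(1)[OF formsD(1)[OF f 0(3)]] \<tau>(2)
    by (cases "l = r") (simp_all add: alg_op_scale alg_op_vertex single_form_def)
  then show ?case
    using kQ_scale_closed[OF vertex_idem_carrier[OF r]] by blast
next
  case (Suc d)
  then have d: "fst r + snd r = Suc (fst l + snd l + d)"
    by linarith
  note l = Suc.prems(2)
  have snd_le: "snd l \<le> fst l"
    using l by (simp add: young_iff)
  show ?case
  proof (rule covariant_decomposition[OF Suc.prems(1) d])
    fix G H
    assume G: "\<And>i. covariant (Suc (fst l), snd l) r (G i)"
      and H: "\<And>i. snd l < fst l \<Longrightarrow> covariant (fst l, Suc (snd l)) r (H i)"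
      and F: "\<And>c p. degree p \<le> fst l - snd l \<Longrightarrow>
        F c p = (\<Sum>i\<in>UNIV. G i c (lin (c i) * p)) +
          (if snd l < fst l then \<Sum>i\<in>UNIV. H i c (wedge (fst l - snd l) (c i) p) else 0)"
    have step: "\<exists>x\<in>carrier kQ. \<forall>c f q. f \<in> forms \<longrightarrow> alg_op c x f q =
        single_form r (G' c (arrow_op c (l, i, \<rho>) (f l))) q"
      if arc: "(l, i, \<rho>) \<in> arcs tilting_quiver" and G': "covariant (l + unit_weight i) r G'"
        and d': "d = fst r + snd r - (fst (l + unit_weight i) + snd (l + unit_weight i))" for i and \<rho> :: 'n and G'
    proof -
      have "l + unit_weight i \<in> young (CARD('n) - 2)"
        using arc by (simp add: tilting_quiver_simps)
      from Suc.hyps(1)[OF d' G' this] obtain y where y: "y \<in> carrier kQ"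
        "\<And>c f q. f \<in> forms \<Longrightarrow> alg_op c y f q = single_form r (G' c (f (l + unit_weight i))) q"
        by blast
      note a = arrow_elem_carrier[OF arc]
      have "alg_op c (y \<otimes>\<^bsub>kQ\<^esub> arrow_elem tilting_quiver (l, i, \<rho>)) f q =
          single_form r (G' c (arrow_op c (l, i, \<rho>) (f l))) q"
        if f: "f \<in> forms" for c f q
        unfolding alg_op_mult y(2)[OF alg_op_forms[OF a f]] alg_op_arrow by (simp add: single_form_def)
      then show ?thesis
        using kQ_mult_closed[OF y(1) a] by blast
    qed
    have "\<exists>x\<in>carrier kQ. \<forall>c f q. f \<in> forms \<longrightarrow> alg_op c x f q = single_form r (G i c (lin (c i) * f l)) q" for i
    proof (cases "(Suc (fst l), snd l) \<in> young (CARD('n) - 2)")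
      case True
      then have "(l, 1, i) \<in> arcs tilting_quiver"
        using l by (simp add: tilting_quiver_simps add_unit_weight)
      from step[OF this, of "G i"] G[of i] d show ?thesis
        by (simp add: add_unit_weight arrow_op_def)
    next
      case False
      \<comment> \<open>Leaving the index set upwards means that l already has the maximal first
        entry n - 2, which r cannot exceed. The family from the missing vertex therefore vanishes,
        and the zero element realises its contribution.\<close>
      then have less: "fst r < fst (Suc (fst l), snd l)"
        using l r by (simp add: young_iff)
      have "G i c (lin (c i) * f l) = 0" if f: "f \<in> forms" for c f
      proof (rule covariant_eq_0[OF G less])
        show "degree (lin (c i) * f l) \<le> fst (Suc (fst l), snd l) - snd (Suc (fst l), snd l)"
          using degree_mult_le[of "lin (c i)" "f l"] degree_lin[of "c i"] formsD(1)[OF f l] snd_le by simp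
      qed
      then show ?thesis
        by (intro bexI[of _ 0]) (simp_all add: single_form_def kQ_simps(1))
    qed
    then obtain x where x: "\<And>i. x i \<in> carrier kQ"
      "\<And>i c f q. f \<in> forms \<Longrightarrow> alg_op c (x i) f q = single_form r (G i c (lin (c i) * f l)) q"
      by metis
    have "\<exists>y\<in>carrier kQ. \<forall>c f q. f \<in> forms \<longrightarrow> alg_op c y f q
        = single_form r (if snd l < fst l then H i c (wedge (fst l - snd l) (c i) (f l)) else 0) q" for i
    proof (cases "snd l < fst l")
      case True
      then have "(l, 2, i) \<in> arcs tilting_quiver"
        using l by (simp add: tilting_quiver_simps add_unit_weight young_iff)
      from step[OF this, of "H i"] H[of i] d True show ?thesis
        by (simp add: add_unit_weight arrow_op_def)
    next
      case False
      then show ?thesis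
        by (intro bexI[of _ 0]) (simp_all add: single_form_def kQ_simps(1))
    qed
    then obtain y where y: "\<And>i. y i \<in> carrier kQ"
      "\<And>i c f q. f \<in> forms \<Longrightarrow> alg_op c (y i) f q
        = single_form r (if snd l < fst l then H i c (wedge (fst l - snd l) (c i) (f l)) else 0) q"
      by metis
    have "alg_op c ((\<Sum>i\<in>UNIV. x i) + (\<Sum>i\<in>UNIV. y i)) f q = single_form r (F c (f l)) q" if f: "f \<in> forms" for c f q
      unfolding alg_op_add alg_op_sum x(2)[OF f] y(2)[OF f] F[OF formsD(1)[OF f l]]
      by (simp add: single_form_def)
    then show "\<exists>x\<in>carrier (kQ :: ('k, (nat \<times> nat, 'n arrow) path \<Rightarrow>\<^sub>0 'k) module).
        \<forall>c f q. f \<in> forms \<longrightarrow> alg_op c x f q = single_form r (F c (f l)) q"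
      using kQ_add_closed[OF kQ_carrier_sum kQ_carrier_sum, of UNIV x UNIV y] x(1) y(1) by blast
  qed
qed

text \<open>Each block of \<phi> extends to a covariant family and is realised by an element of the
  path algebra. An endomorphism is determined by its blocks, so the sum of these finitely many
  elements represents \<phi>.\<close>

lemma represent_surj:
  assumes card: "CARD('n) \<ge> 4" and \<phi>: "\<phi> \<in> carrier End_E"
  shows "\<exists>x\<in>carrier kQ. represent x = (\<phi> :: ('k, 'n) E_endo)"
proof -
  let ?Y = "young (CARD('n) - 2)"
  have "\<exists>x\<in>carrier kQ. \<forall>c f q. nondegenerate c \<longrightarrow> f \<in> forms \<longrightarrow>
      alg_op c x f q = single_form r (block (\<phi> (ker c)) l r c (f l)) q" if l: "l \<in> ?Y" and r: "r \<in> ?Y" for l r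
  proof -
    obtain F where F: "covariant l r F"
      "\<And>c p. nondegenerate c \<Longrightarrow> degree p \<le> fst l - snd l \<Longrightarrow> F c p = block (\<phi> (ker c)) l r c p"
      using block_covariant[OF card \<phi> l r] by blast
    obtain x where "x \<in> carrier kQ" "\<And>c f q. f \<in> forms \<Longrightarrow> alg_op c x f q = single_form r (F c (f l)) q"
      using covariant_realized[OF F(1) l r] by blast
    then show ?thesis
      using F(2)[OF _ formsD(1)[OF _ l]] by (intro bexI[of _ x]) simp_all
  qed
  then have "\<forall>l r. \<exists>x. l \<in> ?Y \<longrightarrow> r \<in> ?Y \<longrightarrow> x \<in> carrier kQ \<and> (\<forall>c f q. nondegenerate c \<longrightarrow> f \<in> forms \<longrightarrow>
      alg_op c x f q = single_form r (block (\<phi> (ker c)) l r c (f l)) q)"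
    by blast
  then obtain X where X: "\<And>l r. l \<in> ?Y \<Longrightarrow> r \<in> ?Y \<Longrightarrow> X l r \<in> carrier kQ"
    "\<And>l r c f q. l \<in> ?Y \<Longrightarrow> r \<in> ?Y \<Longrightarrow> nondegenerate c \<Longrightarrow> f \<in> forms \<Longrightarrow>
      alg_op c (X l r) f q = single_form r (block (\<phi> (ker c)) l r c (f l)) q"
    by metis
  define x where "x = (\<Sum>l\<in>?Y. \<Sum>r\<in>?Y. X l r)"
  have x: "x \<in> carrier kQ"
    unfolding x_def by (intro kQ_carrier_sum X)
  have "represent x = \<phi>"
  proof (rule represent_eqI[OF x])
    show "\<phi> \<in> extensional Gr2"
      by (rule End_E_extensional[OF \<phi>])
    show "\<phi> K \<in> extensional (carrier (E_fibre K))" if "K \<in> Gr2" for K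
    proof -
      have "\<phi> \<in> (\<Pi>\<^sub>E K\<in>Gr2. linear_maps (E_fibre K) (E_fibre K))"
        using \<phi> by (simp add: End_E_def)
      then show ?thesis
        using PiE_mem[OF _ that] by (auto simp: linear_maps_def PiE_def)
    qed
    show "\<phi> (ker c) s \<in> carrier (E_fibre (ker c))" if "nondegenerate c" "s \<in> carrier (E_fibre (ker c))" for c s
      by (rule linear_mapsD(1)[OF End_E_linear[OF \<phi> that(1)] that(2)])
    show "EV c (\<phi> (ker c) s) q = alg_op c x (EV c s) q"
      if c: "nondegenerate c" and s: "s \<in> carrier (E_fibre (ker c))" and q: "q \<in> ?Y" for c s q
    proof -
      have "alg_op c x (EV c s) q = (\<Sum>l\<in>?Y. \<Sum>r\<in>?Y. single_form r (block (\<phi> (ker c)) l r c (EV c s l)) q)"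
        unfolding x_def alg_op_sum by (intro sum.cong refl X(2) c EV_forms s)
      also have "\<dots> = (\<Sum>l\<in>?Y. block (\<phi> (ker c)) l q c (EV c s l))"
        using q by (simp add: single_form_def finite_young)
      also have "\<dots> = EV c (\<phi> (ker c) s) q"
        by (rule linear_map_blocks[OF c End_E_linear[OF \<phi> c] s, symmetric])
      finally show ?thesis ..
    qed
  qed
  then show ?thesis
    using x by blast
qed

end

theorem corollary2p15:
  fixes u :: "'n::finite \<Rightarrow> 'k::{alg_closed_field, field_char_0} ^ 'n"
  assumes "CARD('n) \<ge> 4"
    and "inj u" and "vec.independent (range u)" and "vec.span (range u) = UNIV"
  shows "\<exists>\<Phi>. tilting_hom u \<Phi> \<and>
    (\<forall>\<Psi>. tilting_hom u \<Psi> \<longrightarrow> (\<forall>x\<in>carrier kQ. \<Psi> x = \<Phi> x)) \<and>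
    \<Phi> ` carrier kQ = carrier End_E"
proof -
  interpret ordered_basis u
    by unfold_locales (use assms in simp_all)
  have "represent ` carrier kQ = carrier End_E"
    using represent_closed represent_surj[OF assms(1)] by blast
  \<comment> \<open>\<open>represent\<close> is one homomorphism with the prescribed values; any
    other agrees with it on idempotents and arrows, hence on the whole path algebra.\<close>
  then show ?thesis
    using represent_tilting_hom alg_hom_unique[OF represent_tilting_hom] by (intro exI[of _ represent]) blast
qed

end
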